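(* Let $\overline{M}_f^{\,n+1}$ be an oriented complete weighted manifold with $\overline{\mathrm{Ric}}_f\ge k>0$, where $k$ is a fixed constant. Then there is no complete noncompact orientable $f$-minimal hypersurface $M^n$ immersed into $\overline{M}_f^{\,n+1}$ with $\mathrm{Vol}_f(M)=+\infty$, $\mathrm{ind}_fM<+\infty$, and polynomial growth of the weighted volume.
   Context: A weighted manifold $\overline M_f=(\overline M,\langle\,,\rangle,e^{-f}d\mu)$ is a (connected) Riemannian manifold with Riemannian volume element $d\mu$ and a smooth function $f:\overline M\to\mathbb{R}$. $\overline{\mathrm{Ric}}_f=\overline{\mathrm{Ric}}+\overline\nabla^2f$ is the Bakry–Émery Ricci tensor of $\overline M$, and $\overline{\mathrm{Ric}}_f\ge k$ means $\overline{\mathrm{Ric}}_f\ge k\langle\,,\rangle$. Restricting $f$ to an (isometrically immersed) hypersurface $M$ with unit normal field $\eta$ gives the weighted measure $e^{-f}d\sigma$ on $M$ ($d\sigma$ the volume element of $M$); $\mathrm{Vol}_f(A)=\int_Ae^{-f}d\sigma$ for $A\subset M$, and $\Delta_fu=\Delta u-\langle\nabla f,\nabla u\rangle$ on $M$. The weighted volume of $M$ has polynomial growth if there are positive numbers $\alpha,C,R_0$ with $\mathrm{Vol}_f(B_r)\le Cr^\alpha$ for all $r\ge R_0$, where $B_r$ is the geodesic ball of $M$ of radius $r$ centered at a fixed point $o\in M$. With second fundamental form $A(X,Y)=(\overline\nabla_XY)^\perp$, the weighted mean curvature vector is $\mathbf{H}_f=\mathrm{tr}A+(\overline\nabla f)^\perp$;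 $M$ is $f$-minimal if $\mathbf{H}_f\equiv0$. The $f$-stability operator is $L_f=\Delta_f+|A|^2+\overline{\mathrm{Ric}}_f(\eta,\eta)$, with quadratic form $I_f(u,u)=-\int_MuL_fu\,e^{-f}d\sigma$. For a compact domain $\Omega\subset M$, $\mathrm{ind}_f\Omega$ is the maximal dimension of a subspace of $C_c^\infty(\Omega)$ on which $I_f$ is negative definite, and $\mathrm{ind}_fM=\sup_\Omega\mathrm{ind}_f\Omega$ over all compact domains $\Omega\subset M$. *)

theory Defs
  imports "HOL-Analysis.Analysis" "HOL-Library.Function_Algebras" "HOL-Library.Extended_Nat"
begin

text \<open>
  A manifold is a connected Hausdorff second countable space, given as a type, with a smooth
  atlas. Tensor fields are given by their components in the charts of the atlas, as functions of
  the coordinates, subject to the usual transformation law. The local formulas below are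
  stated for coordinate functions on an open subset of \<open>real^'n\<close>.
\<close>

section \<open>Coordinate calculus\<close>

primrec Ck_on :: "nat \<Rightarrow> ('e::real_normed_vector) set \<Rightarrow> ('e \<Rightarrow> 'f::real_normed_vector) \<Rightarrow> bool" where
  "Ck_on 0 S F \<longleftrightarrow> continuous_on S F"
| "Ck_on (Suc k) S F \<longleftrightarrow> (\<forall>x\<in>S. F differentiable (at x)) \<and>
     (\<forall>v. Ck_on k S (\<lambda>x. frechet_derivative F (at x) v))"

text \<open>Only used for open \<open>S\<close>.\<close>
definition smooth_on :: "('e::real_normed_vector) set \<Rightarrow> ('e \<Rightarrow> 'f::real_normed_vector) \<Rightarrow> bool" where
  "smooth_on S F \<longleftrightarrow> (\<forall>k. Ck_on k S F)"

definition pd :: "'n::finite \<Rightarrow> (real^'n \<Rightarrow> 'f::real_normed_vector) \<Rightarrow> real^'n \<Rightarrow> 'f" where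
  "pd i F x = frechet_derivative F (at x) (axis i 1)"

definition ip :: "real^'n^'n \<Rightarrow> real^'n \<Rightarrow> real^'n \<Rightarrow> real" where
  "ip S v w = v \<bullet> (S *v w)"

definition christoffel ::
  "(real^'n \<Rightarrow> real^'n^'n) \<Rightarrow> 'n::finite \<Rightarrow> 'n \<Rightarrow> 'n \<Rightarrow> real^'n \<Rightarrow> real" where
  "christoffel G k i j x = (1/2) * (\<Sum>l\<in>UNIV. matrix_inv (G x) $ k $ l *
     (pd i (\<lambda>y. G y $ j $ l) x + pd j (\<lambda>y. G y $ i $ l) x - pd l (\<lambda>y. G y $ i $ j) x))"

text \<open>\<open>riemann G l k i j\<close> is the \<open>l\<close>-th component of \<open>R(\<partial>\<^sub>i, \<partial>\<^sub>j)\<partial>\<^sub>k\<close>, where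
  \<open>R(X,Y)Z = \<nabla>\<^sub>X\<nabla>\<^sub>YZ - \<nabla>\<^sub>Y\<nabla>\<^sub>XZ - \<nabla>\<^bsub>[X,Y]\<^esub>Z\<close>; with this sign round spheres have positive Ricci
  curvature.\<close>
definition riemann ::
  "(real^'n \<Rightarrow> real^'n^'n) \<Rightarrow> 'n::finite \<Rightarrow> 'n \<Rightarrow> 'n \<Rightarrow> 'n \<Rightarrow> real^'n \<Rightarrow> real" where
  "riemann G l k i j x =
     pd i (christoffel G l j k) x - pd j (christoffel G l i k) x
     + (\<Sum>m\<in>UNIV. christoffel G m j k x * christoffel G l i m x
               - christoffel G m i k x * christoffel G l j m x)"

definition ricci :: "(real^'n \<Rightarrow> real^'n^'n) \<Rightarrow> real^'n \<Rightarrow> real^'n^('n::finite)" where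
  "ricci G x = (\<chi> j k. \<Sum>i\<in>UNIV. riemann G i k i j x)"

definition hess :: "(real^'n \<Rightarrow> real^'n^'n) \<Rightarrow> (real^'n \<Rightarrow> real) \<Rightarrow> real^'n \<Rightarrow> real^'n^('n::finite)" where
  "hess G F x = (\<chi> i j. pd i (pd j F) x - (\<Sum>k\<in>UNIV. christoffel G k i j x * pd k F x))"

definition bakry_emery_ricci ::
  "(real^'n \<Rightarrow> real^'n^'n) \<Rightarrow> (real^'n \<Rightarrow> real) \<Rightarrow> real^'n \<Rightarrow> real^'n^('n::finite)" where
  "bakry_emery_ricci G F x = ricci G x + hess G F x"

definition grad :: "(real^'n \<Rightarrow> real^'n^'n) \<Rightarrow> (real^'n \<Rightarrow> real) \<Rightarrow> real^'n \<Rightarrow> real^('n::finite)" where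
  "grad G F x = matrix_inv (G x) *v (\<chi> i. pd i F x)"

definition diverg :: "(real^'n \<Rightarrow> real^'n^'n) \<Rightarrow> (real^'n \<Rightarrow> real^'n) \<Rightarrow> real^('n::finite) \<Rightarrow> real" where
  "diverg G W x = (\<Sum>i\<in>UNIV. pd i (\<lambda>y. sqrt (det (G y)) * W y $ i) x) / sqrt (det (G x))"

definition laplacian :: "(real^'n \<Rightarrow> real^'n^'n) \<Rightarrow> (real^'n \<Rightarrow> real) \<Rightarrow> real^('n::finite) \<Rightarrow> real" where
  "laplacian G F x = diverg G (grad G F) x"

definition weighted_laplacian ::
  "(real^'n \<Rightarrow> real^'n^'n) \<Rightarrow> (real^'n \<Rightarrow> real) \<Rightarrow> (real^'n \<Rightarrow> real) \<Rightarrow> real^('n::finite) \<Rightarrow> real" where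
  "weighted_laplacian G F U x = laplacian G U x - ip (G x) (grad G F x) (grad G U x)"

section \<open>Hypersurfaces in coordinates\<close>

text \<open>\<open>F\<close> is an immersion of an open subset of \<open>real^'n\<close> into an open subset of \<open>real^'m\<close> with
  metric \<open>G\<close>, and \<open>H\<close> is the induced metric.\<close>

definition is_unit_normal ::
  "(real^'m \<Rightarrow> real^'m^'m) \<Rightarrow> (real^'n \<Rightarrow> real^'m) \<Rightarrow> real^('n::finite) \<Rightarrow> real^('m::finite) \<Rightarrow> bool" where
  "is_unit_normal G F x \<nu> \<longleftrightarrow> ip (G (F x)) \<nu> \<nu> = 1 \<and> (\<forall>i. ip (G (F x)) \<nu> (pd i F x) = 0)"

text \<open>In codimension one the unit normal at a point is unique up to sign, and everything below is
  even in it. So no global choice of sign is needed in the local formulas.\<close>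
definition unit_normal ::
  "(real^'m \<Rightarrow> real^'m^'m) \<Rightarrow> (real^'n \<Rightarrow> real^'m) \<Rightarrow> real^('n::finite) \<Rightarrow> real^('m::finite)" where
  "unit_normal G F x = (SOME \<nu>. is_unit_normal G F x \<nu>)"

definition normal_part ::
  "(real^'m \<Rightarrow> real^'m^'m) \<Rightarrow> (real^'n \<Rightarrow> real^'m) \<Rightarrow> real^('n::finite) \<Rightarrow> real^'m \<Rightarrow> real^('m::finite)" where
  "normal_part G F x w = ip (G (F x)) w (unit_normal G F x) *\<^sub>R unit_normal G F x"

text \<open>The ambient covariant derivative of the vector field \<open>\<partial>\<^sub>jF\<close> along \<open>F\<close> in direction
  \<open>\<partial>\<^sub>i\<close>.\<close>
definition cov_deriv_along ::
  "(real^'m \<Rightarrow> real^'m^'m) \<Rightarrow> (real^'n \<Rightarrow> real^'m) \<Rightarrow> 'n::finite \<Rightarrow> 'n \<Rightarrow> real^'n \<Rightarrow> real^('m::finite)" where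
  "cov_deriv_along G F i j x =
     (\<chi> a. pd i (pd j F) x $ a +
        (\<Sum>b\<in>UNIV. \<Sum>c\<in>UNIV. christoffel G a b c (F x) * pd i F x $ b * pd j F x $ c))"

definition second_fund ::
  "(real^'m \<Rightarrow> real^'m^'m) \<Rightarrow> (real^'n \<Rightarrow> real^'m) \<Rightarrow> 'n::finite \<Rightarrow> 'n \<Rightarrow> real^'n \<Rightarrow> real^('m::finite)" where
  "second_fund G F i j x = normal_part G F x (cov_deriv_along G F i j x)"

definition second_fund_normsq ::
  "(real^'m \<Rightarrow> real^'m^'m) \<Rightarrow> (real^'n \<Rightarrow> real^'n^'n) \<Rightarrow> (real^'n \<Rightarrow> real^('m::finite)) \<Rightarrow> real^('n::finite) \<Rightarrow> real" where
  "second_fund_normsq G H F x = (\<Sum>i\<in>UNIV. \<Sum>j\<in>UNIV. \<Sum>k\<in>UNIV. \<Sum>l\<in>UNIV.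
     matrix_inv (H x) $ i $ k * matrix_inv (H x) $ j $ l *
     ip (G (F x)) (second_fund G F i j x) (second_fund G F k l x))"

definition weighted_mean_curvature ::
  "(real^'m \<Rightarrow> real^'m^'m) \<Rightarrow> (real^'m \<Rightarrow> real) \<Rightarrow> (real^'n \<Rightarrow> real^'n^'n) \<Rightarrow> (real^'n \<Rightarrow> real^'m)
     \<Rightarrow> real^('n::finite) \<Rightarrow> real^('m::finite)" where
  "weighted_mean_curvature G f H F x =
     (\<Sum>i\<in>UNIV. \<Sum>j\<in>UNIV. matrix_inv (H x) $ i $ j *\<^sub>R second_fund G F i j x)
     + normal_part G F x (grad G f (F x))"

definition stability_potential ::
  "(real^'m \<Rightarrow> real^'m^'m) \<Rightarrow> (real^'m \<Rightarrow> real) \<Rightarrow> (real^'n \<Rightarrow> real^'n^'n) \<Rightarrow> (real^'n \<Rightarrow> real^('m::finite))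
     \<Rightarrow> real^('n::finite) \<Rightarrow> real" where
  "stability_potential G f H F x = second_fund_normsq G H F x +
     ip (bakry_emery_ricci G f (F x)) (unit_normal G F x) (unit_normal G F x)"

section \<open>Manifolds\<close>

type_synonym ('a, 'n) chart = "'a set \<times> ('a \<Rightarrow> real^'n)"

type_synonym ('a, 'n) metric_field = "('a, 'n) chart \<Rightarrow> real^'n \<Rightarrow> real^'n^'n"

definition cdom :: "('a, 'n::finite) chart \<Rightarrow> (real^'n) set" where
  "cdom c = snd c ` fst c"

definition param :: "('a, 'n::finite) chart \<Rightarrow> real^'n \<Rightarrow> 'a" where
  "param c = inv_into (fst c) (snd c)"

definition transition :: "('a, 'n::finite) chart \<Rightarrow> ('a, 'n) chart \<Rightarrow> real^'n \<Rightarrow> real^'n" where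
  "transition c c' = snd c' \<circ> param c"

definition overlap :: "('a, 'n::finite) chart \<Rightarrow> ('a, 'n) chart \<Rightarrow> (real^'n) set" where
  "overlap c c' = snd c ` (fst c \<inter> fst c')"

definition smooth_atlas :: "('a::topological_space, 'n::finite) chart set \<Rightarrow> bool" where
  "smooth_atlas \<A> \<longleftrightarrow>
     (\<Union>c\<in>\<A>. fst c) = UNIV \<and>
     (\<forall>c\<in>\<A>. open (fst c) \<and> open (cdom c) \<and> homeomorphism (fst c) (cdom c) (snd c) (param c)) \<and>
     (\<forall>c\<in>\<A>. \<forall>c'\<in>\<A>. smooth_on (overlap c c') (transition c c'))"

definition oriented_atlas :: "('a::topological_space, 'n::finite) chart set \<Rightarrow> bool" where
  "oriented_atlas \<A> \<longleftrightarrow> smooth_atlas \<A> \<and>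
     (\<forall>c\<in>\<A>. \<forall>c'\<in>\<A>. \<forall>x\<in>overlap c c'. det (jacobian (transition c c') (at x)) > 0)"

definition orientable :: "('a::topological_space, 'n::finite) chart set \<Rightarrow> bool" where
  "orientable \<A> \<longleftrightarrow> (\<exists>\<B>. oriented_atlas \<B> \<and> smooth_atlas (\<A> \<union> \<B>))"

definition riemannian_metric ::
  "('a, 'n::finite) chart set \<Rightarrow> ('a, 'n) metric_field \<Rightarrow> bool" where
  "riemannian_metric \<A> g \<longleftrightarrow>
     (\<forall>c\<in>\<A>. smooth_on (cdom c) (g c)) \<and>
     (\<forall>c\<in>\<A>. \<forall>x\<in>cdom c. transpose (g c x) = g c x \<and> (\<forall>v. v \<noteq> 0 \<longrightarrow> ip (g c x) v v > 0)) \<and>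
     (\<forall>c\<in>\<A>. \<forall>c'\<in>\<A>. \<forall>x\<in>overlap c c'.
        g c x = transpose (jacobian (transition c c') (at x)) ** g c' (transition c c' x)
                  ** jacobian (transition c c') (at x))"

definition riemannian_manifold ::
  "('a::{t2_space,second_countable_topology}, 'n::finite) chart set \<Rightarrow> ('a, 'n) metric_field \<Rightarrow> bool" where
  "riemannian_manifold \<A> g \<longleftrightarrow>
     connected (UNIV :: 'a set) \<and> smooth_atlas \<A> \<and> riemannian_metric \<A> g"

definition smooth_function ::
  "('a, 'n::finite) chart set \<Rightarrow> ('a \<Rightarrow> real) \<Rightarrow> bool" where
  "smooth_function \<A> u \<longleftrightarrow> (\<forall>c\<in>\<A>. smooth_on (cdom c) (u \<circ> param c))"

definition weighted_manifold ::
  "('a::{t2_space,second_countable_topology}, 'n::finite) chart set \<Rightarrow> ('a, 'n) metric_field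
     \<Rightarrow> ('a \<Rightarrow> real) \<Rightarrow> bool" where
  "weighted_manifold \<A> g f \<longleftrightarrow> riemannian_manifold \<A> g \<and> smooth_function \<A> f"

definition bakry_emery_ge ::
  "('a, 'n::finite) chart set \<Rightarrow> ('a, 'n) metric_field \<Rightarrow> ('a \<Rightarrow> real) \<Rightarrow> real \<Rightarrow> bool" where
  "bakry_emery_ge \<A> g f k \<longleftrightarrow>
     (\<forall>c\<in>\<A>. \<forall>x\<in>cdom c. \<forall>v.
        ip (bakry_emery_ricci (g c) (f \<circ> param c) x) v v \<ge> k * ip (g c x) v v)"

text \<open>An arbitrary chart around a point, for evaluating expressions that do not depend on the
  chart.\<close>
definition chart_at :: "('a, 'n::finite) chart set \<Rightarrow> 'a \<Rightarrow> ('a, 'n) chart" where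
  "chart_at \<A> p = (SOME c. c \<in> \<A> \<and> p \<in> fst c)"

section \<open>Distance, completeness and volume\<close>

definition piecewise_C1_curve ::
  "('a::topological_space, 'n::finite) chart set \<Rightarrow> (real \<Rightarrow> 'a) \<Rightarrow> bool" where
  "piecewise_C1_curve \<A> \<gamma> \<longleftrightarrow> continuous_on {0..1} \<gamma> \<and>
     (\<exists>S. finite S \<and> (\<forall>c\<in>\<A>. (snd c \<circ> \<gamma>) C1_differentiable_on {t \<in> {0..1} - S. \<gamma> t \<in> fst c}))"

definition speed ::
  "('a, 'n::finite) chart set \<Rightarrow> ('a, 'n) metric_field \<Rightarrow> (real \<Rightarrow> 'a) \<Rightarrow> real \<Rightarrow> real" where
  "speed \<A> g \<gamma> t =
     (let c = chart_at \<A> (\<gamma> t); v = vector_derivative (snd c \<circ> \<gamma>) (at t)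
      in sqrt (ip (g c (snd c (\<gamma> t))) v v))"

text \<open>The length may be infinite, since one-sided limits of the velocity at the
  break points are not required.\<close>
definition curve_length ::
  "('a, 'n::finite) chart set \<Rightarrow> ('a, 'n) metric_field \<Rightarrow> (real \<Rightarrow> 'a) \<Rightarrow> ennreal" where
  "curve_length \<A> g \<gamma> = (\<integral>\<^sup>+t\<in>{0..1}. ennreal (speed \<A> g \<gamma> t) \<partial>lborel)"

definition rdist ::
  "('a::topological_space, 'n::finite) chart set \<Rightarrow> ('a, 'n) metric_field \<Rightarrow> 'a \<Rightarrow> 'a \<Rightarrow> real" where
  "rdist \<A> g p q =
     enn2real (INF \<gamma>\<in>{\<gamma>. piecewise_C1_curve \<A> \<gamma> \<and> \<gamma> 0 = p \<and> \<gamma> 1 = q}. curve_length \<A> g \<gamma>)"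

definition complete_riemannian ::
  "('a::topological_space, 'n::finite) chart set \<Rightarrow> ('a, 'n) metric_field \<Rightarrow> bool" where
  "complete_riemannian \<A> g \<longleftrightarrow> Metric_space.mcomplete UNIV (rdist \<A> g)"

abbreviation geodesic_ball ::
  "('a::topological_space, 'n::finite) chart set \<Rightarrow> ('a, 'n) metric_field \<Rightarrow> 'a \<Rightarrow> real \<Rightarrow> 'a set" where
  "geodesic_ball \<A> g \<equiv> Metric_space.mball UNIV (rdist \<A> g)"

text \<open>The unique Borel measure which is \<open>sqrt (det g) dx\<close> in every chart.\<close>
definition riemannian_volume ::
  "('a::topological_space, 'n::finite) chart set \<Rightarrow> ('a, 'n) metric_field \<Rightarrow> 'a measure" where
  "riemannian_volume \<A> g = (THE \<sigma>. sets \<sigma> = sets borel \<and>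
     (\<forall>c\<in>\<A>. \<forall>B\<in>sets borel. B \<subseteq> fst c \<longrightarrow>
        emeasure \<sigma> B = (\<integral>\<^sup>+x\<in>snd c ` B. ennreal (sqrt (det (g c x))) \<partial>lborel)))"

definition weighted_volume ::
  "('a::topological_space, 'n::finite) chart set \<Rightarrow> ('a, 'n) metric_field \<Rightarrow> ('a \<Rightarrow> real) \<Rightarrow> 'a measure" where
  "weighted_volume \<A> g f = density (riemannian_volume \<A> g) (\<lambda>p. ennreal (exp (- f p)))"

definition polynomial_weighted_volume_growth ::
  "('a::topological_space, 'n::finite) chart set \<Rightarrow> ('a, 'n) metric_field \<Rightarrow> ('a \<Rightarrow> real) \<Rightarrow> bool" where
  "polynomial_weighted_volume_growth \<A> g f \<longleftrightarrow>
     (\<exists>p. \<exists>\<alpha>>0. \<exists>C>0. \<exists>R\<^sub>0>0. \<forall>r\<ge>R\<^sub>0.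
        emeasure (weighted_volume \<A> g f) (geodesic_ball \<A> g p r) \<le> ennreal (C * r powr \<alpha>))"

section \<open>Immersed hypersurfaces\<close>

definition local_rep ::
  "('a, 'm::finite) chart \<Rightarrow> ('b \<Rightarrow> 'a) \<Rightarrow> ('b, 'n::finite) chart \<Rightarrow> real^'n \<Rightarrow> real^'m" where
  "local_rep c X d = snd c \<circ> X \<circ> param d"

definition local_dom ::
  "('a, 'm::finite) chart \<Rightarrow> ('b \<Rightarrow> 'a) \<Rightarrow> ('b, 'n::finite) chart \<Rightarrow> (real^'n) set" where
  "local_dom c X d = snd d ` (fst d \<inter> X -` fst c)"

definition smooth_map ::
  "('a::topological_space, 'm::finite) chart set \<Rightarrow> ('b::topological_space, 'n::finite) chart set
     \<Rightarrow> ('b \<Rightarrow> 'a) \<Rightarrow> bool" where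
  "smooth_map \<A> \<B> X \<longleftrightarrow> continuous_on UNIV X \<and>
     (\<forall>c\<in>\<A>. \<forall>d\<in>\<B>. smooth_on (local_dom c X d) (local_rep c X d))"

definition immersion ::
  "('a::topological_space, 'm::finite) chart set \<Rightarrow> ('b::topological_space, 'n::finite) chart set
     \<Rightarrow> ('b \<Rightarrow> 'a) \<Rightarrow> bool" where
  "immersion \<A> \<B> X \<longleftrightarrow> smooth_map \<A> \<B> X \<and>
     (\<forall>c\<in>\<A>. \<forall>d\<in>\<B>. \<forall>x\<in>local_dom c X d. inj (frechet_derivative (local_rep c X d) (at x)))"

definition isometric_immersion ::
  "('a::topological_space, 'm::finite) chart set \<Rightarrow> ('a, 'm) metric_field
     \<Rightarrow> ('b::topological_space, 'n::finite) chart set \<Rightarrow> ('b, 'n) metric_field \<Rightarrow> ('b \<Rightarrow> 'a) \<Rightarrow> bool" where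
  "isometric_immersion \<A> g \<B> h X \<longleftrightarrow> immersion \<A> \<B> X \<and>
     (\<forall>c\<in>\<A>. \<forall>d\<in>\<B>. \<forall>x\<in>local_dom c X d.
        h d x = transpose (jacobian (local_rep c X d) (at x)) ** g c (local_rep c X d x)
                  ** jacobian (local_rep c X d) (at x))"

text \<open>The domain is abstract, so self-intersections are allowed and \<open>X\<close> need not be proper.\<close>
definition immersed_hypersurface ::
  "('a::topological_space, 'm::finite) chart set \<Rightarrow> ('a, 'm) metric_field
     \<Rightarrow> ('b::{t2_space,second_countable_topology}, 'n::finite) chart set \<Rightarrow> ('b, 'n) metric_field
     \<Rightarrow> ('b \<Rightarrow> 'a) \<Rightarrow> bool" where
  "immersed_hypersurface \<A> g \<B> h X \<longleftrightarrow>
     CARD('m) = CARD('n) + 1 \<and> riemannian_manifold \<B> h \<and> isometric_immersion \<A> g \<B> h X"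

definition f_minimal ::
  "('a, 'm::finite) chart set \<Rightarrow> ('a, 'm) metric_field \<Rightarrow> ('a \<Rightarrow> real)
     \<Rightarrow> ('b, 'n::finite) chart set \<Rightarrow> ('b, 'n) metric_field \<Rightarrow> ('b \<Rightarrow> 'a) \<Rightarrow> bool" where
  "f_minimal \<A> g f \<B> h X \<longleftrightarrow>
     (\<forall>c\<in>\<A>. \<forall>d\<in>\<B>. \<forall>x\<in>local_dom c X d.
        weighted_mean_curvature (g c) (f \<circ> param c) (h d) (local_rep c X d) x = 0)"

section \<open>Stability operator and index\<close>

definition stability_op ::
  "('a, 'm::finite) chart set \<Rightarrow> ('a, 'm) metric_field \<Rightarrow> ('a \<Rightarrow> real)
     \<Rightarrow> ('b, 'n::finite) chart set \<Rightarrow> ('b, 'n) metric_field \<Rightarrow> ('b \<Rightarrow> 'a)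
     \<Rightarrow> ('b \<Rightarrow> real) \<Rightarrow> 'b \<Rightarrow> real" where
  "stability_op \<A> g f \<B> h X u p =
     (let c = chart_at \<A> (X p); d = chart_at \<B> p; x = snd d p in
        weighted_laplacian (h d) (f \<circ> X \<circ> param d) (u \<circ> param d) x
        + stability_potential (g c) (f \<circ> param c) (h d) (local_rep c X d) x * u p)"

definition stability_form ::
  "('a, 'm::finite) chart set \<Rightarrow> ('a, 'm) metric_field \<Rightarrow> ('a \<Rightarrow> real)
     \<Rightarrow> ('b::topological_space, 'n::finite) chart set \<Rightarrow> ('b, 'n) metric_field \<Rightarrow> ('b \<Rightarrow> 'a)
     \<Rightarrow> ('b \<Rightarrow> real) \<Rightarrow> real" where
  "stability_form \<A> g f \<B> h X u =
     - (\<integral>p. u p * stability_op \<A> g f \<B> h X u p \<partial>weighted_volume \<B> h (f \<circ> X))"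

definition compact_domain :: "('b::topological_space) set \<Rightarrow> bool" where
  "compact_domain \<Omega> \<longleftrightarrow> compact \<Omega> \<and> connected (interior \<Omega>) \<and> interior \<Omega> \<noteq> {}
     \<and> closure (interior \<Omega>) = \<Omega>"

definition smooth_compact_support ::
  "('b::topological_space, 'n::finite) chart set \<Rightarrow> 'b set \<Rightarrow> ('b \<Rightarrow> real) set" where
  "smooth_compact_support \<B> \<Omega> =
     {u. smooth_function \<B> u \<and> compact (closure {p. u p \<noteq> 0}) \<and> closure {p. u p \<noteq> 0} \<subseteq> interior \<Omega>}"

instantiation "fun" :: (type, real_vector) real_vector
begin

definition "scaleR_fun r u = (\<lambda>p. r *\<^sub>R u p)"

instance
  by standard (simp_all add: scaleR_fun_def fun_eq_iff scaleR_add_right scaleR_add_left)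

end

text \<open>The library function \<open>dim\<close> is \<open>0\<close> on infinite-dimensional spaces. This does not
  affect the supremum: such a subspace contains finite-dimensional subspaces of every dimension, which
  occur in it as well.\<close>
definition index_on ::
  "('a, 'm::finite) chart set \<Rightarrow> ('a, 'm) metric_field \<Rightarrow> ('a \<Rightarrow> real)
     \<Rightarrow> ('b::topological_space, 'n::finite) chart set \<Rightarrow> ('b, 'n) metric_field \<Rightarrow> ('b \<Rightarrow> 'a)
     \<Rightarrow> 'b set \<Rightarrow> enat" where
  "index_on \<A> g f \<B> h X \<Omega> =
     (SUP W \<in> {W. subspace W \<and> W \<subseteq> smooth_compact_support \<B> \<Omega> \<and>
                  (\<forall>u\<in>W. u \<noteq> 0 \<longrightarrow> stability_form \<A> g f \<B> h X u < 0)}. enat (dim W))"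

definition f_index ::
  "('a, 'm::finite) chart set \<Rightarrow> ('a, 'm) metric_field \<Rightarrow> ('a \<Rightarrow> real)
     \<Rightarrow> ('b::topological_space, 'n::finite) chart set \<Rightarrow> ('b, 'n) metric_field \<Rightarrow> ('b \<Rightarrow> 'a) \<Rightarrow> enat" where
  "f_index \<A> g f \<B> h X = (SUP \<Omega>\<in>{\<Omega>. compact_domain \<Omega>}. index_on \<A> g f \<B> h X \<Omega>)"

end

theory Submission
  imports Defs "HOL-Real_Asymp.Real_Asymp"
begin

text \<open>
  The zeroth-order term of the stability operator is at least \<open>k > 0\<close>. If \<open>u\<close> cuts off an annulus
  \<open>a < r \<le> b\<close> of \<open>M\<close>, with bounded gradient supported in the two unit collars, then the stability form
  of \<open>u\<close> is at most a constant times the volume of the collars minus \<open>k\<close> times the volume of the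
  annulus. Were this nonnegative for all large \<open>b\<close>, the volume of balls would grow exponentially. So
  polynomial growth and infinite volume give, for every \<open>a\<close>, an annulus with negative form. Disjoint
  annuli span negative definite subspaces of every dimension, so the index is infinite.

  Geodesic balls are relatively compact by Hopf--Rinow. The distance function is
  only Lipschitz, so it is replaced by smooth cutoff functions built from bumps in charts.
\<close>

section \<open>Smooth functions on open sets\<close>

text \<open>Charts and unit normals enter by choice: the operator is evaluated in an arbitrary chart
  with one of the two normals, so even continuity of its zeroth-order term has to be recovered. It
  comes from a formula containing only the square \<nu>\<nu>^T and from the naturality of curvature
  under chart changes; the bound by \<open>k\<close> holds because |A|^2 >= 0 and Ric_f(\<nu>,\<nu>)
  >= k. The weighted Laplacian is compared between charts weakly: integrated against bumps, both
  expressions give the same Green integral. The gradient constant of the cutoffs must not depend on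
  the radius, while the charts that carry the bumps may shrink without control towards infinity.
  With V(b) the weighted volume of the ball of radius b and D depending only on that constant,
  failure of negativity for all large b reads D (V(b+1) - V(b)) >= k V(b) - E with E fixed; once
  V(b) is large, this multiplies V by at least 1 + k/(2D) at each step. Nonnegative functions with
  disjoint supports have no cross terms in the form, since each has a minimum wherever it vanishes,
  so negativity passes from the single functions to their span.\<close>

definition dird :: "'e::real_normed_vector \<Rightarrow> ('e \<Rightarrow> 'f::real_normed_vector) \<Rightarrow> 'e \<Rightarrow> 'f" where
  "dird v F x = frechet_derivative F (at x) v"

lemma dird_eqI: "(F has_derivative F') (at x) \<Longrightarrow> dird v F x = F' v"
  by (simp add: dird_def flip: frechet_derivative_at)

lemma has_derivative_dird:
  "F differentiable (at x) \<Longrightarrow> (F has_derivative (\<lambda>v. dird v F x)) (at x)"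
  by (simp add: dird_def frechet_derivative_works)

lemma dird_linear: "F differentiable (at x) \<Longrightarrow> linear (\<lambda>v. dird v F x)"
  using has_derivative_dird has_derivative_linear by blast

text \<open>\<open>frechet_derivative\<close> is a choice among all derivatives at the point, so it
  suffices that both functions have the same ones.\<close>

lemma dird_cong:
  assumes "open S" "x \<in> S" "\<And>y. y \<in> S \<Longrightarrow> F y = G y"
  shows "dird v F x = dird v G x"
proof -
  have "(F has_derivative D) (at x) \<longleftrightarrow> (G has_derivative D) (at x)" for D
    using has_derivative_transform_within_open[OF _ assms(1,2)] assms(3) by metis
  then show ?thesis by (simp add: dird_def frechet_derivative_def)
qed

lemma differentiable_cong:
  assumes "open S" "x \<in> S" "\<And>y. y \<in> S \<Longrightarrow> F y = G y"
  shows "F differentiable (at x) \<longleftrightarrow> G differentiable (at x)"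
proof -
  have "(F has_derivative D) (at x) \<longleftrightarrow> (G has_derivative D) (at x)" for D
    using has_derivative_transform_within_open[OF _ assms(1,2)] assms(3) by metis
  then show ?thesis by (simp add: differentiable_def)
qed

lemma Ck_on_Suc: "Ck_on (Suc k) S F \<longleftrightarrow> (\<forall>x\<in>S. F differentiable (at x)) \<and> (\<forall>v. Ck_on k S (dird v F))"
  by (simp add: dird_def[abs_def])

declare Ck_on.simps(2)[simp del]

lemma Ck_on_cong:
  assumes "open S" "\<And>x. x \<in> S \<Longrightarrow> F x = G x"
  shows "Ck_on k S F \<longleftrightarrow> Ck_on k S G"
  using assms(2)
proof (induction k arbitrary: F G)
  case 0
  then show ?case using continuous_on_cong by auto
next
  case (Suc k)
  have "dird v F x = dird v G x" if "x \<in> S" for x v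
    by (rule dird_cong[OF \<open>open S\<close> that Suc.prems])
  then have "Ck_on k S (dird v F) \<longleftrightarrow> Ck_on k S (dird v G)" for v
    by (rule Suc.IH)
  then show ?case
    using differentiable_cong[OF \<open>open S\<close> _ Suc.prems] by (auto simp: Ck_on_Suc)
qed

lemma Ck_on_subset: "Ck_on k S F \<Longrightarrow> T \<subseteq> S \<Longrightarrow> Ck_on k T F"
  by (induction k arbitrary: F) (auto simp: Ck_on_Suc intro: continuous_on_subset)

lemma Ck_on_SucD: "Ck_on (Suc k) S F \<Longrightarrow> Ck_on k S F"
proof (induction k arbitrary: F)
  case 0
  then show ?case
    by (simp add: Ck_on_Suc continuous_at_imp_continuous_on differentiable_imp_continuous_within)
qed (auto simp: Ck_on_Suc)

lemma Ck_on_Union: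
  assumes "\<And>T. T \<in> \<T> \<Longrightarrow> open T" "\<And>T. T \<in> \<T> \<Longrightarrow> Ck_on k T F"
  shows "Ck_on k (\<Union>\<T>) F"
  using assms(2)
proof (induction k arbitrary: F)
  case 0
  then show ?case using assms(1) by (auto intro: continuous_on_open_Union)
qed (auto simp: Ck_on_Suc)

lemma Ck_on_const: "Ck_on k (S :: 'a::real_normed_vector set) (\<lambda>x. c)"
proof (induction k arbitrary: c)
  case (Suc k)
  have "dird v (\<lambda>x. c) = (\<lambda>x. 0)" for v :: 'a using dird_eqI[OF has_derivative_const] by (intro ext) auto
  then show ?case using Suc by (auto simp: Ck_on_Suc)
qed auto

lemma Ck_on_bounded_linear:
  assumes "bounded_linear L" shows "Ck_on k S L"
proof (cases k)
  case (Suc n)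
  have "dird v L = (\<lambda>x. L v)" for v
    by (intro ext dird_eqI bounded_linear_imp_has_derivative assms)
  then show ?thesis using Suc assms
    by (auto simp: Ck_on_Suc Ck_on_const bounded_linear_imp_differentiable)
qed (use assms in \<open>auto intro: linear_continuous_on\<close>)

lemma Ck_on_add:
  assumes "Ck_on k S F" "Ck_on k S G" "open S"
  shows "Ck_on k S (\<lambda>x. F x + G x)"
  using assms(1,2)
proof (induction k arbitrary: F G)
  case (Suc k)
  have *: "dird v (\<lambda>x. F x + G x) x = dird v F x + dird v G x" if "x \<in> S" for v x
    using Suc.prems that
    by (intro dird_eqI has_derivative_add has_derivative_dird) (auto simp: Ck_on_Suc)
  have "Ck_on k S (dird v (\<lambda>x. F x + G x))" for v
    using Ck_on_cong[OF \<open>open S\<close> *] Suc by (auto simp: Ck_on_Suc)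
  then show ?case using Suc.prems by (auto simp: Ck_on_Suc)
qed (auto intro: continuous_on_add)

text \<open>By the product rule the derivative is a sum of two terms of the same shape, so the
  induction closes. One lemma serves scaling, products, inner products and matrix-vector
  products.\<close>

lemma Ck_on_bilinear:
  assumes "bounded_bilinear B" "Ck_on k S F" "Ck_on k S G" "open S"
  shows "Ck_on k S (\<lambda>x. B (F x) (G x))"
  using assms(2,3)
proof (induction k arbitrary: F G)
  case 0
  then show ?case by (simp add: bounded_bilinear.continuous_on[OF assms(1)])
next
  case (Suc k)
  have d: "((\<lambda>x. B (F x) (G x)) has_derivative (\<lambda>v. B (F x) (dird v G x) + B (dird v F x) (G x))) (at x)"
    if "x \<in> S" for x
    using Suc.prems that
    by (intro bounded_bilinear.FDERIV[OF assms(1)] has_derivative_dird) (auto simp: Ck_on_Suc)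
  have *: "dird v (\<lambda>x. B (F x) (G x)) x = B (F x) (dird v G x) + B (dird v F x) (G x)" if "x \<in> S" for v x
    using dird_eqI[OF d[OF that]] .
  have "Ck_on k S (dird v (\<lambda>x. B (F x) (G x)))" for v
    using Suc.prems Suc.IH Ck_on_SucD[OF Suc.prems(1)] Ck_on_SucD[OF Suc.prems(2)]
    by (intro Ck_on_cong[THEN iffD2, OF \<open>open S\<close> *] Ck_on_add \<open>open S\<close>) (auto simp: Ck_on_Suc)
  then show ?case using d by (auto simp: Ck_on_Suc differentiable_def)
qed

lemma Ck_on_sum:
  assumes "\<And>i. i \<in> I \<Longrightarrow> Ck_on k S (F i)" "open S"
  shows "Ck_on k S (\<lambda>x. \<Sum>i\<in>I. F i x)"
  using assms by (induction I rule: infinite_finite_induct) (auto intro: Ck_on_add Ck_on_const)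

text \<open>By the chain rule the outer function is differentiated in the direction
  \<open>dird v F x\<close>, which moves with \<open>x\<close>. Expanding it in a basis gives
  derivatives in fixed directions, to which the induction hypothesis applies, with the components of
  \<open>dird v F\<close> as coefficients.\<close>

lemma Ck_on_compose:
  fixes G :: "'e::euclidean_space \<Rightarrow> 'f::real_normed_vector"
    and F :: "'d::real_normed_vector \<Rightarrow> 'e"
  assumes "Ck_on k S F" "Ck_on k T G" "F ` S \<subseteq> T" "open S" "open T"
  shows "Ck_on k S (\<lambda>x. G (F x))"
  using assms(1,2)
proof (induction k arbitrary: G)
  case 0
  then show ?case using assms(3) by (auto intro: continuous_on_compose2)
next
  case (Suc k)
  have d: "((\<lambda>x. G (F x)) has_derivative (\<lambda>v. dird (dird v F x) G (F x))) (at x)" if "x \<in> S" for x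
    using Suc.prems assms(3) that
    by (intro has_derivative_compose[where f=F and g=G] has_derivative_dird) (auto simp: Ck_on_Suc)
  have *: "dird v (\<lambda>x. G (F x)) x = (\<Sum>b\<in>Basis. (dird v F x \<bullet> b) *\<^sub>R dird b G (F x))" if "x \<in> S" for v x
  proof -
    have l: "linear (\<lambda>v. dird v G (F x))"
      using Suc.prems(2) that assms(3) by (intro dird_linear) (auto simp: Ck_on_Suc)
    have "dird v (\<lambda>x. G (F x)) x = dird (dird v F x) G (F x)"
      using dird_eqI[OF d[OF that]] .
    also have "\<dots> = dird (\<Sum>b\<in>Basis. (dird v F x \<bullet> b) *\<^sub>R b) G (F x)"
      by (simp add: euclidean_representation)
    also have "\<dots> = (\<Sum>b\<in>Basis. (dird v F x \<bullet> b) *\<^sub>R dird b G (F x))"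
      by (simp add: linear_sum[OF l] linear_cmul[OF l])
    finally show ?thesis .
  qed
  have "Ck_on k S (dird v (\<lambda>x. G (F x)))" for v
  proof (rule Ck_on_cong[THEN iffD2, OF \<open>open S\<close> *], assumption, intro Ck_on_sum \<open>open S\<close> Ck_on_bilinear[OF bounded_bilinear_scaleR])
    fix b :: 'e
    have "Ck_on k S (dird v F)" using Suc.prems by (simp add: Ck_on_Suc)
    then show "Ck_on k S (\<lambda>x. dird v F x \<bullet> b)"
      by (intro Ck_on_bilinear[OF bounded_bilinear_inner] Ck_on_const \<open>open S\<close>)
    show "Ck_on k S (\<lambda>x. dird b G (F x))"
      using Suc.prems by (intro Suc.IH Ck_on_SucD[OF Suc.prems(1)]) (auto simp: Ck_on_Suc)
  qed
  then show ?case using d by (auto simp: Ck_on_Suc differentiable_def)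
qed

lemma dird_real:
  fixes F :: "real \<Rightarrow> real"
  assumes "(F has_real_derivative D) (at x)" shows "dird v F x = v * D"
  using dird_eqI[of F "\<lambda>v. v * D" x v] assms by (simp add: has_field_derivative_def mult.commute[of _ D])

text \<open>Induction on the order, carried out for a whole family at once: every derivative has to
  be built from members at the same order. This suits the powers of 1/x, none of which reproduces
  itself under differentiation.\<close>

lemma Ck_on_family:
  fixes A :: "('e::real_normed_vector \<Rightarrow> 'f::real_normed_vector) set"
  assumes "open S" "\<And>F x. F \<in> A \<Longrightarrow> x \<in> S \<Longrightarrow> F differentiable (at x)"
    and "\<And>F v k. F \<in> A \<Longrightarrow> (\<And>G. G \<in> A \<Longrightarrow> Ck_on k S G) \<Longrightarrow> Ck_on k S (dird v F)"
    and "F \<in> A"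
  shows "Ck_on k S F"
  using assms(4)
proof (induction k arbitrary: F)
  case 0
  then show ?case using assms(2)
    by (simp add: continuous_at_imp_continuous_on differentiable_imp_continuous_within)
next
  case (Suc k)
  show ?case unfolding Ck_on_Suc
    using assms(2)[OF Suc.prems] assms(3)[OF Suc.prems Suc.IH] by blast
qed

section \<open>Closure properties of smooth functions\<close>

lemma smooth_onD_differentiable: "smooth_on S F \<Longrightarrow> x \<in> S \<Longrightarrow> F differentiable (at x)"
  unfolding smooth_on_def by (metis Ck_on_Suc)

lemma smooth_on_dird: "smooth_on S F \<Longrightarrow> smooth_on S (dird v F)"
  unfolding smooth_on_def by (metis Ck_on_Suc)

lemma smooth_on_pd: "smooth_on S F \<Longrightarrow> smooth_on S (pd i F)"
  using smooth_on_dird[of S F "axis i 1"] by (simp add: dird_def[abs_def] pd_def[abs_def])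

lemma smooth_on_continuous: "smooth_on S F \<Longrightarrow> continuous_on S F"
  unfolding smooth_on_def by (metis Ck_on.simps(1))

lemma smooth_on_cong: "open S \<Longrightarrow> (\<And>x. x \<in> S \<Longrightarrow> F x = G x) \<Longrightarrow> smooth_on S F \<longleftrightarrow> smooth_on S G"
  unfolding smooth_on_def using Ck_on_cong by blast

lemma smooth_on_subset: "smooth_on S F \<Longrightarrow> T \<subseteq> S \<Longrightarrow> smooth_on T F"
  unfolding smooth_on_def using Ck_on_subset by blast

lemma smooth_on_Union:
  "(\<And>T. T \<in> \<T> \<Longrightarrow> open T) \<Longrightarrow> (\<And>T. T \<in> \<T> \<Longrightarrow> smooth_on T F) \<Longrightarrow> smooth_on (\<Union>\<T>) F"
  unfolding smooth_on_def using Ck_on_Union by blast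

lemma smooth_on_Un: "open S \<Longrightarrow> open T \<Longrightarrow> smooth_on S F \<Longrightarrow> smooth_on T F \<Longrightarrow> smooth_on (S \<union> T) F"
  using smooth_on_Union[of "{S, T}" F] by auto

lemma smooth_on_locally:
  assumes "\<And>x. x \<in> S \<Longrightarrow> \<exists>T. open T \<and> x \<in> T \<and> smooth_on T F"
  shows "smooth_on S F"
proof -
  have "smooth_on (\<Union>{T. open T \<and> smooth_on T F}) F" by (rule smooth_on_Union) auto
  moreover have "S \<subseteq> \<Union>{T. open T \<and> smooth_on T F}" using assms by blast
  ultimately show ?thesis by (rule smooth_on_subset)
qed

named_theorems smooth_intros

lemma smooth_on_const [smooth_intros]: "smooth_on S (\<lambda>x. c)"
  by (simp add: smooth_on_def Ck_on_const)

lemma smooth_on_bounded_linear: "bounded_linear L \<Longrightarrow> smooth_on S L"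
  by (simp add: smooth_on_def Ck_on_bounded_linear)

lemma smooth_on_id [smooth_intros]: "smooth_on S (\<lambda>x. x)"
  by (simp add: smooth_on_bounded_linear bounded_linear_ident)

lemma smooth_on_add [smooth_intros]:
  "smooth_on S F \<Longrightarrow> smooth_on S G \<Longrightarrow> open S \<Longrightarrow> smooth_on S (\<lambda>x. F x + G x)"
  by (simp add: smooth_on_def Ck_on_add)

lemma smooth_on_bilinear:
  "bounded_bilinear B \<Longrightarrow> smooth_on S F \<Longrightarrow> smooth_on S G \<Longrightarrow> open S \<Longrightarrow> smooth_on S (\<lambda>x. B (F x) (G x))"
  by (simp add: smooth_on_def Ck_on_bilinear)

lemmas smooth_on_scaleR [smooth_intros] = smooth_on_bilinear[OF bounded_bilinear_scaleR]
  and smooth_on_mult [smooth_intros] = smooth_on_bilinear[OF bounded_bilinear_mult]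
  and smooth_on_inner [smooth_intros] = smooth_on_bilinear[OF bounded_bilinear_inner]

lemma smooth_on_sum [smooth_intros]:
  "(\<And>i. i \<in> I \<Longrightarrow> smooth_on S (F i)) \<Longrightarrow> open S \<Longrightarrow> smooth_on S (\<lambda>x. \<Sum>i\<in>I. F i x)"
  by (simp add: smooth_on_def Ck_on_sum)

lemma smooth_on_uminus [smooth_intros]:
  "smooth_on S F \<Longrightarrow> open S \<Longrightarrow> smooth_on S (\<lambda>x. - F x)"
  using smooth_on_scaleR[OF smooth_on_const, of S F "-1"] by simp

lemma smooth_on_diff [smooth_intros]:
  "smooth_on S F \<Longrightarrow> smooth_on S G \<Longrightarrow> open S \<Longrightarrow> smooth_on S (\<lambda>x. F x - G x)"
  using smooth_on_add[OF _ smooth_on_uminus, of S F G] by simp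

lemma smooth_on_prod [smooth_intros]:
  fixes F :: "'i \<Rightarrow> 'e::real_normed_vector \<Rightarrow> 'f::{real_normed_algebra,comm_ring_1}"
  assumes "\<And>i. i \<in> I \<Longrightarrow> smooth_on S (F i)" "open S"
  shows "smooth_on S (\<lambda>x. \<Prod>i\<in>I. F i x)"
  using assms by (induction I rule: infinite_finite_induct) (auto intro: smooth_intros)

lemma smooth_on_compose:
  fixes G :: "'e::euclidean_space \<Rightarrow> 'f::real_normed_vector"
  assumes "smooth_on T G" "smooth_on S F" "F ` S \<subseteq> T" "open S" "open T"
  shows "smooth_on S (\<lambda>x. G (F x))"
  using assms unfolding smooth_on_def by (blast intro: Ck_on_compose)

lemma dird_compose:
  assumes "F differentiable (at x)" "G differentiable (at (F x))"
  shows "dird v (\<lambda>x. G (F x)) x = dird (dird v F x) G (F x)"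
  by (rule dird_eqI, rule has_derivative_compose[where f=F and g=G]) (auto intro: has_derivative_dird assms)

section \<open>Exponential, inverse and square root\<close>

lemma smooth_on_exp': "smooth_on UNIV (exp :: real \<Rightarrow> real)"
proof -
  have "Ck_on k UNIV (exp :: real \<Rightarrow> real)" for k
  proof (induction k)
    case (Suc k)
    have "dird v exp = (\<lambda>x::real. v * exp x)" for v
      using dird_real[OF DERIV_exp] by auto
    moreover have "Ck_on k UNIV (\<lambda>x::real. v * exp x)" for v
      by (intro Ck_on_bilinear[OF bounded_bilinear_mult] Ck_on_const Suc) auto
    ultimately show ?case
      by (auto simp: Ck_on_Suc real_differentiable_def intro: DERIV_exp)
  qed (auto intro: continuous_intros)
  then show ?thesis by (simp add: smooth_on_def)
qed

text \<open>The functions \<open>c * inverse x ^ n\<close> form a family that differentiation maps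
  into itself: the exponent rises by one and the constant picks up the factor
  \<open>- v * n\<close>.\<close>

lemma smooth_on_inverse': "smooth_on {0<..} (inverse :: real \<Rightarrow> real)"
  unfolding smooth_on_def
proof (intro allI, rule Ck_on_family[where A="range (\<lambda>(c,n) x. c * inverse x ^ n)"])
  fix F :: "real \<Rightarrow> real" and v k
  assume "F \<in> range (\<lambda>(c,n) x. c * inverse x ^ n)"
    and IH: "\<And>G. G \<in> range (\<lambda>(c,n) x. c * inverse x ^ n) \<Longrightarrow> Ck_on k {0::real<..} G"
  then obtain c n where c: "F = (\<lambda>x. c * inverse x ^ n)" by auto
  have *: "dird v F x = (- v * c * n) * inverse x ^ (n+1)" if "x \<in> {0<..}" for x
    unfolding c using that
    by (subst dird_real[OF DERIV_cmult[OF DERIV_power[OF DERIV_inverse']], OF DERIV_ident])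
       (cases n; auto simp: field_simps)+
  have "(\<lambda>x. (- v * c * n) * inverse x ^ (n+1)) \<in> range (\<lambda>(c,n) (x::real). c * inverse x ^ n)"
    by (rule range_eqI[of _ _ "(- v * c * n, n+1)"]) auto
  from IH[OF this] show "Ck_on k {0::real<..} (dird v F)"
    by (intro Ck_on_cong[THEN iffD2, OF _ *]) auto
next
  show "inverse \<in> range (\<lambda>(c,n) (x::real). c * inverse x ^ n)" by (rule range_eqI[of _ _ "(1,1)"]) auto
qed (auto intro!: differentiable_mult differentiable_power differentiable_inverse)

text \<open>The derivative is a constant times \<open>sqrt x * inverse x\<close>, so only
  \<open>sqrt\<close> itself at lower order and the smooth inverse occur.\<close>

lemma smooth_on_sqrt': "smooth_on {0<..} sqrt"
  unfolding smooth_on_def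
proof
  fix k show "Ck_on k {0<..} sqrt"
  proof (induction k)
    case (Suc k)
    have *: "dird v sqrt x = (v / 2) * (sqrt x * inverse x)" if "x \<in> {0<..}" for v x
      using that by (subst dird_real[OF DERIV_real_sqrt]) (auto simp: field_simps real_sqrt_divide real_div_sqrt)
    have "Ck_on k {0<..} (\<lambda>x. (v / 2) * (sqrt x * inverse x))" for v :: real
      using Suc smooth_on_inverse' unfolding smooth_on_def
      by (intro Ck_on_bilinear[OF bounded_bilinear_mult] Ck_on_const) auto
    then have "Ck_on k {0<..} (dird v sqrt)" for v
      by (intro Ck_on_cong[THEN iffD2, OF _ *]) auto
    moreover have "sqrt differentiable (at x)" if "x > 0" for x
      using that DERIV_real_sqrt by (auto simp: differentiable_def has_field_derivative_def)
    ultimately show ?case by (auto simp: Ck_on_Suc)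
  qed (auto intro: continuous_intros)
qed

lemma smooth_on_exp [smooth_intros]: "smooth_on S F \<Longrightarrow> open S \<Longrightarrow> smooth_on S (\<lambda>x. exp (F x :: real))"
  by (rule smooth_on_compose[OF smooth_on_exp']) auto

lemma smooth_on_inverse:
  "smooth_on S F \<Longrightarrow> open S \<Longrightarrow> (\<And>x. x \<in> S \<Longrightarrow> F x > 0) \<Longrightarrow> smooth_on S (\<lambda>x. inverse (F x :: real))"
  by (rule smooth_on_compose[OF smooth_on_inverse']) auto

lemma smooth_on_divide:
  "smooth_on S F \<Longrightarrow> smooth_on S G \<Longrightarrow> open S \<Longrightarrow> (\<And>x. x \<in> S \<Longrightarrow> G x > 0) \<Longrightarrow> smooth_on S (\<lambda>x. F x / G x :: real)"
  unfolding divide_inverse by (intro smooth_on_mult smooth_on_inverse)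

lemma smooth_on_sqrt:
  "smooth_on S F \<Longrightarrow> open S \<Longrightarrow> (\<And>x. x \<in> S \<Longrightarrow> F x > 0) \<Longrightarrow> smooth_on S (\<lambda>x. sqrt (F x :: real))"
  by (rule smooth_on_compose[OF smooth_on_sqrt']) auto

lemma bounded_linear_component2: "bounded_linear (\<lambda>A::real^'n^'m. A $ i $ j)"
  by (intro bounded_linear_compose[OF bounded_linear_vec_nth] bounded_linear_vec_nth)

lemma smooth_on_nth [smooth_intros]:
  fixes F :: "'e::real_normed_vector \<Rightarrow> ('f::euclidean_space)^'n"
  assumes "smooth_on S F" "open S" shows "smooth_on S (\<lambda>x. F x $ i)"
  by (rule smooth_on_compose[OF smooth_on_bounded_linear[OF bounded_linear_vec_nth] assms(1), where T=UNIV])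
     (auto simp: assms)

lemma smooth_on_vec:
  fixes F :: "'n::finite \<Rightarrow> 'e::real_normed_vector \<Rightarrow> 'f::euclidean_space"
  assumes "\<And>i. smooth_on S (F i)" "open S" shows "smooth_on S (\<lambda>x. \<chi> i. F i x)"
proof -
  have l: "bounded_linear (axis i :: 'f \<Rightarrow> 'f^'n)" for i
    unfolding linear_conv_bounded_linear[symmetric] linear_iff vec_eq_iff axis_def vec_lambda_beta
      vector_add_component vector_scaleR_component
    by simp
  have "(\<lambda>x. \<chi> i. F i x) = (\<lambda>x. \<Sum>i\<in>UNIV. axis i (F i x))"
    by (simp add: fun_eq_iff vec_eq_iff axis_def)
  moreover have "smooth_on S (\<lambda>x. axis i (F i x))" for i
    using smooth_on_compose[OF smooth_on_bounded_linear[OF l, of UNIV] assms(1)[of i] _ assms(2)] by simp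
  ultimately show ?thesis by (simp add: smooth_on_sum assms)
qed

lemma bounded_bilinear_matrix_vector: "bounded_bilinear ((*v) :: real^'n^'m \<Rightarrow> _)"
proof (rule bilinear_conv_bounded_bilinear[THEN iffD1], unfold bilinear_def, safe)
  fix x :: "real^'n^'m" show "linear ((*v) x)" by simp
next
  fix y :: "real^'n" show "linear (\<lambda>x::real^'n^'m. x *v y)"
    by (rule linearI) (auto simp: vec_eq_iff matrix_vector_mult_def algebra_simps sum.distrib sum_distrib_left)
qed

lemmas smooth_on_mult_vec [smooth_intros] = smooth_on_bilinear[OF bounded_bilinear_matrix_vector]

lemma smooth_on_ip [smooth_intros]:
  "smooth_on S G \<Longrightarrow> smooth_on S v \<Longrightarrow> smooth_on S w \<Longrightarrow> open S \<Longrightarrow> smooth_on S (\<lambda>x. ip (G x) (v x) (w x))"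
  unfolding ip_def by (intro smooth_intros)

lemma smooth_on_det [smooth_intros]:
  fixes G :: "'e::real_normed_vector \<Rightarrow> real^'n^'n"
  assumes "smooth_on S G" "open S" shows "smooth_on S (\<lambda>x. det (G x))"
  unfolding det_def by (intro smooth_intros assms)

section \<open>Symmetry of second derivatives\<close>

lemma has_vector_derivative_line:
  assumes "F differentiable (at (x + t *\<^sub>R v))"
  shows "((\<lambda>t. F (x + t *\<^sub>R v)) has_vector_derivative dird v F (x + t *\<^sub>R v)) (at t)"
proof -
  have "((\<lambda>t. x + t *\<^sub>R v) has_derivative (\<lambda>s. s *\<^sub>R v)) (at t)"
    by (auto intro!: derivative_eq_intros)
  from has_derivative_compose[OF this has_derivative_dird[OF assms]]
  show ?thesis
    by (simp add: has_vector_derivative_def linear_cmul[OF dird_linear[OF assms]])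
qed

text \<open>The mean value theorem is used twice: in direction \<open>u\<close> for the difference
  of \<open>F\<close> along two parallel segments, then in direction \<open>v\<close> for
  \<open>dird u F\<close>. The left side is symmetric in \<open>u\<close> and \<open>v\<close> while
  the right side fixes an order of differentiation; comparing both readings gives the symmetry of
  mixed derivatives.\<close>

lemma second_difference:
  fixes F :: "'e::real_normed_vector \<Rightarrow> real"
  assumes F: "smooth_on S F" and s: "0 < s"
    and in_S: "\<And>a b. 0 \<le> a \<Longrightarrow> a \<le> s \<Longrightarrow> 0 \<le> b \<Longrightarrow> b \<le> s \<Longrightarrow> x + a *\<^sub>R u + b *\<^sub>R v \<in> S"
  obtains a b where "0 < a" "a < s" "0 < b" "b < s"
    "F (x + s *\<^sub>R u + s *\<^sub>R v) - F (x + s *\<^sub>R u) - F (x + s *\<^sub>R v) + F x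
      = s\<^sup>2 * dird v (dird u F) (x + a *\<^sub>R u + b *\<^sub>R v)"
proof -
  have d: "((\<lambda>t. H (y + t *\<^sub>R w)) has_real_derivative dird w H (y + t *\<^sub>R w)) (at t)"
    if "smooth_on S H" "y + t *\<^sub>R w \<in> S" for H :: "'e \<Rightarrow> real" and y t w
    using has_vector_derivative_line[OF smooth_onD_differentiable[OF that]]
    by (simp add: has_real_derivative_iff_has_vector_derivative)
  have "\<exists>a>0. a < s \<and> (F ((x + s *\<^sub>R v) + s *\<^sub>R u) - F (x + s *\<^sub>R u)) - (F ((x + s *\<^sub>R v) + 0 *\<^sub>R u) - F (x + 0 *\<^sub>R u))
      = (s - 0) * (dird u F ((x + s *\<^sub>R v) + a *\<^sub>R u) - dird u F (x + a *\<^sub>R u))"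
  proof (rule MVT2[OF s, of "\<lambda>t. F ((x + s *\<^sub>R v) + t *\<^sub>R u) - F (x + t *\<^sub>R u)"
        "\<lambda>t. dird u F ((x + s *\<^sub>R v) + t *\<^sub>R u) - dird u F (x + t *\<^sub>R u)"])
    fix t assume t: "0 \<le> t" "t \<le> s"
    have "(x + s *\<^sub>R v) + t *\<^sub>R u \<in> S" "x + t *\<^sub>R u \<in> S"
      using in_S[of t s] in_S[of t 0] t s by (simp_all add: add_ac)
    then show "((\<lambda>t. F ((x + s *\<^sub>R v) + t *\<^sub>R u) - F (x + t *\<^sub>R u)) has_real_derivative
        dird u F ((x + s *\<^sub>R v) + t *\<^sub>R u) - dird u F (x + t *\<^sub>R u)) (at t)"
      by (intro DERIV_diff d F)
  qed
  then obtain a where a: "0 < a" "a < s"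
    "F (x + s *\<^sub>R v + s *\<^sub>R u) - F (x + s *\<^sub>R u) - (F (x + s *\<^sub>R v) - F x)
      = s * (dird u F (x + s *\<^sub>R v + a *\<^sub>R u) - dird u F (x + a *\<^sub>R u))" by auto
  have "\<exists>b>0. b < s \<and> dird u F ((x + a *\<^sub>R u) + s *\<^sub>R v) - dird u F ((x + a *\<^sub>R u) + 0 *\<^sub>R v)
      = (s - 0) * dird v (dird u F) ((x + a *\<^sub>R u) + b *\<^sub>R v)"
  proof (rule MVT2[OF s, of "\<lambda>t. dird u F ((x + a *\<^sub>R u) + t *\<^sub>R v)"
        "\<lambda>t. dird v (dird u F) ((x + a *\<^sub>R u) + t *\<^sub>R v)"])
    fix t assume "0 \<le> t" "t \<le> s"
    then have "(x + a *\<^sub>R u) + t *\<^sub>R v \<in> S" using in_S[of a t] a by simp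
    then show "((\<lambda>t. dird u F ((x + a *\<^sub>R u) + t *\<^sub>R v)) has_real_derivative
        dird v (dird u F) ((x + a *\<^sub>R u) + t *\<^sub>R v)) (at t)"
      by (intro d smooth_on_dird F)
  qed
  then obtain b where "0 < b" "b < s" "dird u F (x + a *\<^sub>R u + s *\<^sub>R v) - dird u F (x + a *\<^sub>R u)
      = s * dird v (dird u F) (x + a *\<^sub>R u + b *\<^sub>R v)" by auto
  with a that show ?thesis by (simp add: power2_eq_square algebra_simps)
qed

lemma dird_commute_real:
  fixes F :: "'e::real_normed_vector \<Rightarrow> real"
  assumes "open S" "smooth_on S F" "x \<in> S"
  shows "dird u (dird v F) x = dird v (dird u F) x"
proof (rule ccontr)
  assume neq: "dird u (dird v F) x \<noteq> dird v (dird u F) x"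
  \<comment> \<open>Half the gap, so that the \<open>e\<close>-neighbourhoods of the two distinct
    values are disjoint.\<close>
  define e where "e = \<bar>dird u (dird v F) x - dird v (dird u F) x\<bar> / 2"
  have e: "e > 0" using neq by (simp add: e_def)
  have cont: "isCont (dird a (dird b F)) x" for a b
    using smooth_on_continuous[OF smooth_on_dird[OF smooth_on_dird[OF assms(2)]]] assms(1,3)
    by (simp add: continuous_on_eq_continuous_at)
  obtain r1 where r1: "r1 > 0" "\<And>y. dist y x < r1 \<Longrightarrow> dist (dird u (dird v F) y) (dird u (dird v F) x) < e"
    using cont[of u v] e unfolding continuous_at_eps_delta by blast
  obtain r2 where r2: "r2 > 0" "\<And>y. dist y x < r2 \<Longrightarrow> dist (dird v (dird u F) y) (dird v (dird u F) x) < e"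
    using cont[of v u] e unfolding continuous_at_eps_delta by blast
  obtain r3 where r3: "r3 > 0" "ball x r3 \<subseteq> S" using assms open_contains_ball by blast
  define r where "r = min r1 (min r2 r3)"
  \<comment> \<open>Small enough for the parallelogram spanned by \<open>s *\<^sub>R u\<close> and
    \<open>s *\<^sub>R v\<close> to stay in the ball of radius \<open>r\<close>; the added 1 covers
    \<open>u = v = 0\<close>.\<close>
  define s where "s = r / (norm u + norm v + 1)"
  have r: "r > 0" using r1 r2 r3 by (auto simp: r_def)
  have nn: "norm u + norm v + 1 > 0" by (simp add: add_nonneg_pos)
  then have s: "s > 0" using r by (simp add: s_def)
  have near: "dist (x + a *\<^sub>R p + b *\<^sub>R q) x < r"
    if "0 \<le> a" "a \<le> s" "0 \<le> b" "b \<le> s" and pq: "norm p + norm q = norm u + norm v" for a b p q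
  proof -
    have "dist (x + a *\<^sub>R p + b *\<^sub>R q) x \<le> a * norm p + b * norm q"
      using norm_triangle_ineq[of "a *\<^sub>R p" "b *\<^sub>R q"] that by (simp add: dist_norm algebra_simps)
    also have "\<dots> \<le> s * norm p + s * norm q" using that by (intro add_mono mult_right_mono) auto
    also have "\<dots> = s * (norm u + norm v)" using pq by (metis distrib_left)
    also have "\<dots> < s * (norm u + norm v + 1)" using s by simp
    also have "\<dots> = r" using nn by (simp add: s_def)
    finally show ?thesis .
  qed
  have inS: "x + a *\<^sub>R p + b *\<^sub>R q \<in> S"
    if "0 \<le> a" "a \<le> s" "0 \<le> b" "b \<le> s" "norm p + norm q = norm u + norm v" for a b p q
    using near[OF that] r3 by (auto simp: r_def dist_commute subset_iff)
  obtain a b where ab: "0 < a" "a < s" "0 < b" "b < s"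
    "F (x + s *\<^sub>R u + s *\<^sub>R v) - F (x + s *\<^sub>R u) - F (x + s *\<^sub>R v) + F x
      = s\<^sup>2 * dird v (dird u F) (x + a *\<^sub>R u + b *\<^sub>R v)"
    using second_difference[OF assms(2) s, of x u v] inS[of _ _ u v] by blast
  obtain c d where cd: "0 < c" "c < s" "0 < d" "d < s"
    "F (x + s *\<^sub>R v + s *\<^sub>R u) - F (x + s *\<^sub>R v) - F (x + s *\<^sub>R u) + F x
      = s\<^sup>2 * dird u (dird v F) (x + c *\<^sub>R v + d *\<^sub>R u)"
    using second_difference[OF assms(2) s, of x v u] inS[of _ _ v u] by (metis add.commute)
  have "s\<^sup>2 * dird v (dird u F) (x + a *\<^sub>R u + b *\<^sub>R v) = s\<^sup>2 * dird u (dird v F) (x + c *\<^sub>R v + d *\<^sub>R u)"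
    using ab(5) cd(5) by (simp add: algebra_simps)
  then have eq: "dird v (dird u F) (x + a *\<^sub>R u + b *\<^sub>R v) = dird u (dird v F) (x + c *\<^sub>R v + d *\<^sub>R u)"
    using s by simp
  have "dist (x + a *\<^sub>R u + b *\<^sub>R v) x < r2" "dist (x + c *\<^sub>R v + d *\<^sub>R u) x < r1"
    using near[of a b u v] near[of c d v u] ab cd by (auto simp: r_def)
  from r2(2)[OF this(1)] r1(2)[OF this(2)] eq show False
    unfolding e_def dist_real_def by (auto simp: abs_if field_simps split: if_splits)
qed

lemma dird_inner_right:
  assumes "F differentiable (at x)"
  shows "dird v (\<lambda>y. F y \<bullet> b) x = dird v F x \<bullet> b"
  by (rule dird_eqI[OF has_derivative_inner_left[OF has_derivative_dird[OF assms]]])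

lemma dird_commute:
  fixes F :: "'e::real_normed_vector \<Rightarrow> 'f::euclidean_space"
  assumes "open S" "smooth_on S F" "x \<in> S"
  shows "dird u (dird v F) x = dird v (dird u F) x"
proof (rule euclidean_eqI)
  fix b :: 'f assume "b \<in> Basis"
  have "dird u (dird v F) x \<bullet> b = dird u (dird v (\<lambda>y. F y \<bullet> b)) x" for u v
  proof -
    have "dird u (dird v (\<lambda>y. F y \<bullet> b)) x = dird u (\<lambda>y. dird v F y \<bullet> b) x"
      by (rule dird_cong[OF assms(1,3)], rule dird_inner_right, rule smooth_onD_differentiable[OF assms(2)])
    also have "\<dots> = dird u (dird v F) x \<bullet> b"
      by (rule dird_inner_right, rule smooth_onD_differentiable[OF smooth_on_dird[OF assms(2)] assms(3)])
    finally show ?thesis by simp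
  qed
  then show "dird u (dird v F) x \<bullet> b = dird v (dird u F) x \<bullet> b"
    using dird_commute_real[OF assms(1) _ assms(3), of "\<lambda>y. F y \<bullet> b"]
      smooth_on_inner[OF assms(2) smooth_on_const assms(1)] by simp
qed

section \<open>A smooth step function\<close>

text \<open>The functions x^(-m) exp(-1/x), extended by 0. The powers are carried along because the
  derivatives of the classical case m = 0 are combinations of them.\<close>

definition flat_exp :: "nat \<Rightarrow> real \<Rightarrow> real" where
  "flat_exp m x = (if x \<le> 0 then 0 else inverse x ^ m * exp (- inverse x))"

lemma flat_exp_nonneg: "0 \<le> flat_exp m x" by (simp add: flat_exp_def)

text \<open>With y = 1/x the claim is y^(m+2) <= (m+2)! exp y, a single term of the exponential
  series. The quadratic decay at 0 is what sends the difference quotient there to 0.\<close>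

lemma flat_exp_le: "\<bar>flat_exp m x\<bar> \<le> fact (m + 2) * x\<^sup>2"
proof (cases "x \<le> 0")
  case False
  define y where "y = inverse x"
  have y: "y > 0" using False by (simp add: y_def)
  have "y ^ (m+2) \<le> fact (m+2) * exp y"
  proof -
    have "(y ^ (m+2)) /\<^sub>R fact (m+2) \<le> (\<Sum>n\<in>{m+2}. y ^ n /\<^sub>R fact n)" by simp
    also have "\<dots> \<le> exp y"
      unfolding exp_def using y by (intro sum_le_suminf summable_exp_generic) auto
    finally have "y ^ (m+2) / fact (m+2) \<le> exp y" by (simp add: divide_inverse mult.commute)
    then show ?thesis by (simp add: divide_le_eq mult.commute del: fact_Suc power_Suc)
  qed
  then have "y ^ m * exp (- y) \<le> fact (m+2) * (inverse y)\<^sup>2"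
    using y by (simp add: exp_minus field_simps power2_eq_square)
  then show ?thesis using False by (simp add: flat_exp_def y_def)
qed (simp add: flat_exp_def)

text \<open>Away from 0 the function agrees locally with 0 or with the explicit formula; at 0 the
  bound \<open>flat_exp_le\<close> forces the derivative 0.\<close>

lemma DERIV_flat_exp:
  "(flat_exp m has_real_derivative flat_exp (m+2) x - m * flat_exp (m+1) x) (at x)"
proof -
  consider "x < 0" | "x = 0" | "x > 0" by linarith
  then show ?thesis
  proof cases
    case 1
    have "((\<lambda>x. 0) has_real_derivative 0) (at x)" by simp
    then have "(flat_exp m has_real_derivative 0) (at x)"
      by (rule has_field_derivative_transform_within_open[of _ _ _ "{..<0}"]) (use 1 in \<open>auto simp: flat_exp_def\<close>)
    then show ?thesis using 1 by (simp add: flat_exp_def)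
  next
    case 2
    have "((\<lambda>h. (flat_exp m (0 + h) - flat_exp m 0) / h) \<longlongrightarrow> 0) (at 0)"
    proof (rule Lim_null_comparison[where g="\<lambda>h. fact (m+2) * \<bar>h\<bar>"])
      show "\<forall>\<^sub>F h in at 0. norm ((flat_exp m (0 + h) - flat_exp m 0) / h) \<le> fact (m+2) * \<bar>h\<bar>"
      proof (rule always_eventually, rule allI)
        fix h :: real
        have "\<bar>flat_exp m h\<bar> / \<bar>h\<bar> \<le> fact (m+2) * h\<^sup>2 / \<bar>h\<bar>"
          using flat_exp_le by (intro divide_right_mono) auto
        also have "\<dots> = fact (m+2) * \<bar>h\<bar>" by (auto simp: power2_eq_square abs_if)
        finally show "norm ((flat_exp m (0 + h) - flat_exp m 0) / h) \<le> fact (m+2) * \<bar>h\<bar>"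
          by (simp add: flat_exp_def[of m 0] abs_divide)
      qed
      show "((\<lambda>h. fact (m+2) * \<bar>h\<bar>) \<longlongrightarrow> 0) (at (0::real))"
        by (auto intro!: tendsto_eq_intros)
    qed
    then show ?thesis using 2 by (simp add: DERIV_def flat_exp_def[of "m+2" 0] flat_exp_def[of "m+1" 0] flat_exp_def[of "Suc m" 0] flat_exp_def[of "Suc (Suc m)" 0])
  next
    case 3
    have "((\<lambda>x. inverse x ^ m * exp (- inverse x)) has_real_derivative
        flat_exp (m+2) x - m * flat_exp (m+1) x) (at x)"
      using 3 by (auto intro!: derivative_eq_intros simp: flat_exp_def power2_eq_square)
        (cases m; simp add: field_simps power2_eq_square)
    then show ?thesis
      by (rule has_field_derivative_transform_within_open[of _ _ _ "{0<..}"]) (use 3 in \<open>auto simp: flat_exp_def\<close>)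
  qed
qed

lemma smooth_on_flat_exp: "smooth_on UNIV (flat_exp m)"
proof -
  have "Ck_on k UNIV (flat_exp m)" for k
  proof (induction k arbitrary: m)
    case 0
    then show ?case using DERIV_flat_exp DERIV_continuous_on[of UNIV "flat_exp m"] by fastforce
  next
    case (Suc k)
    have "dird v (flat_exp m) = (\<lambda>x. v * (flat_exp (m+2) x - m * flat_exp (m+1) x))" for v
      using dird_real[OF DERIV_flat_exp] by auto
    moreover have "Ck_on k UNIV (\<lambda>x. v * (flat_exp (m+2) x + (- real m) * flat_exp (m+1) x))" for v
      by (intro Ck_on_bilinear[OF bounded_bilinear_mult] Ck_on_const Ck_on_add Suc.IH) auto
    ultimately show ?case
      by (auto simp: Ck_on_Suc real_differentiable_def intro: DERIV_flat_exp)
  qed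
  then show ?thesis by (simp add: smooth_on_def)
qed

text \<open>For E = \<open>flat_exp 0\<close> the function E(t) / (E(t) + E(1 - t)) works: the
  denominator is positive because t and 1 - t are not both nonpositive. The derivative vanishes
  outside the unit interval and is bounded on it by compactness.\<close>

lemma smooth_step_exists:
  "\<exists>\<theta>::real\<Rightarrow>real. smooth_on UNIV \<theta> \<and> (\<forall>t\<le>0. \<theta> t = 0) \<and> (\<forall>t\<ge>1. \<theta> t = 1) \<and> (\<forall>t. 0 \<le> \<theta> t \<and> \<theta> t \<le> 1)
     \<and> (\<exists>L>0. \<forall>t v. \<bar>dird v \<theta> t\<bar> \<le> L * \<bar>v\<bar>)"
proof -
  define \<theta> where "\<theta> = (\<lambda>t. flat_exp 0 t / (flat_exp 0 t + flat_exp 0 (1 - t)))"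
  have pos: "flat_exp 0 t + flat_exp 0 (1 - t) > 0" for t by (auto simp: flat_exp_def add_pos_pos)
  have sm: "smooth_on UNIV \<theta>" unfolding \<theta>_def
  proof (intro smooth_on_divide smooth_on_add smooth_on_flat_exp pos open_UNIV)
    show "smooth_on UNIV (\<lambda>x. flat_exp 0 (1 - x))"
      by (rule smooth_on_compose[OF smooth_on_flat_exp]) (auto intro!: smooth_intros)
  qed
  have zero: "\<theta> t = 0" if "t \<le> 0" for t using that by (simp add: \<theta>_def flat_exp_def)
  have one: "\<theta> t = 1" if "t \<ge> 1" for t using that pos[of t] by (auto simp: \<theta>_def flat_exp_def)
  have "compact ((\<lambda>t. dird 1 \<theta> t) ` {0..1})"
    by (intro compact_continuous_image continuous_on_subset[OF smooth_on_continuous[OF smooth_on_dird[OF sm]]]) auto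
  then have "bounded ((\<lambda>t. dird 1 \<theta> t) ` {0..1})" by (rule compact_imp_bounded)
  then obtain L where L: "L > 0" "\<And>t. t \<in> {0..1} \<Longrightarrow> \<bar>dird 1 \<theta> t\<bar> \<le> L"
    unfolding bounded_pos real_norm_def by blast
  have "\<bar>dird 1 \<theta> t\<bar> \<le> L" for t
  proof -
    have "dird 1 \<theta> t = dird 1 (\<lambda>_. 0) t" if "t < 0"
      by (rule dird_cong[of "{..<0}"]) (use that zero in auto)
    moreover have "dird 1 \<theta> t = dird 1 (\<lambda>_. 1) t" if "t > 1"
      by (rule dird_cong[of "{1<..}"]) (use that one in auto)
    moreover have "dird 1 (\<lambda>_. c) t = 0" for c :: real using dird_eqI[OF has_derivative_const] by auto
    ultimately show ?thesis using L by (cases "t < 0"; cases "t > 1") auto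
  qed
  moreover have "dird v \<theta> t = v * dird 1 \<theta> t" for v t
    using linear_cmul[OF dird_linear[OF smooth_onD_differentiable[OF sm]], of t v 1] by simp
  ultimately have "\<bar>dird v \<theta> t\<bar> \<le> L * \<bar>v\<bar>" for v t
    by (metis abs_ge_zero abs_mult mult.commute mult_left_mono)
  moreover have "0 \<le> \<theta> t \<and> \<theta> t \<le> 1" for t
    using pos[of t] flat_exp_nonneg[of 0 t] flat_exp_nonneg[of 0 "1-t"] by (auto simp: \<theta>_def divide_le_eq)
  ultimately show ?thesis using sm zero one L(1) by blast
qed

section \<open>Inverse matrices\<close>

lemma matrix_inv_both:
  fixes A :: "real^'n^'n" assumes "det A \<noteq> 0"
  shows "A ** matrix_inv A = mat 1" "matrix_inv A ** A = mat 1"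
proof -
  have "\<exists>A'. A ** A' = mat 1 \<and> A' ** A = mat 1"
    using assms by (simp add: invertible_det_nz[symmetric] invertible_def)
  then have "A ** matrix_inv A = mat 1 \<and> matrix_inv A ** A = mat 1"
    unfolding matrix_inv_def by (rule someI_ex)
  then show "A ** matrix_inv A = mat 1" "matrix_inv A ** A = mat 1" by auto
qed

text \<open>Cramer's rule for the columns of the inverse. It exhibits the entries as quotients of
  polynomials, from which smoothness of \<open>matrix_inv\<close>, itself defined by choice, is read
  off.\<close>

lemma matrix_inv_nth:
  fixes A :: "real^'n^'n" assumes "det A \<noteq> 0"
  shows "matrix_inv A $ k $ j = det (\<chi> i l. if l = k then axis j 1 $ i else A $ i $ l) / det A"
proof -
  have "A *v (matrix_inv A *v axis j 1) = axis j 1" by (simp add: matrix_vector_mul_assoc matrix_inv_both[OF assms])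
  then have "matrix_inv A *v axis j 1 = (\<chi> k. det (\<chi> i l. if l = k then axis j 1 $ i else A $ i $ l) / det A)"
    using cramer[OF assms] by blast
  then show ?thesis by (metis (no_types, lifting) matrix_vector_mul_component vec_lambda_beta matrix_vector_mult_basis column_def)
qed

lemma smooth_on_matrix_inv [smooth_intros]:
  fixes G :: "'e::real_normed_vector \<Rightarrow> real^'n^'n"
  assumes "smooth_on S G" "open S" "\<And>x. x \<in> S \<Longrightarrow> det (G x) > 0"
  shows "smooth_on S (\<lambda>x. matrix_inv (G x))"
proof -
  have "smooth_on S (\<lambda>x. \<chi> k j. det (\<chi> i l. if l = k then axis j 1 $ i else G x $ i $ l) / det (G x))"
  proof (intro smooth_on_vec smooth_on_divide smooth_intros assms)
    fix k j i l
    show "smooth_on S (\<lambda>x. if l = k then axis j 1 $ i else G x $ i $ l)"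
      by (cases "l = k") (auto intro!: smooth_intros assms)
  qed
  moreover have "matrix_inv (G x) = (\<chi> k j. det (\<chi> i l. if l = k then axis j 1 $ i else G x $ i $ l) / det (G x))"
    if "x \<in> S" for x
    using matrix_inv_nth[of "G x"] assms(3)[OF that] by (simp add: vec_eq_iff)
  ultimately show ?thesis using smooth_on_cong[OF assms(2)] by (metis (no_types, lifting))
qed

section \<open>Riemannian metrics in coordinates\<close>

lemma linear_expand:
  fixes f :: "real^'n \<Rightarrow> 'b::real_vector"
  assumes "linear f" shows "f v = (\<Sum>i\<in>UNIV. v $ i *\<^sub>R f (axis i 1))"
proof -
  have "v = (\<Sum>i\<in>UNIV. v $ i *\<^sub>R axis i 1)"
    using basis_expansion[of v] by (simp add: scalar_mult_eq_scaleR)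
  then have "f v = f (\<Sum>i\<in>UNIV. v $ i *\<^sub>R axis i 1)" by simp
  also have "\<dots> = (\<Sum>i\<in>UNIV. v $ i *\<^sub>R f (axis i 1))"
    by (simp only: linear_sum[OF assms] linear_cmul[OF assms])
  finally show ?thesis .
qed

lemma dird_expand:
  "F differentiable (at x) \<Longrightarrow> dird v F x = (\<Sum>i\<in>UNIV. v $ i *\<^sub>R pd i F x)"
  unfolding pd_def dird_def[symmetric] by (rule linear_expand[OF dird_linear])

lemma pd_eq_dird: "pd i F = dird (axis i 1) F"
  by (simp add: fun_eq_iff pd_def dird_def)

lemma ip_expand: "ip A v w = (\<Sum>i\<in>UNIV. \<Sum>j\<in>UNIV. v $ i * w $ j * A $ i $ j)"
  by (simp add: ip_def inner_vec_def matrix_vector_mult_def sum_distrib_left mult_ac)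

lemma ip_add_left: "ip A (u + v) w = ip A u w + ip A v w"
  and ip_diff_left: "ip A (u - v) w = ip A u w - ip A v w"
  and ip_scale_left: "ip A (r *\<^sub>R v) w = r * ip A v w"
  and ip_zero_left: "ip A 0 w = 0"
  and ip_add_right: "ip A v (w + z) = ip A v w + ip A v z"
  and ip_diff_right: "ip A v (w - z) = ip A v w - ip A v z"
  and ip_scale_right: "ip A v (r *\<^sub>R w) = r * ip A v w"
  and ip_zero_right: "ip A v 0 = 0"
  by (simp_all add: ip_def inner_add_left inner_diff_left inner_add_right inner_diff_right
      matrix_vector_right_distrib matrix_vector_mult_diff_distrib matrix_vector_mult_scaleR)

lemmas ip_simps = ip_add_left ip_diff_left ip_scale_left ip_zero_left
  ip_add_right ip_diff_right ip_scale_right ip_zero_right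

lemma ip_sum_left: "ip A (\<Sum>i\<in>I. v i) w = (\<Sum>i\<in>I. ip A (v i) w)"
  by (induction I rule: infinite_finite_induct) (auto simp: ip_simps)

lemma ip_sum_right: "ip A w (\<Sum>i\<in>I. v i) = (\<Sum>i\<in>I. ip A w (v i))"
  by (induction I rule: infinite_finite_induct) (auto simp: ip_simps)

lemma ip_axis: "ip A (axis i 1) (axis j 1) = A $ i $ j"
  by (simp add: ip_def inner_axis' matrix_vector_mult_basis column_def)

lemma ip_congruence: "ip (transpose J ** A ** J) v w = ip A (J *v v) (J *v w)"
  unfolding ip_def matrix_vector_mul_assoc[symmetric] by (metis dot_lmul_matrix vector_transpose_matrix)

section \<open>Positive definite matrices\<close>

definition posdef :: "real^'n^'n \<Rightarrow> bool" where
  "posdef A \<longleftrightarrow> transpose A = A \<and> (\<forall>v. v \<noteq> 0 \<longrightarrow> ip A v v > 0)"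

lemma ip_commute: "transpose A = A \<Longrightarrow> ip A v w = ip A w v"
  unfolding ip_def by (metis dot_lmul_matrix inner_commute transpose_matrix_vector)

lemma posdef_pos: "posdef A \<Longrightarrow> v \<noteq> 0 \<Longrightarrow> ip A v v > 0" by (simp add: posdef_def)

lemma posdef_nonneg: "posdef A \<Longrightarrow> ip A v v \<ge> 0"
  by (cases "v = 0") (auto simp: posdef_def ip_simps intro: less_imp_le)

lemma posdef_commute: "posdef A \<Longrightarrow> ip A v w = ip A w v"
  by (simp add: posdef_def ip_commute)

lemma posdef_eqI: "posdef A \<Longrightarrow> (\<And>z. ip A u z = ip A v z) \<Longrightarrow> u = v"
  using posdef_pos[of A "u - v"] by (force simp: ip_simps)

lemma posdef_det_nz: assumes "posdef A" shows "det A \<noteq> 0"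
proof -
  have "inj ((*v) A)"
  proof (rule linear_injective_0[THEN iffD2], simp, intro allI impI)
    fix v assume "A *v v = 0"
    then have "ip A v v = 0" by (simp add: ip_def)
    then show "v = 0" using posdef_pos[OF assms, of v] by fastforce
  qed
  then show ?thesis
    by (simp add: invertible_det_nz[symmetric] invertible_left_inverse matrix_left_invertible_injective)
qed

text \<open>The segment from the identity to \<open>A\<close> consists of positive definite
  matrices, on which the determinant has no zero; as it starts at 1, it cannot reach a value <=
  0.\<close>

lemma posdef_det: assumes "posdef A" shows "det A > 0"
proof (rule ccontr)
  assume "\<not> det A > 0"
  define B where "B t = (1 - t) *\<^sub>R mat 1 + t *\<^sub>R A" for t :: real
  have pd: "posdef (B t)" if "0 \<le> t" "t \<le> 1" for t
  proof -
    have "ip (B t) v v = (1 - t) * (v \<bullet> v) + t * ip A v v" for v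
      by (simp add: ip_def B_def matrix_vector_mult_add_rdistrib inner_add_right scaleR_matrix_vector_assoc[symmetric])
    moreover have "(1 - t) * (v \<bullet> v) + t * ip A v v > 0" if "v \<noteq> 0" for v
    proof (cases "t = 0")
      case False
      then have "t * ip A v v > 0" using \<open>0 \<le> t\<close> posdef_pos[OF assms that] by auto
      moreover have "(1 - t) * (v \<bullet> v) \<ge> 0" using \<open>t \<le> 1\<close> by simp
      ultimately show ?thesis by linarith
    qed (use that in auto)
    moreover have "transpose (B t) = B t" using assms
      by (simp add: B_def posdef_def vec_eq_iff transpose_def mat_def)
    ultimately show ?thesis by (simp add: posdef_def)
  qed
  have "continuous_on {0..1} (\<lambda>t. det (B t))"
    unfolding det_def B_def by (auto intro!: continuous_intros)
  moreover have "det (B 0) = 1" "det (B 1) = det A" by (simp_all add: B_def)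
  ultimately obtain t where "0 \<le> t" "t \<le> 1" "det (B t) = 0"
    using IVT2'[of "\<lambda>t. det (B t)" 1 0 0] \<open>\<not> det A > 0\<close> by auto
  then show False using posdef_det_nz[OF pd] by blast
qed

definition metric_on :: "(real^'n) set \<Rightarrow> (real^'n \<Rightarrow> real^'n^'n) \<Rightarrow> bool" where
  "metric_on S G \<longleftrightarrow> open S \<and> smooth_on S G \<and> (\<forall>x\<in>S. posdef (G x))"

lemma metric_onD:
  assumes "metric_on S G"
  shows "open S" "smooth_on S G" "x \<in> S \<Longrightarrow> posdef (G x)"
  using assms by (auto simp: metric_on_def)

lemma has_derivative_ip:
  assumes "(A has_derivative A') (at x)" "(a has_derivative a') (at x)" "(b has_derivative b') (at x)"
  shows "((\<lambda>y. ip (A y) (a y) (b y)) has_derivative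
     (\<lambda>v. ip (A' v) (a x) (b x) + ip (A x) (a' v) (b x) + ip (A x) (a x) (b' v))) (at x)"
  unfolding ip_def
  by (rule has_derivative_eq_rhs[OF bounded_bilinear.FDERIV[OF bounded_bilinear_inner assms(2)
          bounded_bilinear.FDERIV[OF bounded_bilinear_matrix_vector assms(1,3)]]])
     (auto simp: fun_eq_iff inner_add_right)

lemma dird_ip:
  assumes "A differentiable (at x)" "a differentiable (at x)" "b differentiable (at x)"
  shows "dird v (\<lambda>y. ip (A y) (a y) (b y)) x
    = ip (dird v A x) (a x) (b x) + ip (A x) (dird v a x) (b x) + ip (A x) (a x) (dird v b x)"
  by (rule dird_eqI[OF has_derivative_ip[OF assms[THEN has_derivative_dird]]])

lemma dird_const: "dird v (\<lambda>y. c) x = 0"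
  by (rule dird_eqI[OF has_derivative_const])

lemma dird_nth2:
  fixes G :: "'e::real_normed_vector \<Rightarrow> real^'n^'m"
  assumes "G differentiable (at x)" shows "dird v (\<lambda>y. G y $ i $ j) x = dird v G x $ i $ j"
  by (rule dird_eqI[OF bounded_linear.has_derivative[OF bounded_linear_component2 has_derivative_dird[OF assms]]])

lemma dird_nth:
  fixes G :: "'e::real_normed_vector \<Rightarrow> real^'n"
  assumes "G differentiable (at x)" shows "dird v (\<lambda>y. G y $ i) x = dird v G x $ i"
  by (rule dird_eqI[OF bounded_linear.has_derivative[OF bounded_linear_vec_nth has_derivative_dird[OF assms]]])

section \<open>Connection and curvature as multilinear maps\<close>

text \<open>The Christoffel symbols as a vector-valued bilinear map, that is, the covariant
  derivative of the constant field \<open>w\<close> in direction \<open>v\<close>. With vectors in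
  place of indices the transformation laws become identities without sums.\<close>

definition chr :: "(real^'n \<Rightarrow> real^'n^'n) \<Rightarrow> real^'n \<Rightarrow> real^'n \<Rightarrow> real^'n \<Rightarrow> real^'n" where
  "chr G x v w = (\<chi> k. \<Sum>i\<in>UNIV. \<Sum>j\<in>UNIV. v $ i * w $ j * christoffel G k i j x)"

lemma chr_axis: "chr G x (axis i 1) (axis j 1) $ k = christoffel G k i j x"
proof -
  have "(\<Sum>a\<in>UNIV. \<Sum>b\<in>UNIV. axis i (1::real) $ a * axis j 1 $ b * christoffel G k a b x)
    = (\<Sum>a\<in>UNIV. axis i (1::real) $ a * (\<Sum>b\<in>UNIV. axis j 1 $ b * christoffel G k a b x))"
    by (simp add: sum_distrib_left mult_ac)
  also have "\<dots> = christoffel G k i j x" by (simp add: axis_def if_distrib[of "\<lambda>z. z * _"] cong: if_cong)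
  finally show ?thesis by (simp add: chr_def)
qed

lemma chr_add_left: "chr G x (u + v) w = chr G x u w + chr G x v w"
  and chr_add_right: "chr G x w (u + v) = chr G x w u + chr G x w v"
  and chr_scale_left: "chr G x (r *\<^sub>R v) w = r *\<^sub>R chr G x v w"
  and chr_scale_right: "chr G x w (r *\<^sub>R v) = r *\<^sub>R chr G x w v"
  by (simp_all add: chr_def vec_eq_iff algebra_simps sum.distrib sum_distrib_left)

lemma linear_chr_left: "linear (\<lambda>v. chr G x v w)" and linear_chr_right: "linear (chr G x v)"
  by (auto intro!: linearI simp: chr_add_left chr_add_right chr_scale_left chr_scale_right)

text \<open>The Koszul formula for constant fields, whose brackets vanish. Pairing with
  \<open>G\<close> cancels the inverse metric in \<open>christoffel\<close>; what remains is the
  expansion of the three forms in components.\<close>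

lemma koszul:
  assumes G: "metric_on S G" and x: "x \<in> S"
  shows "ip (G x) (chr G x v w) z
    = (1/2) * (ip (dird v G x) w z + ip (dird w G x) v z - ip (dird z G x) v w)"
proof -
  note dG = smooth_onD_differentiable[OF metric_onD(2)[OF G] x]
  note pos = metric_onD(3)[OF G x]
  \<comment> \<open>The Christoffel symbols of the first kind.\<close>
  define T where "T i j l = (1/2) * (pd i (\<lambda>y. G y $ j $ l) x + pd j (\<lambda>y. G y $ i $ l) x - pd l (\<lambda>y. G y $ i $ j) x)" for i j l
  define t where "t = (\<chi> l. \<Sum>i\<in>UNIV. \<Sum>j\<in>UNIV. v $ i * w $ j * T i j l)"
  have T: "T i j l = (1/2) * (pd i G x $ j $ l + pd j G x $ i $ l - pd l G x $ i $ j)" for i j l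
    by (simp add: T_def pd_eq_dird dird_nth2[OF dG])
  have "chr G x v w = matrix_inv (G x) *v t"
  proof (rule vec_eq_iff[THEN iffD2], rule allI)
    fix k
    have "(matrix_inv (G x) *v t) $ k = (\<Sum>l\<in>UNIV. matrix_inv (G x) $ k $ l * (\<Sum>i\<in>UNIV. \<Sum>j\<in>UNIV. v $ i * w $ j * T i j l))"
      by (simp add: matrix_vector_mult_def t_def)
    also have "\<dots> = (\<Sum>l\<in>UNIV. \<Sum>i\<in>UNIV. \<Sum>j\<in>UNIV. v $ i * w $ j * (matrix_inv (G x) $ k $ l * T i j l))"
      by (simp add: sum_distrib_left mult_ac)
    also have "\<dots> = (\<Sum>i\<in>UNIV. \<Sum>l\<in>UNIV. \<Sum>j\<in>UNIV. v $ i * w $ j * (matrix_inv (G x) $ k $ l * T i j l))"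
      by (rule sum.swap)
    also have "\<dots> = (\<Sum>i\<in>UNIV. \<Sum>j\<in>UNIV. \<Sum>l\<in>UNIV. v $ i * w $ j * (matrix_inv (G x) $ k $ l * T i j l))"
      by (rule sum.cong[OF refl], rule sum.swap)
    also have "\<dots> = chr G x v w $ k"
      by (simp add: chr_def christoffel_def T_def sum_distrib_left mult_ac)
    finally show "chr G x v w $ k = (matrix_inv (G x) *v t) $ k" by simp
  qed
  then have "ip (G x) (chr G x v w) z = z \<bullet> (G x *v (matrix_inv (G x) *v t))"
    using posdef_commute[OF pos] by (simp add: ip_def)
  also have "\<dots> = z \<bullet> t"
    by (simp add: matrix_vector_mul_assoc matrix_inv_both[OF posdef_det_nz[OF pos]])
  also have "\<dots> = (\<Sum>l\<in>UNIV. \<Sum>i\<in>UNIV. \<Sum>j\<in>UNIV. z $ l * v $ i * w $ j * T i j l)"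
    by (simp add: t_def inner_vec_def sum_distrib_left mult_ac)
  also have "\<dots> = (1/2) * ((\<Sum>l\<in>UNIV. \<Sum>i\<in>UNIV. \<Sum>j\<in>UNIV. z $ l * v $ i * w $ j * pd i G x $ j $ l)
      + (\<Sum>l\<in>UNIV. \<Sum>i\<in>UNIV. \<Sum>j\<in>UNIV. z $ l * v $ i * w $ j * pd j G x $ i $ l)
      - (\<Sum>l\<in>UNIV. \<Sum>i\<in>UNIV. \<Sum>j\<in>UNIV. z $ l * v $ i * w $ j * pd l G x $ i $ j))"
    by (simp add: T algebra_simps sum.distrib sum_subtractf sum_distrib_left)
  also have "(\<Sum>l\<in>UNIV. \<Sum>i\<in>UNIV. \<Sum>j\<in>UNIV. z $ l * v $ i * w $ j * pd i G x $ j $ l) = ip (dird v G x) w z"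
  proof -
    have "ip (dird v G x) w z = (\<Sum>j\<in>UNIV. \<Sum>l\<in>UNIV. \<Sum>i\<in>UNIV. z $ l * v $ i * w $ j * pd i G x $ j $ l)"
      by (simp add: ip_expand dird_expand[OF dG] sum_distrib_left mult_ac)
    also have "\<dots> = (\<Sum>l\<in>UNIV. \<Sum>j\<in>UNIV. \<Sum>i\<in>UNIV. z $ l * v $ i * w $ j * pd i G x $ j $ l)" by (rule sum.swap)
    also have "\<dots> = (\<Sum>l\<in>UNIV. \<Sum>i\<in>UNIV. \<Sum>j\<in>UNIV. z $ l * v $ i * w $ j * pd i G x $ j $ l)"
      by (rule sum.cong[OF refl], rule sum.swap)
    finally show ?thesis by simp
  qed
  also have "(\<Sum>l\<in>UNIV. \<Sum>i\<in>UNIV. \<Sum>j\<in>UNIV. z $ l * v $ i * w $ j * pd j G x $ i $ l) = ip (dird w G x) v z"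
  proof -
    have "ip (dird w G x) v z = (\<Sum>i\<in>UNIV. \<Sum>l\<in>UNIV. \<Sum>j\<in>UNIV. z $ l * v $ i * w $ j * pd j G x $ i $ l)"
      by (simp add: ip_expand dird_expand[OF dG] sum_distrib_left mult_ac)
    also have "\<dots> = (\<Sum>l\<in>UNIV. \<Sum>i\<in>UNIV. \<Sum>j\<in>UNIV. z $ l * v $ i * w $ j * pd j G x $ i $ l)" by (rule sum.swap)
    finally show ?thesis by simp
  qed
  also have "(\<Sum>l\<in>UNIV. \<Sum>i\<in>UNIV. \<Sum>j\<in>UNIV. z $ l * v $ i * w $ j * pd l G x $ i $ j) = ip (dird z G x) v w"
  proof -
    have "ip (dird z G x) v w = (\<Sum>i\<in>UNIV. \<Sum>j\<in>UNIV. \<Sum>l\<in>UNIV. z $ l * v $ i * w $ j * pd l G x $ i $ j)"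
      by (simp add: ip_expand dird_expand[OF dG] sum_distrib_left mult_ac)
    also have "\<dots> = (\<Sum>i\<in>UNIV. \<Sum>l\<in>UNIV. \<Sum>j\<in>UNIV. z $ l * v $ i * w $ j * pd l G x $ i $ j)"
      by (rule sum.cong[OF refl], rule sum.swap)
    also have "\<dots> = (\<Sum>l\<in>UNIV. \<Sum>i\<in>UNIV. \<Sum>j\<in>UNIV. z $ l * v $ i * w $ j * pd l G x $ i $ j)" by (rule sum.swap)
    finally show ?thesis by simp
  qed
  finally show ?thesis .
qed

lemma smooth_on_christoffel [smooth_intros]:
  assumes "metric_on S G" shows "smooth_on S (christoffel G k i j)"
proof -
  note G = metric_onD[OF assms]
  have "smooth_on S (\<lambda>x. christoffel G k i j x)" unfolding christoffel_def
    by (intro smooth_on_mult smooth_on_const smooth_on_sum smooth_on_nth smooth_on_matrix_inv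
        smooth_on_add smooth_on_diff smooth_on_pd G posdef_det)
  then show ?thesis by simp
qed

lemma smooth_on_chr:
  assumes "metric_on S G" shows "smooth_on S (\<lambda>x. chr G x v w)"
  unfolding chr_def by (intro smooth_on_vec smooth_on_sum smooth_on_mult smooth_on_const
      smooth_on_christoffel assms metric_onD(1)[OF assms])

lemma chr_bilinear_expand:
  "chr G x a b = (\<Sum>i\<in>UNIV. \<Sum>j\<in>UNIV. (a $ i * b $ j) *\<^sub>R chr G x (axis i 1) (axis j 1))"
  by (subst linear_expand[OF linear_chr_left], subst linear_expand[OF linear_chr_right])
     (simp add: scaleR_sum_right)

text \<open>The base point and both arguments vary at once. Expanding into products of components
  with the symbols on fixed basis vectors reduces this to the ordinary product and chain
  rules.\<close>

lemma dird_chr: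
  assumes G: "metric_on S G" and p: "p x \<in> S"
    and d: "p differentiable (at x)" "a differentiable (at x)" "b differentiable (at x)"
  shows "dird u (\<lambda>y. chr G (p y) (a y) (b y)) x
    = dird (dird u p x) (\<lambda>z. chr G z (a x) (b x)) (p x)
      + chr G (p x) (dird u a x) (b x) + chr G (p x) (a x) (dird u b x)"
proof -
  define C where "C i j z = chr G z (axis i 1) (axis j 1)" for i j z
  have dC: "C i j differentiable (at (p x))" for i j
    unfolding C_def[abs_def] by (rule smooth_onD_differentiable[OF smooth_on_chr[OF G] p])
  have hC: "((\<lambda>y. C i j (p y)) has_derivative (\<lambda>u. dird (dird u p x) (C i j) (p x))) (at x)" for i j
    by (rule has_derivative_compose[OF has_derivative_dird[OF d(1)] has_derivative_dird[OF dC]])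
  have hn: "((\<lambda>y. c y $ i) has_derivative (\<lambda>u. dird u c x $ i)) (at x)" if "c differentiable (at x)" for c :: "_ \<Rightarrow> real^_" and i
    by (rule bounded_linear.has_derivative[OF bounded_linear_vec_nth has_derivative_dird[OF that]])
  have 1: "((\<lambda>y. \<Sum>i\<in>UNIV. \<Sum>j\<in>UNIV. (a y $ i * b y $ j) *\<^sub>R C i j (p y)) has_derivative
     (\<lambda>u. \<Sum>i\<in>UNIV. \<Sum>j\<in>UNIV. (a x $ i * b x $ j) *\<^sub>R dird (dird u p x) (C i j) (p x)
        + (a x $ i * dird u b x $ j + dird u a x $ i * b x $ j) *\<^sub>R C i j (p x))) (at x)"
    by (intro has_derivative_sum has_derivative_scaleR has_derivative_mult hn hC d)
  have 2: "((\<lambda>z. \<Sum>i\<in>UNIV. \<Sum>j\<in>UNIV. (a x $ i * b x $ j) *\<^sub>R C i j z) has_derivative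
     (\<lambda>u. \<Sum>i\<in>UNIV. \<Sum>j\<in>UNIV. (a x $ i * b x $ j) *\<^sub>R dird u (C i j) (p x))) (at (p x))"
    by (intro has_derivative_sum has_derivative_scaleR_right has_derivative_dird dC)
  have e: "chr G z a b = (\<Sum>i\<in>UNIV. \<Sum>j\<in>UNIV. (a $ i * b $ j) *\<^sub>R C i j z)" for z a b
    unfolding C_def by (rule chr_bilinear_expand)
  show ?thesis
    unfolding e dird_eqI[OF 1] dird_eqI[OF 2]
    by (simp add: sum.distrib scaleR_add_left)
qed

lemma dird_chr_const:
  assumes G: "metric_on S G" and x: "x \<in> S"
  shows "linear (\<lambda>u. dird u (\<lambda>y. chr G y v w) x)"
    "linear (\<lambda>v. dird u (\<lambda>y. chr G y v w) x)" "linear (\<lambda>w. dird u (\<lambda>y. chr G y v w) x)"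
proof -
  note d = smooth_onD_differentiable[OF smooth_on_chr[OF G] x, THEN has_derivative_dird]
  show "linear (\<lambda>u. dird u (\<lambda>y. chr G y v w) x)"
    by (rule dird_linear[OF smooth_onD_differentiable[OF smooth_on_chr[OF G] x]])
  show "linear (\<lambda>v. dird u (\<lambda>y. chr G y v w) x)"
    by (intro linearI; unfold chr_add_left chr_scale_left; rule dird_eqI;
        intro has_derivative_add has_derivative_scaleR_right d)
  show "linear (\<lambda>w. dird u (\<lambda>y. chr G y v w) x)"
    by (intro linearI; unfold chr_add_right chr_scale_right; rule dird_eqI;
        intro has_derivative_add has_derivative_scaleR_right d)
qed

text \<open>R(u,v)w for constant fields, so the bracket term of the curvature is absent.\<close>

definition curv :: "(real^'n \<Rightarrow> real^'n^'n) \<Rightarrow> real^'n \<Rightarrow> real^'n \<Rightarrow> real^'n \<Rightarrow> real^'n \<Rightarrow> real^'n" where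
  "curv G x u v w = dird u (\<lambda>y. chr G y v w) x - dird v (\<lambda>y. chr G y u w) x
     + chr G x u (chr G x v w) - chr G x v (chr G x u w)"

lemma linear_curv:
  assumes G: "metric_on S G" and x: "x \<in> S"
  shows "linear (\<lambda>u. curv G x u v w)" "linear (\<lambda>v. curv G x u v w)" "linear (curv G x u v)"
  using dird_chr_const[OF assms]
  by (auto simp: linear_iff curv_def chr_add_left chr_add_right chr_scale_left chr_scale_right algebra_simps)

lemma riemann_eq_curv:
  assumes G: "metric_on S G" and x: "x \<in> S"
  shows "riemann G l k i j x = curv G x (axis i 1) (axis j 1) (axis k 1) $ l"
proof -
  have 1: "pd i (christoffel G l j k) x = dird (axis i 1) (\<lambda>y. chr G y (axis j 1) (axis k 1)) x $ l" for i j k l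
    using dird_nth[OF smooth_onD_differentiable[OF smooth_on_chr[OF G] x], of "axis i 1" "axis j 1" "axis k 1" l]
    by (simp add: chr_axis pd_eq_dird)
  have 2: "chr G x (axis i 1) (chr G x (axis j 1) (axis k 1)) $ l
     = (\<Sum>m\<in>UNIV. christoffel G m j k x * christoffel G l i m x)" for i j k l
    by (subst linear_expand[OF linear_chr_right]) (simp add: chr_axis)
  show ?thesis by (simp add: riemann_def curv_def 1 2 sum_subtractf)
qed

text \<open>The Ricci form is the trace of the endomorphism that sends \<open>u\<close> to
  \<open>curv G x u v w\<close>. Traces are invariant under conjugation, which gives the naturality
  of the Ricci form under chart changes.\<close>

lemma ip_ricci:
  assumes G: "metric_on S G" and x: "x \<in> S"
  shows "ip (ricci G x) v w = (\<Sum>i\<in>UNIV. curv G x (axis i 1) v w $ i)"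
proof -
  have "curv G x u v w = (\<Sum>j\<in>UNIV. \<Sum>k\<in>UNIV. (v $ j * w $ k) *\<^sub>R curv G x u (axis j 1) (axis k 1))" for u
    by (subst linear_expand[OF linear_curv(2)[OF assms]], subst linear_expand[OF linear_curv(3)[OF assms]])
       (simp add: scaleR_sum_right)
  then have "(\<Sum>i\<in>UNIV. curv G x (axis i 1) v w $ i)
    = (\<Sum>i\<in>UNIV. \<Sum>j\<in>UNIV. \<Sum>k\<in>UNIV. v $ j * w $ k * riemann G i k i j x)"
    by (simp add: riemann_eq_curv[OF assms])
  also have "\<dots> = (\<Sum>j\<in>UNIV. \<Sum>i\<in>UNIV. \<Sum>k\<in>UNIV. v $ j * w $ k * riemann G i k i j x)" by (rule sum.swap)
  also have "\<dots> = (\<Sum>j\<in>UNIV. \<Sum>k\<in>UNIV. \<Sum>i\<in>UNIV. v $ j * w $ k * riemann G i k i j x)"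
    by (rule sum.cong[OF refl], rule sum.swap)
  also have "\<dots> = ip (ricci G x) v w" by (simp add: ip_expand ricci_def sum_distrib_left)
  finally show ?thesis by simp
qed

lemma ip_hess:
  assumes G: "metric_on S G" and F: "smooth_on S F" and x: "x \<in> S"
  shows "ip (hess G F x) v w = dird v (dird w F) x - dird (chr G x v w) F x"
proof -
  note dF = smooth_onD_differentiable[OF F]
  note ddF = smooth_onD_differentiable[OF smooth_on_pd[OF F] x]
  have "dird v (dird w F) x = dird v (\<lambda>y. \<Sum>j\<in>UNIV. w $ j *\<^sub>R pd j F y) x"
    by (rule dird_cong[OF metric_onD(1)[OF G] x]) (rule dird_expand[OF dF])
  also have "\<dots> = (\<Sum>j\<in>UNIV. w $ j *\<^sub>R dird v (pd j F) x)"
    by (rule dird_eqI) (intro has_derivative_sum has_derivative_scaleR_right has_derivative_dird ddF)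
  also have "\<dots> = (\<Sum>j\<in>UNIV. \<Sum>i\<in>UNIV. v $ i * w $ j * pd i (pd j F) x)"
    by (simp add: dird_expand[OF ddF] sum_distrib_left mult_ac)
  also have "\<dots> = (\<Sum>i\<in>UNIV. \<Sum>j\<in>UNIV. v $ i * w $ j * pd i (pd j F) x)" by (rule sum.swap)
  finally have 1: "dird v (dird w F) x = (\<Sum>i\<in>UNIV. \<Sum>j\<in>UNIV. v $ i * w $ j * pd i (pd j F) x)" .
  have "dird (chr G x v w) F x = (\<Sum>k\<in>UNIV. \<Sum>i\<in>UNIV. \<Sum>j\<in>UNIV. v $ i * w $ j * (christoffel G k i j x * pd k F x))"
    by (simp add: dird_expand[OF dF[OF x]] chr_def sum_distrib_right sum_distrib_left mult_ac)
  also have "\<dots> = (\<Sum>i\<in>UNIV. \<Sum>k\<in>UNIV. \<Sum>j\<in>UNIV. v $ i * w $ j * (christoffel G k i j x * pd k F x))" by (rule sum.swap)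
  also have "\<dots> = (\<Sum>i\<in>UNIV. \<Sum>j\<in>UNIV. \<Sum>k\<in>UNIV. v $ i * w $ j * (christoffel G k i j x * pd k F x))"
    by (rule sum.cong[OF refl], rule sum.swap)
  finally show ?thesis
    by (simp add: 1 ip_expand hess_def right_diff_distrib sum_subtractf sum_distrib_left)
qed

section \<open>Isometries in coordinates\<close>

lemma matrix_apply:
  fixes f :: "real^'n \<Rightarrow> real^'m" assumes "linear f" shows "matrix f *v v = f v"
  by (subst linear_expand[OF assms]) (simp add: vec_eq_iff matrix_def matrix_vector_mult_def mult.commute)

lemma dird_dird_expand:
  fixes F :: "real^'n \<Rightarrow> 'b::real_normed_vector"
  assumes "open S" "smooth_on S F" "x \<in> S"
  shows "dird u (dird v F) x = (\<Sum>i\<in>UNIV. v $ i *\<^sub>R dird u (pd i F) x)"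
proof -
  have "dird u (dird v F) x = dird u (\<lambda>y. \<Sum>i\<in>UNIV. v $ i *\<^sub>R pd i F y) x"
    by (rule dird_cong[OF assms(1,3)]) (rule dird_expand[OF smooth_onD_differentiable[OF assms(2)]])
  also have "\<dots> = (\<Sum>i\<in>UNIV. v $ i *\<^sub>R dird u (pd i F) x)"
    by (rule dird_eqI) (intro has_derivative_sum has_derivative_scaleR_right has_derivative_dird
        smooth_onD_differentiable[OF smooth_on_pd[OF assms(2)] assms(3)])
  finally show ?thesis .
qed

text \<open>The inner derivative \<open>dird v p y\<close> depends on \<open>y\<close>, so the outer
  derivative is first expanded in partial derivatives. The term with the second derivative of
  \<open>p\<close> is the nontensorial part that the Christoffel symbols have to compensate.\<close>

lemma second_chain:
  fixes F :: "real^'m \<Rightarrow> 'b::real_normed_vector" and p :: "real^'n \<Rightarrow> real^'m"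
  assumes "open S" "smooth_on S p" "x \<in> S" "open T" "smooth_on T F" "p ` S \<subseteq> T"
  shows "dird u (dird v (\<lambda>y. F (p y))) x
    = dird (dird u (dird v p) x) F (p x) + dird (dird u p x) (dird (dird v p x) F) (p x)"
proof -
  have D: "((\<lambda>y. pd i F (p y)) has_derivative (\<lambda>u. dird (dird u p x) (pd i F) (p x))) (at x)" for i
    using assms(3,6) by (intro has_derivative_compose[where f=p and g="pd i F"] has_derivative_dird
        smooth_onD_differentiable[OF assms(2)] smooth_onD_differentiable[OF smooth_on_pd[OF assms(5)]]) auto
  have C: "((\<lambda>y. dird v p y $ i) has_derivative (\<lambda>u. dird u (dird v p) x $ i)) (at x)" for i
    by (intro bounded_linear.has_derivative[OF bounded_linear_vec_nth] has_derivative_dird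
        smooth_onD_differentiable[OF smooth_on_dird[OF assms(2)] assms(3)])
  have "dird v (\<lambda>y. F (p y)) y = (\<Sum>i\<in>UNIV. dird v p y $ i *\<^sub>R pd i F (p y))" if "y \<in> S" for y
    using assms that by (subst dird_compose) (auto intro!: dird_expand intro: smooth_onD_differentiable)
  then have "dird u (dird v (\<lambda>y. F (p y))) x = dird u (\<lambda>y. \<Sum>i\<in>UNIV. dird v p y $ i *\<^sub>R pd i F (p y)) x"
    by (rule dird_cong[OF assms(1,3)])
  also have "\<dots> = (\<Sum>i\<in>UNIV. dird v p x $ i *\<^sub>R dird (dird u p x) (pd i F) (p x) + dird u (dird v p) x $ i *\<^sub>R pd i F (p x))"
    by (rule dird_eqI) (intro has_derivative_sum has_derivative_scaleR C D)
  also have "\<dots> = (\<Sum>i\<in>UNIV. dird v p x $ i *\<^sub>R dird (dird u p x) (pd i F) (p x)) + (\<Sum>i\<in>UNIV. dird u (dird v p) x $ i *\<^sub>R pd i F (p x))"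
    by (rule sum.distrib)
  also have "(\<Sum>i\<in>UNIV. dird u (dird v p) x $ i *\<^sub>R pd i F (p x)) = dird (dird u (dird v p) x) F (p x)"
    using assms by (intro dird_expand[symmetric] smooth_onD_differentiable[OF assms(5)]) auto
  also have "(\<Sum>i\<in>UNIV. dird v p x $ i *\<^sub>R dird (dird u p x) (pd i F) (p x)) = dird (dird u p x) (dird (dird v p x) F) (p x)"
    using assms by (intro dird_dird_expand[symmetric, OF assms(4,5)]) auto
  finally show ?thesis by (simp add: add.commute)
qed

lemma dird_dird_var:
  fixes F :: "real^'n \<Rightarrow> 'b::real_normed_vector"
  assumes "open S" "smooth_on S F" "x \<in> S" "c differentiable (at x)"
  shows "dird u (\<lambda>y. dird (c y) F y) x = dird (dird u c x) F x + dird u (dird (c x) F) x"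
proof -
  have C: "((\<lambda>y. c y $ i) has_derivative (\<lambda>u. dird u c x $ i)) (at x)" for i
    by (intro bounded_linear.has_derivative[OF bounded_linear_vec_nth] has_derivative_dird assms)
  have "dird u (\<lambda>y. dird (c y) F y) x = dird u (\<lambda>y. \<Sum>i\<in>UNIV. c y $ i *\<^sub>R pd i F y) x"
    by (rule dird_cong[OF assms(1,3)]) (rule dird_expand[OF smooth_onD_differentiable[OF assms(2)]])
  also have "\<dots> = (\<Sum>i\<in>UNIV. c x $ i *\<^sub>R dird u (pd i F) x + dird u c x $ i *\<^sub>R pd i F x)"
    by (rule dird_eqI) (intro has_derivative_sum has_derivative_scaleR C has_derivative_dird
        smooth_onD_differentiable[OF smooth_on_pd[OF assms(2)] assms(3)])
  also have "\<dots> = (\<Sum>i\<in>UNIV. c x $ i *\<^sub>R dird u (pd i F) x) + (\<Sum>i\<in>UNIV. dird u c x $ i *\<^sub>R pd i F x)"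
    by (rule sum.distrib)
  also have "\<dots> = dird u (dird (c x) F) x + dird (dird u c x) F x"
    by (simp add: dird_dird_expand[OF assms(1-3)] dird_expand[OF smooth_onD_differentiable[OF assms(2,3)]])
  finally show ?thesis by (simp add: add.commute)
qed

lemma smooth_on_dird_var:
  fixes F :: "real^'n \<Rightarrow> 'b::real_normed_vector"
  assumes "open S" "smooth_on S F" "smooth_on S c"
  shows "smooth_on S (\<lambda>y. dird (c y) F y)"
proof -
  have e: "dird (c y) F y = (\<Sum>i\<in>UNIV. c y $ i *\<^sub>R pd i F y)" if "y \<in> S" for y
    by (rule dird_expand[OF smooth_onD_differentiable[OF assms(2) that]])
  show ?thesis
    by (rule smooth_on_cong[THEN iffD2, OF assms(1) e])
       (assumption | intro smooth_intros smooth_on_pd assms)+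
qed

text \<open>A chart change seen as a local isometry between coordinate domains. The same locale
  serves the chart changes of the ambient manifold and those of the hypersurface.\<close>

locale coord_isometry =
  fixes S S' :: "(real^'n) set" and G G' :: "real^'n \<Rightarrow> real^'n^'n" and \<phi> :: "real^'n \<Rightarrow> real^'n"
  assumes G: "metric_on S G" and G': "metric_on S' G'"
    and smooth: "smooth_on S \<phi>" and into: "\<phi> ` S \<subseteq> S'"
    and pull: "\<And>x v w. x \<in> S \<Longrightarrow> ip (G x) v w = ip (G' (\<phi> x)) (dird v \<phi> x) (dird w \<phi> x)"
begin

lemma open_S: "open S" and open_S': "open S'" using G G' metric_onD by auto

lemma in_S': "x \<in> S \<Longrightarrow> \<phi> x \<in> S'" using into by auto

lemma diff: "x \<in> S \<Longrightarrow> \<phi> differentiable (at x)"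
  by (rule smooth_onD_differentiable[OF smooth])

lemma lin: "x \<in> S \<Longrightarrow> linear (\<lambda>v. dird v \<phi> x)"
  by (rule dird_linear[OF diff])

lemma inj: assumes "x \<in> S" shows "inj (\<lambda>v. dird v \<phi> x)"
proof (rule linear_injective_0[THEN iffD2, OF lin[OF assms]], intro allI impI)
  fix v assume "dird v \<phi> x = 0"
  then have "ip (G x) v v = 0" using pull[OF assms] by (simp add: ip_simps)
  then show "v = 0" using posdef_pos[OF metric_onD(3)[OF G assms], of v] by fastforce
qed

lemma surj: "x \<in> S \<Longrightarrow> surj (\<lambda>v. dird v \<phi> x)"
  by (rule linear_injective_imp_surjective[OF lin inj]) auto

lemma dird_metric:
  assumes x: "x \<in> S"
  shows "ip (dird u G x) v w = ip (dird (dird u \<phi> x) G' (\<phi> x)) (dird v \<phi> x) (dird w \<phi> x)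
     + ip (G' (\<phi> x)) (dird u (dird v \<phi>) x) (dird w \<phi> x) + ip (G' (\<phi> x)) (dird v \<phi> x) (dird u (dird w \<phi>) x)"
proof -
  have "ip (dird u G x) v w = dird u (\<lambda>y. ip (G y) v w) x"
    by (subst dird_ip) (auto intro: smooth_onD_differentiable[OF metric_onD(2)[OF G] x] simp: dird_const ip_simps)
  also have "\<dots> = dird u (\<lambda>y. ip (G' (\<phi> y)) (dird v \<phi> y) (dird w \<phi> y)) x"
    by (rule dird_cong[OF open_S x pull])
  also have "\<dots> = ip (dird u (\<lambda>y. G' (\<phi> y)) x) (dird v \<phi> x) (dird w \<phi> x)
     + ip (G' (\<phi> x)) (dird u (dird v \<phi>) x) (dird w \<phi> x) + ip (G' (\<phi> x)) (dird v \<phi> x) (dird u (dird w \<phi>) x)"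
  proof (rule dird_ip)
    show "(\<lambda>y. G' (\<phi> y)) differentiable at x"
      by (rule smooth_onD_differentiable[OF smooth_on_compose[OF metric_onD(2)[OF G'] smooth into open_S open_S'] x])
  qed (rule smooth_onD_differentiable[OF smooth_on_dird[OF smooth] x])+
  also have "dird u (\<lambda>y. G' (\<phi> y)) x = dird (dird u \<phi> x) G' (\<phi> x)"
    by (rule dird_compose[OF diff[OF x] smooth_onD_differentiable[OF metric_onD(2)[OF G'] in_S'[OF x]]])
  finally show ?thesis .
qed

text \<open>Both sides are tested against vectors in the image of the differential, which is onto.
  In the Koszul formula of the pulled back metric six terms with second derivatives of \<phi>
  appear; by their symmetry four cancel and the other two agree.\<close>

lemma chr_transform:
  assumes x: "x \<in> S"
  shows "dird (chr G x v w) \<phi> x = dird v (dird w \<phi>) x + chr G' (\<phi> x) (dird v \<phi> x) (dird w \<phi> x)"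
proof (rule posdef_eqI)
  show p: "posdef (G' (\<phi> x))" by (rule metric_onD(3)[OF G' in_S'[OF x]])
  fix z'
  obtain z where z: "z' = dird z \<phi> x" using surj[OF x] by (metis surjD)
  have c: "dird a (dird b \<phi>) x = dird b (dird a \<phi>) x" for a b
    by (rule dird_commute[OF open_S smooth x])
  have "ip (G' (\<phi> x)) (dird (chr G x v w) \<phi> x) z' = ip (G x) (chr G x v w) z"
    using pull[OF x] z by simp
  also have "\<dots> = ip (G' (\<phi> x)) (dird v (dird w \<phi>) x + chr G' (\<phi> x) (dird v \<phi> x) (dird w \<phi> x)) z'"
    unfolding koszul[OF G x] dird_metric[OF x] ip_add_left koszul[OF G' in_S'[OF x]] z
    using c[of v w] c[of v z] c[of w z] posdef_commute[OF p]
    by (simp add: algebra_simps)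
  finally show "ip (G' (\<phi> x)) (dird (chr G x v w) \<phi> x) z'
     = ip (G' (\<phi> x)) (dird v (dird w \<phi>) x + chr G' (\<phi> x) (dird v \<phi> x) (dird w \<phi> x)) z'" .
qed

text \<open>Differentiating \<open>chr_transform\<close> gives one half of the curvature plus terms
  with second and third derivatives of \<phi>. These extra terms are symmetric in \<open>u\<close>
  and \<open>v\<close> and drop out on antisymmetrization.\<close>

lemma curv_transform:
  assumes x: "x \<in> S"
  shows "dird (curv G x u v w) \<phi> x = curv G' (\<phi> x) (dird u \<phi> x) (dird v \<phi> x) (dird w \<phi> x)"
proof -
  note dS = smooth_onD_differentiable[OF smooth_on_dird[OF smooth] x]
  define J where "J v = dird v \<phi> x" for v
  define H where "H v w = dird v (dird w \<phi>) x" for v w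
  have c: "H a b = H b a" for a b unfolding H_def by (rule dird_commute[OF open_S smooth x])
  have key: "J (dird u (\<lambda>y. chr G y v w) x + chr G x u (chr G x v w))
    = dird u (dird v (dird w \<phi>)) x + dird (J u) (\<lambda>z. chr G' z (J v) (J w)) (\<phi> x)
      + chr G' (\<phi> x) (H u v) (J w) + chr G' (\<phi> x) (J v) (H u w)
      + chr G' (\<phi> x) (J u) (H v w) + chr G' (\<phi> x) (J u) (chr G' (\<phi> x) (J v) (J w))" for u v w
  proof -
    have "dird u (\<lambda>y. dird (chr G y v w) \<phi> y) x
      = dird u (\<lambda>y. dird v (dird w \<phi>) y + chr G' (\<phi> y) (dird v \<phi> y) (dird w \<phi> y)) x"
      by (rule dird_cong[OF open_S x chr_transform])
    also have "\<dots> = dird u (dird v (dird w \<phi>)) x + dird u (\<lambda>y. chr G' (\<phi> y) (dird v \<phi> y) (dird w \<phi> y)) x"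
    proof (rule dird_eqI, rule has_derivative_add; rule has_derivative_dird)
      show "dird v (dird w \<phi>) differentiable at x"
        by (rule smooth_onD_differentiable[OF smooth_on_dird[OF smooth_on_dird[OF smooth]] x])
      \<comment> \<open>By \<open>chr_transform\<close> this difference equals the composite whose
        differentiability is wanted.\<close>
      have "smooth_on S (\<lambda>y. dird (chr G y v w) \<phi> y - dird v (dird w \<phi>) y)"
      proof (intro smooth_on_diff smooth_on_dird smooth open_S)
        show "smooth_on S (\<lambda>y. dird (chr G y v w) \<phi> y)"
          by (rule smooth_on_dird_var[OF open_S smooth smooth_on_chr[OF G]])
      qed
      then have "(\<lambda>y. dird (chr G y v w) \<phi> y - dird v (dird w \<phi>) y) differentiable at x"
        using smooth_onD_differentiable x by blast
      then show "(\<lambda>y. chr G' (\<phi> y) (dird v \<phi> y) (dird w \<phi> y)) differentiable at x"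
        using differentiable_cong[OF open_S x, of "\<lambda>y. dird (chr G y v w) \<phi> y - dird v (dird w \<phi>) y"] chr_transform
        by simp
    qed
    also have "dird u (\<lambda>y. chr G' (\<phi> y) (dird v \<phi> y) (dird w \<phi> y)) x
      = dird (J u) (\<lambda>z. chr G' z (J v) (J w)) (\<phi> x) + chr G' (\<phi> x) (H u v) (J w) + chr G' (\<phi> x) (J v) (H u w)"
      unfolding J_def H_def by (rule dird_chr[where a="dird v \<phi>" and b="dird w \<phi>", OF G' in_S'[OF x] diff[OF x] dS dS])
    also have "dird u (\<lambda>y. dird (chr G y v w) \<phi> y) x = J (dird u (\<lambda>y. chr G y v w) x) + H u (chr G x v w)"
      unfolding J_def H_def
      by (rule dird_dird_var[OF open_S smooth x smooth_onD_differentiable[OF smooth_on_chr[OF G] x]])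
    finally have 1: "J (dird u (\<lambda>y. chr G y v w) x) + H u (chr G x v w) = dird u (dird v (dird w \<phi>)) x +
      (dird (J u) (\<lambda>z. chr G' z (J v) (J w)) (\<phi> x) + chr G' (\<phi> x) (H u v) (J w) + chr G' (\<phi> x) (J v) (H u w))" .
    have "J (chr G x u (chr G x v w)) = H u (chr G x v w) + chr G' (\<phi> x) (J u) (J (chr G x v w))"
      unfolding J_def H_def by (rule chr_transform[OF x])
    also have "J (chr G x v w) = H v w + chr G' (\<phi> x) (J v) (J w)"
      unfolding J_def H_def by (rule chr_transform[OF x])
    finally have 2: "J (chr G x u (chr G x v w)) = H u (chr G x v w)
       + chr G' (\<phi> x) (J u) (H v w) + chr G' (\<phi> x) (J u) (chr G' (\<phi> x) (J v) (J w))"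
      by (simp add: chr_add_right)
    have "J (dird u (\<lambda>y. chr G y v w) x + chr G x u (chr G x v w))
      = J (dird u (\<lambda>y. chr G y v w) x) + J (chr G x u (chr G x v w))"
      unfolding J_def by (rule linear_add[OF lin[OF x]])
    with 1 2 show ?thesis by (simp add: algebra_simps)
  qed
  have "curv G x u v w = (dird u (\<lambda>y. chr G y v w) x + chr G x u (chr G x v w))
      - (dird v (\<lambda>y. chr G y u w) x + chr G x v (chr G x u w))"
    by (simp add: curv_def)
  then have "J (curv G x u v w) = J (dird u (\<lambda>y. chr G y v w) x + chr G x u (chr G x v w))
      - J (dird v (\<lambda>y. chr G y u w) x + chr G x v (chr G x u w))"
    unfolding J_def by (simp only: linear_diff[OF lin[OF x]])
  also have "\<dots> = curv G' (\<phi> x) (J u) (J v) (J w)"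
    unfolding key curv_def using c[of u v] dird_commute[OF open_S smooth_on_dird[OF smooth] x, of u v w]
    by (simp add: algebra_simps)
  finally show ?thesis by (simp add: J_def)
qed

text \<open>By \<open>curv_transform\<close> the differential intertwines the two endomorphisms
  whose traces are the Ricci forms; being invertible, it conjugates one into the other.\<close>

lemma ricci_transform:
  assumes x: "x \<in> S"
  shows "ip (ricci G x) v w = ip (ricci G' (\<phi> x)) (dird v \<phi> x) (dird w \<phi> x)"
proof -
  define J where "J = matrix (\<lambda>v. dird v \<phi> x)"
  define A where "A = matrix (\<lambda>u. curv G x u v w)"
  define B where "B = matrix (\<lambda>u. curv G' (\<phi> x) u (dird v \<phi> x) (dird w \<phi> x))"
  have J: "J *v u = dird u \<phi> x" for u
    unfolding J_def by (rule matrix_apply) (rule lin[OF x])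
  have A: "A *v u = curv G x u v w" for u
    unfolding A_def by (rule matrix_apply) (rule linear_curv(1)[OF G x])
  have B: "B *v u = curv G' (\<phi> x) u (dird v \<phi> x) (dird w \<phi> x)" for u
    unfolding B_def by (rule matrix_apply) (rule linear_curv(1)[OF G' in_S'[OF x]])
  have JA: "J ** A = B ** J"
  proof (rule matrix_eq[THEN iffD2], rule allI)
    fix u show "(J ** A) *v u = (B ** J) *v u"
      by (simp add: matrix_vector_mul_assoc[symmetric] J A B curv_transform[OF x])
  qed
  have "inj ((*v) J)" using inj[OF x] by (simp add: J[abs_def])
  then obtain K where K: "K ** J = mat 1" using matrix_left_invertible_injective by blast
  then have K': "J ** K = mat 1" by (rule matrix_left_right_inverse[THEN iffD1])
  have "trace A = trace (K ** (J ** A))" by (simp add: matrix_mul_assoc K)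
  also have "\<dots> = trace (B ** J ** K)" by (metis JA trace_mul_sym)
  also have "\<dots> = trace B" by (simp add: matrix_mul_assoc[symmetric] K')
  finally have "trace A = trace B" .
  moreover have "trace M = (\<Sum>i\<in>UNIV. (M *v axis i 1) $ i)" for M :: "real^'n^'n"
    by (simp add: trace_def matrix_vector_mult_basis column_def)
  ultimately show ?thesis
    by (simp add: ip_ricci[OF G x] ip_ricci[OF G' in_S'[OF x]] A B)
qed

text \<open>The second derivative term of the chain rule cancels against the one in the
  transformation law of the Christoffel symbols.\<close>

lemma hess_transform:
  assumes x: "x \<in> S" and F: "smooth_on S F" and F': "smooth_on S' F'" and e: "\<And>y. y \<in> S \<Longrightarrow> F y = F' (\<phi> y)"
  shows "ip (hess G F x) v w = ip (hess G' F' (\<phi> x)) (dird v \<phi> x) (dird w \<phi> x)"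
proof -
  have 1: "dird b F y = dird b (\<lambda>y. F' (\<phi> y)) y" if "y \<in> S" for b y
    by (rule dird_cong[OF open_S that e])
  have 2: "dird a (dird b F) x = dird a (dird b (\<lambda>y. F' (\<phi> y))) x" for a b
    by (rule dird_cong[OF open_S x 1])
  have 3: "dird b F x = dird (dird b \<phi> x) F' (\<phi> x)" for b
    unfolding 1[OF x] by (rule dird_compose[OF diff[OF x] smooth_onD_differentiable[OF F' in_S'[OF x]]])
  note l = dird_linear[OF smooth_onD_differentiable[OF F' in_S'[OF x]]]
  show ?thesis
    unfolding ip_hess[OF G F x] ip_hess[OF G' F' in_S'[OF x]] 3 chr_transform[OF x]
    by (simp add: 2 second_chain[OF open_S smooth x open_S' F' into] linear_add[OF l])
qed

lemma bakry_emery_transform: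
  assumes "x \<in> S" "smooth_on S F" "smooth_on S' F'" "\<And>y. y \<in> S \<Longrightarrow> F y = F' (\<phi> y)"
  shows "ip (bakry_emery_ricci G F x) v w
    = ip (bakry_emery_ricci G' F' (\<phi> x)) (dird v \<phi> x) (dird w \<phi> x)"
proof -
  have "ip (A + B) v w = ip A v w + ip B v w" for A B :: "real^'n^'n" and v w
    by (simp add: ip_def matrix_vector_mult_add_rdistrib inner_add_right)
  then show ?thesis
    unfolding bakry_emery_ricci_def using ricci_transform[OF assms(1)] hess_transform[OF assms] by metis
qed

end

section \<open>Local hypersurfaces\<close>

lemma ip_eqI: "(\<And>v w. ip A v w = ip B v w) \<Longrightarrow> A = B"
  by (simp add: vec_eq_iff flip: ip_axis)

text \<open>The inverse form is the original form evaluated on the vectors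
  \<open>matrix_inv A *v v\<close>, so it inherits symmetry and positivity.\<close>

lemma posdef_matrix_inv: assumes "posdef A" shows "posdef (matrix_inv A)"
proof -
  note inv = matrix_inv_both[OF posdef_det_nz[OF assms]]
  have A: "v = A *v (matrix_inv A *v v)" for v by (simp add: matrix_vector_mul_assoc inv)
  have *: "ip (matrix_inv A) v w = ip A (matrix_inv A *v v) (matrix_inv A *v w)" for v w
    by (subst A[of v], subst posdef_commute[OF assms]) (simp add: ip_def inner_commute)
  have "transpose (matrix_inv A) = matrix_inv A"
  proof (rule ip_eqI)
    fix v w
    have "ip (transpose (matrix_inv A)) v w = ip (matrix_inv A) w v"
      unfolding ip_def by (metis dot_lmul_matrix inner_commute transpose_matrix_vector transpose_transpose)
    then show "ip (transpose (matrix_inv A)) v w = ip (matrix_inv A) v w"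
      using * posdef_commute[OF assms] by metis
  qed
  moreover have "ip (matrix_inv A) v v > 0" if "v \<noteq> 0" for v
    unfolding * by (rule posdef_pos[OF assms]) (use that A[of v] in auto)
  ultimately show ?thesis by (simp add: posdef_def)
qed

text \<open>Elimination of one index at a time. Completing the square in the variable
  \<open>p\<close> splits off a rank one form and leaves a semidefinite form supported on the
  smaller index set.\<close>

lemma psd_rank_one_decomposition:
  fixes A :: "real^'n^'n"
  assumes "transpose A = A" "\<And>v. ip A v v \<ge> 0"
  shows "\<exists>b :: 'n \<Rightarrow> real^'n. \<forall>i j. A $ i $ j = (\<Sum>m\<in>UNIV. b m $ i * b m $ j)"
proof -
  have "\<exists>b :: 'n \<Rightarrow> real^'n. \<forall>i j. A $ i $ j = (\<Sum>m\<in>I. b m $ i * b m $ j)"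
    if "finite I" "transpose A = A" "\<And>v. ip A v v \<ge> 0" "\<And>i j. i \<notin> I \<Longrightarrow> A $ i $ j = 0"
    for I :: "'n set" and A :: "real^'n^'n"
    using that
  proof (induction I arbitrary: A rule: finite_induct)
    case (insert p I)
    note com = ip_commute[OF insert.prems(1)]
    have sym: "A $ i $ j = A $ j $ i" for i j using com[of "axis i 1" "axis j 1"] by (simp add: ip_axis)
    show ?case
    proof (cases "A $ p $ p = 0")
      case True
      have "A $ p $ j = 0" for j
      proof (rule ccontr)
        assume nz: "A $ p $ j \<noteq> 0"
        \<comment> \<open>Solves A_jj + 2 t A_pj = -1, which is impossible for a semidefinite form:
          a vanishing diagonal entry forces its whole row to vanish.\<close>
        define t where "t = - (A $ j $ j + 1) / (2 * A $ p $ j)"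
        have "ip A (axis j 1 + t *\<^sub>R axis p 1) (axis j 1 + t *\<^sub>R axis p 1) = A $ j $ j + 2 * t * A $ p $ j"
          using True sym[of j p] by (simp add: ip_simps ip_axis)
        also have "\<dots> = - 1" using nz by (simp add: t_def field_simps)
        finally show False using insert.prems(2)[of "axis j 1 + t *\<^sub>R axis p 1"] by linarith
      qed
      then have "i \<notin> I \<Longrightarrow> A $ i $ j = 0" for i j using insert.prems(3) by (cases "i = p") auto
      from insert.IH[OF insert.prems(1,2) this]
      obtain b where b: "A $ i $ j = (\<Sum>m\<in>I. b m $ i * b m $ j)" for i j by blast
      have "A $ i $ j = (\<Sum>m\<in>insert p I. (b(p := 0)) m $ i * (b(p := 0)) m $ j)" for i j
      proof -
        have "(\<Sum>m\<in>insert p I. (b(p := 0)) m $ i * (b(p := 0)) m $ j) = (\<Sum>m\<in>I. (b(p := 0)) m $ i * (b(p := 0)) m $ j)"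
          using insert.hyps by simp
        also have "\<dots> = (\<Sum>m\<in>I. b m $ i * b m $ j)"
          using insert.hyps by (intro sum.cong) auto
        finally show ?thesis using b by simp
      qed
      then show ?thesis by blast
    next
      case False
      have pos: "A $ p $ p > 0" using insert.prems(2)[of "axis p 1"] False by (simp add: ip_axis)
      \<comment> \<open>One step of Cholesky elimination; \<open>B\<close> is the Schur complement
        of the pivot \<open>A $ p $ p\<close>.\<close>
      define c where "c = (\<chi> i. A $ p $ i / sqrt (A $ p $ p))"
      define B where "B = (\<chi> i j. A $ i $ j - c $ i * c $ j)"
      have cc: "c $ i * c $ j = A $ p $ i * A $ p $ j / A $ p $ p" for i j
        using pos by (simp add: c_def)
      have ipB: "ip B v w = ip A v w - (c \<bullet> v) * (c \<bullet> w)" for v w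
        by (simp add: B_def ip_expand inner_vec_def sum_product algebra_simps sum_subtractf)
      have cv: "c \<bullet> v = ip A (axis p 1) v / sqrt (A $ p $ p)" for v
        unfolding ip_def inner_axis' by (simp add: c_def inner_vec_def matrix_vector_mult_def sum_divide_distrib)
      have "transpose B = B" using sym by (simp add: B_def transpose_def vec_eq_iff)
      moreover have "ip B v v \<ge> 0" for v
      proof -
        \<comment> \<open>The minimizer of the form on the line through \<open>v\<close> in
          direction \<open>axis p 1\<close>; the minimum is the value of \<open>B\<close> at
          \<open>v\<close>.\<close>
        define t where "t = ip A (axis p 1) v / A $ p $ p"
        have "ip A (v - t *\<^sub>R axis p 1) (v - t *\<^sub>R axis p 1)
           = ip A v v - 2 * t * ip A (axis p 1) v + t * t * A $ p $ p"
          using com[of v "axis p 1"] by (simp add: ip_simps ip_axis algebra_simps)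
        also have "\<dots> = ip A v v - ip A (axis p 1) v * ip A (axis p 1) v / A $ p $ p"
          using pos by (simp add: t_def field_simps)
        also have "\<dots> = ip B v v" using pos by (simp add: ipB cv)
        finally show ?thesis using insert.prems(2) by metis
      qed
      moreover have "i \<notin> I \<Longrightarrow> B $ i $ j = 0" for i j
      proof (cases "i = p")
        case True then show ?thesis using False by (simp add: B_def cc)
      next
        case False
        assume "i \<notin> I"
        with False insert.prems(3) have "A $ i $ j = 0" "A $ i $ p = 0" by auto
        then show ?thesis using sym[of i p] by (simp add: B_def cc)
      qed
      ultimately obtain b where b: "B $ i $ j = (\<Sum>m\<in>I. b m $ i * b m $ j)" for i j
        using insert.IH[of B] by blast
      have "A $ i $ j = (\<Sum>m\<in>insert p I. (b(p := c)) m $ i * (b(p := c)) m $ j)" for i j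
      proof -
        have "(\<Sum>m\<in>insert p I. (b(p := c)) m $ i * (b(p := c)) m $ j)
            = c $ i * c $ j + (\<Sum>m\<in>I. (b(p := c)) m $ i * (b(p := c)) m $ j)"
          using insert.hyps by simp
        also have "(\<Sum>m\<in>I. (b(p := c)) m $ i * (b(p := c)) m $ j) = (\<Sum>m\<in>I. b m $ i * b m $ j)"
          using insert.hyps by (intro sum.cong) auto
        also have "c $ i * c $ j + \<dots> = A $ i $ j" unfolding b[symmetric] by (simp add: B_def)
        finally show ?thesis by simp
      qed
      then show ?thesis by blast
    qed
  qed auto
  from this[of UNIV A] assms show ?thesis by simp
qed

text \<open>The squared norm of the bilinear form \<open>a\<close> when \<open>B\<close> is the
  inverse metric; for the scalar second fundamental form it is |A|^2.\<close>

definition form_normsq :: "real^'n^'n \<Rightarrow> real^'n^'n \<Rightarrow> real" where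
  "form_normsq B a = (\<Sum>i\<in>UNIV. \<Sum>j\<in>UNIV. \<Sum>k\<in>UNIV. \<Sum>l\<in>UNIV.
     B $ i $ k * B $ j $ l * (a $ i $ j * a $ k $ l))"

lemma form_normsq_trace: "form_normsq B a = trace (transpose B ** a ** B ** transpose a)"
proof -
  define t where "t i j k l = B $ i $ k * B $ j $ l * (a $ i $ j * a $ k $ l)" for i j k l
  have "trace (transpose B ** a ** B ** transpose a) = (\<Sum>k\<in>UNIV. \<Sum>l\<in>UNIV. \<Sum>j\<in>UNIV. \<Sum>i\<in>UNIV. t i j k l)"
    by (simp add: trace_def matrix_matrix_mult_def transpose_def t_def sum_distrib_left sum_distrib_right mult_ac)
  also have "\<dots> = (\<Sum>k\<in>UNIV. \<Sum>l\<in>UNIV. \<Sum>i\<in>UNIV. \<Sum>j\<in>UNIV. t i j k l)"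
    by (rule sum.cong[OF refl], rule sum.cong[OF refl], rule sum.swap)
  also have "\<dots> = (\<Sum>k\<in>UNIV. \<Sum>i\<in>UNIV. \<Sum>l\<in>UNIV. \<Sum>j\<in>UNIV. t i j k l)"
    by (rule sum.cong[OF refl], rule sum.swap)
  also have "\<dots> = (\<Sum>i\<in>UNIV. \<Sum>k\<in>UNIV. \<Sum>l\<in>UNIV. \<Sum>j\<in>UNIV. t i j k l)"
    by (rule sum.swap)
  also have "\<dots> = (\<Sum>i\<in>UNIV. \<Sum>k\<in>UNIV. \<Sum>j\<in>UNIV. \<Sum>l\<in>UNIV. t i j k l)"
    by (rule sum.cong[OF refl], rule sum.cong[OF refl], rule sum.swap)
  also have "\<dots> = (\<Sum>i\<in>UNIV. \<Sum>j\<in>UNIV. \<Sum>k\<in>UNIV. \<Sum>l\<in>UNIV. t i j k l)"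
    by (rule sum.cong[OF refl], rule sum.swap)
  finally show ?thesis by (simp add: form_normsq_def t_def)
qed

text \<open>Cyclic invariance moves \<open>K\<close> around in the trace formula. This is the
  coordinate invariance of the norm.\<close>

lemma form_normsq_congruence:
  fixes K :: "real^'n^'n"
  assumes "a = transpose K ** a' ** K" "B' = K ** B ** transpose K"
  shows "form_normsq B' a' = form_normsq B a"
proof -
  have "form_normsq B' a' = trace (K ** (transpose B ** transpose K ** a' ** K ** B ** transpose K ** transpose a'))"
    by (simp add: form_normsq_trace assms(2) matrix_transpose_mul matrix_mul_assoc transpose_transpose)
  also have "\<dots> = trace ((transpose B ** transpose K ** a' ** K ** B ** transpose K ** transpose a') ** K)"
    by (rule trace_mul_sym)
  also have "\<dots> = form_normsq B a"
    by (simp add: form_normsq_trace assms(1) matrix_transpose_mul matrix_mul_assoc transpose_transpose)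
  finally show ?thesis .
qed

text \<open>Writing \<open>B\<close> as a sum of rank one matrices b b^T turns the trace of
  \<open>B ** M\<close> into the sum of the values of the semidefinite form \<open>M\<close> at the
  vectors \<open>b m\<close>.\<close>

lemma form_normsq_nonneg:
  fixes a B :: "real^'n^'n"
  assumes "posdef B" shows "form_normsq B a \<ge> 0"
proof -
  have sym: "transpose B = B" using assms by (simp add: posdef_def)
  obtain b :: "'n \<Rightarrow> real^'n" where b: "B $ i $ j = (\<Sum>m\<in>UNIV. b m $ i * b m $ j)" for i j
    using psd_rank_one_decomposition[OF sym posdef_nonneg[OF assms]] by blast
  define M where "M = a ** B ** transpose a"
  have M: "ip M v v \<ge> 0" for v
    using ip_congruence[of "transpose a" B v v] posdef_nonneg[OF assms] by (simp add: M_def transpose_transpose)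
  have "form_normsq B a = trace (B ** M)" by (simp add: form_normsq_trace sym M_def matrix_mul_assoc)
  also have "\<dots> = (\<Sum>i\<in>UNIV. \<Sum>k\<in>UNIV. \<Sum>m\<in>UNIV. b m $ k * b m $ i * M $ k $ i)"
    by (simp add: trace_def matrix_matrix_mult_def b sum_distrib_right sum_distrib_left mult_ac)
  also have "\<dots> = (\<Sum>i\<in>UNIV. \<Sum>m\<in>UNIV. \<Sum>k\<in>UNIV. b m $ k * b m $ i * M $ k $ i)"
    by (rule sum.cong[OF refl], rule sum.swap)
  also have "\<dots> = (\<Sum>m\<in>UNIV. \<Sum>i\<in>UNIV. \<Sum>k\<in>UNIV. b m $ k * b m $ i * M $ k $ i)" by (rule sum.swap)
  also have "\<dots> = (\<Sum>m\<in>UNIV. \<Sum>k\<in>UNIV. \<Sum>i\<in>UNIV. b m $ k * b m $ i * M $ k $ i)"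
    by (rule sum.cong[OF refl], rule sum.swap)
  also have "\<dots> = (\<Sum>m\<in>UNIV. ip M (b m) (b m))" by (simp add: ip_expand)
  finally show ?thesis using M by (simp add: sum_nonneg)
qed

lemma smooth_on_bakry_emery:
  assumes G: "metric_on S G" and f: "smooth_on S f"
  shows "smooth_on S (\<lambda>x. bakry_emery_ricci G f x $ i $ j)"
proof -
  note o = metric_onD(1)[OF G]
  have 1: "smooth_on S (\<lambda>x. riemann G l k i j x)" for i j k l unfolding riemann_def
    by (intro smooth_intros smooth_on_pd smooth_on_christoffel G o)
  have 2: "smooth_on S (\<lambda>x. ricci G x $ i $ j)" unfolding ricci_def
    by (simp, intro smooth_on_sum 1 o)
  have 3: "smooth_on S (\<lambda>x. hess G f x $ i $ j)" unfolding hess_def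
    by (simp, intro smooth_intros smooth_on_pd smooth_on_christoffel G f o)
  show ?thesis unfolding bakry_emery_ricci_def
    by (simp, intro smooth_on_add 2 3 o)
qed

section \<open>A hypersurface in one pair of charts\<close>

locale local_hypersurface =
  fixes U :: "(real^'m) set" and V :: "(real^'n) set" and G :: "real^'m \<Rightarrow> real^'m^'m"
    and f :: "real^'m \<Rightarrow> real" and h :: "real^'n \<Rightarrow> real^'n^'n" and F :: "real^'n \<Rightarrow> real^'m"
  assumes G: "metric_on U G" and f: "smooth_on U f" and h: "metric_on V h" and F: "smooth_on V F"
    and into: "F ` V \<subseteq> U" and card: "CARD('m) = CARD('n) + 1"
    and pull: "\<And>x v w. x \<in> V \<Longrightarrow> ip (h x) v w = ip (G (F x)) (dird v F x) (dird w F x)"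
begin

lemma open_U: "open U" and open_V: "open V" using G h metric_onD by auto
lemma in_U: "x \<in> V \<Longrightarrow> F x \<in> U" using into by auto
lemma diff: "x \<in> V \<Longrightarrow> F differentiable (at x)" by (rule smooth_onD_differentiable[OF F])
lemma lin: "x \<in> V \<Longrightarrow> linear (\<lambda>v. dird v F x)" by (rule dird_linear[OF diff])
lemma pos_G: "x \<in> V \<Longrightarrow> posdef (G (F x))" by (rule metric_onD(3)[OF G in_U])
lemma pos_h: "x \<in> V \<Longrightarrow> posdef (h x)" by (rule metric_onD(3)[OF h])

lemma is_unit_normal_iff:
  assumes "x \<in> V"
  shows "is_unit_normal G F x \<nu> \<longleftrightarrow> ip (G (F x)) \<nu> \<nu> = 1 \<and> (\<forall>v. ip (G (F x)) \<nu> (dird v F x) = 0)"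
proof -
  have "(\<forall>i. ip (G (F x)) \<nu> (pd i F x) = 0) \<longleftrightarrow> (\<forall>v. ip (G (F x)) \<nu> (dird v F x) = 0)"
  proof safe
    fix v assume "\<forall>i. ip (G (F x)) \<nu> (pd i F x) = 0"
    then show "ip (G (F x)) \<nu> (dird v F x) = 0"
      by (simp add: dird_expand[OF diff[OF assms]] ip_sum_right ip_simps)
  qed (simp add: pd_eq_dird)
  then show ?thesis by (simp add: is_unit_normal_def)
qed

text \<open>The metric is absorbed into the covectors \<open>G (F x) *v pd i F x\<close>. There are
  too few of them to span, so a nonzero vector is Euclidean orthogonal to them all, and it is
  rescaled to unit length.\<close>

lemma unit_normal_exists:
  assumes x: "x \<in> V" shows "\<exists>\<nu>. is_unit_normal G F x \<nu>"
proof -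
  define B where "B = range (\<lambda>i. G (F x) *v pd i F x)"
  have "dim B \<le> card B" by (rule dim_le_card) (auto simp: B_def intro: span_base)
  also have "card B \<le> CARD('n)" unfolding B_def by (rule card_image_le) simp
  also have "\<dots> < DIM(real^'m)" using card by simp
  finally obtain w where w: "w \<noteq> 0" "\<And>y. y \<in> span B \<Longrightarrow> orthogonal w y"
    using orthogonal_to_subspace_exists by blast
  then have "ip (G (F x)) w (pd i F x) = 0" for i
    unfolding ip_def B_def orthogonal_def by (auto intro: span_base)
  moreover have "ip (G (F x)) w w > 0" by (rule posdef_pos[OF pos_G[OF x] w(1)])
  ultimately have "is_unit_normal G F x ((1 / sqrt (ip (G (F x)) w w)) *\<^sub>R w)"
    by (simp add: is_unit_normal_def ip_simps)
  then show ?thesis by blast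
qed

lemma unit_normal: "x \<in> V \<Longrightarrow> is_unit_normal G F x (unit_normal G F x)"
  unfolding unit_normal_def by (rule someI_ex[OF unit_normal_exists])

text \<open>The linear map from pairs (a, t) to the image of \<open>a\<close> plus t times \<nu> is
  injective, and by codimension one both sides have the same dimension.\<close>

lemma tangent_normal_decomposition:
  assumes x: "x \<in> V" and n: "is_unit_normal G F x \<nu>"
  obtains a where "u = dird a F x + ip (G (F x)) u \<nu> *\<^sub>R \<nu>"
proof -
  note n = n[unfolded is_unit_normal_iff[OF x]]
  note com = posdef_commute[OF pos_G[OF x]]
  define L where "L = (\<lambda>(a, t). dird a F x + t *\<^sub>R \<nu>)"
  have ipL: "ip (G (F x)) (L p) \<nu> = snd p" for p
  proof -
    have "ip (G (F x)) (dird a F x) \<nu> = 0" for a using n com by metis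
    then show ?thesis using n by (simp add: L_def ip_simps split: prod.split)
  qed
  have l: "linear L"
    by (rule linearI) (auto simp: L_def linear_add[OF lin[OF x]] linear_cmul[OF lin[OF x]] algebra_simps)
  have "inj L"
  proof (rule linear_injective_0[THEN iffD2, OF l], intro allI impI)
    fix p assume p: "L p = 0"
    then have 2: "snd p = 0" using ipL[of p] by (simp add: ip_simps)
    with p have "dird (fst p) F x = 0" by (auto simp: L_def split: prod.splits)
    then have "ip (h x) (fst p) (fst p) = 0" by (simp add: pull[OF x] ip_simps)
    then have "fst p = 0" using posdef_pos[OF pos_h[OF x], of "fst p"] by fastforce
    with 2 show "p = 0" by (simp add: prod_eq_iff)
  qed
  then have "dim (range L) = dim (UNIV :: ((real^'n) \<times> real) set)"
    by (intro dim_image_eq[OF l]) (auto simp: inj_on_def inj_def)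
  then have "dim (range L) = DIM(real^'m)" using card by simp
  then have "span (range L) = UNIV" by (simp only: dim_eq_full)
  then have "range L = UNIV" using linear_subspace_image[OF l subspace_UNIV] span_eq_iff by metis
  then obtain p where p: "u = L p" by (metis surjD)
  then have "u = dird (fst p) F x + ip (G (F x)) u \<nu> *\<^sub>R \<nu>"
    using ipL[of p] by (auto simp: L_def split: prod.splits)
  then show ?thesis by (rule that)
qed

text \<open>Uniqueness up to the sign \<open>s\<close>: the tangential part of \<mu> is orthogonal
  to both \<mu> and \<nu>, hence to itself, so it vanishes.\<close>

lemma unit_normal_products:
  assumes x: "x \<in> V" and n: "is_unit_normal G F x \<nu>" and n': "is_unit_normal G F x \<mu>"
  obtains s where "s * s = 1" "\<mu> = s *\<^sub>R \<nu>"
proof -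
  note i = n[unfolded is_unit_normal_iff[OF x]] n'[unfolded is_unit_normal_iff[OF x]]
  note com = posdef_commute[OF pos_G[OF x]]
  obtain a where a: "\<mu> = dird a F x + ip (G (F x)) \<mu> \<nu> *\<^sub>R \<nu>"
    by (rule tangent_normal_decomposition[OF x n])
  define s where "s = ip (G (F x)) \<mu> \<nu>"
  have 0: "ip (G (F x)) (dird a F x) (dird a F x) = 0"
  proof -
    have "0 = ip (G (F x)) \<mu> (dird a F x)" using i by simp
    also have "\<dots> = ip (G (F x)) (dird a F x) (dird a F x)"
      by (subst a) (use i in \<open>simp add: ip_simps\<close>)
    finally show ?thesis by simp
  qed
  then have "dird a F x = 0" using posdef_pos[OF pos_G[OF x], of "dird a F x"] by fastforce
  with a have "\<mu> = s *\<^sub>R \<nu>" by (simp add: s_def)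
  moreover from this have "s * s = 1" using i by (simp add: ip_simps)
  ultimately show ?thesis by (rule that[rotated])
qed

text \<open>The ambient covariant derivative along \<open>F\<close>, in direction \<open>v\<close>,
  of the image of the constant field \<open>w\<close>.\<close>

definition cov :: "real^'n \<Rightarrow> real^'n \<Rightarrow> real^'n \<Rightarrow> real^'m" where
  "cov x v w = dird v (dird w F) x + chr G (F x) (dird v F x) (dird w F x)"

lemma cov_deriv_along_eq: "cov_deriv_along G F i j x = cov x (axis i 1) (axis j 1)"
  by (simp add: vec_eq_iff cov_deriv_along_def cov_def chr_def pd_eq_dird mult_ac)

lemma cov_linear:
  assumes x: "x \<in> V" shows "linear (\<lambda>v. cov x v w)" "linear (cov x v)"
proof -
  note l1 = dird_linear[OF smooth_onD_differentiable[OF smooth_on_dird[OF F] x]]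
  note c = dird_commute[OF open_V F x]
  show "linear (\<lambda>v. cov x v w)" unfolding cov_def
    by (rule linearI) (simp_all add: linear_add[OF l1] linear_cmul[OF l1] linear_add[OF lin[OF x]]
        linear_cmul[OF lin[OF x]] chr_add_left chr_scale_left algebra_simps)
  show "linear (cov x v)" unfolding cov_def c[of v]
    by (rule linearI) (simp_all add: linear_add[OF l1] linear_cmul[OF l1] linear_add[OF lin[OF x]]
        linear_cmul[OF lin[OF x]] chr_add_right chr_scale_right algebra_simps)
qed

text \<open>The scalar second fundamental form with respect to \<nu>. It changes sign with \<nu>,
  but enters the norm only through products of two entries.\<close>

definition sff :: "real^'m \<Rightarrow> real^'n \<Rightarrow> real^'n^'n" where
  "sff \<nu> x = (\<chi> i j. ip (G (F x)) (cov x (axis i 1) (axis j 1)) \<nu>)"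

lemma ip_sff: assumes x: "x \<in> V" shows "ip (sff \<nu> x) v w = ip (G (F x)) (cov x v w) \<nu>"
  unfolding ip_expand[of "sff \<nu> x"]
  by (subst linear_expand[OF cov_linear(1)[OF x]], subst linear_expand[OF cov_linear(2)[OF x]])
     (simp add: ip_sum_left ip_simps sff_def sum_distrib_left mult_ac)

text \<open>Each term contains the normal an even number of times, so the normal picked by
  \<open>unit_normal\<close> may be exchanged for any other.\<close>

lemma stability_potential_eq:
  assumes x: "x \<in> V" and n: "is_unit_normal G F x \<nu>"
  shows "stability_potential G f h F x
    = form_normsq (matrix_inv (h x)) (sff \<nu> x) + ip (bakry_emery_ricci G f (F x)) \<nu> \<nu>"
proof -
  define \<mu> where "\<mu> = unit_normal G F x"
  obtain s where s: "s * s = 1" "\<mu> = s *\<^sub>R \<nu>"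
    using unit_normal_products[OF x n unit_normal[OF x]] unfolding \<mu>_def by blast
  have m1: "ip (G (F x)) \<mu> \<mu> = 1" using unit_normal[OF x] by (simp add: \<mu>_def is_unit_normal_def)
  have ss: "s * (y * (s * z)) = y * z" for y z using s(1) by (metis mult.left_commute mult.assoc mult_1)
  have "ip (G (F x)) (second_fund G F i j x) (second_fund G F k l x) = sff \<nu> x $ i $ j * sff \<nu> x $ k $ l" for i j k l
    using m1 by (simp add: second_fund_def normal_part_def \<mu>_def[symmetric] ip_simps cov_deriv_along_eq sff_def)
      (simp add: s ip_simps ss)
  then have "second_fund_normsq G h F x = form_normsq (matrix_inv (h x)) (sff \<nu> x)"
    by (simp add: second_fund_normsq_def form_normsq_def)
  moreover have "ip A \<mu> \<mu> = ip A \<nu> \<nu>" for A using s by (simp add: ip_simps flip: mult.assoc)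
  ultimately show ?thesis by (simp add: stability_potential_def \<mu>_def)
qed

lemma stability_potential_ge:
  assumes x: "x \<in> V" and k: "\<And>v. ip (bakry_emery_ricci G f (F x)) v v \<ge> k * ip (G (F x)) v v"
  shows "stability_potential G f h F x \<ge> k"
  using stability_potential_eq[OF x unit_normal[OF x]] form_normsq_nonneg[OF posdef_matrix_inv[OF pos_h[OF x]]]
    k[of "unit_normal G F x"] unit_normal[OF x]
  by (simp add: is_unit_normal_def add_increasing)

text \<open>Unlike the unit normal itself, its outer square is visibly smooth:
  \<open>\<nu>\<nu>\<^sup>T = G\<^sup>-\<^sup>1 - DF h\<^sup>-\<^sup>1 DF\<^sup>T\<close>.\<close>
definition normal_square :: "real^'n \<Rightarrow> real^'m^'m" where
  "normal_square x = matrix_inv (G (F x))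
     - (\<chi> a b. \<Sum>i\<in>UNIV. \<Sum>j\<in>UNIV. pd i F x $ a * matrix_inv (h x) $ i $ j * pd j F x $ b)"

text \<open>DF h^(-1) DF^T G is the tangential projection: applied to \<open>u\<close> it first
  solves for the tangential coordinates \<open>a\<close> and then maps them back. Subtracting it
  from the identity leaves the normal part.\<close>

lemma normal_square_apply:
  assumes x: "x \<in> V" and n: "is_unit_normal G F x \<nu>"
  shows "normal_square x *v (G (F x) *v u) = ip (G (F x)) u \<nu> *\<^sub>R \<nu>"
proof -
  note n' = n[unfolded is_unit_normal_iff[OF x]]
  note com = posdef_commute[OF pos_G[OF x]]
  obtain a where a: "u = dird a F x + ip (G (F x)) u \<nu> *\<^sub>R \<nu>"
    by (rule tangent_normal_decomposition[OF x n])
  define E where "E = matrix (\<lambda>v. dird v F x)"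
  have E: "E *v v = dird v F x" for v unfolding E_def by (rule matrix_apply[OF lin[OF x]])
  have P: "(\<chi> a b. \<Sum>i\<in>UNIV. \<Sum>j\<in>UNIV. pd i F x $ a * matrix_inv (h x) $ i $ j * pd j F x $ b)
    = E ** matrix_inv (h x) ** transpose E"
  proof -
    have "(\<Sum>i\<in>UNIV. \<Sum>j\<in>UNIV. pd i F x $ a * matrix_inv (h x) $ i $ j * pd j F x $ b)
      = (\<Sum>j\<in>UNIV. \<Sum>i\<in>UNIV. pd i F x $ a * matrix_inv (h x) $ i $ j * pd j F x $ b)" for a b
      by (rule sum.swap)
    then show ?thesis
      by (simp add: vec_eq_iff matrix_matrix_mult_def transpose_def E_def matrix_def pd_eq_dird sum_distrib_right)
  qed
  \<comment> \<open>The normal equations: pairing with tangent vectors kills the \<nu> part of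
    \<open>u\<close>, and \<open>pull\<close> turns the rest into \<open>h\<close>.\<close>
  have "transpose E *v (G (F x) *v u) = h x *v a"
  proof (rule vector_eq_ldot[THEN iffD1], rule allI)
    fix z
    have "z \<bullet> (transpose E *v (G (F x) *v u)) = ip (G (F x)) (E *v z) u"
      unfolding ip_def by (metis dot_lmul_matrix vector_transpose_matrix)
    also have "\<dots> = ip (G (F x)) (dird z F x) (dird a F x)"
    proof -
      have "ip (G (F x)) (dird z F x) \<nu> = 0" using n' com by metis
      then show ?thesis by (subst a) (simp add: E ip_simps)
    qed
    also have "\<dots> = z \<bullet> (h x *v a)" by (simp only: pull[OF x, symmetric]) (simp only: ip_def)
    finally show "z \<bullet> (transpose E *v (G (F x) *v u)) = z \<bullet> (h x *v a)" .
  qed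
  then have "(E ** matrix_inv (h x) ** transpose E) *v (G (F x) *v u) = dird a F x"
    by (simp add: matrix_vector_mul_assoc[symmetric] E)
       (simp add: matrix_vector_mul_assoc matrix_inv_both[OF posdef_det_nz[OF pos_h[OF x]]])
  moreover have "matrix_inv (G (F x)) *v (G (F x) *v u) = u"
    by (simp add: matrix_vector_mul_assoc matrix_inv_both[OF posdef_det_nz[OF pos_G[OF x]]])
  ultimately have "normal_square x *v (G (F x) *v u) = u - dird a F x"
    by (simp add: normal_square_def P matrix_vector_mult_diff_rdistrib)
  also have "\<dots> = ip (G (F x)) u \<nu> *\<^sub>R \<nu>" using a by (metis add_diff_cancel_left')
  finally show ?thesis .
qed

text \<open>The normals occur in pairs, so they can be expressed by \<open>normal_square\<close>.
  This removes the choice and leaves only smooth ingredients.\<close>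

lemma stability_potential_smooth_formula:
  assumes x: "x \<in> V"
  shows "stability_potential G f h F x =
     (\<Sum>i\<in>UNIV. \<Sum>j\<in>UNIV. \<Sum>k\<in>UNIV. \<Sum>l\<in>UNIV. matrix_inv (h x) $ i $ k * matrix_inv (h x) $ j $ l *
        ((G (F x) *v cov_deriv_along G F i j x) \<bullet> (normal_square x *v (G (F x) *v cov_deriv_along G F k l x))))
     + (\<Sum>a\<in>UNIV. \<Sum>b\<in>UNIV. bakry_emery_ricci G f (F x) $ a $ b * normal_square x $ a $ b)"
proof -
  define \<nu> where "\<nu> = unit_normal G F x"
  have n: "is_unit_normal G F x \<nu>" unfolding \<nu>_def by (rule unit_normal[OF x])
  note N = normal_square_apply[OF x n]
  note com = posdef_commute[OF pos_G[OF x]]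
  have 1: "(G (F x) *v u) \<bullet> (normal_square x *v (G (F x) *v w)) = ip (G (F x)) u \<nu> * ip (G (F x)) w \<nu>" for u w
    using com[of u \<nu>] by (simp add: N) (simp add: ip_def inner_commute)
  have 2: "normal_square x $ a $ b = \<nu> $ a * \<nu> $ b" for a b
  proof -
    \<comment> \<open>Chosen so that \<open>G (F x) *v u\<close> is a basis vector;
      \<open>normal_square_apply\<close> then reads off column \<open>b\<close>.\<close>
    define u where "u = matrix_inv (G (F x)) *v axis b 1"
    have u: "G (F x) *v u = axis b 1"
      by (simp add: u_def matrix_vector_mul_assoc matrix_inv_both[OF posdef_det_nz[OF pos_G[OF x]]])
    have "normal_square x $ a $ b = (normal_square x *v axis b 1) $ a"
      by (simp add: matrix_vector_mult_basis column_def)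
    also have "\<dots> = ip (G (F x)) u \<nu> * \<nu> $ a" using N[of u] by (simp add: u)
    also have "ip (G (F x)) u \<nu> = \<nu> $ b" using com[of u \<nu>] u by (simp add: ip_def inner_axis)
    finally show ?thesis by (simp add: mult.commute)
  qed
  show ?thesis
    unfolding stability_potential_eq[OF x n] form_normsq_def 1 2
    by (simp add: sff_def cov_deriv_along_eq ip_expand[of "bakry_emery_ricci G f (F x)"] mult_ac)
qed

lemma continuous_on_stability_potential: "continuous_on V (stability_potential G f h F)"
proof -
  have GF: "smooth_on V (\<lambda>x. G (F x))"
    by (rule smooth_on_compose[OF metric_onD(2)[OF G] F into open_V open_U])
  have CF: "smooth_on V (\<lambda>x. christoffel G a b c (F x))" for a b c
    by (rule smooth_on_compose[OF smooth_on_christoffel[OF G] F into open_V open_U])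
  have BF: "smooth_on V (\<lambda>x. bakry_emery_ricci G f (F x) $ a $ b)" for a b
    by (rule smooth_on_compose[OF smooth_on_bakry_emery[OF G f] F into open_V open_U])
  have hi: "smooth_on V (\<lambda>x. matrix_inv (h x))"
    by (intro smooth_on_matrix_inv metric_onD[OF h] posdef_det)
  have C: "smooth_on V (\<lambda>x. cov_deriv_along G F i j x)" for i j
    unfolding cov_deriv_along_def
    by (intro smooth_on_vec smooth_intros smooth_on_pd F CF open_V)
  have N: "smooth_on V normal_square" unfolding normal_square_def[abs_def]
    by (intro smooth_on_vec smooth_intros smooth_on_pd F hi GF posdef_det pos_G open_V)
  have "smooth_on V (\<lambda>x. (\<Sum>i\<in>UNIV. \<Sum>j\<in>UNIV. \<Sum>k\<in>UNIV. \<Sum>l\<in>UNIV. matrix_inv (h x) $ i $ k * matrix_inv (h x) $ j $ l *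
        ((G (F x) *v cov_deriv_along G F i j x) \<bullet> (normal_square x *v (G (F x) *v cov_deriv_along G F k l x))))
     + (\<Sum>a\<in>UNIV. \<Sum>b\<in>UNIV. bakry_emery_ricci G f (F x) $ a $ b * normal_square x $ a $ b))"
    by (intro smooth_intros N C BF hi GF open_V)
  then show ?thesis
    by (intro continuous_on_cong[THEN iffD2, OF refl stability_potential_smooth_formula] smooth_on_continuous)
qed

end

section \<open>Change of charts on the hypersurface and in the ambient manifold\<close>

locale hypersurface_change =
  A: local_hypersurface U V G f h F + B: local_hypersurface U' V' G' f' h' F'
  + amb: coord_isometry U U' G G' \<phi> + dom: coord_isometry V V' h h' \<psi>
  for U U' :: "(real^'m) set" and V V' :: "(real^'n) set" and G G' f f' h h' F F' \<phi> \<psi> +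
  assumes f_eq: "\<And>y. y \<in> U \<Longrightarrow> f y = f' (\<phi> y)" and F_eq: "\<And>x. x \<in> V \<Longrightarrow> F' (\<psi> x) = \<phi> (F x)"
begin

lemma dF_eq: assumes x: "x \<in> V" shows "dird (dird v \<psi> x) F' (\<psi> x) = dird (dird v F x) \<phi> (F x)"
proof -
  have "dird (dird v \<psi> x) F' (\<psi> x) = dird v (\<lambda>x. F' (\<psi> x)) x"
    by (rule dird_compose[symmetric, OF dom.diff[OF x] B.diff[OF dom.in_S'[OF x]]])
  also have "\<dots> = dird v (\<lambda>x. \<phi> (F x)) x" by (rule dird_cong[OF A.open_V x F_eq])
  also have "\<dots> = dird (dird v F x) \<phi> (F x)"
    by (rule dird_compose[OF A.diff[OF x] amb.diff[OF A.in_U[OF x]]])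
  finally show ?thesis .
qed

text \<open>The differential of \<phi> preserves the metric, and every tangent direction in the new
  chart comes from one in the old chart because the differential of \<psi> is onto.\<close>

lemma unit_normal_push:
  assumes x: "x \<in> V" and n: "is_unit_normal G F x \<nu>"
  shows "is_unit_normal G' F' (\<psi> x) (dird \<nu> \<phi> (F x))"
proof -
  note n' = n[unfolded A.is_unit_normal_iff[OF x]]
  note pull = amb.pull[OF A.in_U[OF x], symmetric]
  have "ip (G' (\<phi> (F x))) (dird \<nu> \<phi> (F x)) (dird w F' (\<psi> x)) = 0" for w
  proof -
    obtain v where "w = dird v \<psi> x" using dom.surj[OF x] by (metis surjD)
    then show ?thesis using n' by (simp add: dF_eq[OF x] pull)
  qed
  then show ?thesis using n'
    unfolding B.is_unit_normal_iff[OF dom.in_S'[OF x]] F_eq[OF x] by (simp add: pull)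
qed

text \<open>Differentiating F' o \<psi> = \<phi> o F twice produces second derivatives of both chart
  changes. That of \<phi> is absorbed by the Christoffel symbols; that of \<psi> survives as a
  tangential vector, which the normal does not see.\<close>

lemma cov_push:
  assumes x: "x \<in> V"
  shows "\<exists>t. B.cov (\<psi> x) (dird v \<psi> x) (dird w \<psi> x) = dird (A.cov x v w) \<phi> (F x) + dird t F' (\<psi> x)"
proof -
  have 1: "dird w (\<lambda>y. F' (\<psi> y)) y = dird w (\<lambda>y. \<phi> (F y)) y" if "y \<in> V" for y
    by (rule dird_cong[OF A.open_V that F_eq])
  have "dird v (dird w (\<lambda>y. F' (\<psi> y))) x = dird v (dird w (\<lambda>y. \<phi> (F y))) x"
    by (rule dird_cong[OF A.open_V x 1])
  then have "dird (dird v (dird w \<psi>) x) F' (\<psi> x) + dird (dird v \<psi> x) (dird (dird w \<psi> x) F') (\<psi> x)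
     = dird (dird v (dird w F) x) \<phi> (F x) + dird (dird v F x) (dird (dird w F x) \<phi>) (F x)"
    unfolding second_chain[OF A.open_V dom.smooth x B.open_V B.F dom.into]
      second_chain[OF A.open_V A.F x A.open_U amb.smooth A.into] .
  moreover note amb.chr_transform[OF A.in_U[OF x], of "dird v F x" "dird w F x"]
  moreover have "dird (A.cov x v w) \<phi> (F x)
     = dird (dird v (dird w F) x) \<phi> (F x) + dird (chr G (F x) (dird v F x) (dird w F x)) \<phi> (F x)"
    unfolding A.cov_def by (rule linear_add[OF amb.lin[OF A.in_U[OF x]]])
  moreover have "dird (- dird v (dird w \<psi>) x) F' (\<psi> x) = - dird (dird v (dird w \<psi>) x) F' (\<psi> x)"
    by (rule linear_neg[OF B.lin[OF dom.in_S'[OF x]]])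
  ultimately have "B.cov (\<psi> x) (dird v \<psi> x) (dird w \<psi> x)
     = dird (A.cov x v w) \<phi> (F x) + dird (- dird v (dird w \<psi>) x) F' (\<psi> x)"
    by (simp add: B.cov_def dF_eq[OF x] F_eq[OF x] algebra_simps)
  then show ?thesis by blast
qed

text \<open>With the normal pushed forward, the second fundamental form and the metric are both
  pulled back by the differential \<open>K\<close> of \<psi>, so the norm is unchanged; the Ricci
  term is natural under \<phi>.\<close>

lemma stability_potential_transform:
  assumes x: "x \<in> V"
  shows "stability_potential G f h F x = stability_potential G' f' h' F' (\<psi> x)"
proof -
  define \<nu> where "\<nu> = unit_normal G F x"
  define \<nu>' where "\<nu>' = dird \<nu> \<phi> (F x)"
  have n: "is_unit_normal G F x \<nu>" unfolding \<nu>_def by (rule A.unit_normal[OF x])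
  have n': "is_unit_normal G' F' (\<psi> x) \<nu>'" unfolding \<nu>'_def by (rule unit_normal_push[OF x n])
  note x' = dom.in_S'[OF x]
  define K where "K = matrix (\<lambda>v. dird v \<psi> x)"
  have K: "K *v v = dird v \<psi> x" for v unfolding K_def by (rule matrix_apply[OF dom.lin[OF x]])
  have hK: "h x = transpose K ** h' (\<psi> x) ** K"
    by (rule ip_eqI) (simp add: ip_congruence K dom.pull[OF x])
  have sK: "A.sff \<nu> x = transpose K ** B.sff \<nu>' (\<psi> x) ** K"
  proof (rule ip_eqI)
    fix v w
    obtain t where t: "B.cov (\<psi> x) (dird v \<psi> x) (dird w \<psi> x) = dird (A.cov x v w) \<phi> (F x) + dird t F' (\<psi> x)"
      using cov_push[OF x] by blast
    have "ip (G' (F' (\<psi> x))) (dird t F' (\<psi> x)) \<nu>' = 0"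
      using n'[unfolded B.is_unit_normal_iff[OF x']] posdef_commute[OF B.pos_G[OF x']] by metis
    then have "ip (G' (F' (\<psi> x))) (B.cov (\<psi> x) (dird v \<psi> x) (dird w \<psi> x)) \<nu>'
      = ip (G' (\<phi> (F x))) (dird (A.cov x v w) \<phi> (F x)) \<nu>'"
      unfolding t by (simp add: ip_simps F_eq[OF x])
    also have "\<dots> = ip (G (F x)) (A.cov x v w) \<nu>"
      unfolding \<nu>'_def by (rule amb.pull[OF A.in_U[OF x], symmetric])
    finally show "ip (A.sff \<nu> x) v w = ip (transpose K ** B.sff \<nu>' (\<psi> x) ** K) v w"
      by (simp add: ip_congruence K A.ip_sff[OF x] B.ip_sff[OF x'])
  qed
  have "inj ((*v) K)" using dom.inj[OF x] by (simp add: K[abs_def])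
  then obtain L where "L ** K = mat 1" using matrix_left_invertible_injective by blast
  then have "K ** L = mat 1" by (rule matrix_left_right_inverse[THEN iffD1])
  then have L: "transpose L ** transpose K = mat 1" by (metis matrix_transpose_mul transpose_mat)
  note hi = matrix_inv_both[OF posdef_det_nz[OF A.pos_h[OF x]]]
  note hi' = matrix_inv_both[OF posdef_det_nz[OF B.pos_h[OF x']]]
  \<comment> \<open>Inverse metrics transform contragrediently; the steps below verify that this
    candidate is the inverse of \<open>h' (\<psi> x)\<close>.\<close>
  define X where "X = K ** matrix_inv (h x) ** transpose K"
  have "transpose K ** (h' (\<psi> x) ** X) = (transpose K ** h' (\<psi> x) ** K) ** matrix_inv (h x) ** transpose K"
    by (simp add: X_def matrix_mul_assoc)
  also have "\<dots> = transpose K" unfolding hK[symmetric] by (simp add: hi)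
  finally have "h' (\<psi> x) ** X = mat 1" by (metis L matrix_mul_assoc matrix_mul_lid)
  then have X: "matrix_inv (h' (\<psi> x)) = X" by (metis hi'(2) matrix_mul_assoc matrix_mul_lid matrix_mul_rid)
  have "form_normsq (matrix_inv (h' (\<psi> x))) (B.sff \<nu>' (\<psi> x)) = form_normsq (matrix_inv (h x)) (A.sff \<nu> x)"
    by (rule form_normsq_congruence[OF sK]) (simp add: X X_def)
  moreover have "ip (bakry_emery_ricci G f (F x)) \<nu> \<nu> = ip (bakry_emery_ricci G' f' (F' (\<psi> x))) \<nu>' \<nu>'"
    unfolding \<nu>'_def F_eq[OF x] by (rule amb.bakry_emery_transform[OF A.in_U[OF x] A.f B.f f_eq])
  ultimately show ?thesis
    by (simp add: A.stability_potential_eq[OF x n] B.stability_potential_eq[OF x' n'])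
qed

end

section \<open>Smooth functions on a manifold\<close>

text \<open>The constant is the minimum over the compact unit sphere; homogeneity extends the bound
  to all vectors.\<close>

lemma posdef_lower_bound:
  assumes "posdef A" shows "\<exists>m>0. \<forall>v. m * (norm v)\<^sup>2 \<le> ip A v v"
proof -
  have c: "continuous_on (sphere 0 1) (\<lambda>v. ip A v v)" unfolding ip_def
    by (intro continuous_intros linear_continuous_on) (simp add: matrix_vector_mul_bounded_linear)
  have ne: "sphere 0 (1::real) \<noteq> ({} :: (real^'n) set)" by simp
  obtain w where w: "w \<in> sphere 0 1" "\<And>v. v \<in> sphere 0 1 \<Longrightarrow> ip A w w \<le> ip A v v"
    using continuous_attains_inf[OF compact_sphere ne c] by blast
  have "ip A w w * (norm v)\<^sup>2 \<le> ip A v v" for v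
  proof (cases "v = 0")
    case False
    have "ip A w w \<le> ip A ((1 / norm v) *\<^sub>R v) ((1 / norm v) *\<^sub>R v)"
      by (rule w(2)) (use False in simp)
    also have "\<dots> = ip A v v / (norm v)\<^sup>2" by (simp add: ip_simps power2_eq_square)
    finally show ?thesis using False by (simp add: field_simps)
  qed (simp add: ip_simps)
  moreover have "ip A w w > 0" by (rule posdef_pos[OF assms]) (use w in auto)
  ultimately show ?thesis by blast
qed

lemma ip_diff_bound:
  fixes A :: "real^'n^'n"
  shows "\<exists>K>0. \<forall>A B :: real^'n^'n. \<forall>v. \<bar>ip A v v - ip B v v\<bar> \<le> K * norm (A - B) * (norm v)\<^sup>2"
proof -
  obtain K where K: "K > 0" "\<And>(A :: real^'n^'n) v. norm (A *v v) \<le> norm A * norm v * K"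
    using bounded_bilinear.pos_bounded[OF bounded_bilinear_matrix_vector] by blast
  have "\<bar>ip A v v - ip B v v\<bar> \<le> K * norm (A - B) * (norm v)\<^sup>2" for A B :: "real^'n^'n" and v
  proof -
    have "ip A v v - ip B v v = v \<bullet> ((A - B) *v v)"
      by (simp add: ip_def matrix_vector_mult_diff_rdistrib inner_diff_right)
    then have "\<bar>ip A v v - ip B v v\<bar> \<le> norm v * norm ((A - B) *v v)"
      using Cauchy_Schwarz_ineq2 by metis
    also have "\<dots> \<le> norm v * (norm (A - B) * norm v * K)" by (intro mult_left_mono K) auto
    finally show ?thesis by (simp add: power2_eq_square mult_ac)
  qed
  with K(1) show ?thesis by blast
qed

text \<open>Near \<open>x\<close> the form differs from the one at \<open>x\<close> by at most half
  of the latter. The cruder factor 4 has the convenient square root 2, which is the factor between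
  lengths.\<close>

lemma metric_comparison:
  fixes G :: "real^'n \<Rightarrow> real^'n^'n"
  assumes G: "metric_on S G" and x: "x \<in> S"
  shows "\<exists>r>0. cball x r \<subseteq> S \<and> (\<forall>y\<in>cball x r. \<forall>v. ip (G x) v v / 4 \<le> ip (G y) v v \<and> ip (G y) v v \<le> 4 * ip (G x) v v)"
proof -
  obtain m where m: "m > 0" "\<And>v. m * (norm v)\<^sup>2 \<le> ip (G x) v v"
    using posdef_lower_bound[OF metric_onD(3)[OF G x]] by blast
  obtain K where K: "K > 0" "\<And>(A :: real^'n^'n) B v. \<bar>ip A v v - ip B v v\<bar> \<le> K * norm (A - B) * (norm v)\<^sup>2"
    using ip_diff_bound by blast
  have "isCont G x"
    using smooth_on_continuous[OF metric_onD(2)[OF G]] metric_onD(1)[OF G] x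
    by (simp add: continuous_on_eq_continuous_at)
  moreover have "m / (2 * K) > 0" using m K by simp
  ultimately obtain d where d: "d > 0" "\<And>y. dist y x < d \<Longrightarrow> dist (G y) (G x) < m / (2 * K)"
    unfolding continuous_at_eps_delta by blast
  obtain e where e: "e > 0" "cball x e \<subseteq> S" using metric_onD(1)[OF G] x open_contains_cball by blast
  define r where "r = min e (d / 2)"
  have r: "r > 0" using d e by (simp add: r_def)
  have "ip (G x) v v / 4 \<le> ip (G y) v v \<and> ip (G y) v v \<le> 4 * ip (G x) v v" if "y \<in> cball x r" for y v
  proof -
    have "dist y x < d" using that d by (simp add: r_def dist_commute)
    then have "K * norm (G y - G x) \<le> m / 2"
      using d(2)[of y] K(1) by (simp add: dist_norm field_simps)
    then have "K * norm (G y - G x) * (norm v)\<^sup>2 \<le> m / 2 * (norm v)\<^sup>2" by (intro mult_right_mono) auto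
    with K(2)[of "G y" v "G x"] m(2)[of v] have "\<bar>ip (G y) v v - ip (G x) v v\<bar> \<le> ip (G x) v v / 2"
      by linarith
    moreover have "ip (G x) v v \<ge> 0" by (rule posdef_nonneg[OF metric_onD(3)[OF G x]])
    ultimately show ?thesis by linarith
  qed
  moreover have "cball x r \<subseteq> S" using e by (auto simp: r_def)
  ultimately show ?thesis using r by blast
qed

lemma posdef_ellipsoid_compact:
  assumes "posdef A" shows "compact {x. ip A (x - a) (x - a) \<le> r}"
proof -
  obtain m where m: "m > 0" "\<And>v. m * (norm v)\<^sup>2 \<le> ip A v v" using posdef_lower_bound[OF assms] by blast
  have "closed {x. ip A (x - a) (x - a) \<le> r}" unfolding ip_def
    by (intro closed_Collect_le continuous_intros
        linear_continuous_on_compose[OF _ matrix_vector_mul_linear]) 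
  moreover have "bounded {x. ip A (x - a) (x - a) \<le> r}"
  proof (rule boundedI)
    fix x assume "x \<in> {x. ip A (x - a) (x - a) \<le> r}"
    then have "m * (norm (x - a))\<^sup>2 \<le> r" using m(2)[of "x - a"] by simp
    then have "(norm (x - a))\<^sup>2 \<le> r / m" using m(1) by (simp add: field_simps)
    then have "norm (x - a) \<le> sqrt (r / m)" by (rule real_le_rsqrt)
    then show "norm x \<le> sqrt (r / m) + norm a" using norm_triangle_sub[of x a] by linarith
  qed
  ultimately show ?thesis by (simp add: compact_eq_bounded_closed)
qed

locale rmanifold =
  fixes \<B> :: "('b::{t2_space,second_countable_topology}, 'n::finite) chart set"
    and h :: "('b, 'n) metric_field"
  assumes M: "riemannian_manifold \<B> h"
begin

lemma atlas: "smooth_atlas \<B>" and metric: "riemannian_metric \<B> h" and connected_M: "connected (UNIV :: 'b set)"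
  using M by (auto simp: riemannian_manifold_def)

lemma chartD:
  assumes "c \<in> \<B>"
  shows "open (fst c)" "open (cdom c)" "homeomorphism (fst c) (cdom c) (snd c) (param c)"
  using atlas assms by (auto simp: smooth_atlas_def)

lemma chart_cont:
  assumes "c \<in> \<B>" shows "continuous_on (fst c) (snd c)" "continuous_on (cdom c) (param c)"
  using chartD(3)[OF assms] by (auto simp: homeomorphism_def)

lemma param_snd [simp]: "c \<in> \<B> \<Longrightarrow> p \<in> fst c \<Longrightarrow> param c (snd c p) = p"
  using chartD(3) by (auto simp: homeomorphism_def)

lemma snd_param [simp]: "c \<in> \<B> \<Longrightarrow> x \<in> cdom c \<Longrightarrow> snd c (param c x) = x"
  using chartD(3) by (auto simp: homeomorphism_def)

lemma snd_in [simp]: "p \<in> fst c \<Longrightarrow> snd c p \<in> cdom c" by (simp add: cdom_def)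

lemma param_in [simp]: "c \<in> \<B> \<Longrightarrow> x \<in> cdom c \<Longrightarrow> param c x \<in> fst c"
  using homeomorphism_image2[OF chartD(3)[of c]] by blast

lemma chart_at: "chart_at \<B> p \<in> \<B>" "p \<in> fst (chart_at \<B> p)"
proof -
  have "p \<in> (\<Union>c\<in>\<B>. fst c)" using atlas by (simp add: smooth_atlas_def)
  then have "\<exists>c. c \<in> \<B> \<and> p \<in> fst c" by blast
  then have "chart_at \<B> p \<in> \<B> \<and> p \<in> fst (chart_at \<B> p)" unfolding chart_at_def by (rule someI_ex)
  then show "chart_at \<B> p \<in> \<B>" "p \<in> fst (chart_at \<B> p)" by auto
qed

lemma snd_image: "c \<in> \<B> \<Longrightarrow> A \<subseteq> fst c \<Longrightarrow> snd c ` A = {x \<in> cdom c. param c x \<in> A}"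
  by (auto simp: image_iff) (metis param_snd snd_param subsetD)+

lemma param_image: "c \<in> \<B> \<Longrightarrow> T \<subseteq> cdom c \<Longrightarrow> param c ` T = {p \<in> fst c. snd c p \<in> T}"
  by (auto simp: image_iff) (metis param_snd snd_param subsetD)+

lemma open_snd_image:
  assumes "c \<in> \<B>" "open A" "A \<subseteq> fst c" shows "open (snd c ` A)"
proof -
  have "snd c ` A = cdom c \<inter> param c -` A" using snd_image[OF assms(1,3)] by blast
  then show ?thesis
    using continuous_open_preimage[OF chart_cont(2)[OF assms(1)] chartD(2)[OF assms(1)] assms(2)] by simp
qed

lemma open_param_image:
  assumes "c \<in> \<B>" "open T" "T \<subseteq> cdom c" shows "open (param c ` T)"
proof -
  have "param c ` T = fst c \<inter> snd c -` T" using param_image[OF assms(1,3)] by blast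
  then show ?thesis
    using continuous_open_preimage[OF chart_cont(1)[OF assms(1)] chartD(1)[OF assms(1)] assms(2)] by simp
qed

lemma compact_param_image: "c \<in> \<B> \<Longrightarrow> compact K \<Longrightarrow> K \<subseteq> cdom c \<Longrightarrow> compact (param c ` K)"
  by (rule compact_continuous_image[OF continuous_on_subset[OF chart_cont(2)]])

lemma overlap_iff: "c \<in> \<B> \<Longrightarrow> x \<in> overlap c c' \<longleftrightarrow> x \<in> cdom c \<and> param c x \<in> fst c'"
  unfolding overlap_def by (subst snd_image) auto

lemma open_overlap: "c \<in> \<B> \<Longrightarrow> c' \<in> \<B> \<Longrightarrow> open (overlap c c')"
  unfolding overlap_def by (rule open_snd_image) (auto simp: chartD)

lemma overlap_snd: "p \<in> fst c \<Longrightarrow> p \<in> fst c' \<Longrightarrow> snd c p \<in> overlap c c'"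
  by (auto simp: overlap_def)

lemma transition_snd [simp]: "c \<in> \<B> \<Longrightarrow> p \<in> fst c \<Longrightarrow> transition c c' (snd c p) = snd c' p"
  by (simp add: transition_def)

lemma transition_in: "c \<in> \<B> \<Longrightarrow> c' \<in> \<B> \<Longrightarrow> transition c c' ` overlap c c' \<subseteq> cdom c'"
  by (auto simp: overlap_def)

lemma param_transition: "c \<in> \<B> \<Longrightarrow> c' \<in> \<B> \<Longrightarrow> x \<in> overlap c c' \<Longrightarrow> param c' (transition c c' x) = param c x"
  by (auto simp: overlap_def)

lemma smooth_transition: "c \<in> \<B> \<Longrightarrow> c' \<in> \<B> \<Longrightarrow> smooth_on (overlap c c') (transition c c')"
  using atlas by (auto simp: smooth_atlas_def)

lemma metric_on_chart: "c \<in> \<B> \<Longrightarrow> metric_on (cdom c) (h c)"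
  using metric chartD by (auto simp: riemannian_metric_def metric_on_def posdef_def)

lemma metric_on_overlap: "c \<in> \<B> \<Longrightarrow> c' \<in> \<B> \<Longrightarrow> metric_on (overlap c c') (h c)"
  using metric_on_chart[of c] open_overlap[of c c'] overlap_iff[of c _ c'] unfolding metric_on_def
  by (auto intro: smooth_on_subset)

lemma jacobian_apply:
  fixes F :: "real^'k \<Rightarrow> real^'l"
  assumes "F differentiable (at x)"
  shows "jacobian F (at x) *v v = dird v F x"
proof -
  have "linear (frechet_derivative F (at x))" using dird_linear[OF assms] by (simp add: dird_def)
  then show ?thesis unfolding jacobian_def dird_def by (rule matrix_apply)
qed

lemma coord_isometry_transition:
  assumes "c \<in> \<B>" "c' \<in> \<B>"
  shows "coord_isometry (overlap c c') (cdom c') (h c) (h c') (transition c c')"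
proof
  fix x v w assume x: "x \<in> overlap c c'"
  have "h c x = transpose (jacobian (transition c c') (at x)) ** h c' (transition c c' x)
                  ** jacobian (transition c c') (at x)"
    using metric assms x by (auto simp: riemannian_metric_def)
  then show "ip (h c x) v w = ip (h c' (transition c c' x)) (dird v (transition c c') x) (dird w (transition c c') x)"
    by (simp add: ip_congruence jacobian_apply[OF smooth_onD_differentiable[OF smooth_transition[OF assms] x]])
next
  show "metric_on (overlap c c') (h c)" by (rule metric_on_overlap[OF assms])
  show "metric_on (cdom c') (h c')" by (rule metric_on_chart[OF assms(2)])
  show "smooth_on (overlap c c') (transition c c')" by (rule smooth_transition[OF assms])
  show "transition c c' ` overlap c c' \<subseteq> cdom c'" by (rule transition_in[OF assms])
qed

abbreviation "smooth \<equiv> smooth_function \<B>"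

lemma smooth_iff: "smooth u \<longleftrightarrow> (\<forall>c\<in>\<B>. smooth_on (cdom c) (\<lambda>x. u (param c x)))"
  by (simp add: smooth_function_def o_def)

lemma smoothD: "smooth u \<Longrightarrow> c \<in> \<B> \<Longrightarrow> smooth_on (cdom c) (\<lambda>x. u (param c x))"
  by (simp add: smooth_iff)

lemma smooth_const: "smooth (\<lambda>p. a)" by (simp add: smooth_iff smooth_on_const)
lemma smooth_diff: "smooth u \<Longrightarrow> smooth w \<Longrightarrow> smooth (\<lambda>p. u p - w p)"
  by (simp add: smooth_iff smooth_on_diff chartD)
lemma smooth_mult: "smooth u \<Longrightarrow> smooth w \<Longrightarrow> smooth (\<lambda>p. u p * w p)"
  by (simp add: smooth_iff smooth_on_mult chartD)
lemma smooth_sum: "(\<And>i. i \<in> I \<Longrightarrow> smooth (u i)) \<Longrightarrow> smooth (\<lambda>p. \<Sum>i\<in>I. u i p)"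
  by (simp add: smooth_iff smooth_on_sum chartD)
lemma smooth_real_compose: "smooth_on UNIV \<theta> \<Longrightarrow> smooth u \<Longrightarrow> smooth (\<lambda>p. \<theta> (u p :: real))"
  unfolding smooth_iff
proof
  fix c assume "c \<in> \<B>" and "smooth_on UNIV \<theta>" "\<forall>c\<in>\<B>. smooth_on (cdom c) (\<lambda>x. u (param c x))"
  then show "smooth_on (cdom c) (\<lambda>x. \<theta> (u (param c x)))"
    using smooth_on_compose[of UNIV \<theta> "cdom c" "\<lambda>x. u (param c x)"] chartD(2)[of c] by blast
qed

lemma smooth_continuous: assumes "smooth u" shows "continuous_on UNIV u"
proof -
  have "continuous (at p) u" for p
  proof -
    define c where "c = chart_at \<B> p"
    have c: "c \<in> \<B>" "p \<in> fst c" using chart_at by (auto simp: c_def)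
    have "continuous_on (fst c) (\<lambda>q. u (param c (snd c q)))"
      by (rule continuous_on_compose2[OF smooth_on_continuous[OF smoothD[OF assms c(1)]] chart_cont(1)[OF c(1)]]) auto
    then have "continuous_on (fst c) u"
      by (rule continuous_on_eq) (use c in auto)
    then show ?thesis using c chartD by (simp add: continuous_on_eq_continuous_at)
  qed
  then show ?thesis by (simp add: continuous_at_imp_continuous_on)
qed

text \<open>In another chart the domain is covered by the overlap and by the complement of the
  support. That complement is open because the compact image of \<open>K\<close> is closed in a
  Hausdorff space.\<close>

lemma smooth_extend:
  assumes c: "c \<in> \<B>" and \<phi>: "smooth_on (cdom c) \<phi>" and K: "compact K" "K \<subseteq> cdom c"
    and z: "\<And>x. x \<in> cdom c - K \<Longrightarrow> \<phi> x = 0"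
  shows "smooth (\<lambda>p. if p \<in> fst c then \<phi> (snd c p) else 0)" (is "smooth ?u")
  unfolding smooth_iff
proof
  fix c' assume c': "c' \<in> \<B>"
  have cl: "closed (param c ` K)" by (rule compact_imp_closed[OF compact_param_image[OF c K]])
  define T where "T = snd c' ` (fst c' - param c ` K)"
  have oT: "open T" unfolding T_def using c' cl by (intro open_snd_image) (auto simp: chartD)
  have 1: "smooth_on (overlap c' c) (\<lambda>x. ?u (param c' x))"
  proof (rule smooth_on_cong[THEN iffD2, OF open_overlap[OF c' c]])
    show "?u (param c' x) = \<phi> (transition c' c x)" if "x \<in> overlap c' c" for x
      using that by (simp add: overlap_iff[OF c'] transition_def)
    show "smooth_on (overlap c' c) (\<lambda>x. \<phi> (transition c' c x))"
      by (rule smooth_on_compose[OF \<phi> smooth_transition[OF c' c] transition_in[OF c' c] open_overlap[OF c' c] chartD(2)[OF c]])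
  qed
  have 2: "smooth_on T (\<lambda>x. ?u (param c' x))"
  proof (rule smooth_on_cong[THEN iffD2, OF oT])
    show "?u (param c' x) = 0" if "x \<in> T" for x
      using that c c' z by (auto simp: T_def image_iff) (metis DiffI param_snd snd_in)
  qed (rule smooth_on_const)
  have "smooth_on (overlap c' c \<union> T) (\<lambda>x. ?u (param c' x))"
    by (rule smooth_on_Un[OF open_overlap[OF c' c] oT 1 2])
  moreover have "cdom c' \<subseteq> overlap c' c \<union> T"
  proof
    fix x assume "x \<in> cdom c'"
    then obtain p where p: "x = snd c' p" "p \<in> fst c'" by (auto simp: cdom_def)
    have "p \<in> fst c" if "p \<in> param c ` K" using that c K by auto
    then show "x \<in> overlap c' c \<union> T" using p by (auto simp: overlap_def T_def)
  qed
  ultimately show "smooth_on (cdom c') (\<lambda>x. ?u (param c' x))" by (rule smooth_on_subset)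
qed

end

section \<open>Gradient bounds and bump functions\<close>

lemma smooth_on_ln': "smooth_on {0<..} (ln :: real \<Rightarrow> real)"
  unfolding smooth_on_def
proof
  fix k show "Ck_on k {0<..} (ln :: real \<Rightarrow> real)"
  proof (cases k)
    case (Suc n)
    have *: "dird v ln x = v * inverse x" if "x \<in> {0<..}" for v x :: real
      using that by (subst dird_real[OF DERIV_ln]) auto
    have "Ck_on n {0<..} (\<lambda>x::real. v * inverse x)" for v :: real
      using smooth_on_inverse' unfolding smooth_on_def
      by (intro Ck_on_bilinear[OF bounded_bilinear_mult] Ck_on_const) auto
    then have "Ck_on n {0<..} (dird v (ln :: real \<Rightarrow> real))" for v
      by (intro Ck_on_cong[THEN iffD2, OF _ *]) auto
    moreover have "(ln :: real \<Rightarrow> real) differentiable (at x)" if "x > 0" for x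
      using DERIV_ln[OF that] by (auto simp: real_differentiable_def)
    ultimately show ?thesis using Suc by (auto simp: Ck_on_Suc)
  qed (auto intro: continuous_intros)
qed

lemma smooth_on_ln:
  "smooth_on S F \<Longrightarrow> open S \<Longrightarrow> (\<And>x. x \<in> S \<Longrightarrow> F x > 0) \<Longrightarrow> smooth_on S (\<lambda>x. ln (F x :: real))"
  by (rule smooth_on_compose[OF smooth_on_ln']) auto

text \<open>Fixed once and for all, so that the single constant \<open>step_bound\<close> enters
  every gradient estimate.\<close>

definition smooth_step :: "real \<Rightarrow> real" where
  "smooth_step = (SOME \<theta>. smooth_on UNIV \<theta> \<and> (\<forall>t\<le>0. \<theta> t = 0) \<and> (\<forall>t\<ge>1. \<theta> t = 1)
     \<and> (\<forall>t. 0 \<le> \<theta> t \<and> \<theta> t \<le> 1) \<and> (\<exists>L>0. \<forall>t v. \<bar>dird v \<theta> t\<bar> \<le> L * \<bar>v\<bar>))"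

lemma smooth_step:
  "smooth_on UNIV smooth_step" "t \<le> 0 \<Longrightarrow> smooth_step t = 0" "t \<ge> 1 \<Longrightarrow> smooth_step t = 1"
  "0 \<le> smooth_step t" "smooth_step t \<le> 1" "\<exists>L>0. \<forall>t v. \<bar>dird v smooth_step t\<bar> \<le> L * \<bar>v\<bar>"
  using someI_ex[OF smooth_step_exists] unfolding smooth_step_def[symmetric] by auto

definition step_bound :: real where
  "step_bound = (SOME L. L > 0 \<and> (\<forall>t v. \<bar>dird v smooth_step t\<bar> \<le> L * \<bar>v\<bar>))"

lemma step_bound: "step_bound > 0" "\<bar>dird v smooth_step t\<bar> \<le> step_bound * \<bar>v\<bar>"
proof -
  have "\<exists>L. L > 0 \<and> (\<forall>t v. \<bar>dird v smooth_step t\<bar> \<le> L * \<bar>v\<bar>)" using smooth_step(6) by auto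
  from someI_ex[OF this] show "step_bound > 0" "\<bar>dird v smooth_step t\<bar> \<le> step_bound * \<bar>v\<bar>"
    unfolding step_bound_def[symmetric] by auto
qed

lemma posdef_Cauchy_Schwarz:
  assumes "posdef A" shows "\<bar>ip A v w\<bar> \<le> sqrt (ip A v v) * sqrt (ip A w w)"
proof (cases "w = 0")
  case False
  define t where "t = ip A v w / ip A w w"
  have p: "ip A w w > 0" by (rule posdef_pos[OF assms False])
  have "0 \<le> ip A (v - t *\<^sub>R w) (v - t *\<^sub>R w)" by (rule posdef_nonneg[OF assms])
  also have "\<dots> = ip A v v - (ip A v w)\<^sup>2 / ip A w w"
    using p posdef_commute[OF assms, of w v]
    by (simp add: ip_simps t_def power2_eq_square field_simps)
  finally have "(ip A v w)\<^sup>2 \<le> ip A v v * ip A w w" using p by (simp add: field_simps)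
  then have "sqrt ((ip A v w)\<^sup>2) \<le> sqrt (ip A v v * ip A w w)" by (rule real_sqrt_le_mono)
  then show ?thesis by (simp add: real_sqrt_mult)
qed (simp add: ip_simps)

context rmanifold
begin

lemma posdef_h: "c \<in> \<B> \<Longrightarrow> x \<in> cdom c \<Longrightarrow> posdef (h c x)"
  by (rule metric_onD(3)[OF metric_on_chart])

lemma diff_chart: "smooth u \<Longrightarrow> c \<in> \<B> \<Longrightarrow> x \<in> cdom c \<Longrightarrow> (\<lambda>x. u (param c x)) differentiable (at x)"
  by (rule smooth_onD_differentiable[OF smoothD])

lemma dird_transition:
  assumes u: "smooth u" and c: "c \<in> \<B>" "c' \<in> \<B>" and x: "x \<in> overlap c c'"
  shows "dird v (\<lambda>x. u (param c x)) x = dird (dird v (transition c c') x) (\<lambda>x. u (param c' x)) (transition c c' x)"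
proof -
  have "dird v (\<lambda>x. u (param c x)) x = dird v (\<lambda>x. u (param c' (transition c c' x))) x"
    by (rule dird_cong[OF open_overlap[OF c] x]) (simp add: param_transition[OF c])
  also have "\<dots> = dird (dird v (transition c c') x) (\<lambda>x. u (param c' x)) (transition c c' x)"
    by (rule dird_compose[of "transition c c'" x "\<lambda>x. u (param c' x)"])
       (use transition_in[OF c] x in \<open>auto intro: smooth_onD_differentiable[OF smooth_transition[OF c]] diff_chart[OF u c(2)]\<close>)
  finally show ?thesis .
qed

text \<open>By duality this says that the gradient of \<open>u\<close> at \<open>p\<close> has norm at most \<open>L\<close>.\<close>
definition grad_le :: "('b \<Rightarrow> real) \<Rightarrow> 'b \<Rightarrow> real \<Rightarrow> bool" where
  "grad_le u p L \<longleftrightarrow> (\<forall>c\<in>\<B>. p \<in> fst c \<longrightarrow>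
     (\<forall>v. \<bar>dird v (\<lambda>x. u (param c x)) (snd c p)\<bar> \<le> L * sqrt (ip (h c (snd c p)) v v)))"

lemma grad_leD: "grad_le u p L \<Longrightarrow> c \<in> \<B> \<Longrightarrow> p \<in> fst c \<Longrightarrow>
    \<bar>dird v (\<lambda>x. u (param c x)) (snd c p)\<bar> \<le> L * sqrt (ip (h c (snd c p)) v v)"
  by (auto simp: grad_le_def)

text \<open>The differential of \<open>u\<close> transforms by the chain rule and the chart change
  preserves lengths, so the bound passes from one chart to all.\<close>

lemma grad_leI_chart:
  assumes u: "smooth u" and c: "c \<in> \<B>" "p \<in> fst c"
    and le: "\<And>v. \<bar>dird v (\<lambda>x. u (param c x)) (snd c p)\<bar> \<le> L * sqrt (ip (h c (snd c p)) v v)"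
  shows "grad_le u p L"
  unfolding grad_le_def
proof (intro ballI impI allI)
  fix c' v assume c': "c' \<in> \<B>" "p \<in> fst c'"
  interpret coord_isometry "overlap c' c" "cdom c" "h c'" "h c" "transition c' c"
    by (rule coord_isometry_transition[OF c'(1) c(1)])
  have x: "snd c' p \<in> overlap c' c" by (rule overlap_snd[OF c'(2) c(2)])
  show "\<bar>dird v (\<lambda>x. u (param c' x)) (snd c' p)\<bar> \<le> L * sqrt (ip (h c' (snd c' p)) v v)"
    unfolding dird_transition[OF u c'(1) c(1) x] pull[OF x] using le c' by simp
qed

lemma grad_le_mono: assumes "grad_le u p L" "L \<le> L'" shows "grad_le u p L'"
  unfolding grad_le_def
proof (intro ballI impI allI)
  fix c v assume c: "c \<in> \<B>" "p \<in> fst c"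
  have "\<bar>dird v (\<lambda>x. u (param c x)) (snd c p)\<bar> \<le> L * sqrt (ip (h c (snd c p)) v v)"
    by (rule grad_leD[OF assms(1) c])
  also have "\<dots> \<le> L' * sqrt (ip (h c (snd c p)) v v)"
    by (rule mult_right_mono[OF assms(2)]) (simp add: posdef_nonneg[OF posdef_h] c)
  finally show "\<bar>dird v (\<lambda>x. u (param c x)) (snd c p)\<bar> \<le> L' * sqrt (ip (h c (snd c p)) v v)" .
qed

lemma dird_extremum:
  assumes u: "smooth u" and c: "c \<in> \<B>" "p \<in> fst c" and ext: "(\<forall>q. u q \<le> u p) \<or> (\<forall>q. u p \<le> u q)"
  shows "dird v (\<lambda>x. u (param c x)) (snd c p) = 0"
proof -
  have "(\<lambda>v. dird v (\<lambda>x. u (param c x)) (snd c p)) = (\<lambda>v. 0)"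
    by (rule differential_zero_maxmin[of "snd c p" "cdom c" "\<lambda>x. u (param c x)"])
       (use c ext chartD in \<open>auto intro!: has_derivative_dird diff_chart[OF u]\<close>)
  then show ?thesis by meson
qed

text \<open>Meant for points where a cutoff takes the values 0 or 1, which are its extremes: there
  the gradient vanishes, even on the boundary of the support.\<close>

lemma grad_le_extremum:
  "smooth u \<Longrightarrow> (\<forall>q. u q \<le> u p) \<or> (\<forall>q. u p \<le> u q) \<Longrightarrow> L \<ge> 0 \<Longrightarrow> grad_le u p L"
  unfolding grad_le_def using dird_extremum by (auto simp: posdef_nonneg[OF posdef_h])

lemma grad_le_compose:
  assumes u: "smooth u" and \<theta>: "smooth_on UNIV \<theta>" "\<And>w. \<bar>dird w \<theta> (u p)\<bar> \<le> K * \<bar>w\<bar>" and "K \<ge> 0" "grad_le u p L"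
  shows "grad_le (\<lambda>q. \<theta> (u q) :: real) p (K * L)"
  unfolding grad_le_def
proof (intro ballI impI allI)
  fix c v assume c: "c \<in> \<B>" "p \<in> fst c"
  have "dird v (\<lambda>x. \<theta> (u (param c x))) (snd c p) = dird (dird v (\<lambda>x. u (param c x)) (snd c p)) \<theta> (u (param c (snd c p)))"
    by (rule dird_compose[of "\<lambda>x. u (param c x)"])
       (use c in \<open>auto intro: diff_chart[OF u] smooth_onD_differentiable[OF \<theta>(1)]\<close>)
  also have "\<bar>\<dots>\<bar> \<le> K * \<bar>dird v (\<lambda>x. u (param c x)) (snd c p)\<bar>" using \<theta>(2) c by simp
  also have "\<dots> \<le> K * (L * sqrt (ip (h c (snd c p)) v v))"
    by (intro mult_left_mono grad_leD assms c)
  finally show "\<bar>dird v (\<lambda>x. \<theta> (u (param c x))) (snd c p)\<bar> \<le> K * L * sqrt (ip (h c (snd c p)) v v)"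
    by (simp add: mult.assoc)
qed

lemma dird_chart_mult:
  assumes "smooth u" "smooth w" "c \<in> \<B>" "x \<in> cdom c"
  shows "dird v (\<lambda>x. u (param c x) * w (param c x)) x
    = u (param c x) * dird v (\<lambda>x. w (param c x)) x + dird v (\<lambda>x. u (param c x)) x * w (param c x)"
  by (rule dird_eqI[OF has_derivative_mult[OF has_derivative_dird has_derivative_dird]]) (intro diff_chart assms)+

lemma dird_chart_sum:
  assumes "\<And>i. i \<in> I \<Longrightarrow> smooth (u i)" "c \<in> \<B>" "x \<in> cdom c"
  shows "dird v (\<lambda>x. \<Sum>i\<in>I. u i (param c x)) x = (\<Sum>i\<in>I. dird v (\<lambda>x. u i (param c x)) x)"
  by (rule dird_eqI[OF has_derivative_sum[OF has_derivative_dird]]) (intro diff_chart assms)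

lemma grad_le_mult:
  assumes u: "smooth u" "\<bar>u p\<bar> \<le> 1" "grad_le u p L" and w: "smooth w" "\<bar>w p\<bar> \<le> 1" "grad_le w p K"
  shows "grad_le (\<lambda>q. u q * w q) p (L + K)"
  unfolding grad_le_def
proof (intro ballI impI allI)
  fix c v assume c: "c \<in> \<B>" "p \<in> fst c"
  have 1: "\<bar>a * b\<bar> \<le> \<bar>b\<bar>" if "\<bar>a\<bar> \<le> 1" for a b :: real
    using mult_right_mono[OF that, of "\<bar>b\<bar>"] by (simp add: abs_mult)
  have "\<bar>dird v (\<lambda>x. u (param c x) * w (param c x)) (snd c p)\<bar>
    \<le> \<bar>dird v (\<lambda>x. w (param c x)) (snd c p)\<bar> + \<bar>dird v (\<lambda>x. u (param c x)) (snd c p)\<bar>"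
    using 1[OF u(2), of "dird v (\<lambda>x. w (param c x)) (snd c p)"] 1[OF w(2), of "dird v (\<lambda>x. u (param c x)) (snd c p)"]
    by (subst dird_chart_mult[OF u(1) w(1) c(1)]) (use c in \<open>auto simp: mult.commute[of _ "w p"]\<close>)
  also have "\<dots> \<le> (L + K) * sqrt (ip (h c (snd c p)) v v)"
    using grad_leD[OF u(3) c, of v] grad_leD[OF w(3) c, of v] by (simp add: algebra_simps)
  finally show "\<bar>dird v (\<lambda>x. u (param c x) * w (param c x)) (snd c p)\<bar> \<le> (L + K) * sqrt (ip (h c (snd c p)) v v)" .
qed

lemma grad_le_sum:
  assumes "\<And>i. i \<in> I \<Longrightarrow> smooth (u i)" "\<And>i. i \<in> I \<Longrightarrow> grad_le (u i) p (L i)"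
  shows "grad_le (\<lambda>q. \<Sum>i\<in>I. u i q) p (\<Sum>i\<in>I. L i)"
  unfolding grad_le_def
proof (intro ballI impI allI)
  fix c v assume c: "c \<in> \<B>" "p \<in> fst c"
  have "\<bar>dird v (\<lambda>x. \<Sum>i\<in>I. u i (param c x)) (snd c p)\<bar> = \<bar>\<Sum>i\<in>I. dird v (\<lambda>x. u i (param c x)) (snd c p)\<bar>"
    by (subst dird_chart_sum) (use assms c in auto)
  also have "\<dots> \<le> (\<Sum>i\<in>I. \<bar>dird v (\<lambda>x. u i (param c x)) (snd c p)\<bar>)" by (rule sum_abs)
  also have "\<dots> \<le> (\<Sum>i\<in>I. L i * sqrt (ip (h c (snd c p)) v v))"
    by (intro sum_mono grad_leD assms c)
  finally show "\<bar>dird v (\<lambda>x. \<Sum>i\<in>I. u i (param c x)) (snd c p)\<bar> \<le> (\<Sum>i\<in>I. L i) * sqrt (ip (h c (snd c p)) v v)"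
    by (simp add: sum_distrib_right)
qed

lemma grad_le_cmult:
  assumes "smooth u" "grad_le u p L" shows "grad_le (\<lambda>q. a * u q) p (\<bar>a\<bar> * L)"
proof (rule grad_le_compose[OF assms(1), of "(*) a"])
  have "dird w ((*) a) t = a * w" for w t
    by (rule dird_eqI) (auto intro!: derivative_eq_intros)
  then show "\<bar>dird w ((*) a) (u p)\<bar> \<le> \<bar>a\<bar> * \<bar>w\<bar>" for w by (simp add: abs_mult)
qed (auto intro!: smooth_intros assms)

section \<open>Bumps on ellipsoids\<close>

text \<open>In its uses with a gradient bound, \<open>A\<close> is the metric frozen at a nearby
  point, so that the ellipsoids approximate metric balls. The bump is 1 for squared radius up to
  \<delta>^2 / 2 and 0 from \<delta>^2 on; the squared radius is smooth also at the centre.\<close>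

definition ebump :: "('b, 'n) chart \<Rightarrow> real^'n^'n \<Rightarrow> real^'n \<Rightarrow> real \<Rightarrow> 'b \<Rightarrow> real" where
  "ebump c A a \<delta> p = (if p \<in> fst c
     then smooth_step (2 - (2 / \<delta>\<^sup>2) * ip A (snd c p - a) (snd c p - a)) else 0)"

lemma ebump_range: "0 \<le> ebump c A a \<delta> p" "ebump c A a \<delta> p \<le> 1"
  by (auto simp: ebump_def smooth_step)

lemma ebump_one:
  assumes "p \<in> fst c" "\<delta> > 0" "ip A (snd c p - a) (snd c p - a) \<le> \<delta>\<^sup>2 / 2" shows "ebump c A a \<delta> p = 1"
  using assms by (auto simp: ebump_def divide_simps intro!: smooth_step(3))

lemma ebump_zero:
  assumes "\<delta> > 0" "ip A (snd c p - a) (snd c p - a) \<ge> \<delta>\<^sup>2" shows "ebump c A a \<delta> p = 0"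
  using assms by (auto simp: ebump_def divide_simps intro!: smooth_step(2))

lemma smooth_on_ebump_chart: "smooth_on UNIV (\<lambda>x. smooth_step (2 - (2 / \<delta>\<^sup>2) * ip A (x - a) (x - a)))"
  by (rule smooth_on_compose[OF smooth_step(1)], intro smooth_intros) auto

lemma ebump_smooth:
  assumes "c \<in> \<B>" "posdef A" "\<delta> > 0" and E: "{x. ip A (x - a) (x - a) \<le> \<delta>\<^sup>2} \<subseteq> cdom c"
  shows "smooth (ebump c A a \<delta>)"
  unfolding ebump_def[abs_def]
proof (rule smooth_extend[where K="{x. ip A (x - a) (x - a) \<le> \<delta>\<^sup>2}"])
  show "smooth_on (cdom c) (\<lambda>x. smooth_step (2 - (2 / \<delta>\<^sup>2) * ip A (x - a) (x - a)))"
    by (rule smooth_on_subset[OF smooth_on_ebump_chart]) auto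
  show "compact {x. ip A (x - a) (x - a) \<le> \<delta>\<^sup>2}" by (rule posdef_ellipsoid_compact[OF assms(2)])
qed (use assms in \<open>auto intro!: smooth_step(2) simp: divide_simps\<close>)

lemma ebump_support:
  assumes "c \<in> \<B>" "posdef A" "\<delta> > 0" and E: "{x. ip A (x - a) (x - a) \<le> \<delta>\<^sup>2} \<subseteq> cdom c"
  defines "K \<equiv> param c ` {x. ip A (x - a) (x - a) \<le> \<delta>\<^sup>2}"
  shows "compact K" "closure {p. ebump c A a \<delta> p \<noteq> 0} \<subseteq> K" "K \<subseteq> fst c"
proof -
  show "compact K" unfolding K_def
    by (rule compact_param_image[OF assms(1) posdef_ellipsoid_compact[OF assms(2)] E])
  then have "closed K" by (rule compact_imp_closed)
  moreover have "{p. ebump c A a \<delta> p \<noteq> 0} \<subseteq> K"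
  proof
    fix p assume p: "p \<in> {p. ebump c A a \<delta> p \<noteq> 0}"
    then have "p \<in> fst c" by (auto simp: ebump_def split: if_splits)
    moreover have "ip A (snd c p - a) (snd c p - a) \<le> \<delta>\<^sup>2"
      using p ebump_zero[OF assms(3), of A c p a] by fastforce
    ultimately show "p \<in> K" unfolding K_def using assms(1) by (intro image_eqI[of _ _ "snd c p"]) auto
  qed
  ultimately show "closure {p. ebump c A a \<delta> p \<noteq> 0} \<subseteq> K" by (rule closure_minimal[rotated])
  show "K \<subseteq> fst c" using E assms(1) by (auto simp: K_def)
qed

text \<open>The inner function has a derivative of size 4 / \<delta>^2 times |A(v, x - a)|.
  Cauchy-Schwarz bounds the latter by \<delta> times the \<open>A\<close>-length of
  \<open>v\<close>, which is at most twice its length for \<open>h\<close>; the product gives the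
  constant 8.\<close>

lemma ebump_grad:
  assumes c: "c \<in> \<B>" "posdef A" "\<delta> > 0" and E: "{x. ip A (x - a) (x - a) \<le> \<delta>\<^sup>2} \<subseteq> cdom c"
    and le: "\<And>x v. ip A (x - a) (x - a) \<le> \<delta>\<^sup>2 \<Longrightarrow> ip A v v \<le> 4 * ip (h c x) v v"
  shows "grad_le (ebump c A a \<delta>) p (8 * step_bound / \<delta>)"
proof (cases "p \<in> fst c \<and> ip A (snd c p - a) (snd c p - a) \<le> \<delta>\<^sup>2")
  case False
  then have "ebump c A a \<delta> p = 0" using ebump_zero[OF c(3), of A c p a] by (auto simp: ebump_def)
  then show ?thesis
    using step_bound(1) c by (intro grad_le_extremum ebump_smooth[OF c E]) (auto simp: ebump_range)
next
  case True
  define x where "x = snd c p"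
  have x: "x \<in> cdom c" "ip A (x - a) (x - a) \<le> \<delta>\<^sup>2" using True by (auto simp: x_def)
  define \<phi> where "\<phi> y = 2 - (2 / \<delta>\<^sup>2) * ip A (y - a) (y - a)" for y
  have hd: "((\<lambda>y. ip A (y - a) (y - a)) has_derivative (\<lambda>v. ip 0 (x - a) (x - a) + ip A v (x - a) + ip A (x - a) v)) (at x)"
    by (rule has_derivative_ip) (auto intro!: derivative_eq_intros)
  have "(\<phi> has_derivative (\<lambda>v. 0 - (2 / \<delta>\<^sup>2) * (ip 0 (x - a) (x - a) + ip A v (x - a) + ip A (x - a) v))) (at x)"
    unfolding \<phi>_def by (intro has_derivative_diff has_derivative_const has_derivative_mult_right hd)
  then have d\<phi>: "\<phi> differentiable (at x)" "dird v \<phi> x = - (4 / \<delta>\<^sup>2) * ip A v (x - a)" for v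
    by (auto simp: differentiable_def dird_eqI posdef_commute[OF c(2), of "x - a"] ip_def[of 0])
  show ?thesis
  proof (rule grad_leI_chart[OF ebump_smooth[OF c E] c(1)])
    show "p \<in> fst c" using True by simp
    fix v
    have "dird v (\<lambda>y. ebump c A a \<delta> (param c y)) (snd c p) = dird v (\<lambda>y. smooth_step (\<phi> y)) x"
      unfolding x_def[symmetric]
      by (rule dird_cong[OF chartD(2)[OF c(1)] x(1)]) (simp add: ebump_def c \<phi>_def)
    also have "\<dots> = dird (dird v \<phi> x) smooth_step (\<phi> x)"
      by (rule dird_compose[OF d\<phi>(1)]) (rule smooth_onD_differentiable[OF smooth_step(1)], simp)
    also have "\<bar>\<dots>\<bar> \<le> step_bound * \<bar>dird v \<phi> x\<bar>" by (rule step_bound)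
    also have "\<bar>dird v \<phi> x\<bar> = (4 / \<delta>\<^sup>2) * \<bar>ip A v (x - a)\<bar>" by (simp add: d\<phi> abs_mult)
    also have "step_bound * \<dots> \<le> step_bound * ((4 / \<delta>\<^sup>2) * ((2 * sqrt (ip (h c x) v v)) * \<delta>))"
    proof (intro mult_left_mono)
      have "\<bar>ip A v (x - a)\<bar> \<le> sqrt (ip A v v) * sqrt (ip A (x - a) (x - a))"
        by (rule posdef_Cauchy_Schwarz[OF c(2)])
      also have "\<dots> \<le> (2 * sqrt (ip (h c x) v v)) * \<delta>"
      proof (rule mult_mono)
        have "sqrt (ip A v v) \<le> sqrt (4 * ip (h c x) v v)" using le[OF x(2)] by simp
        then show "sqrt (ip A v v) \<le> 2 * sqrt (ip (h c x) v v)" by (simp add: real_sqrt_mult)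
        show "sqrt (ip A (x - a) (x - a)) \<le> \<delta>" using x(2) c(3) by (simp add: real_le_lsqrt)
      qed (use posdef_nonneg[OF posdef_h[OF c(1) x(1)]] posdef_nonneg[OF c(2)] in auto)
      finally show "\<bar>ip A v (x - a)\<bar> \<le> (2 * sqrt (ip (h c x) v v)) * \<delta>" .
    qed (use step_bound c in auto)
    also have "\<dots> = 8 * step_bound / \<delta> * sqrt (ip (h c x) v v)"
      using c by (simp add: field_simps power2_eq_square)
    finally show "\<bar>dird v (\<lambda>y. ebump c A a \<delta> (param c y)) (snd c p)\<bar> \<le> 8 * step_bound / \<delta> * sqrt (ip (h c (snd c p)) v v)"
      by (simp add: x_def)
  qed
qed

end

context rmanifold
begin

lemma smooth_ln: "smooth u \<Longrightarrow> (\<And>p. u p > 0) \<Longrightarrow> smooth (\<lambda>p. ln (u p))"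
  by (simp add: smooth_iff smooth_on_ln chartD)
lemma smooth_exp: "smooth u \<Longrightarrow> smooth (\<lambda>p. exp (u p))"
  by (simp add: smooth_iff smooth_on_exp chartD)

text \<open>The gradient of log-sum-exp is a convex combination of the gradients, so the bound on the
  gradient does not depend on the number of functions.\<close>
lemma smooth_maximum:
  fixes b :: "'i \<Rightarrow> 'b \<Rightarrow> real"
  assumes fin: "finite Z" "Z \<noteq> {}" and b: "\<And>z. z \<in> Z \<Longrightarrow> smooth (b z)"
    and range: "\<And>z p. z \<in> Z \<Longrightarrow> 0 \<le> b z p \<and> b z p \<le> 1"
    and grad: "\<And>z p. z \<in> Z \<Longrightarrow> grad_le (b z) p L" and L: "L \<ge> 0"
  shows "\<exists>w. smooth w \<and> (\<forall>p. 0 \<le> w p \<and> w p \<le> 1) \<and> (\<forall>p. (\<exists>z\<in>Z. b z p = 1) \<longrightarrow> w p = 1)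
    \<and> (\<forall>p. (\<forall>z\<in>Z. b z p = 0) \<longrightarrow> w p = 0) \<and> (\<forall>p. grad_le w p (2 * step_bound * L))"
proof -
  \<comment> \<open>At a point where all functions vanish, l = ln (card Z) / \<beta> has to be at
    most 1/4; the summand 1 keeps \<beta> positive for a singleton.\<close>
  define \<beta> where "\<beta> = 4 * ln (card Z) + 1"
  have N: "card Z \<ge> 1" using fin by (simp add: Suc_le_eq card_gt_0_iff)
  have \<beta>: "\<beta> > 0" using N by (simp add: \<beta>_def add_nonneg_pos)
  define s where "s p = (\<Sum>z\<in>Z. exp (\<beta> * b z p))" for p
  define l where "l p = (1 / \<beta>) * ln (s p)" for p
  \<comment> \<open>Sends l <= 1/4 to 0 and l >= 1 to 1, because the argument is then at most 0 or
    at least 3/2.\<close>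
  define w where "w p = smooth_step (2 * l p - 1 / 2)" for p
  have s: "s p > 0" for p unfolding s_def using fin by (intro sum_pos) auto
  have sm_s: "smooth s" unfolding s_def[abs_def] by (intro smooth_sum smooth_exp smooth_mult smooth_const b)
  have sm_l: "smooth l" unfolding l_def[abs_def] by (intro smooth_mult smooth_const smooth_ln sm_s s)
  have sm2: "smooth (\<lambda>p. 2 * l p)" by (intro smooth_mult smooth_const sm_l)
  have sm_w: "smooth w" unfolding w_def[abs_def]
    by (rule smooth_real_compose[OF smooth_step(1)]) (intro smooth_diff smooth_const sm2)
  have one: "w p = 1" if "z \<in> Z" "b z p = 1" for p z
  proof -
    have "exp \<beta> \<le> s p" unfolding s_def
      using member_le_sum[of z Z "\<lambda>z. exp (\<beta> * b z p)"] that fin by simp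
    then have "\<beta> \<le> ln (s p)" using s ln_ge_iff by blast
    then have "l p \<ge> 1" using \<beta> by (simp add: l_def field_simps)
    then show ?thesis by (simp add: w_def smooth_step)
  qed
  have zero: "w p = 0" if "\<And>z. z \<in> Z \<Longrightarrow> b z p = 0" for p
  proof -
    have "s p = card Z" using that by (simp add: s_def)
    then have "l p \<le> 1 / 4" using \<beta> by (simp add: l_def \<beta>_def field_simps)
    then show ?thesis by (simp add: w_def smooth_step)
  qed
  have "grad_le l p L" for p
    unfolding grad_le_def
  proof (intro ballI impI allI)
    fix c v assume c: "c \<in> \<B>" "p \<in> fst c"
    define x where "x = snd c p"
    have x: "x \<in> cdom c" "param c x = p" using c by (auto simp: x_def)
    define R where "R = L * sqrt (ip (h c x) v v)"
    have "((\<lambda>y. s (param c y)) has_derivative (\<lambda>v. \<Sum>z\<in>Z. exp (\<beta> * b z p) * (\<beta> * dird v (\<lambda>y. b z (param c y)) x))) (at x)"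
      unfolding s_def
    proof (rule has_derivative_sum)
      fix z assume z: "z \<in> Z"
      have "((\<lambda>y. \<beta> * b z (param c y)) has_derivative (\<lambda>v. \<beta> * dird v (\<lambda>y. b z (param c y)) x)) (at x)"
        by (intro has_derivative_mult_right has_derivative_dird diff_chart b c x z)
      from has_derivative_exp[OF this] show "((\<lambda>y. exp (\<beta> * b z (param c y))) has_derivative
          (\<lambda>v. exp (\<beta> * b z p) * (\<beta> * dird v (\<lambda>y. b z (param c y)) x))) (at x)"
        by (simp add: x mult_ac)
    qed
    from has_derivative_mult_right[OF has_derivative_ln[OF _ this], of "1 / \<beta>"]
    have "((\<lambda>y. l (param c y)) has_derivative
       (\<lambda>v. (1 / \<beta>) * ((\<Sum>z\<in>Z. exp (\<beta> * b z p) * (\<beta> * dird v (\<lambda>y. b z (param c y)) x)) * inverse (s p)))) (at x)"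
      using s by (simp add: l_def x)
    from dird_eqI[OF this, of v]
    have "dird v (\<lambda>y. l (param c y)) x = (\<Sum>z\<in>Z. exp (\<beta> * b z p) * dird v (\<lambda>y. b z (param c y)) x) / s p"
    proof -
      have "(\<Sum>z\<in>Z. exp (\<beta> * b z p) * (\<beta> * dird v (\<lambda>y. b z (param c y)) x))
        = \<beta> * (\<Sum>z\<in>Z. exp (\<beta> * b z p) * dird v (\<lambda>y. b z (param c y)) x)"
        by (simp add: sum_distrib_left mult_ac)
      with \<open>dird v (\<lambda>y. l (param c y)) x = _\<close> show ?thesis using \<beta> by (simp add: divide_inverse)
    qed
    also have "\<bar>\<dots>\<bar> = \<bar>\<Sum>z\<in>Z. exp (\<beta> * b z p) * dird v (\<lambda>y. b z (param c y)) x\<bar> / s p"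
      using s[of p] by simp
    also have "\<dots> \<le> (\<Sum>z\<in>Z. \<bar>exp (\<beta> * b z p) * dird v (\<lambda>y. b z (param c y)) x\<bar>) / s p"
      using s[of p] by (intro divide_right_mono sum_abs) simp
    also have "\<dots> \<le> (\<Sum>z\<in>Z. exp (\<beta> * b z p) * R) / s p"
      using s[of p] grad_leD[OF grad c, of _ v]
      by (intro divide_right_mono sum_mono) (auto simp: abs_mult R_def x_def)
    also have "\<dots> = R" using s[of p] by (simp add: s_def sum_distrib_right[symmetric])
    finally show "\<bar>dird v (\<lambda>y. l (param c y)) (snd c p)\<bar> \<le> L * sqrt (ip (h c (snd c p)) v v)"
      by (simp add: R_def x_def)
  qed
  then have "grad_le (\<lambda>p. 2 * l p) p (2 * L)" for p
    using grad_le_cmult[OF sm_l, of p L 2] by simp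
  then have "grad_le w p (step_bound * (2 * L))" for p
  proof -
    define \<theta> where "\<theta> t = smooth_step (t - 1 / 2)" for t
    have sh: "smooth_on UNIV \<theta>" unfolding \<theta>_def
      by (rule smooth_on_compose[OF smooth_step(1)], intro smooth_intros) auto
    have "dird v \<theta> t = dird v smooth_step (t - 1 / 2)" for v t
    proof -
      have "dird v (\<lambda>t. t - 1 / 2 :: real) t = v"
        by (rule dird_eqI) (auto intro!: derivative_eq_intros)
      then show ?thesis unfolding \<theta>_def
        using dird_compose[of "\<lambda>t. t - 1 / 2 :: real" t smooth_step v] smooth_onD_differentiable[OF smooth_step(1)]
        by (simp add: field_differentiable_imp_differentiable)
    qed
    then show ?thesis
      using grad_le_compose[OF sm2 sh _ _ \<open>grad_le (\<lambda>p. 2 * l p) p (2 * L)\<close>, of step_bound] step_bound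
      by (simp add: \<theta>_def w_def[abs_def])
  qed
  then have "\<forall>p. grad_le w p (2 * step_bound * L)" by (simp add: mult_ac)
  moreover have "\<forall>p. 0 \<le> w p \<and> w p \<le> 1" by (simp add: w_def smooth_step)
  ultimately show ?thesis using sm_w one zero by blast
qed

text \<open>An ellipsoidal bump for the identity matrix, that is, on a Euclidean ball inside the
  image of \<open>W\<close>.\<close>

lemma bump_exists:
  assumes W: "open W" "p \<in> W" and c: "c \<in> \<B>" "p \<in> fst c"
  obtains b K where "smooth b" "\<And>q. 0 \<le> b q" "\<And>q. b q \<le> 1" "b p = 1"
    "compact K" "closure {q. b q \<noteq> 0} \<subseteq> K" "K \<subseteq> W \<inter> fst c"
proof -
  define T where "T = snd c ` (W \<inter> fst c)"
  have "open T" unfolding T_def by (rule open_snd_image[OF c(1)]) (use W chartD[OF c(1)] in auto)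
  moreover have "snd c p \<in> T" using W c by (auto simp: T_def)
  ultimately obtain e where e: "e > 0" "cball (snd c p) e \<subseteq> T" using open_contains_cball by blast
  have pd: "posdef (mat 1 :: real^'n^'n)"
    by (simp add: posdef_def ip_def transpose_mat)
  have eq: "{x. ip (mat 1) (x - snd c p) (x - snd c p) \<le> e\<^sup>2} = cball (snd c p) e"
  proof -
    have "(x - snd c p) \<bullet> (x - snd c p) \<le> e\<^sup>2 \<longleftrightarrow> dist (snd c p) x \<le> e" for x
      using e(1) by (simp add: dist_norm norm_minus_commute flip: power2_norm_eq_inner)
    then show ?thesis unfolding cball_def ip_def matrix_vector_mul_lid by blast
  qed
  have E: "{x. ip (mat 1) (x - snd c p) (x - snd c p) \<le> e\<^sup>2} \<subseteq> cdom c"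
    unfolding eq using e(2) by (auto simp: T_def)
  show ?thesis
  proof (rule that[OF ebump_smooth[OF c(1) pd e(1) E] ebump_range _ ebump_support(1,2)[OF c(1) pd e(1) E]])
    show "ebump c (mat 1) (snd c p) e p = 1"
      by (rule ebump_one) (use c e in \<open>auto simp: ip_simps\<close>)
    show "param c ` {x. ip (mat 1) (x - snd c p) (x - snd c p) \<le> e\<^sup>2} \<subseteq> W \<inter> fst c"
      unfolding eq using e(2) c(1) by (auto simp: T_def)
  qed
qed

section \<open>Decomposition into functions supported in charts\<close>

definition chart_supported :: "('b \<Rightarrow> real) \<Rightarrow> ('b, 'n) chart \<Rightarrow> bool" where
  "chart_supported u c \<longleftrightarrow> c \<in> \<B> \<and> compact (closure {p. u p \<noteq> 0}) \<and> closure {p. u p \<noteq> 0} \<subseteq> fst c"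

text \<open>A partition of unity on the support of \<open>v\<close>: finitely many bumps with sum
  \<open>s\<close>, positive on the support, are multiplied by \<open>v / s\<close>.\<close>

lemma smooth_compact_decomposition:
  assumes v: "smooth v" "compact (closure {p. v p \<noteq> 0})"
  obtains I :: "'b set" and w c where "finite I" "\<And>i. i \<in> I \<Longrightarrow> smooth (w i)"
    "\<And>i. i \<in> I \<Longrightarrow> chart_supported (w i) (c i)" "\<And>p. v p = (\<Sum>i\<in>I. w i p)"
proof -
  define K where "K = closure {p. v p \<noteq> 0}"
  have "\<exists>b c. smooth b \<and> (\<forall>q. 0 \<le> b q) \<and> b p = 1 \<and> chart_supported b c" for p
  proof -
    obtain b :: "'b \<Rightarrow> real" and K where b: "smooth b" "\<And>q. 0 \<le> b q" "\<And>q. b q \<le> 1" "b p = 1" "compact K"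
      "closure {q. b q \<noteq> 0} \<subseteq> K" "K \<subseteq> UNIV \<inter> fst (chart_at \<B> p)"
      using bump_exists[OF open_UNIV UNIV_I chart_at[of p]] by blast
    have "compact (closure {q. b q \<noteq> 0})"
      using compact_Int_closed[OF b(5) closed_closure, of "{q. b q \<noteq> 0}"] b(6) by (simp add: Int_absorb1)
    then have "chart_supported b (chart_at \<B> p)" using b(6,7) chart_at by (auto simp: chart_supported_def)
    then show ?thesis using b(1,2,4) by blast
  qed
  then have "\<forall>p. \<exists>bc. smooth (fst bc) \<and> (\<forall>q. 0 \<le> fst bc q) \<and> fst bc p = 1 \<and> chart_supported (fst bc) (snd bc)"
    by simp
  from choice[OF this] obtain bc where bc:
    "\<forall>p. smooth (fst (bc p)) \<and> (\<forall>q. 0 \<le> fst (bc p) q) \<and> fst (bc p) p = 1 \<and> chart_supported (fst (bc p)) (snd (bc p))" ..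
  define b where "b p = fst (bc p)" for p
  define c where "c p = snd (bc p)" for p
  have b: "smooth (b p)" "0 \<le> b p q" "b p p = 1" "chart_supported (b p) (c p)" for p q
    using bc by (auto simp: b_def c_def)
  define O' where "O' p = {q. b p q > 0}" for p
  have oO: "open (O' p)" for p
    unfolding O'_def by (intro open_Collect_less continuous_on_const smooth_continuous b)
  have cov: "K \<subseteq> (\<Union>p\<in>K. O' p)"
  proof
    fix q assume "q \<in> K" then show "q \<in> (\<Union>p\<in>K. O' p)" by (intro UN_I[of q]) (simp_all add: O'_def b)
  qed
  obtain I where I: "I \<subseteq> K" "finite I" "K \<subseteq> (\<Union>p\<in>I. O' p)"
    by (rule compactE_image[OF v(2)[folded K_def] oO cov])
  define s where "s q = (\<Sum>p\<in>I. b p q)" for q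
  have s: "s q > 0" if q: "q \<in> (\<Union>p\<in>I. O' p)" for q
  proof -
    obtain p where p: "p \<in> I" "b p q > 0" using q by (auto simp: O'_def)
    have "b p q \<le> s q" unfolding s_def using I(2) p b(2) by (intro member_le_sum) auto
    then show ?thesis using p by linarith
  qed
  have sm_s: "smooth s" unfolding s_def[abs_def] by (intro smooth_sum b)
  \<comment> \<open>Off \<open>K\<close> the numerator is 0, hence so is the quotient, even where
    \<open>s\<close> vanishes. Near \<open>K\<close> the sum \<open>s\<close> is positive, and these
    two open sets cover every chart.\<close>
  define v' where "v' q = v q / s q" for q
  have v0: "v q = 0" if "q \<notin> K" for q using that closure_subset[of "{p. v p \<noteq> 0}"] by (auto simp: K_def)
  have "smooth_on (cdom d) (\<lambda>x. v' (param d x))" if d: "d \<in> \<B>" for d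
  proof -
    define T1 where "T1 = snd d ` (fst d \<inter> (\<Union>p\<in>I. O' p))"
    define T2 where "T2 = snd d ` (fst d - K)"
    have o1: "open T1" unfolding T1_def using oO chartD[OF d] by (intro open_snd_image[OF d]) auto
    have o2: "open T2" unfolding T2_def K_def using chartD[OF d] by (intro open_snd_image[OF d]) auto
    have 1: "smooth_on T1 (\<lambda>x. v' (param d x))" unfolding v'_def
    proof (rule smooth_on_divide[OF _ _ o1])
      show "smooth_on T1 (\<lambda>x. v (param d x))" "smooth_on T1 (\<lambda>x. s (param d x))"
        by (rule smooth_on_subset[OF smoothD[OF v(1) d]] smooth_on_subset[OF smoothD[OF sm_s d]], auto simp: T1_def)+
      show "s (param d x) > 0" if "x \<in> T1" for x using that d by (auto simp: T1_def intro!: s)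
    qed
    have e: "v' (param d x) = 0" if x: "x \<in> T2" for x
    proof -
      obtain q where q: "x = snd d q" "q \<in> fst d" "q \<notin> K" using x unfolding T2_def by blast
      show ?thesis by (simp add: v'_def q d v0)
    qed
    have 2: "smooth_on T2 (\<lambda>x. v' (param d x))"
      by (rule smooth_on_cong[THEN iffD2, OF o2 e smooth_on_const])
    have "cdom d \<subseteq> T1 \<union> T2" using I(3) unfolding T1_def T2_def cdom_def by blast
    then show ?thesis by (rule smooth_on_subset[OF smooth_on_Un[OF o1 o2 1 2]])
  qed
  then have sm: "smooth v'" unfolding smooth_iff by blast
  show ?thesis
  proof (rule that[of I "\<lambda>p q. v' q * b p q" c])
    show "finite I" by (rule I(2))
    show "smooth (\<lambda>q. v' q * b p q)" for p by (intro smooth_mult sm b)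
    show "chart_supported (\<lambda>q. v' q * b p q) (c p)" for p
    proof -
      have sub: "closure {q. v' q * b p q \<noteq> 0} \<subseteq> closure {q. b p q \<noteq> 0}" by (rule closure_mono) auto
      then have "compact (closure {q. v' q * b p q \<noteq> 0})"
        using compact_Int_closed[OF _ closed_closure, of "closure {q. b p q \<noteq> 0}" "{q. v' q * b p q \<noteq> 0}"] b(4)[of p]
        by (simp add: chart_supported_def Int_absorb1)
      then show ?thesis using b(4)[of p] sub by (auto simp: chart_supported_def)
    qed
    show "v p = (\<Sum>i\<in>I. v' p * b i p)" for p
    proof (cases "p \<in> K")
      case True
      then have "s p > 0" using I(3) s by blast
      moreover have "(\<Sum>i\<in>I. v' p * b i p) = v' p * s p" by (simp only: s_def sum_distrib_left)
      ultimately show ?thesis by (simp add: v'_def)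
    qed (simp add: v0 v'_def)
  qed
qed

section \<open>Compact domains\<close>

lemma connected_neighbourhood:
  fixes p :: 'b
  obtains W where "open W" "connected W" "compact (closure W)" "p \<in> W"
proof -
  define c where "c = chart_at \<B> p"
  have c: "c \<in> \<B>" "p \<in> fst c" using chart_at by (auto simp: c_def)
  obtain e where e: "e > 0" "cball (snd c p) e \<subseteq> cdom c"
    using open_contains_cball[THEN iffD1, OF chartD(2)[OF c(1)], rule_format, OF snd_in[OF c(2)]] by auto
  define W where "W = param c ` ball (snd c p) e"
  have b: "ball (snd c p) e \<subseteq> cdom c" using e by auto
  have comp: "compact (param c ` cball (snd c p) e)" by (rule compact_param_image[OF c(1) compact_cball e(2)])
  have "closure W \<subseteq> param c ` cball (snd c p) e"
    by (rule closure_minimal[OF _ compact_imp_closed[OF comp]]) (auto simp: W_def)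
  then have "compact (closure W)"
    using compact_Int_closed[OF comp closed_closure, of W] by (simp add: Int_absorb1)
  moreover have "open W" unfolding W_def by (rule open_param_image[OF c(1) open_ball b])
  moreover have "connected W" unfolding W_def
    by (rule connected_continuous_image[OF continuous_on_subset[OF chart_cont(2)[OF c(1)] b]]) simp
  moreover have "p \<in> W" unfolding W_def using c e by (intro image_eqI[of _ _ "snd c p"]) auto
  ultimately show ?thesis using that by blast
qed

text \<open>The points \<open>q\<close> with such a set \<open>W\<close> form an open set. It is
  also closed, because the union of two overlapping sets of this kind is again of this kind;
  connectedness of the manifold finishes the argument.\<close>

lemma connected_relatively_compact_pair:
  fixes p q :: 'b
  shows "\<exists>W. open W \<and> connected W \<and> compact (closure W) \<and> p \<in> W \<and> q \<in> W"
proof -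
  define R where "R = {q. \<exists>W. open W \<and> connected W \<and> compact (closure W) \<and> p \<in> W \<and> q \<in> W}"
  have "open R"
  proof (subst open_subopen, rule ballI)
    fix q assume "q \<in> R"
    then obtain W where W: "open W" "connected W" "compact (closure W)" "p \<in> W" "q \<in> W" by (auto simp: R_def)
    then have "W \<subseteq> R" by (auto simp: R_def)
    then show "\<exists>T. open T \<and> q \<in> T \<and> T \<subseteq> R" using W by blast
  qed
  moreover have "closed R" unfolding closed_def
  proof (subst open_subopen, rule ballI)
    fix q assume q: "q \<in> - R"
    obtain W where W: "open W" "connected W" "compact (closure W)" "q \<in> W" by (rule connected_neighbourhood)
    have "W \<subseteq> - R"
    proof (rule ccontr)
      assume "\<not> W \<subseteq> - R"
      then obtain r V where V: "r \<in> W" "open V" "connected V" "compact (closure V)" "p \<in> V" "r \<in> V"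
        by (auto simp: R_def)
      have "connected (V \<union> W)" by (rule connected_Un) (use V W in auto)
      moreover have "compact (closure (V \<union> W))" using V W by (simp add: closure_Un compact_Un)
      ultimately have "q \<in> R" unfolding R_def using V W by blast
      with q show False by simp
    qed
    then show "\<exists>T. open T \<and> q \<in> T \<and> T \<subseteq> - R" using W by blast
  qed
  moreover have "p \<in> R"
  proof -
    obtain W where "open W" "connected W" "compact (closure W)" "p \<in> W" by (rule connected_neighbourhood)
    then show ?thesis unfolding R_def by blast
  qed
  ultimately have "R = UNIV" using connected_M connected_clopen[of UNIV]
    by (metis Int_UNIV_right closed_closedin empty_iff open_openin subtopology_UNIV)
  then have "q \<in> R" by blast
  then show ?thesis unfolding R_def by blast
qed

text \<open>The sets \<open>W q\<close> all contain the point \<open>o'\<close>, so finite unions of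
  them are connected and relatively compact. The closure of such a union is a compact domain, since
  its interior lies between a connected set and the closure of that set.\<close>

lemma compact_domain_exists:
  fixes K :: "'b set"
  assumes K: "compact K" obtains \<Omega> where "compact_domain \<Omega>" "K \<subseteq> interior \<Omega>"
proof -
  fix o' :: 'b
  obtain W where W: "\<And>q. open (W q)" "\<And>q. connected (W q)" "\<And>q. compact (closure (W q))"
     "\<And>q. o' \<in> W q" "\<And>q. q \<in> W q"
    using connected_relatively_compact_pair[of o'] by metis
  obtain I where I: "I \<subseteq> K" "finite I" "K \<subseteq> (\<Union>q\<in>I. W q)"
    by (rule compactE_image[OF K, of K W]) (use W(1,5) in blast)+
  define V where "V = (\<Union>q\<in>insert o' I. W q)"
  have oV: "open V" unfolding V_def using W by auto
  have "o' \<in> \<Inter> (W ` insert o' I)" using W(4) by blast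
  then have "connected V" unfolding V_def by (intro connected_Union) (use W(2) in blast)+
  have "closure V \<subseteq> (\<Union>q\<in>insert o' I. closure (W q))"
    unfolding V_def
  proof (rule closure_minimal)
    show "(\<Union>q\<in>insert o' I. W q) \<subseteq> (\<Union>q\<in>insert o' I. closure (W q))"
      by (intro UN_mono order_refl closure_subset)
    show "closed (\<Union>q\<in>insert o' I. closure (W q))" using I(2) by (intro closed_UN) auto
  qed
  moreover have "compact (\<Union>q\<in>insert o' I. closure (W q))" using I(2) W by (intro compact_UN) auto
  ultimately have cV: "compact (closure V)"
    using compact_Int_closed[OF _ closed_closure, of "\<Union>q\<in>insert o' I. closure (W q)" V] by (simp add: Int_absorb1)
  have sub: "V \<subseteq> interior (closure V)" by (rule interior_maximal[OF closure_subset oV])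
  have "connected (interior (closure V))"
    by (rule connected_intermediate_closure[OF \<open>connected V\<close> sub interior_subset])
  moreover have "closure (interior (closure V)) = closure V"
    using closure_mono[OF sub] closure_minimal[OF interior_subset closed_closure, of V] by auto
  moreover have "interior (closure V) \<noteq> {}" using sub \<open>o' \<in> \<Inter> (W ` insert o' I)\<close> unfolding V_def by blast
  ultimately have "compact_domain (closure V)" using cV by (simp add: compact_domain_def)
  moreover have "K \<subseteq> interior (closure V)" using I sub by (auto simp: V_def)
  ultimately show ?thesis by (rule that)
qed

section \<open>Inner products of gradients\<close>

definition gip :: "('b \<Rightarrow> real) \<Rightarrow> ('b \<Rightarrow> real) \<Rightarrow> 'b \<Rightarrow> real" where
  "gip u w p = (let c = chart_at \<B> p; x = snd c p in
     ip (h c x) (grad (h c) (\<lambda>x. u (param c x)) x) (grad (h c) (\<lambda>x. w (param c x)) x))"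

lemma ip_grad:
  assumes "c \<in> \<B>" "x \<in> cdom c" "F differentiable (at x)"
  shows "ip (h c x) (grad (h c) F x) v = dird v F x"
proof -
  note pd = posdef_h[OF assms(1,2)]
  have "ip (h c x) (grad (h c) F x) v = ip (h c x) v (grad (h c) F x)" by (rule posdef_commute[OF pd])
  also have "\<dots> = v \<bullet> (\<chi> i. pd i F x)"
    by (simp add: ip_def grad_def matrix_vector_mul_assoc matrix_inv_both[OF posdef_det_nz[OF pd]])
  also have "\<dots> = dird v F x" by (simp add: inner_vec_def dird_expand[OF assms(3)])
  finally show ?thesis .
qed

text \<open>The chart change carries gradients to gradients, since both represent the same
  differential and the metric is nondegenerate.\<close>

lemma gip_chart:
  assumes u: "smooth u" and w: "smooth w" and c: "c \<in> \<B>" "p \<in> fst c"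
  shows "gip u w p = ip (h c (snd c p)) (grad (h c) (\<lambda>x. u (param c x)) (snd c p)) (grad (h c) (\<lambda>x. w (param c x)) (snd c p))"
proof -
  define c' where "c' = chart_at \<B> p"
  have c': "c' \<in> \<B>" "p \<in> fst c'" using chart_at by (auto simp: c'_def)
  define x where "x = snd c p"
  define x' where "x' = snd c' p"
  interpret coord_isometry "overlap c c'" "cdom c'" "h c" "h c'" "transition c c'"
    by (rule coord_isometry_transition[OF c(1) c'(1)])
  have x: "x \<in> overlap c c'" "x \<in> cdom c" "transition c c' x = x'" "x' \<in> cdom c'"
    using c c' by (auto simp: x_def x'_def overlap_snd)
  have push: "dird (grad (h c) (\<lambda>x. u (param c x)) x) (transition c c') x = grad (h c') (\<lambda>x. u (param c' x)) x'"
    if "smooth u" for u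
  proof (rule posdef_eqI[OF posdef_h[OF c'(1) x(4)]])
    fix z'
    obtain z where z: "z' = dird z (transition c c') x" using surj[OF x(1)] by (metis surjD)
    have "ip (h c' x') (dird (grad (h c) (\<lambda>x. u (param c x)) x) (transition c c') x) z'
      = ip (h c x) (grad (h c) (\<lambda>x. u (param c x)) x) z" using pull[OF x(1)] x by (simp add: z)
    also have "\<dots> = dird z (\<lambda>x. u (param c x)) x" by (rule ip_grad[OF c(1) x(2) diff_chart[OF that c(1) x(2)]])
    also have "\<dots> = dird z' (\<lambda>x. u (param c' x)) x'"
      using dird_transition[OF that c(1) c'(1) x(1)] x by (simp add: z)
    also have "\<dots> = ip (h c' x') (grad (h c') (\<lambda>x. u (param c' x)) x') z'"
      by (rule ip_grad[OF c'(1) x(4) diff_chart[OF that c'(1) x(4)], symmetric])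
    finally show "ip (h c' x') (dird (grad (h c) (\<lambda>x. u (param c x)) x) (transition c c') x) z'
      = ip (h c' x') (grad (h c') (\<lambda>x. u (param c' x)) x') z'" .
  qed
  have "gip u w p = ip (h c' x') (grad (h c') (\<lambda>x. u (param c' x)) x') (grad (h c') (\<lambda>x. w (param c' x)) x')"
    by (simp add: gip_def c'_def x'_def Let_def)
  also have "\<dots> = ip (h c x) (grad (h c) (\<lambda>x. u (param c x)) x) (grad (h c) (\<lambda>x. w (param c x)) x)"
    unfolding push[OF u, symmetric] push[OF w, symmetric] using pull[OF x(1)] x(3) by simp
  finally show ?thesis by (simp add: x_def)
qed

lemma gip_dird:
  assumes "smooth u" "smooth w" "c \<in> \<B>" "p \<in> fst c"
  shows "gip u w p = dird (grad (h c) (\<lambda>x. w (param c x)) (snd c p)) (\<lambda>x. u (param c x)) (snd c p)"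
  unfolding gip_chart[OF assms] by (rule ip_grad) (intro diff_chart assms snd_in)+

lemma gip_commute: "gip u w p = gip w u p"
  unfolding gip_def Let_def by (rule posdef_commute) (intro posdef_h chart_at snd_in)

lemma gip_nonneg: "gip u u p \<ge> 0"
  unfolding gip_def Let_def by (rule posdef_nonneg) (intro posdef_h chart_at snd_in)

text \<open>The bound is applied in the direction of the gradient itself, where it reads |grad u|^2
  <= L |grad u|.\<close>

lemma gip_le:
  assumes u: "smooth u" and g: "grad_le u p L" and L: "L \<ge> 0"
  shows "gip u u p \<le> L\<^sup>2"
proof -
  define c where "c = chart_at \<B> p"
  have c: "c \<in> \<B>" "p \<in> fst c" using chart_at by (auto simp: c_def)
  have "gip u u p \<le> L * sqrt (gip u u p)"
    using grad_leD[OF g c, of "grad (h c) (\<lambda>x. u (param c x)) (snd c p)"]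
    unfolding gip_dird[OF u u c, symmetric] gip_chart[OF u u c, symmetric] by simp
  then have *: "sqrt (gip u u p) * sqrt (gip u u p) \<le> L * sqrt (gip u u p)"
    using gip_nonneg[of u p] by simp
  have "sqrt (gip u u p) \<le> L"
  proof (cases "gip u u p = 0")
    case False
    then have "sqrt (gip u u p) > 0" using gip_nonneg[of u p] by simp
    then show ?thesis using * by (rule mult_right_le_imp_le[rotated])
  qed (use L in simp)
  then show ?thesis using gip_nonneg[of u p] by (simp add: sqrt_le_D)
qed

lemma gip_sum_left:
  assumes "\<And>i. i \<in> I \<Longrightarrow> smooth (u i)" "smooth w"
  shows "gip (\<lambda>p. \<Sum>i\<in>I. u i p) w p = (\<Sum>i\<in>I. gip (u i) w p)"
proof -
  define c where "c = chart_at \<B> p"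
  have c: "c \<in> \<B>" "p \<in> fst c" using chart_at by (auto simp: c_def)
  have "(\<Sum>i\<in>I. gip (u i) w p) = (\<Sum>i\<in>I. dird (grad (h c) (\<lambda>x. w (param c x)) (snd c p)) (\<lambda>x. u i (param c x)) (snd c p))"
    by (intro sum.cong refl gip_dird assms c)
  then show ?thesis
    by (subst gip_dird[OF smooth_sum[OF assms(1)] assms(2) c]) (simp_all add: dird_chart_sum assms c)
qed

lemma continuous_gip: assumes "smooth u" "smooth w" shows "continuous_on UNIV (gip u w)"
proof -
  have "continuous (at p) (gip u w)" for p
  proof -
    define c where "c = chart_at \<B> p"
    have c: "c \<in> \<B>" "p \<in> fst c" using chart_at by (auto simp: c_def)
    have g: "smooth_on (cdom c) (grad (h c) (\<lambda>x. w (param c x)))" if "smooth w" for w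
      unfolding grad_def[abs_def]
      by (intro smooth_intros smooth_on_vec smooth_on_pd smoothD[OF that c(1)] chartD(2)[OF c(1)]
          metric_onD(2)[OF metric_on_chart[OF c(1)]] posdef_det posdef_h[OF c(1)])
    have "smooth_on (cdom c) (\<lambda>x. ip (h c x) (grad (h c) (\<lambda>x. u (param c x)) x) (grad (h c) (\<lambda>x. w (param c x)) x))"
      by (intro smooth_intros g assms chartD(2)[OF c(1)] metric_onD(2)[OF metric_on_chart[OF c(1)]])
    from continuous_on_compose2[OF smooth_on_continuous[OF this] chart_cont(1)[OF c(1)]]
    have "continuous_on (fst c) (\<lambda>p. ip (h c (snd c p)) (grad (h c) (\<lambda>x. u (param c x)) (snd c p)) (grad (h c) (\<lambda>x. w (param c x)) (snd c p)))"
      by (simp add: cdom_def)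
    then have "continuous_on (fst c) (gip u w)"
      by (rule continuous_on_eq) (simp add: gip_chart[OF assms c(1)])
    then show ?thesis using c chartD(1)[OF c(1)] by (simp add: continuous_on_eq_continuous_at)
  qed
  then show ?thesis by (simp add: continuous_at_imp_continuous_on)
qed

end

section \<open>Riemannian volume\<close>

text \<open>The library proves the change of variables formula only for vectors whose index type is
  well-ordered. An order is chosen on a copy of the index type.\<close>
typedef (overloaded) ('a::finite) windex = "UNIV :: 'a set" ..

instance windex :: (finite) finite
proof
  have "(UNIV :: 'a windex set) = range Abs_windex" by (metis Rep_windex_inverse surj_def)
  then show "finite (UNIV :: 'a windex set)" by (metis finite finite_imageI)
qed

instantiation windex :: (finite) wellorder
begin
definition less_eq_windex :: "'a windex \<Rightarrow> 'a windex \<Rightarrow> bool" where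
  "less_eq_windex x y \<longleftrightarrow> to_nat (Rep_windex x) \<le> to_nat (Rep_windex y)"
definition less_windex :: "'a windex \<Rightarrow> 'a windex \<Rightarrow> bool" where
  "less_windex x y \<longleftrightarrow> to_nat (Rep_windex x) < to_nat (Rep_windex y)"
instance
proof
  fix P :: "'a windex \<Rightarrow> bool" and a
  assume step: "\<And>x. (\<And>y. y < x \<Longrightarrow> P y) \<Longrightarrow> P x"
  show "P a"
    by (induction a rule: measure_induct_rule[of "\<lambda>x. to_nat (Rep_windex x)"])
       (auto intro: step simp: less_windex_def)
qed (auto simp: less_eq_windex_def less_windex_def Rep_windex_inject)
end

section \<open>Change of variables\<close>

lemma Rep_Abs_windex [simp]: "Rep_windex (Abs_windex i) = i" by (simp add: Abs_windex_inverse)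
lemma Abs_Rep_windex [simp]: "Abs_windex (Rep_windex i) = i" by (simp add: Rep_windex_inverse)

lemma bij_Rep_windex: "bij Rep_windex"
  by (rule o_bij[of Abs_windex]) (auto simp: fun_eq_iff)

text \<open>Conjugation with the bijection matches the permutations of the two index types and
  preserves their signs.\<close>

lemma det_reindex:
  fixes A :: "real^'b^'b" and f :: "'a::finite \<Rightarrow> 'b"
  assumes f: "bij f" shows "det (\<chi> i j. A $ f i $ f j) = det A"
proof -
  have mp: "map_permutation UNIV f p = f \<circ> p \<circ> inv f" for p
    using f by (simp add: map_permutation_def restrict_id_def fun_eq_iff bij_is_surj)
  have inv: "inv f (f i) = i" "f (inv f b) = b" for i b
    using f by (simp_all add: bij_is_inj bij_is_surj surj_f_inv_f)
  have per: "p permutes UNIV \<longleftrightarrow> bij p" for p :: "'c \<Rightarrow> 'c" by (simp add: permutes_def bij_def inj_def surj_def) metis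
  have bi: "bij (inv f)" by (rule bij_imp_bij_inv[OF f])
  show ?thesis unfolding det_def
  proof (rule sum.reindex_bij_witness[where i="\<lambda>q. inv f \<circ> q \<circ> f" and j="\<lambda>p. f \<circ> p \<circ> inv f"])
    fix p :: "'a \<Rightarrow> 'a" assume p: "p \<in> {p. p permutes UNIV}"
    show "inv f \<circ> (f \<circ> p \<circ> inv f) \<circ> f = p" by (simp add: fun_eq_iff inv)
    show "f \<circ> p \<circ> inv f \<in> {p. p permutes UNIV}" using p f bi by (simp add: per bij_comp)
    have "sign (f \<circ> p \<circ> inv f) = sign p"
      unfolding mp[symmetric] using p f by (intro sign_map_permutation) (auto simp: bij_is_inj)
    moreover have "(\<Prod>b\<in>UNIV. A $ b $ (f \<circ> p \<circ> inv f) b) = (\<Prod>i\<in>UNIV. A $ f i $ f (p i))"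
      using prod.reindex_bij_betw[OF f, of "\<lambda>b. A $ b $ (f \<circ> p \<circ> inv f) b"] by (simp add: inv)
    ultimately show "of_int (sign (f \<circ> p \<circ> inv f)) * (\<Prod>i\<in>UNIV. A $ i $ (f \<circ> p \<circ> inv f) i) =
       of_int (sign p) * (\<Prod>i\<in>UNIV. (\<chi> i j. A $ f i $ f j) $ i $ p i)" by simp
  next
    fix q :: "'b \<Rightarrow> 'b" assume q: "q \<in> {p. p permutes UNIV}"
    show "f \<circ> (inv f \<circ> q \<circ> f) \<circ> inv f = q" by (simp add: fun_eq_iff inv)
    show "inv f \<circ> q \<circ> f \<in> {p. p permutes UNIV}" using q f bi by (simp add: per bij_comp)
  qed
qed

definition to_w :: "real^'n \<Rightarrow> real^('n windex)" where "to_w v = (\<chi> i. v $ Rep_windex i)"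
definition of_w :: "real^('n windex) \<Rightarrow> real^'n" where "of_w w = (\<chi> j. w $ Abs_windex j)"

lemma to_of_w [simp]: "to_w (of_w w) = w" and of_to_w [simp]: "of_w (to_w v) = v"
  by (simp_all add: to_w_def of_w_def vec_eq_iff)

lemma linear_to_w: "linear to_w" and linear_of_w: "linear of_w"
  by (auto intro!: linearI simp: to_w_def of_w_def vec_eq_iff)

lemma continuous_to_w: "continuous_on S to_w" and continuous_of_w: "continuous_on T of_w"
  by (simp_all add: linear_to_w linear_of_w linear_continuous_on linear_linear)

lemma borel_to_w [measurable]: "to_w \<in> borel_measurable borel"
  by (rule borel_measurable_continuous_onI[OF continuous_to_w])

lemma borel_of_w [measurable]: "of_w \<in> borel_measurable borel"
  by (rule borel_measurable_continuous_onI[OF continuous_of_w])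

lemma prod_Basis_cart: "(\<Prod>b\<in>Basis. (v :: real^'n) \<bullet> b) = (\<Prod>i\<in>UNIV. v $ i)"
proof -
  have B: "(Basis :: (real^'n) set) = range (\<lambda>i. axis i 1)" by (auto simp: Basis_vec_def)
  have inj: "inj ((\<lambda>i. axis i 1) :: 'n \<Rightarrow> real^'n)" by (auto simp: inj_def axis_eq_axis)
  show ?thesis unfolding B prod.reindex[OF inj] by (simp add: inner_axis)
qed

text \<open>Lebesgue measure is determined by its values on boxes, and reindexing permutes the sides
  of a box.\<close>

lemma distr_of_w: "distr lborel borel of_w = (lborel :: (real^'n) measure)"
proof (rule lborel_eqI[symmetric])
  fix l u :: "real^'n" assume le: "\<And>b. b \<in> Basis \<Longrightarrow> l \<bullet> b \<le> u \<bullet> b"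
  have lei: "l $ i \<le> u $ i" for i using le[of "axis i 1"] by (simp add: inner_axis Basis_vec_def) blast
  have "of_w -` box l u = box (to_w l) (to_w u)"
  proof -
    have "(\<forall>i. l $ i < w $ Abs_windex i \<and> w $ Abs_windex i < u $ i)
      \<longleftrightarrow> (\<forall>i. l $ Rep_windex i < w $ i \<and> w $ i < u $ Rep_windex i)" for w :: "real^('n windex)"
      by (metis Rep_Abs_windex Abs_Rep_windex)
    then show ?thesis by (auto simp: mem_box_cart of_w_def to_w_def)
  qed
  then have "emeasure (distr lborel borel of_w) (box l u) = emeasure lborel (box (to_w l) (to_w u))"
    by (simp add: emeasure_distr)
  also have "\<dots> = (\<Prod>b\<in>Basis. (to_w u - to_w l) \<bullet> b)"
    by (rule emeasure_lborel_box) (auto simp: Basis_vec_def inner_axis to_w_def lei)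
  also have "(\<Prod>b\<in>Basis. (to_w u - to_w l) \<bullet> b) = (\<Prod>b\<in>Basis. (u - l) \<bullet> b)"
    unfolding prod_Basis_cart
    using prod.reindex_bij_betw[OF bij_Rep_windex, of "\<lambda>i. (u - l) $ i"] by (simp add: to_w_def)
  finally show "emeasure (distr lborel borel of_w) (box l u) = (\<Prod>b\<in>Basis. (u - l) \<bullet> b)" .
qed simp

lemma nn_integral_of_w:
  fixes F :: "real^'n \<Rightarrow> ennreal"
  assumes [measurable]: "F \<in> borel_measurable borel"
  shows "(\<integral>\<^sup>+x. F x \<partial>lborel) = (\<integral>\<^sup>+x. F (of_w x) \<partial>lborel)"
  by (subst distr_of_w[symmetric], subst nn_integral_distr) auto

lemma borel_indicator_continuous:
  fixes w :: "'e::topological_space \<Rightarrow> real"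
  assumes "A \<in> sets borel" "continuous_on A w"
  shows "(\<lambda>x. ennreal (w x) * indicator A x) \<in> borel_measurable borel"
proof -
  have "(\<lambda>x. indicator A x *\<^sub>R w x) \<in> borel_measurable borel"
    by (rule borel_measurable_continuous_on_indicator[OF assms])
  then have "(\<lambda>x. ennreal (indicator A x *\<^sub>R w x)) \<in> borel_measurable borel" by measurable
  moreover have "(\<lambda>x. ennreal (indicator A x *\<^sub>R w x)) = (\<lambda>x. ennreal (w x) * indicator A x)"
    by (auto simp: fun_eq_iff indicator_def)
  ultimately show ?thesis by simp
qed

lemma smooth_on_det_dird:
  fixes \<tau> :: "real^'n \<Rightarrow> real^'n"
  assumes "open U" "smooth_on U \<tau>" shows "smooth_on U (\<lambda>x. det (matrix (\<lambda>v. dird v \<tau> x)))"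
  unfolding matrix_def by (intro smooth_on_det smooth_on_vec smooth_on_nth smooth_on_dird assms)

text \<open>The formula for absolutely integrable functions applies on the bounded pieces
  \<open>Bn n\<close>, where the integrand is bounded because \<open>C n\<close> is compact.
  Continuity from below of two density measures then passes to \<open>B\<close>.\<close>

lemma change_of_variables_wellorder:
  fixes \<tau> :: "real^'m::{finite,wellorder} \<Rightarrow> real^'m::_"
  assumes U: "open U" and \<tau>: "smooth_on U \<tau>" and inj: "inj_on \<tau> U"
    and img: "\<And>A. A \<in> sets borel \<Longrightarrow> A \<subseteq> U \<Longrightarrow> \<tau> ` A \<in> sets borel"
    and w: "continuous_on (\<tau> ` U) w" "\<And>x. x \<in> U \<Longrightarrow> w (\<tau> x) \<ge> 0"
    and B: "B \<in> sets borel" "B \<subseteq> U"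
  shows "(\<integral>\<^sup>+y. ennreal (w y) * indicator (\<tau> ` B) y \<partial>lborel)
    = (\<integral>\<^sup>+x. ennreal (\<bar>det (matrix (\<lambda>v. dird v \<tau> x))\<bar> * w (\<tau> x)) * indicator B x \<partial>lborel)"
proof -
  define D where "D x = \<bar>det (matrix (\<lambda>v. dird v \<tau> x))\<bar> * w (\<tau> x)" for x
  have cD: "continuous_on U D" unfolding D_def
    using smooth_on_continuous[OF smooth_on_det_dird[OF U \<tau>]] smooth_on_continuous[OF \<tau>]
    by (intro continuous_intros continuous_on_compose2[OF w(1)]) auto
  obtain C where C: "\<And>n. compact (C n)" "\<And>n. C n \<subseteq> U" "\<And>n. C n \<subseteq> interior (C (Suc n))" "\<Union>(range C) = U"
    using open_Union_compact_subsets[OF U] by metis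
  have incC: "incseq C" using C(3) interior_subset by (intro incseq_SucI) blast
  define Bn where "Bn n = B \<inter> C n" for n
  have Bn: "Bn n \<in> sets borel" "Bn n \<subseteq> U" "Bn n \<subseteq> C n" for n
    using B C(2) borel_compact[OF C(1)] by (auto simp: Bn_def)
  have UB: "(\<Union>n. Bn n) = B" using B(2) C(4) by (auto simp: Bn_def)
  have incB: "incseq Bn" using incC by (auto simp: Bn_def incseq_def)
  have step: "(\<integral>\<^sup>+y. ennreal (w y) * indicator (\<tau> ` Bn n) y \<partial>lborel) = (\<integral>\<^sup>+x. ennreal (D x) * indicator (Bn n) x \<partial>lborel)" for n
  proof -
    have leb: "Bn n \<in> sets lebesgue" using Bn(1) by simp
    have lm: "Bn n \<in> lmeasurable"
      using bounded_set_imp_lmeasurable[OF bounded_subset[OF compact_imp_bounded[OF C(1)] Bn(3)] leb] .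
    have "bounded (D ` C n)"
      by (rule compact_imp_bounded[OF compact_continuous_image[OF continuous_on_subset[OF cD C(2)] C(1)]])
    then obtain K where K: "\<And>x. x \<in> C n \<Longrightarrow> norm (D x) \<le> K" unfolding bounded_iff by blast
    have D_int: "D absolutely_integrable_on Bn n"
    proof (rule measurable_bounded_by_integrable_imp_absolutely_integrable[OF _ leb])
      show "D \<in> borel_measurable (lebesgue_on (Bn n))"
        by (rule continuous_imp_measurable_on_sets_lebesgue[OF continuous_on_subset[OF cD Bn(2)] leb])
      show "(\<lambda>x. K) integrable_on Bn n" by (rule integrable_on_const[OF lm])
      show "norm (D x) \<le> K" if "x \<in> Bn n" for x using that Bn(3) K by blast
    qed
    have der: "(\<tau> has_derivative (\<lambda>v. dird v \<tau> x)) (at x within Bn n)" if "x \<in> Bn n" for x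
      using has_derivative_dird[OF smooth_onD_differentiable[OF \<tau>]] that Bn(2)
      by (meson has_derivative_at_withinI subsetD)
    \<comment> \<open>The formula concerns vector-valued integrands, so \<open>w\<close> is wrapped
      into vectors of length one. The value prescribed for both integrals is that of the pulled back
      integrand, so the left side is known to hold.\<close>
    have "(\<lambda>x. \<bar>det (matrix (\<lambda>v. dird v \<tau> x))\<bar> *\<^sub>R (vec (w (\<tau> x)) :: real^1)) absolutely_integrable_on Bn n \<and>
        integral (Bn n) (\<lambda>x. \<bar>det (matrix (\<lambda>v. dird v \<tau> x))\<bar> *\<^sub>R (vec (w (\<tau> x)) :: real^1)) = vec (integral (Bn n) D)
      \<longleftrightarrow> (\<lambda>y. vec (w y) :: real^1) absolutely_integrable_on (\<tau> ` Bn n)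
        \<and> integral (\<tau> ` Bn n) (\<lambda>y. vec (w y) :: real^1) = vec (integral (Bn n) D)"
      by (rule has_absolute_integral_change_of_variables[OF leb der inj_on_subset[OF inj Bn(2)]])
    then have "w absolutely_integrable_on (\<tau> ` Bn n) \<and> integral (\<tau> ` Bn n) w = integral (Bn n) D"
      using D_int unfolding absolutely_integrable_on_1_iff integral_on_1_eq
      by (simp add: D_def[abs_def] vec_eq_iff)
    then have "(w has_integral integral (Bn n) D) (\<tau> ` Bn n)"
      by (metis absolutely_integrable_on_def has_integral_integral)
    moreover have "(D has_integral integral (Bn n) D) (Bn n)"
      using D_int by (simp add: absolutely_integrable_on_def has_integral_integral[symmetric])
    moreover have "0 \<le> w y" if "y \<in> \<tau> ` Bn n" for y using that w(2) Bn(2)[of n] by auto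
    moreover have "0 \<le> D x" if "x \<in> Bn n" for x using that w(2) Bn(2)[of n] by (auto simp: D_def)
    ultimately show ?thesis
      using nn_integral_has_integral_lebesgue'[of "\<tau> ` Bn n" w "integral (Bn n) D"]
        nn_integral_has_integral_lebesgue'[of "Bn n" D "integral (Bn n) D"] by simp
  qed
  define Fw where "Fw y = ennreal (w y) * indicator (\<tau> ` U) y" for y
  define FD where "FD x = ennreal (D x) * indicator U x" for x
  have mw: "Fw \<in> borel_measurable lborel"
    using borel_indicator_continuous[OF img[OF _ order_refl] w(1)] U by (simp add: Fw_def[abs_def])
  have mD: "FD \<in> borel_measurable lborel"
    using borel_indicator_continuous[OF _ cD] U by (simp add: FD_def[abs_def])
  have ew: "emeasure (density lborel Fw) (\<tau> ` A) = (\<integral>\<^sup>+y. ennreal (w y) * indicator (\<tau> ` A) y \<partial>lborel)"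
    if "A \<in> sets borel" "A \<subseteq> U" for A
    using that img[OF that] by (subst emeasure_density[OF mw]) (auto simp: Fw_def intro!: nn_integral_cong split: split_indicator, blast)
  have eD: "emeasure (density lborel FD) A = (\<integral>\<^sup>+y. ennreal (D y) * indicator A y \<partial>lborel)"
    if "A \<in> sets borel" "A \<subseteq> U" for A
    using that by (subst emeasure_density[OF mD]) (auto simp: FD_def intro!: nn_integral_cong split: split_indicator)
  have "emeasure (density lborel Fw) (\<tau> ` B) = (SUP n. emeasure (density lborel Fw) (\<tau> ` Bn n))"
  proof -
    have "incseq (\<lambda>n. \<tau> ` Bn n)" using incB by (auto simp: incseq_def)
    moreover have "range (\<lambda>n. \<tau> ` Bn n) \<subseteq> sets (density lborel Fw)" using img Bn by auto
    moreover have "(\<Union>n. \<tau> ` Bn n) = \<tau> ` B" using UB by auto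
    ultimately show ?thesis using SUP_emeasure_incseq[of "\<lambda>n. \<tau> ` Bn n" "density lborel Fw"] by simp
  qed
  also have "\<dots> = (SUP n. emeasure (density lborel FD) (Bn n))"
    using ew eD step Bn by simp
  also have "\<dots> = emeasure (density lborel FD) B"
    using SUP_emeasure_incseq[of Bn "density lborel FD"] incB Bn UB by auto
  finally show ?thesis using ew[OF B] eD[OF B] by (simp add: D_def)
qed

text \<open>Everything is conjugated with the reindexing maps. They preserve Lebesgue measure, and
  by \<open>det_reindex\<close> also the Jacobian determinant.\<close>

theorem change_of_variables:
  fixes \<tau> :: "real^'n \<Rightarrow> real^'n"
  assumes U: "open U" and \<tau>: "smooth_on U \<tau>" and inj: "inj_on \<tau> U"
    and img: "\<And>A. A \<in> sets borel \<Longrightarrow> A \<subseteq> U \<Longrightarrow> \<tau> ` A \<in> sets borel"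
    and w: "continuous_on (\<tau> ` U) w" "\<And>x. x \<in> U \<Longrightarrow> w (\<tau> x) \<ge> 0"
    and B: "B \<in> sets borel" "B \<subseteq> U"
  shows "(\<integral>\<^sup>+y. ennreal (w y) * indicator (\<tau> ` B) y \<partial>lborel)
    = (\<integral>\<^sup>+x. ennreal (\<bar>det (matrix (\<lambda>v. dird v \<tau> x))\<bar> * w (\<tau> x)) * indicator B x \<partial>lborel)"
proof -
  define \<tau>' where "\<tau>' x = to_w (\<tau> (of_w x))" for x
  define U' where "U' = of_w -` U"
  define B' where "B' = of_w -` B"
  define D where "D x = \<bar>det (matrix (\<lambda>v. dird v \<tau> x))\<bar> * w (\<tau> x)" for x
  have oU': "open U'" unfolding U'_def using U by (intro open_vimage continuous_of_w)
  have bl: "bounded_linear to_w" "bounded_linear of_w"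
    using linear_to_w linear_of_w by (simp_all add: linear_conv_bounded_linear)
  have vim: "of_w -` A = to_w ` A" for A :: "(real^'n) set"
    by (auto simp: image_iff) (metis to_of_w of_to_w)+
  have sm1: "smooth_on U' (\<lambda>x. \<tau> (of_w x))"
    by (rule smooth_on_compose[OF \<tau> smooth_on_bounded_linear[OF bl(2)] _ oU' U]) (auto simp: U'_def)
  have sm: "smooth_on U' \<tau>'" unfolding \<tau>'_def
    by (rule smooth_on_compose[OF smooth_on_bounded_linear[OF bl(1)] sm1 _ oU' open_UNIV]) auto
  have image: "\<tau>' ` (of_w -` A) = of_w -` (\<tau> ` A)" for A unfolding vim by (auto simp: \<tau>'_def image_iff)
  have "inj_on \<tau>' U'"
  proof (rule inj_onI)
    fix x y assume *: "x \<in> U'" "y \<in> U'" "\<tau>' x = \<tau>' y"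
    then have "\<tau> (of_w x) = \<tau> (of_w y)" unfolding \<tau>'_def by (metis of_to_w)
    then have "of_w x = of_w y" using inj * by (auto simp: U'_def inj_on_def)
    then show "x = y" by (metis to_of_w)
  qed
  moreover have vb: "of_w -` A \<in> sets borel" if "A \<in> sets borel" for A :: "(real^'n) set"
    using measurable_sets[OF borel_of_w that] by simp
  moreover have "\<tau>' ` A \<in> sets borel" if A: "A \<in> sets borel" "A \<subseteq> U'" for A
  proof -
    have "to_w -` A \<in> sets borel" using measurable_sets[OF borel_to_w A(1)] by simp
    moreover have "to_w -` A \<subseteq> U" using A(2) by (auto simp: U'_def)
    ultimately have "of_w -` (\<tau> ` (to_w -` A)) \<in> sets borel" by (intro vb img)
    moreover have "of_w -` (to_w -` A) = A" by auto
    ultimately show ?thesis using image[of "to_w -` A"] by simp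
  qed
  moreover have "continuous_on (\<tau>' ` U') (\<lambda>x. w (of_w x))"
    by (rule continuous_on_compose2[OF w(1) continuous_of_w]) (auto simp: \<tau>'_def U'_def)
  moreover have "w (of_w (\<tau>' x)) \<ge> 0" if "x \<in> U'" for x using that w(2) by (simp add: \<tau>'_def U'_def)
  moreover have "B' \<in> sets borel" "B' \<subseteq> U'" using B vb by (auto simp: B'_def U'_def)
  ultimately have main: "(\<integral>\<^sup>+y. ennreal (w (of_w y)) * indicator (\<tau>' ` B') y \<partial>lborel)
    = (\<integral>\<^sup>+x. ennreal (\<bar>det (matrix (\<lambda>v. dird v \<tau>' x))\<bar> * w (of_w (\<tau>' x))) * indicator B' x \<partial>lborel)"
    using change_of_variables_wellorder[OF oU' sm] by blast
  have detD: "det (matrix (\<lambda>v. dird v \<tau>' x)) = det (matrix (\<lambda>v. dird v \<tau> (of_w x)))" if "x \<in> U'" for x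
  proof -
    have d: "\<tau> differentiable (at (of_w x))" using that \<tau> smooth_onD_differentiable by (auto simp: U'_def)
    have "dird v \<tau>' x = to_w (dird (of_w v) \<tau> (of_w x))" for v
      unfolding \<tau>'_def
      by (rule dird_eqI) (rule bounded_linear.has_derivative[OF bl(1)
          has_derivative_compose[OF bounded_linear_imp_has_derivative[OF bl(2)] has_derivative_dird[OF d]]])
    moreover have "of_w (axis j 1) = axis (Rep_windex j) 1" for j :: "'n windex"
      by (auto simp: of_w_def vec_eq_iff axis_def)
    ultimately have "matrix (\<lambda>v. dird v \<tau>' x)
        = (\<chi> i j. matrix (\<lambda>v. dird v \<tau> (of_w x)) $ Rep_windex i $ Rep_windex j)"
      by (simp add: matrix_def to_w_def)
    then show ?thesis by (simp add: det_reindex[OF bij_Rep_windex])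
  qed
  have Bb: "\<tau> ` B \<in> sets borel" by (rule img[OF B])
  have mw: "(\<lambda>y. ennreal (w y) * indicator (\<tau> ` B) y) \<in> borel_measurable borel"
    by (rule borel_indicator_continuous[OF Bb continuous_on_subset[OF w(1)]]) (use B in auto)
  have "continuous_on U D" unfolding D_def
    using smooth_on_continuous[OF smooth_on_det_dird[OF U \<tau>]] smooth_on_continuous[OF \<tau>]
    by (intro continuous_intros continuous_on_compose2[OF w(1)]) auto
  then have mD: "(\<lambda>x. ennreal (D x) * indicator B x) \<in> borel_measurable borel"
    by (rule borel_indicator_continuous[OF B(1) continuous_on_subset]) (rule B(2))
  have "(\<integral>\<^sup>+y. ennreal (w y) * indicator (\<tau> ` B) y \<partial>lborel) = (\<integral>\<^sup>+y. ennreal (w (of_w y)) * indicator (\<tau>' ` B') y \<partial>lborel)"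
    by (subst nn_integral_of_w[OF mw]) (simp add: B'_def image indicator_vimage o_def indicator_def)
  also have "\<dots> = (\<integral>\<^sup>+x. ennreal (D (of_w x)) * indicator B (of_w x) \<partial>lborel)"
    unfolding main using B(2)
    by (intro nn_integral_cong) (auto simp: D_def detD \<tau>'_def B'_def U'_def split: split_indicator)
  also have "\<dots> = (\<integral>\<^sup>+x. ennreal (D x) * indicator B x \<partial>lborel)"
    by (rule nn_integral_of_w[OF mD, symmetric])
  finally show ?thesis by (simp add: D_def)
qed

context rmanifold
begin

section \<open>The volume measure\<close>

definition vdens :: "('b, 'n) chart \<Rightarrow> real^'n \<Rightarrow> real" where
  "vdens c x = sqrt (det (h c x))"

lemma smooth_on_vdens: "c \<in> \<B> \<Longrightarrow> smooth_on (cdom c) (vdens c)"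
  unfolding vdens_def[abs_def]
  by (intro smooth_on_sqrt smooth_on_det metric_onD[OF metric_on_chart] posdef_det)

lemma vdens_pos: "c \<in> \<B> \<Longrightarrow> x \<in> cdom c \<Longrightarrow> vdens c x > 0"
  using posdef_det[OF posdef_h] by (simp add: vdens_def)

lemma vdens_transition:
  assumes c: "c \<in> \<B>" "c' \<in> \<B>" and x: "x \<in> overlap c c'"
  shows "vdens c x = \<bar>det (matrix (\<lambda>v. dird v (transition c c') x))\<bar> * vdens c' (transition c c' x)"
proof -
  interpret coord_isometry "overlap c c'" "cdom c'" "h c" "h c'" "transition c c'"
    by (rule coord_isometry_transition[OF c])
  define J where "J = matrix (\<lambda>v. dird v (transition c c') x)"
  have J: "J *v v = dird v (transition c c') x" for v
    unfolding J_def by (rule matrix_apply[OF lin[OF x]])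
  have "h c x = transpose J ** h c' (transition c c' x) ** J"
    by (rule ip_eqI) (simp add: ip_congruence J pull[OF x])
  then have "det (h c x) = (det J)\<^sup>2 * det (h c' (transition c c' x))"
    by (simp add: det_mul power2_eq_square)
  then show ?thesis by (simp add: vdens_def J_def real_sqrt_mult)
qed

lemma borel_chart [measurable]: "c \<in> \<B> \<Longrightarrow> fst c \<in> sets borel" "c \<in> \<B> \<Longrightarrow> cdom c \<in> sets borel"
  by (auto intro: borel_open chartD)

lemma borel_snd_image:
  assumes c: "c \<in> \<B>" and A: "A \<in> sets borel" "A \<subseteq> fst c" shows "snd c ` A \<in> sets borel"
proof -
  have "param c -` A \<inter> space (restrict_space borel (cdom c)) \<in> sets (restrict_space borel (cdom c))"
    by (rule measurable_sets[OF borel_measurable_continuous_on_restrict[OF chart_cont(2)[OF c]] A(1)])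
  moreover have "param c -` A \<inter> space (restrict_space borel (cdom c)) = snd c ` A"
    unfolding snd_image[OF c A(2)] by (auto simp: space_restrict_space)
  ultimately show ?thesis using borel_chart(2)[OF c] by (auto simp: sets_restrict_space_iff)
qed

lemma borel_param_image:
  assumes c: "c \<in> \<B>" and A: "A \<in> sets borel" "A \<subseteq> cdom c" shows "param c ` A \<in> sets borel"
proof -
  have "snd c -` A \<inter> space (restrict_space borel (fst c)) \<in> sets (restrict_space borel (fst c))"
    by (rule measurable_sets[OF borel_measurable_continuous_on_restrict[OF chart_cont(1)[OF c]] A(1)])
  moreover have "snd c -` A \<inter> space (restrict_space borel (fst c)) = param c ` A"
    unfolding param_image[OF c A(2)] by (auto simp: space_restrict_space)
  ultimately show ?thesis using borel_chart(1)[OF c] by (auto simp: sets_restrict_space_iff)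
qed

definition chart_volume :: "('b, 'n) chart \<Rightarrow> 'b set \<Rightarrow> ennreal" where
  "chart_volume c B = (\<integral>\<^sup>+x\<in>snd c ` B. ennreal (vdens c x) \<partial>lborel)"

text \<open>Change of variables along the transition map, whose Jacobian factor is the ratio of the
  two densities.\<close>

lemma chart_volume_independent:
  assumes c: "c \<in> \<B>" "c' \<in> \<B>" and B: "B \<in> sets borel" "B \<subseteq> fst c" "B \<subseteq> fst c'"
  shows "chart_volume c' B = chart_volume c B"
proof -
  define \<tau> where "\<tau> = transition c c'"
  define U where "U = overlap c c'"
  have img: "\<tau> ` snd c ` A = snd c' ` A" if "A \<subseteq> fst c" for A
    using that c by (force simp: \<tau>_def image_image intro!: image_cong)
  have "(\<integral>\<^sup>+y. ennreal (vdens c' y) * indicator (\<tau> ` snd c ` B) y \<partial>lborel)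
    = (\<integral>\<^sup>+x. ennreal (\<bar>det (matrix (\<lambda>v. dird v \<tau> x))\<bar> * vdens c' (\<tau> x)) * indicator (snd c ` B) x \<partial>lborel)"
  proof (rule change_of_variables[where U=U])
    show "open U" "smooth_on U \<tau>" unfolding U_def \<tau>_def by (rule open_overlap[OF c] smooth_transition[OF c])+
    show "inj_on \<tau> U"
    proof (rule inj_onI)
      fix x y assume xy: "x \<in> U" "y \<in> U" "\<tau> x = \<tau> y"
      then have "param c x = param c y" unfolding U_def \<tau>_def by (metis param_transition[OF c])
      then show "x = y" using xy c unfolding U_def overlap_iff[OF c(1)] by (metis snd_param)
    qed
    show "\<tau> ` A \<in> sets borel" if A: "A \<in> sets borel" "A \<subseteq> U" for A
    proof -
      have sub: "A \<subseteq> cdom c" using A(2) by (auto simp: U_def overlap_iff[OF c(1)])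
      have "snd c' ` param c ` A \<in> sets borel"
        by (rule borel_snd_image[OF c(2) borel_param_image[OF c(1) A(1) sub]])
          (use A(2) in \<open>auto simp: U_def overlap_iff[OF c(1)]\<close>)
      then show ?thesis by (simp add: \<tau>_def transition_def image_comp)
    qed
    have sub: "\<tau> ` U \<subseteq> cdom c'" unfolding \<tau>_def U_def by (rule transition_in[OF c])
    show "continuous_on (\<tau> ` U) (vdens c')"
      by (rule continuous_on_subset[OF smooth_on_continuous[OF smooth_on_vdens[OF c(2)]] sub])
    show "0 \<le> vdens c' (\<tau> x)" if "x \<in> U" for x
      using vdens_pos[OF c(2), of "\<tau> x"] sub that by (auto intro: less_imp_le)
    show "snd c ` B \<in> sets borel" by (rule borel_snd_image[OF c(1) B(1,2)])
    show "snd c ` B \<subseteq> U" using B by (auto simp: U_def overlap_def)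
  qed
  also have "\<dots> = (\<integral>\<^sup>+x. ennreal (vdens c x) * indicator (snd c ` B) x \<partial>lborel)"
  proof (rule nn_integral_cong)
    fix x
    have "x \<in> overlap c c'" if "x \<in> snd c ` B" using that B by (auto simp: overlap_def)
    then show "ennreal (\<bar>det (matrix (\<lambda>v. dird v \<tau> x))\<bar> * vdens c' (\<tau> x)) * indicator (snd c ` B) x
      = ennreal (vdens c x) * indicator (snd c ` B) x"
      using vdens_transition[OF c] by (auto simp: \<tau>_def split: split_indicator)
  qed
  finally show ?thesis by (simp add: chart_volume_def img[OF B(2)])
qed

text \<open>Chart volume is the value of a density measure on the coordinate image, and the chart,
  being injective, keeps images of disjoint sets disjoint.\<close>

lemma chart_volume_additive:
  assumes c: "c \<in> \<B>" and B: "\<And>i::nat. B i \<in> sets borel" "\<And>i. B i \<subseteq> fst c" "disjoint_family B"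
  shows "(\<Sum>i. chart_volume c (B i)) = chart_volume c (\<Union>i. B i)"
proof -
  define D where "D x = ennreal (vdens c x) * indicator (cdom c) x" for x
  have mD: "D \<in> borel_measurable lborel"
    using borel_indicator_continuous[OF borel_chart(2)[OF c] smooth_on_continuous[OF smooth_on_vdens[OF c]]]
    by (simp add: D_def[abs_def])
  have e: "chart_volume c A = emeasure (density lborel D) (snd c ` A)" if A: "A \<in> sets borel" "A \<subseteq> fst c" for A
  proof -
    have "snd c ` A \<in> sets lborel" using borel_snd_image[OF c A] by simp
    then have "emeasure (density lborel D) (snd c ` A) = (\<integral>\<^sup>+x. D x * indicator (snd c ` A) x \<partial>lborel)"
      by (rule emeasure_density[OF mD])
    also have "\<dots> = chart_volume c A" unfolding chart_volume_def D_def
      by (rule nn_integral_cong) (use A(2) in \<open>auto simp: cdom_def split: split_indicator\<close>)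
    finally show ?thesis by simp
  qed
  have "disjoint_family (\<lambda>i. snd c ` B i)" unfolding disjoint_family_on_def
  proof (intro ballI impI)
    fix i j :: nat assume "i \<noteq> j"
    then have "B i \<inter> B j = {}" using B(3) by (auto simp: disjoint_family_on_def)
    moreover have "inj_on (snd c) (fst c)" using c by (metis inj_onI param_snd)
    ultimately show "snd c ` B i \<inter> snd c ` B j = {}" using B(2) by (metis image_empty inj_on_image_Int)
  qed
  moreover have "range (\<lambda>i. snd c ` B i) \<subseteq> sets (density lborel D)"
    using borel_snd_image[OF c B(1,2)] by auto
  ultimately have "(\<Sum>i. emeasure (density lborel D) (snd c ` B i)) = emeasure (density lborel D) (\<Union>i. snd c ` B i)"
    by (rule suminf_emeasure[rotated])
  then show ?thesis using B by (simp add: e UN_subset_iff image_UN sets.countable_UN)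
qed

text \<open>The Lindelof property extracts countably many charts; making their domains disjoint
  gives a Borel partition over which volumes can be summed without overcounting.\<close>

lemma countable_chart_partition:
  obtains cc :: "nat \<Rightarrow> ('b, 'n) chart" and A where "\<And>n. cc n \<in> \<B>" "\<And>n. A n \<in> sets borel"
    "\<And>n. A n \<subseteq> fst (cc n)" "disjoint_family A" "(\<Union>n. A n) = UNIV"
proof -
  obtain \<F> where F: "\<F> \<subseteq> fst ` \<B>" "countable \<F>" "\<Union>\<F> = \<Union>(fst ` \<B>)"
  proof (rule Lindelof_openin[of "fst ` \<B>" UNIV])
    fix S assume "S \<in> fst ` \<B>" then show "openin (top_of_set UNIV) S" using chartD(1) by force
  qed
  have un: "\<Union>\<F> = UNIV" using F(3) atlas by (simp add: smooth_atlas_def)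
  then have "\<F> \<noteq> {}" by auto
  then have range: "range (from_nat_into \<F>) = \<F>" using F(2) by (rule range_from_nat_into)
  have "\<forall>n. \<exists>c. c \<in> \<B> \<and> fst c = from_nat_into \<F> n"
  proof
    fix n
    have "from_nat_into \<F> n \<in> fst ` \<B>" using rangeI[of "from_nat_into \<F>" n] unfolding range using F(1) by (rule subsetD[rotated])
    then obtain c where "c \<in> \<B>" "from_nat_into \<F> n = fst c" by (rule imageE)
    then show "\<exists>c. c \<in> \<B> \<and> fst c = from_nat_into \<F> n" by metis
  qed
  from choice[OF this] obtain cc where cc: "\<And>n. cc n \<in> \<B>" "\<And>n. fst (cc n) = from_nat_into \<F> n" by blast
  have un': "(\<Union>n. fst (cc n)) = UNIV" using un range by (simp add: cc(2))
  show ?thesis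
  proof (rule that[of cc "disjointed (\<lambda>n. fst (cc n))"])
    show "disjointed (\<lambda>n. fst (cc n)) n \<in> sets borel" for n
      using sets.range_disjointed_sets[of "\<lambda>n. fst (cc n)" borel] borel_chart(1)[OF cc(1)] by blast
    show "disjointed (\<lambda>n. fst (cc n)) n \<subseteq> fst (cc n)" for n by (rule disjointed_subset)
    show "disjoint_family (disjointed (\<lambda>n. fst (cc n)))" by (rule disjoint_family_disjointed)
    show "(\<Union>n. disjointed (\<lambda>n. fst (cc n)) n) = UNIV" unfolding UN_disjointed_eq by (rule un')
  qed (rule cc)
qed

text \<open>Justifies the definite description in \<open>riemannian_volume\<close>. The measure is
  assembled from chart volumes on the pieces of a countable partition. On subsets of any chart it
  has the right value because chart volumes agree on overlaps, and the values on the pieces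
  determine it.\<close>

lemma riemannian_volume_exists:
  "\<exists>!\<sigma>. sets \<sigma> = sets borel \<and> (\<forall>c\<in>\<B>. \<forall>B\<in>sets borel. B \<subseteq> fst c \<longrightarrow> emeasure \<sigma> B = chart_volume c B)"
proof -
  obtain cc :: "nat \<Rightarrow> ('b, 'n) chart" and A :: "nat \<Rightarrow> 'b set" where cc: "\<And>n. cc n \<in> \<B>" and A: "\<And>n. A n \<in> sets borel"
    "\<And>n. A n \<subseteq> fst (cc n)" "disjoint_family A" "(\<Union>n. A n) = UNIV"
    by (rule countable_chart_partition, rule that)
  define m where "m B = (\<Sum>n. chart_volume (cc n) (B \<inter> A n))" for B
  define \<sigma> where "\<sigma> = measure_of UNIV (sets borel) m"
  have sets: "sets \<sigma> = sets borel"
    unfolding \<sigma>_def using sets.sigma_sets_eq[of "borel :: 'b measure"] by (simp add: sets_measure_of)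
  have em: "emeasure \<sigma> B = m B" if "B \<in> sets borel" for B
  proof (rule emeasure_measure_of[OF \<sigma>_def])
    show "sets borel \<subseteq> Pow UNIV" by simp
    show "positive (sets \<sigma>) m" by (simp add: positive_def m_def chart_volume_def)
    show "countably_additive (sets \<sigma>) m"
    proof (rule countably_additiveI)
      fix B :: "nat \<Rightarrow> 'b set" assume B: "range B \<subseteq> sets \<sigma>" "disjoint_family B" "(\<Union>i. B i) \<in> sets \<sigma>"
      have Bi: "B i \<in> sets borel" for i using B(1) sets by auto
      have "m (\<Union>i. B i) = (\<Sum>n. \<Sum>i. chart_volume (cc n) (B i \<inter> A n))"
        unfolding m_def
      proof (rule arg_cong[where f=suminf], rule ext)
        fix n
        have "(\<Sum>i. chart_volume (cc n) (B i \<inter> A n)) = chart_volume (cc n) (\<Union>i. B i \<inter> A n)"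
        proof (rule chart_volume_additive[OF cc])
          show "disjoint_family (\<lambda>i. B i \<inter> A n)" by (rule disjoint_family_subset[OF B(2)]) auto
        qed (use Bi A in auto)
        then show "chart_volume (cc n) ((\<Union>i. B i) \<inter> A n) = (\<Sum>i. chart_volume (cc n) (B i \<inter> A n))" by simp
      qed
      \<comment> \<open>One sum is read as an integral over counting measure, so that the two
        infinite sums can be interchanged.\<close>
      also have "\<dots> = (\<integral>\<^sup>+n. (\<Sum>i. chart_volume (cc n) (B i \<inter> A n)) \<partial>count_space UNIV)"
        by (rule nn_integral_count_space_nat[symmetric])
      also have "\<dots> = (\<Sum>i. \<integral>\<^sup>+n. chart_volume (cc n) (B i \<inter> A n) \<partial>count_space UNIV)"
        by (rule nn_integral_suminf) simp
      also have "\<dots> = (\<Sum>i. m (B i))" by (simp add: nn_integral_count_space_nat m_def)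
      finally show "(\<Sum>i. m (B i)) = m (\<Union>i. B i)" by simp
    qed
    show "B \<in> sets \<sigma>" using that sets by simp
  qed
  show ?thesis
  proof (rule ex1I[of _ \<sigma>], intro conjI ballI impI sets)
    fix c B assume c: "c \<in> \<B>" and B: "B \<in> sets borel" "B \<subseteq> fst c"
    have "emeasure \<sigma> B = (\<Sum>n. chart_volume (cc n) (B \<inter> A n))" using em[OF B(1)] by (simp add: m_def)
    also have "\<dots> = (\<Sum>n. chart_volume c (B \<inter> A n))"
    proof (rule arg_cong[where f=suminf], rule ext)
      show "chart_volume (cc n) (B \<inter> A n) = chart_volume c (B \<inter> A n)" for n
        by (rule chart_volume_independent[OF c cc]) (use A B in auto)
    qed
    also have "\<dots> = chart_volume c (\<Union>n. B \<inter> A n)"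
    proof (rule chart_volume_additive[OF c])
      show "disjoint_family (\<lambda>n. B \<inter> A n)" by (rule disjoint_family_subset[OF A(3)]) auto
    qed (use A B in auto)
    also have "(\<Union>n. B \<inter> A n) = B" using A(4) by auto
    finally show "emeasure \<sigma> B = chart_volume c B" .
  next
    fix \<sigma>' assume \<sigma>': "sets \<sigma>' = sets borel \<and> (\<forall>c\<in>\<B>. \<forall>B\<in>sets borel. B \<subseteq> fst c \<longrightarrow> emeasure \<sigma>' B = chart_volume c B)"
    show "\<sigma>' = \<sigma>"
    proof (rule measure_eqI)
      show "sets \<sigma>' = sets \<sigma>" using \<sigma>' sets by simp
      fix B assume "B \<in> sets \<sigma>'"
      then have B: "B \<in> sets borel" using \<sigma>' by simp
      have "(\<Sum>n. emeasure \<sigma>' (B \<inter> A n)) = emeasure \<sigma>' (\<Union>n. B \<inter> A n)"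
      proof (rule suminf_emeasure)
        show "disjoint_family (\<lambda>n. B \<inter> A n)" by (rule disjoint_family_subset[OF A(3)]) auto
      qed (use \<sigma>' A B in auto)
      also have "(\<Union>n. B \<inter> A n) = B" using A(4) by auto
      finally have "emeasure \<sigma>' B = (\<Sum>n. emeasure \<sigma>' (B \<inter> A n))" by simp
      also have "\<dots> = m B" unfolding m_def
      proof (rule arg_cong[where f=suminf], rule ext)
        fix n
        have "B \<inter> A n \<in> sets borel" "B \<inter> A n \<subseteq> fst (cc n)" using A B by auto
        then show "emeasure \<sigma>' (B \<inter> A n) = chart_volume (cc n) (B \<inter> A n)" using \<sigma>' cc by blast
      qed
      finally show "emeasure \<sigma>' B = emeasure \<sigma> B" using em[OF B] by simp
    qed
  qed
qed

abbreviation "vol \<equiv> riemannian_volume \<B> h"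

lemma vol: "sets vol = sets borel" "c \<in> \<B> \<Longrightarrow> B \<in> sets borel \<Longrightarrow> B \<subseteq> fst c \<Longrightarrow> emeasure vol B = chart_volume c B"
  using theI'[OF riemannian_volume_exists] unfolding riemannian_volume_def chart_volume_def vdens_def by auto

lemma measurable_vol_iff [simp]: "f \<in> borel_measurable vol \<longleftrightarrow> f \<in> borel_measurable borel"
  by (rule measurable_cong_sets[THEN arg_cong[where f="\<lambda>S. f \<in> S"]]) (simp_all add: vol)

text \<open>Made total so that \<open>distr\<close> applies; the density in \<open>vol_chart\<close>
  vanishes off \<open>cdom c\<close>.\<close>

definition total_param :: "('b, 'n) chart \<Rightarrow> real^'n \<Rightarrow> 'b" where
  "total_param c x = (if x \<in> cdom c then param c x else undefined)"

lemma measurable_total_param [measurable]: "c \<in> \<B> \<Longrightarrow> total_param c \<in> borel_measurable borel"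
  unfolding total_param_def[abs_def]
  by (rule borel_measurable_continuous_on_if) (auto intro: borel_chart chart_cont)

lemma measurable_chart_density:
  "c \<in> \<B> \<Longrightarrow> (\<lambda>x. indicator (cdom c) x * vdens c x) \<in> borel_measurable borel"
  using borel_measurable_continuous_on_indicator[OF borel_chart(2) smooth_on_continuous[OF smooth_on_vdens]] by simp

lemma vol_chart:
  assumes c: "c \<in> \<B>"
  shows "density vol (\<lambda>p. ennreal (indicator (fst c) p))
    = distr (density lborel (\<lambda>x. ennreal (indicator (cdom c) x * vdens c x))) borel (total_param c)"
proof (rule measure_eqI)
  note [measurable] = borel_chart(1)[OF c] measurable_chart_density[OF c] measurable_total_param[OF c]
  fix B assume "B \<in> sets (density vol (\<lambda>p. ennreal (indicator (fst c) p)))"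
  then have B [measurable]: "B \<in> sets borel" by (simp add: vol)
  have "emeasure (density vol (\<lambda>p. ennreal (indicator (fst c) p))) B = emeasure vol (B \<inter> fst c)"
    by (subst emeasure_density) (auto simp: vol ennreal_indicator indicator_inter_arith[symmetric] Int_commute)
  also have "\<dots> = (\<integral>\<^sup>+x. ennreal (vdens c x) * indicator (snd c ` (B \<inter> fst c)) x \<partial>lborel)"
    by (subst vol(2)[OF c]) (auto simp: chart_volume_def)
  also have "\<dots> = (\<integral>\<^sup>+x. ennreal (indicator (cdom c) x * vdens c x) * indicator (total_param c -` B) x \<partial>lborel)"
  proof (rule nn_integral_cong)
    fix x
    have "x \<in> snd c ` (B \<inter> fst c) \<longleftrightarrow> x \<in> cdom c \<and> total_param c x \<in> B"
      by (subst snd_image[OF c]) (auto simp: total_param_def c)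
    then show "ennreal (vdens c x) * indicator (snd c ` (B \<inter> fst c)) x
      = ennreal (indicator (cdom c) x * vdens c x) * indicator (total_param c -` B) x"
      by (auto split: split_indicator)
  qed
  also have "\<dots> = emeasure (density lborel (\<lambda>x. ennreal (indicator (cdom c) x * vdens c x))) (total_param c -` B)"
    by (rule emeasure_density[symmetric]) (use measurable_sets[OF measurable_total_param[OF c] B] in auto)
  also have "\<dots> = emeasure (distr (density lborel (\<lambda>x. ennreal (indicator (cdom c) x * vdens c x))) borel (total_param c)) B"
    by (subst emeasure_distr) auto
  finally show "emeasure (density vol (\<lambda>p. ennreal (indicator (fst c) p))) B
    = emeasure (distr (density lborel (\<lambda>x. ennreal (indicator (cdom c) x * vdens c x))) borel (total_param c)) B" .
qed (simp add: vol)

end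

locale weighted_rmanifold = rmanifold \<B> h
  for \<B> :: "('b::{t2_space,second_countable_topology}, 'n::finite) chart set" and h +
  fixes F :: "'b \<Rightarrow> real"
  assumes F: "smooth_function \<B> F"
begin

abbreviation "\<mu> \<equiv> weighted_volume \<B> h F"

lemma sets_\<mu> [simp, measurable_cong]: "sets \<mu> = sets borel" by (simp add: weighted_volume_def vol)

lemma borel_smooth: "smooth u \<Longrightarrow> u \<in> borel_measurable borel"
  by (rule borel_measurable_continuous_onI[OF smooth_continuous])

lemma borel_F [measurable]: "F \<in> borel_measurable borel" by (rule borel_smooth[OF F])

lemma integral_chart:
  fixes u :: "'b \<Rightarrow> real"
  assumes c: "c \<in> \<B>" and u: "u \<in> borel_measurable borel" "\<And>p. p \<notin> fst c \<Longrightarrow> u p = 0"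
  shows "integral\<^sup>L \<mu> u = (\<integral>x. indicator (cdom c) x * (vdens c x * exp (- F (param c x)) * u (param c x)) \<partial>lborel)"
    and "integrable \<mu> u \<longleftrightarrow> integrable lborel (\<lambda>x. indicator (cdom c) x * (vdens c x * exp (- F (param c x)) * u (param c x)))"
proof -
  note [measurable] = u(1) borel_chart(1)[OF c] measurable_chart_density[OF c] measurable_total_param[OF c]
  define w where "w p = exp (- F p) * u p" for p
  have [measurable]: "w \<in> borel_measurable borel" unfolding w_def by measurable
  have e: "w = (\<lambda>p. indicator (fst c) p *\<^sub>R w p)" using u(2) by (auto simp: w_def fun_eq_iff indicator_def)
  have d: "indicator (cdom c) x * vdens c x \<ge> 0" for x
    using vdens_pos[OF c, of x] by (auto simp: indicator_def)
  have D: "(\<lambda>x. (indicator (cdom c) x * vdens c x) *\<^sub>R w (total_param c x))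
    = (\<lambda>x. indicator (cdom c) x * (vdens c x * exp (- F (param c x)) * u (param c x)))"
    by (auto simp: w_def total_param_def indicator_def fun_eq_iff)
  have "integral\<^sup>L \<mu> u = integral\<^sup>L vol w" unfolding weighted_volume_def
    by (subst integral_density) (auto simp: w_def[abs_def])
  also have "\<dots> = integral\<^sup>L (density vol (\<lambda>p. ennreal (indicator (fst c) p))) w"
    by (subst (1) e, subst integral_density) auto
  also have "\<dots> = (\<integral>x. (indicator (cdom c) x * vdens c x) *\<^sub>R w (total_param c x) \<partial>lborel)"
    unfolding vol_chart[OF c] by (simp add: integral_distr, subst integral_density) (use d in auto)
  finally show "integral\<^sup>L \<mu> u = (\<integral>x. indicator (cdom c) x * (vdens c x * exp (- F (param c x)) * u (param c x)) \<partial>lborel)"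
    by (simp only: D)
  have "integrable \<mu> u \<longleftrightarrow> integrable vol w" unfolding weighted_volume_def
    by (subst integrable_density) (auto simp: w_def[abs_def])
  also have "\<dots> \<longleftrightarrow> integrable (density vol (\<lambda>p. ennreal (indicator (fst c) p))) w"
    by (subst (1) e, subst integrable_density) auto
  also have "\<dots> \<longleftrightarrow> integrable lborel (\<lambda>x. (indicator (cdom c) x * vdens c x) *\<^sub>R w (total_param c x))"
    unfolding vol_chart[OF c] by (simp add: integrable_distr_eq, subst integrable_density) (use d in auto)
  finally show "integrable \<mu> u \<longleftrightarrow> integrable lborel (\<lambda>x. indicator (cdom c) x * (vdens c x * exp (- F (param c x)) * u (param c x)))"
    by (simp only: D)
qed

end

section \<open>Green's formula\<close>

text \<open>By translation invariance the difference quotients have integral 0. They converge to the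
  partial derivative and are dominated by a constant on a fixed ball.\<close>

lemma integral_pd_eq_0:
  fixes w :: "real^'n \<Rightarrow> real"
  assumes w: "smooth_on UNIV w" and K: "compact K" and z: "\<And>x. x \<notin> K \<Longrightarrow> w x = 0"
  shows "(\<integral>x. pd i w x \<partial>lborel) = 0"
proof -
  define e where "e = (axis i 1 :: real^'n)"
  have ne: "norm e = 1" by (simp add: e_def)
  define D where "D = dird e w"
  have cont: "continuous_on UNIV w" "continuous_on UNIV D"
    unfolding D_def by (rule smooth_on_continuous w smooth_on_dird)+
  have mw: "w \<in> borel_measurable lborel" "D \<in> borel_measurable lborel"
    using cont by (auto intro: borel_measurable_continuous_onI)
  have der: "((\<lambda>t. w (x + t *\<^sub>R e)) has_real_derivative D (x + t *\<^sub>R e)) (at t)" for x t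
    unfolding D_def using has_vector_derivative_line[OF smooth_onD_differentiable[OF w]]
    by (simp add: has_real_derivative_iff_has_vector_derivative)
  have Dz: "D x = 0" if "x \<notin> K" for x
  proof -
    have "D x = dird e (\<lambda>x. 0) x" unfolding D_def
      by (rule dird_cong[of "- K"]) (use that z compact_imp_closed[OF K] in auto)
    then show ?thesis by (simp add: dird_const)
  qed
  have "bounded (D ` K)"
    by (rule compact_imp_bounded[OF compact_continuous_image[OF continuous_on_subset[OF cont(2)] K]]) simp
  then obtain M0 where M0: "\<And>x. x \<in> K \<Longrightarrow> \<bar>D x\<bar> \<le> M0" unfolding bounded_iff by auto
  define M where "M = max M0 0"
  have M: "\<bar>D x\<bar> \<le> M" "M \<ge> 0" for x using M0[of x] Dz[of x] by (cases "x \<in> K"; auto simp: M_def)+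
  obtain R where R: "\<And>x. x \<in> K \<Longrightarrow> norm x \<le> R" using compact_imp_bounded[OF K] unfolding bounded_iff by blast
  define s where "s n x = (w (x + (1 / Suc n) *\<^sub>R e) - w x) / (1 / Suc n)" for n :: nat and x
  have s_bound: "\<bar>s n x\<bar> \<le> M" for n x
  proof -
    have "\<exists>z>0. z < 1 / Suc n \<and> w (x + (1 / Suc n) *\<^sub>R e) - w (x + 0 *\<^sub>R e) = (1 / Suc n - 0) * D (x + z *\<^sub>R e)"
      by (rule MVT2) (auto intro: der)
    then obtain z where "w (x + (1 / Suc n) *\<^sub>R e) - w x = (1 / Suc n) * D (x + z *\<^sub>R e)" by auto
    then have "s n x = D (x + z *\<^sub>R e)" by (simp add: s_def)
    then show ?thesis using M(1) by simp
  qed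
  have iw: "integrable lborel w"
  proof -
    have "integrable lborel (\<lambda>x. indicator K x *\<^sub>R w x)"
      by (rule borel_integrable_compact[OF K continuous_on_subset[OF cont(1)]]) simp
    moreover have "(\<lambda>x. indicator K x *\<^sub>R w x) = w" using z by (auto simp: indicator_def fun_eq_iff)
    ultimately show ?thesis by simp
  qed
  have shift: "integrable lborel (\<lambda>x. w (x + a))" "(\<integral>x. w (x + a) \<partial>lborel) = (\<integral>x. w x \<partial>lborel)" for a
  proof -
    have m: "(+) a \<in> borel_measurable lborel" by simp
    show "(\<integral>x. w (x + a) \<partial>lborel) = (\<integral>x. w x \<partial>lborel)"
      using integral_distr[of "(+) a" lborel borel w] mw lborel_distr_plus[of a] by (simp add: add.commute)
    show "integrable lborel (\<lambda>x. w (x + a))"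
      using integrable_distr_eq[of "(+) a" lborel borel w] mw lborel_distr_plus[of a] iw by (simp add: add.commute)
  qed
  have int_s: "(\<integral>x. s n x \<partial>lborel) = 0" for n
    unfolding s_def using shift iw by simp
  have "(\<lambda>n. \<integral>x. s n x \<partial>lborel) \<longlonglongrightarrow> (\<integral>x. D x \<partial>lborel)"
  \<comment> \<open>The step sizes 1 / Suc n are at most 1, so all quotients vanish outside the ball
    of radius R + 1; \<open>M\<close> bounds them by the mean value theorem.\<close>
  proof (rule integral_dominated_convergence[where w="\<lambda>x. M * indicator (cball 0 (R + 1)) x"])
    show "D \<in> borel_measurable lborel" by (rule mw)
    show "s n \<in> borel_measurable lborel" for n unfolding s_def[abs_def]
      using borel_measurable_integrable[OF shift(1)] mw(1) by measurable
    show "integrable lborel (\<lambda>x::real^'n. M * indicator (cball 0 (R + 1)) x)"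
      by (intro integrable_mult_right integrable_real_indicator) (auto simp: emeasure_lborel_cball_finite[unfolded infinity_ennreal_def])
    show "AE x in lborel. (\<lambda>n. s n x) \<longlonglongrightarrow> D x"
    proof (rule AE_I2)
      fix x
      have "((\<lambda>h. (w (x + (0 + h) *\<^sub>R e) - w (x + 0 *\<^sub>R e)) / h) \<longlongrightarrow> D (x + 0 *\<^sub>R e)) (at 0)"
        using der[of x 0] unfolding DERIV_def .
      then have "((\<lambda>h. (w (x + h *\<^sub>R e) - w x) / h) \<longlongrightarrow> D x) (at 0)" by simp
      moreover have "filterlim (\<lambda>n. 1 / real (Suc n)) (at 0) sequentially"
        unfolding filterlim_at using LIMSEQ_Suc[OF lim_1_over_n] by (auto simp del: of_nat_Suc)
      ultimately show "(\<lambda>n. s n x) \<longlonglongrightarrow> D x" unfolding s_def by (rule filterlim_compose)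
    qed
    show "AE x in lborel. norm (s n x) \<le> M * indicator (cball 0 (R + 1)) x" for n
    proof (rule AE_I2)
      fix x
      show "norm (s n x) \<le> M * indicator (cball 0 (R + 1)) x"
      proof (cases "x \<in> cball 0 (R + 1)")
        case True then show ?thesis using s_bound by simp
      next
        case False
        then have n: "norm x > R + 1" by simp
        have "norm x \<le> norm (x + (1 / Suc n) *\<^sub>R e) + norm ((1 / Suc n) *\<^sub>R e)"
          using norm_triangle_ineq4[of "x + (1 / Suc n) *\<^sub>R e" "(1 / Suc n) *\<^sub>R e"] by simp
        moreover have "norm ((1 / Suc n) *\<^sub>R e) \<le> 1" by (simp add: ne)
        ultimately have "norm (x + (1 / Suc n) *\<^sub>R e) > R" using n by linarith
        then have "x + (1 / Suc n) *\<^sub>R e \<notin> K" "x \<notin> K" using R n by fastforce+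
        then show ?thesis using z M by (simp add: s_def)
      qed
    qed
  qed
  then have "(\<lambda>n. 0) \<longlonglongrightarrow> (\<integral>x. D x \<partial>lborel)" unfolding int_s .
  then have "(\<integral>x. D x \<partial>lborel) = 0" by (simp add: LIMSEQ_const_iff)
  then show ?thesis by (simp add: D_def e_def pd_eq_dird)
qed

lemma integral_pd_eq_0_on:
  fixes w :: "real^'n \<Rightarrow> real"
  assumes S: "open S" and w: "smooth_on S w" and K: "compact K" "K \<subseteq> S" and z: "\<And>x. x \<in> S - K \<Longrightarrow> w x = 0"
  shows "(\<integral>x. indicator S x * pd i w x \<partial>lborel) = 0"
    and "integrable lborel (\<lambda>x. indicator S x * pd i w x)"
proof -
  define v where "v x = (if x \<in> S then w x else 0)" for x
  have oK: "open (- K)" using compact_imp_closed[OF K(1)] by auto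
  have "smooth_on S v"
    by (rule smooth_on_cong[THEN iffD2, OF S _ w]) (simp add: v_def)
  moreover have "smooth_on (- K) v"
    by (rule smooth_on_cong[THEN iffD2, OF oK _ smooth_on_const[of _ 0]]) (use z in \<open>auto simp: v_def\<close>)
  moreover have "S \<union> - K = UNIV" using K by auto
  ultimately have v: "smooth_on UNIV v" using smooth_on_Un[OF S oK] by metis
  have vz: "v x = 0" if "x \<notin> K" for x using that z by (auto simp: v_def)
  have pz: "pd i v x = 0" if "x \<notin> K" for x
  proof -
    have "pd i v x = pd i (\<lambda>x. 0) x" unfolding pd_eq_dird
      by (rule dird_cong[OF oK]) (use that vz in auto)
    then show ?thesis by (simp add: pd_eq_dird dird_const)
  qed
  have e: "(\<lambda>x. indicator S x * pd i w x) = pd i v"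
  proof
    fix x
    show "indicator S x * pd i w x = pd i v x"
    proof (cases "x \<in> S")
      case True
      have "pd i v x = pd i w x" unfolding pd_eq_dird
        by (rule dird_cong[OF S True]) (simp add: v_def)
      then show ?thesis using True by simp
    qed (use pz K in auto)
  qed
  show "(\<integral>x. indicator S x * pd i w x \<partial>lborel) = 0"
    unfolding e by (rule integral_pd_eq_0[OF v K(1) vz])
  have "integrable lborel (\<lambda>x. indicator K x *\<^sub>R pd i v x)"
    by (rule borel_integrable_compact[OF K(1) continuous_on_subset[OF smooth_on_continuous[OF smooth_on_pd[OF v]]]]) simp
  moreover have "(\<lambda>x. indicator K x *\<^sub>R pd i v x) = pd i v" using pz by (auto simp: indicator_def fun_eq_iff)
  ultimately show "integrable lborel (\<lambda>x. indicator S x * pd i w x)" unfolding e by simp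
qed

context weighted_rmanifold
begin

lemma chart_support:
  assumes "chart_supported \<phi> c"
  shows "c \<in> \<B>" "compact (snd c ` closure {p. \<phi> p \<noteq> 0})" "snd c ` closure {p. \<phi> p \<noteq> 0} \<subseteq> cdom c"
    "x \<in> cdom c - snd c ` closure {p. \<phi> p \<noteq> 0} \<Longrightarrow> \<phi> (param c x) = 0"
    "p \<notin> fst c \<Longrightarrow> \<phi> p = 0"
proof -
  note s = assms[unfolded chart_supported_def]
  show c: "c \<in> \<B>" using s by simp
  show "compact (snd c ` closure {p. \<phi> p \<noteq> 0})"
    by (rule compact_continuous_image[OF continuous_on_subset[OF chart_cont(1)[OF c]]]) (use s in auto)
  show "snd c ` closure {p. \<phi> p \<noteq> 0} \<subseteq> cdom c" using s by auto
  show "\<phi> (param c x) = 0" if x: "x \<in> cdom c - snd c ` closure {p. \<phi> p \<noteq> 0}"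
  proof (rule ccontr)
    assume "\<phi> (param c x) \<noteq> 0"
    then have "param c x \<in> closure {p. \<phi> p \<noteq> 0}" using closure_subset[of "{p. \<phi> p \<noteq> 0}"] by auto
    then have "snd c (param c x) \<in> snd c ` closure {p. \<phi> p \<noteq> 0}" by (rule imageI)
    then show False using x c by simp
  qed
  show "\<phi> p = 0" if p: "p \<notin> fst c"
  proof (rule ccontr)
    assume "\<phi> p \<noteq> 0"
    then have "p \<in> closure {p. \<phi> p \<noteq> 0}" using closure_subset[of "{p. \<phi> p \<noteq> 0}"] by auto
    then show False using s p by (meson subsetD)
  qed
qed

lemma integrable_chart_supported:
  assumes g: "continuous_on UNIV g" and \<phi>: "smooth \<phi>" "chart_supported \<phi> c"
  shows "integrable \<mu> (\<lambda>p. g p * \<phi> p)"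
proof -
  note s = chart_support[OF \<phi>(2)]
  define K where "K = snd c ` closure {p. \<phi> p \<noteq> 0}"
  have m: "(\<lambda>p. g p * \<phi> p) \<in> borel_measurable borel"
    by (intro borel_measurable_continuous_onI continuous_intros g smooth_continuous \<phi>)
  have "continuous_on (cdom c) (\<lambda>x. vdens c x * exp (- F (param c x)) * (g (param c x) * \<phi> (param c x)))"
    by (intro continuous_intros smooth_on_continuous[OF smooth_on_vdens] smooth_on_continuous[OF smoothD] F \<phi> s(1)
        continuous_on_compose2[OF g chart_cont(2)[OF s(1)]]) auto
  then have "integrable lborel (\<lambda>x. indicator K x *\<^sub>R (vdens c x * exp (- F (param c x)) * (g (param c x) * \<phi> (param c x))))"
    unfolding K_def by (intro borel_integrable_compact[OF s(2)] continuous_on_subset[OF _ s(3)])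
  moreover have "(\<lambda>x. indicator K x *\<^sub>R (vdens c x * exp (- F (param c x)) * (g (param c x) * \<phi> (param c x))))
    = (\<lambda>x. indicator (cdom c) x * (vdens c x * exp (- F (param c x)) * (g (param c x) * \<phi> (param c x))))"
    using s(3,4) by (auto simp: fun_eq_iff K_def split: split_indicator)
  ultimately show ?thesis using integral_chart(2)[OF s(1) m] s(5) by simp
qed

lemma integrable_compact_support:
  assumes g: "continuous_on UNIV g" and v: "smooth v" "compact (closure {p. v p \<noteq> 0})"
  shows "integrable \<mu> (\<lambda>p. g p * v p)"
proof (rule smooth_compact_decomposition[OF v])
  fix I :: "'b set" and w c
  assume w: "finite I" "\<And>i. i \<in> I \<Longrightarrow> smooth (w i)"
    "\<And>i. i \<in> I \<Longrightarrow> chart_supported (w i) (c i)" "\<And>p. v p = (\<Sum>i\<in>I. w i p)"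
  have "integrable \<mu> (\<lambda>p. \<Sum>i\<in>I. g p * w i p)"
    by (rule Bochner_Integration.integrable_sum) (rule integrable_chart_supported[OF g w(2,3)])
  then show ?thesis by (simp add: w(4) sum_distrib_left)
qed

definition chart_laplacian :: "('b, 'n) chart \<Rightarrow> ('b \<Rightarrow> real) \<Rightarrow> real^'n \<Rightarrow> real" where
  "chart_laplacian c u = weighted_laplacian (h c) (\<lambda>x. F (param c x)) (\<lambda>x. u (param c x))"

lemma smooth_on_grad: "smooth u \<Longrightarrow> c \<in> \<B> \<Longrightarrow> smooth_on (cdom c) (grad (h c) (\<lambda>x. u (param c x)))"
  unfolding grad_def[abs_def]
  by (intro smooth_on_mult_vec smooth_on_matrix_inv smooth_on_vec smooth_on_pd smoothD chartD(2)
      metric_onD(2)[OF metric_on_chart] posdef_det posdef_h)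

lemma smooth_on_flux:
  "smooth u \<Longrightarrow> c \<in> \<B> \<Longrightarrow> smooth_on (cdom c) (\<lambda>y. vdens c y * grad (h c) (\<lambda>x. u (param c x)) y $ i)"
  by (intro smooth_on_mult smooth_on_vdens smooth_on_nth smooth_on_grad chartD(2))

lemma chart_laplacian_eq:
  "chart_laplacian c u x = (\<Sum>i\<in>UNIV. pd i (\<lambda>y. vdens c y * grad (h c) (\<lambda>x. u (param c x)) y $ i) x) / vdens c x
     - ip (h c x) (grad (h c) (\<lambda>x. F (param c x)) x) (grad (h c) (\<lambda>x. u (param c x)) x)"
  by (simp add: chart_laplacian_def weighted_laplacian_def laplacian_def diverg_def vdens_def)

lemma smooth_on_chart_laplacian: "smooth u \<Longrightarrow> c \<in> \<B> \<Longrightarrow> smooth_on (cdom c) (chart_laplacian c u)"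
  unfolding chart_laplacian_eq[abs_def]
  by (intro smooth_on_diff smooth_on_divide smooth_on_sum smooth_on_pd smooth_on_flux smooth_on_vdens
      smooth_on_ip smooth_on_grad F metric_onD(2)[OF metric_on_chart] chartD(2) vdens_pos)

text \<open>Multiplied by the weighted density, the sum of both integrands is the Euclidean
  divergence of a compactly supported field, whose integral vanishes.\<close>

lemma Green_chart:
  assumes \<phi>: "smooth \<phi>" "chart_supported \<phi> c" and u: "smooth u"
  shows "integrable \<mu> (\<lambda>p. if p \<in> fst c then \<phi> p * chart_laplacian c u (snd c p) else 0)"
    and "integrable \<mu> (gip \<phi> u)"
    and "(\<integral>p. (if p \<in> fst c then \<phi> p * chart_laplacian c u (snd c p) else 0) \<partial>\<mu>) = - (\<integral>p. gip \<phi> u p \<partial>\<mu>)"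
proof -
  note s = chart_support[OF \<phi>(2)]
  note c = s(1)
  define K where "K = snd c ` closure {p. \<phi> p \<noteq> 0}"
  have K: "compact K" "K \<subseteq> cdom c" unfolding K_def by (rule s)+
  have \<phi>K: "\<phi> (param c x) = 0" if "x \<in> cdom c - K" for x using s(4) that by (simp add: K_def)
  define \<Phi> where "\<Phi> x = \<phi> (param c x)" for x
  define E where "E x = exp (- F (param c x))" for x
  define gr where "gr x = grad (h c) (\<lambda>x. u (param c x)) x" for x
  have smE: "smooth_on (cdom c) E" unfolding E_def[abs_def]
    by (intro smooth_on_exp smooth_on_uminus smoothD F c chartD(2))
  have smP: "smooth_on (cdom c) \<Phi>" unfolding \<Phi>_def[abs_def] by (rule smoothD[OF \<phi>(1) c])
  have smFl: "smooth_on (cdom c) (\<lambda>y. vdens c y * gr y $ i)" for i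
    unfolding gr_def by (rule smooth_on_flux[OF u c])
  \<comment> \<open>In the divergence of this field, differentiating the metric factor with the
    gradient yields the Laplacian, differentiating exp(-F) the drift term, and differentiating
    \<phi> the inner product \<open>gip \<phi> u\<close>.\<close>
  define W where "W i x = (E x * \<Phi> x) * (vdens c x * gr x $ i)" for i x
  have smW: "smooth_on (cdom c) (W i)" for i unfolding W_def[abs_def]
    by (intro smooth_on_mult smE smP smFl chartD(2)[OF c])
  have gipz: "gip \<phi> u p = 0" if "p \<notin> closure {p. \<phi> p \<noteq> 0}" for p
  proof -
    define d where "d = chart_at \<B> p"
    have d: "d \<in> \<B>" "p \<in> fst d" using chart_at by (auto simp: d_def)
    define T where "T = snd d ` (fst d - closure {p. \<phi> p \<noteq> 0})"
    have oT: "open T" unfolding T_def by (rule open_snd_image[OF d(1)]) (use chartD(1)[OF d(1)] in auto)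
    have pT: "snd d p \<in> T" using d that by (auto simp: T_def)
    have zT: "\<phi> (param d y) = 0" if y: "y \<in> T" for y
    proof -
      obtain q where q: "y = snd d q" "q \<in> fst d" "q \<notin> closure {p. \<phi> p \<noteq> 0}" using y unfolding T_def by blast
      then have "\<phi> q = 0" using closure_subset[of "{p. \<phi> p \<noteq> 0}"] by auto
      then show ?thesis by (simp add: q d)
    qed
    have "dird v (\<lambda>x. \<phi> (param d x)) (snd d p) = dird v (\<lambda>x. 0) (snd d p)" for v
      by (rule dird_cong[OF oT pT zT])
    then show ?thesis by (simp add: gip_dird[OF \<phi>(1) u d] dird_const)
  qed
  define k where "k p = (if p \<in> fst c then \<phi> p * chart_laplacian c u (snd c p) else 0)" for p
  have smk: "smooth k" unfolding k_def[abs_def]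
  proof -
    have "smooth (\<lambda>p. if p \<in> fst c then \<Phi> (snd c p) * chart_laplacian c u (snd c p) else 0)"
    proof (rule smooth_extend[OF c _ K])
      show "smooth_on (cdom c) (\<lambda>x. \<Phi> x * chart_laplacian c u x)"
        by (intro smooth_on_mult smP smooth_on_chart_laplacian u c chartD(2))
    qed (use \<phi>K in \<open>auto simp: \<Phi>_def\<close>)
    moreover have "(\<lambda>p. if p \<in> fst c then \<Phi> (snd c p) * chart_laplacian c u (snd c p) else 0)
      = (\<lambda>p. if p \<in> fst c then \<phi> p * chart_laplacian c u (snd c p) else 0)"
      by (auto simp: \<Phi>_def c fun_eq_iff)
    ultimately show "smooth (\<lambda>p. if p \<in> fst c then \<phi> p * chart_laplacian c u (snd c p) else 0)" by simp
  qed
  have bm: "k \<in> borel_measurable borel" "gip \<phi> u \<in> borel_measurable borel"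
    by (intro borel_measurable_continuous_onI smooth_continuous smk continuous_gip \<phi> u)+
  have out: "k p = 0" "gip \<phi> u p = 0" if "p \<notin> fst c" for p
    using that gipz[of p] \<phi>(2) by (auto simp: k_def chart_supported_def)
  have int: "integrable \<mu> g" if g: "continuous_on UNIV g" "\<And>p. p \<notin> closure {p. \<phi> p \<noteq> 0} \<Longrightarrow> g p = 0" for g :: "'b \<Rightarrow> real"
  proof -
    have m: "g \<in> borel_measurable borel" by (rule borel_measurable_continuous_onI[OF g(1)])
    have gz: "g p = 0" if "p \<notin> fst c" for p using that g(2)[of p] \<phi>(2) by (auto simp: chart_supported_def)
    have "continuous_on (cdom c) (\<lambda>x. vdens c x * exp (- F (param c x)) * g (param c x))"
      by (intro continuous_intros smooth_on_continuous[OF smooth_on_vdens] smooth_on_continuous[OF smoothD] F c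
          continuous_on_compose2[OF g(1) chart_cont(2)[OF c]]) auto
    then have "integrable lborel (\<lambda>x. indicator K x *\<^sub>R (vdens c x * exp (- F (param c x)) * g (param c x)))"
      by (intro borel_integrable_compact[OF K(1)] continuous_on_subset[OF _ K(2)])
    moreover have "(\<lambda>x. indicator K x *\<^sub>R (vdens c x * exp (- F (param c x)) * g (param c x)))
      = (\<lambda>x. indicator (cdom c) x * (vdens c x * exp (- F (param c x)) * g (param c x)))"
    proof
      fix x
      have "g (param c x) = 0" if x: "x \<in> cdom c" "x \<notin> K"
      proof (rule g(2))
        show "param c x \<notin> closure {p. \<phi> p \<noteq> 0}"
        proof
          assume "param c x \<in> closure {p. \<phi> p \<noteq> 0}"
          then have "snd c (param c x) \<in> K" unfolding K_def by (rule imageI)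
          then show False using x c by simp
        qed
      qed
      then show "indicator K x *\<^sub>R (vdens c x * exp (- F (param c x)) * g (param c x))
        = indicator (cdom c) x * (vdens c x * exp (- F (param c x)) * g (param c x))"
        using K(2) by (auto split: split_indicator)
    qed
    ultimately show ?thesis using integral_chart(2)[OF c m gz] by simp
  qed
  have kz: "k p = 0" if "p \<notin> closure {p. \<phi> p \<noteq> 0}" for p
    using that closure_subset[of "{p. \<phi> p \<noteq> 0}"] by (auto simp: k_def)
  show ik: "integrable \<mu> (\<lambda>p. if p \<in> fst c then \<phi> p * chart_laplacian c u (snd c p) else 0)"
    using int[OF smooth_continuous[OF smk] kz] by (simp add: k_def[abs_def])
  show ig: "integrable \<mu> (gip \<phi> u)" by (rule int[OF continuous_gip[OF \<phi>(1) u] gipz])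
  have div: "(\<Sum>i\<in>UNIV. pd i (W i) x) = vdens c x * exp (- F (param c x)) * (k (param c x) + gip \<phi> u (param c x))"
    if x: "x \<in> cdom c" for x
  proof -
    have p: "param c x \<in> fst c" "snd c (param c x) = x" using c x by auto
    have dE: "E differentiable (at x)" and dP: "\<Phi> differentiable (at x)"
      and dF: "(\<lambda>y. vdens c y * gr y $ i) differentiable (at x)" for i
      using smooth_onD_differentiable[OF smE x] smooth_onD_differentiable[OF smP x] smooth_onD_differentiable[OF smFl x]
      by auto
    have dEP: "(\<lambda>y. E y * \<Phi> y) differentiable (at x)" using dE dP by (rule differentiable_mult)
    have 1: "pd i (W i) x = (E x * \<Phi> x) * pd i (\<lambda>y. vdens c y * gr y $ i) x + pd i (\<lambda>y. E y * \<Phi> y) x * (vdens c x * gr x $ i)" for i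
      unfolding W_def[abs_def] pd_eq_dird
      by (rule dird_eqI[OF has_derivative_mult[OF has_derivative_dird[OF dEP] has_derivative_dird[OF dF]]])
    have "(\<Sum>i\<in>UNIV. pd i (\<lambda>y. E y * \<Phi> y) x * (vdens c x * gr x $ i)) = vdens c x * dird (gr x) (\<lambda>y. E y * \<Phi> y) x"
      by (simp add: dird_expand[OF dEP] sum_distrib_left mult_ac)
    also have "dird (gr x) (\<lambda>y. E y * \<Phi> y) x = E x * dird (gr x) \<Phi> x + dird (gr x) E x * \<Phi> x"
      by (rule dird_eqI[OF has_derivative_mult[OF has_derivative_dird[OF dE] has_derivative_dird[OF dP]]])
    also have "dird (gr x) E x = - E x * dird (gr x) (\<lambda>x. F (param c x)) x"
    proof -
      have "((\<lambda>x. - F (param c x)) has_derivative (\<lambda>v. - dird v (\<lambda>x. F (param c x)) x)) (at x)"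
        by (intro has_derivative_minus has_derivative_dird diff_chart F c x)
      from dird_eqI[OF has_derivative_exp[OF this]] show ?thesis by (simp add: E_def[abs_def])
    qed
    also have "dird (gr x) (\<lambda>x. F (param c x)) x = ip (h c x) (grad (h c) (\<lambda>x. F (param c x)) x) (gr x)"
      by (rule ip_grad[OF c x diff_chart[OF F c x], symmetric])
    also have "dird (gr x) \<Phi> x = gip \<phi> u (param c x)"
      using gip_dird[OF \<phi>(1) u c p(1)] by (simp add: p gr_def \<Phi>_def[abs_def])
    finally have 2: "(\<Sum>i\<in>UNIV. pd i (\<lambda>y. E y * \<Phi> y) x * (vdens c x * gr x $ i))
      = vdens c x * (E x * gip \<phi> u (param c x) + - E x * ip (h c x) (grad (h c) (\<lambda>x. F (param c x)) x) (gr x) * \<Phi> x)" .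
    have 3: "(\<Sum>i\<in>UNIV. pd i (\<lambda>y. vdens c y * gr y $ i) x)
      = vdens c x * (chart_laplacian c u x + ip (h c x) (grad (h c) (\<lambda>x. F (param c x)) x) (gr x))"
      using vdens_pos[OF c x] by (simp add: chart_laplacian_eq gr_def)
    have "(\<Sum>i\<in>UNIV. pd i (W i) x) = (E x * \<Phi> x) * (\<Sum>i\<in>UNIV. pd i (\<lambda>y. vdens c y * gr y $ i) x)
       + (\<Sum>i\<in>UNIV. pd i (\<lambda>y. E y * \<Phi> y) x * (vdens c x * gr x $ i))"
      unfolding 1 by (simp add: sum.distrib sum_distrib_left)
    also have "\<dots> = vdens c x * E x * (\<Phi> x * chart_laplacian c u x + gip \<phi> u (param c x))"
      unfolding 2 3 by (simp add: algebra_simps)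
    finally show ?thesis using p by (simp add: k_def E_def \<Phi>_def)
  qed
  have Wz: "W i x = 0" if "x \<in> cdom c - K" for i x using \<phi>K[OF that] by (simp add: W_def \<Phi>_def)
  have "(\<integral>p. k p + gip \<phi> u p \<partial>\<mu>)
    = (\<integral>x. indicator (cdom c) x * (vdens c x * exp (- F (param c x)) * (k (param c x) + gip \<phi> u (param c x))) \<partial>lborel)"
    by (rule integral_chart(1)[OF c]) (use bm out in auto)
  also have "\<dots> = (\<integral>x. (\<Sum>i\<in>UNIV. indicator (cdom c) x * pd i (W i) x) \<partial>lborel)"
    by (rule Bochner_Integration.integral_cong) (auto simp: div sum_distrib_left[symmetric] split: split_indicator)
  also have "\<dots> = (\<Sum>i\<in>UNIV. \<integral>x. indicator (cdom c) x * pd i (W i) x \<partial>lborel)"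
    by (rule Bochner_Integration.integral_sum) (rule integral_pd_eq_0_on(2)[OF chartD(2)[OF c] smW K Wz])
  also have "\<dots> = 0"
    by (intro sum.neutral ballI integral_pd_eq_0_on(1)[OF chartD(2)[OF c] smW K Wz])
  finally have "(\<integral>p. k p + gip \<phi> u p \<partial>\<mu>) = 0" .
  moreover have "(\<integral>p. k p + gip \<phi> u p \<partial>\<mu>) = (\<integral>p. k p \<partial>\<mu>) + (\<integral>p. gip \<phi> u p \<partial>\<mu>)"
    by (rule Bochner_Integration.integral_add) (use ik ig in \<open>auto simp: k_def[abs_def]\<close>)
  ultimately show "(\<integral>p. (if p \<in> fst c then \<phi> p * chart_laplacian c u (snd c p) else 0) \<partial>\<mu>) = - (\<integral>p. gip \<phi> u p \<partial>\<mu>)"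
    by (simp add: k_def[abs_def])
qed

end

context weighted_rmanifold
begin

section \<open>Chart independence of the weighted Laplacian\<close>

text \<open>In a chart the volume density and the weight are both positive, so a nonempty null open
  set would have a nonempty open image of Lebesgue measure zero.\<close>

lemma open_null_empty:
  assumes W: "open W" and null: "emeasure \<mu> W = 0" shows "W = {}"
proof (rule ccontr)
  assume "W \<noteq> {}"
  then obtain p where p: "p \<in> W" by blast
  define c where "c = chart_at \<B> p"
  have c: "c \<in> \<B>" "p \<in> fst c" using chart_at by (auto simp: c_def)
  define V where "V = W \<inter> fst c"
  have oV: "open V" unfolding V_def using W chartD(1)[OF c(1)] by auto
  have bV [measurable]: "V \<in> sets borel" using oV by simp
  have "emeasure \<mu> V \<le> emeasure \<mu> W" by (rule emeasure_mono) (use W in \<open>auto simp: V_def\<close>)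
  then have "(\<integral>\<^sup>+q. ennreal (exp (- F q)) * indicator V q \<partial>vol) = 0"
    using null bV unfolding weighted_volume_def by (subst (asm) (1) emeasure_density) (auto simp: vol)
  then have "AE q in vol. ennreal (exp (- F q)) * indicator V q = 0"
    by (subst (asm) nn_integral_0_iff_AE) auto
  then have "AE q in vol. q \<notin> V" by eventually_elim (auto split: split_indicator_asm)
  then have "emeasure vol V = 0"
    using AE_iff_null_sets[of V vol] bV by (simp add: vol null_sets_def)
  then have "(\<integral>\<^sup>+x. ennreal (vdens c x) * indicator (snd c ` V) x \<partial>lborel) = 0"
    using vol(2)[OF c(1) bV] by (simp add: V_def chart_volume_def)
  moreover have T: "open (snd c ` V)" "snd c ` V \<subseteq> cdom c"
    using open_snd_image[OF c(1) oV] by (auto simp: V_def)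
  have "(\<lambda>x. ennreal (vdens c x) * indicator (snd c ` V) x) \<in> borel_measurable borel"
    by (rule borel_indicator_continuous[OF _ continuous_on_subset[OF smooth_on_continuous[OF smooth_on_vdens[OF c(1)]] T(2)]])
      (use T(1) in simp)
  ultimately have "AE x in lborel. ennreal (vdens c x) * indicator (snd c ` V) x = 0"
    by (subst (asm) nn_integral_0_iff_AE) auto
  then have "AE x in lborel. x \<notin> snd c ` V"
  proof eventually_elim
    fix x assume 0: "ennreal (vdens c x) * indicator (snd c ` V) x = 0"
    show "x \<notin> snd c ` V"
    proof
      assume x: "x \<in> snd c ` V"
      then have "vdens c x > 0" using vdens_pos[OF c(1)] T(2) by blast
      then show False using 0 x by simp
    qed
  qed
  then have "snd c ` V \<in> null_sets lborel" using AE_iff_null_sets[of "snd c ` V" lborel] T(1) by simp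
  then have "negligible (snd c ` V)"
    by (simp add: negligible_iff_null_sets null_sets_completionI)
  then show False using open_not_negligible[OF T(1)] p c by (auto simp: V_def)
qed

text \<open>If one chart expression were larger at \<open>p\<close>, it would be larger on a
  neighbourhood. Tested against a bump supported there, both chart versions of Green's formula have
  the same right side, yet the difference of the integrands is nonnegative and positive near
  \<open>p\<close>.\<close>

lemma chart_laplacian_le:
  assumes u: "smooth u" and c: "c \<in> \<B>" "p \<in> fst c" and c': "c' \<in> \<B>" "p \<in> fst c'"
  shows "chart_laplacian c u (snd c p) \<le> chart_laplacian c' u (snd c' p)"
proof (rule ccontr)
  assume neg: "\<not> chart_laplacian c u (snd c p) \<le> chart_laplacian c' u (snd c' p)"
  define D where "D q = chart_laplacian c u (snd c q) - chart_laplacian c' u (snd c' q)" for q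
  have cL: "continuous_on (fst d) (\<lambda>q. chart_laplacian d u (snd d q))" if "d \<in> \<B>" for d
    by (rule continuous_on_compose2[OF smooth_on_continuous[OF smooth_on_chart_laplacian[OF u that]] chart_cont(1)[OF that]])
      auto
  define Ov where "Ov = fst c \<inter> fst c'"
  have oO: "open Ov" unfolding Ov_def using c c' chartD(1) by blast
  have "continuous_on Ov D" unfolding D_def Ov_def
    by (intro continuous_on_diff continuous_on_subset[OF cL[OF c(1)]] continuous_on_subset[OF cL[OF c'(1)]]) auto
  then have oD: "open (D -` {0<..} \<inter> Ov)"
    using continuous_on_open_vimage[THEN iffD1, OF oO, rule_format, of D "{0<..}"] by simp
  define W where "W = D -` {0<..} \<inter> Ov"
  have "D p > 0" using neg by (simp add: D_def)
  then have pW: "p \<in> W" using c(2) c'(2) by (simp add: W_def Ov_def)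
  note W = W_def oD[folded W_def] pW
  show False
  proof (rule bump_exists[OF W(2,3) c])
    fix b K assume b: "smooth b" "\<And>q. 0 \<le> b q" "\<And>q. b q \<le> 1" "b p = 1" "compact K"
      "closure {q. b q \<noteq> 0} \<subseteq> K" "K \<subseteq> W \<inter> fst c"
    have comp: "compact (closure {q. b q \<noteq> 0})"
      using compact_Int_closed[OF b(5) closed_closure, of "{q. b q \<noteq> 0}"] b(6) by (simp add: Int_absorb1)
    have s: "chart_supported b c" "chart_supported b c'"
    proof -
      have "closure {q. b q \<noteq> 0} \<subseteq> fst c" "closure {q. b q \<noteq> 0} \<subseteq> fst c'"
        using b(6,7) unfolding W(1) Ov_def by blast+
      then show "chart_supported b c" "chart_supported b c'"
        unfolding chart_supported_def using comp c(1) c'(1) by blast+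
    qed
    define k where "k d q = (if q \<in> fst d then b q * chart_laplacian d u (snd d q) else 0)" for d q
    have ik: "integrable \<mu> (k c)" "integrable \<mu> (k c')" "(\<integral>q. k c q \<partial>\<mu>) = (\<integral>q. k c' q \<partial>\<mu>)"
      using Green_chart[OF b(1) s(1) u] Green_chart[OF b(1) s(2) u] by (simp_all add: k_def[abs_def])
    have kz: "k c q - k c' q = 0" if "q \<notin> W" for q
    proof -
      have "b q = 0" using that b(6,7) closure_subset[of "{q. b q \<noteq> 0}"] by blast
      then show ?thesis by (simp add: k_def)
    qed
    have kW: "k c q - k c' q = b q * D q" if "q \<in> W" for q
      using that by (auto simp: k_def D_def W(1) Ov_def algebra_simps)
    have nn: "k c q - k c' q \<ge> 0" for q
    proof (cases "q \<in> W")
      case True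
      then have "D q > 0" by (simp add: W(1))
      then show ?thesis using kW[OF True] b(2) by simp
    qed (simp add: kz)
    have "integrable \<mu> (\<lambda>q. k c q - k c' q)" "(\<integral>q. k c q - k c' q \<partial>\<mu>) = 0"
      using ik by simp_all
    then have AE0: "AE q in \<mu>. k c q - k c' q = 0"
      using integral_nonneg_eq_0_iff_AE[of \<mu> "\<lambda>q. k c q - k c' q"] nn by simp
    define V where "V = W \<inter> {q. 0 < b q}"
    have oV: "open V" unfolding V_def
      by (intro open_Int W open_Collect_less continuous_on_const smooth_continuous b)
    have "AE q in \<mu>. q \<notin> V"
      using AE0
    proof eventually_elim
      fix q assume 0: "k c q - k c' q = 0"
      show "q \<notin> V"
      proof
        assume q: "q \<in> V"
        then have "b q * D q > 0" by (auto simp: V_def W(1))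
        then show False using kW[of q] q 0 by (simp add: V_def)
      qed
    qed
    then have "emeasure \<mu> V = 0"
      using AE_iff_null_sets[of V \<mu>] oV by (simp add: null_sets_def)
    then have "V = {}" by (rule open_null_empty[OF oV])
    then show False using W(3) b(4) by (auto simp: V_def)
  qed
qed

lemma chart_laplacian_unique:
  assumes "smooth u" "c \<in> \<B>" "p \<in> fst c" "c' \<in> \<B>" "p \<in> fst c'"
  shows "chart_laplacian c u (snd c p) = chart_laplacian c' u (snd c' p)"
  using chart_laplacian_le[of u c p c'] chart_laplacian_le[of u c' p c] assms by simp

definition lap :: "('b \<Rightarrow> real) \<Rightarrow> 'b \<Rightarrow> real" where
  "lap u p = chart_laplacian (chart_at \<B> p) u (snd (chart_at \<B> p) p)"

lemma lap_chart: "smooth u \<Longrightarrow> c \<in> \<B> \<Longrightarrow> p \<in> fst c \<Longrightarrow> lap u p = chart_laplacian c u (snd c p)"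
  unfolding lap_def by (rule chart_laplacian_unique) (auto intro: chart_at)

text \<open>\<open>smooth_compact_decomposition\<close> writes \<open>v\<close> as a finite sum of
  functions supported in charts, and both sides are linear in \<open>v\<close>.\<close>

theorem Green:
  assumes v: "smooth v" "compact (closure {p. v p \<noteq> 0})" and u: "smooth u"
  shows "integrable \<mu> (\<lambda>p. v p * lap u p)" "integrable \<mu> (gip v u)"
    "(\<integral>p. v p * lap u p \<partial>\<mu>) = - (\<integral>p. gip v u p \<partial>\<mu>)"
proof -
  have "integrable \<mu> (\<lambda>p. v p * lap u p) \<and> integrable \<mu> (gip v u)
    \<and> (\<integral>p. v p * lap u p \<partial>\<mu>) = - (\<integral>p. gip v u p \<partial>\<mu>)"
  proof (rule smooth_compact_decomposition[OF v])
    fix I :: "'b set" and w c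
    assume w: "finite I" "\<And>i. i \<in> I \<Longrightarrow> smooth (w i)"
      "\<And>i. i \<in> I \<Longrightarrow> chart_supported (w i) (c i)" "\<And>p. v p = (\<Sum>i\<in>I. w i p)"
    have v_eq: "v = (\<lambda>p. \<Sum>i\<in>I. w i p)" using w(4) by auto
    have e: "(\<lambda>p. if p \<in> fst (c i) then w i p * chart_laplacian (c i) u (snd (c i) p) else 0) = (\<lambda>p. w i p * lap u p)"
      if "i \<in> I" for i
      using chart_support(1,5)[OF w(3)[OF that]] lap_chart[OF u, of "c i"] by (auto simp: fun_eq_iff)
    have 1: "(\<lambda>p. v p * lap u p) = (\<lambda>p. \<Sum>i\<in>I. w i p * lap u p)"
      by (simp add: v_eq sum_distrib_right)
    have 2: "gip v u = (\<lambda>p. \<Sum>i\<in>I. gip (w i) u p)"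
      unfolding v_eq by (rule ext) (rule gip_sum_left[OF w(2) u])
    have G1: "integrable \<mu> (\<lambda>p. w i p * lap u p)" and G2: "integrable \<mu> (gip (w i) u)"
      and G3: "(\<integral>p. w i p * lap u p \<partial>\<mu>) = - (\<integral>p. gip (w i) u p \<partial>\<mu>)" if "i \<in> I" for i
      using Green_chart[OF w(2)[OF that] w(3)[OF that] u] unfolding e[OF that] by auto
    show ?thesis unfolding 1 2
      by (auto intro!: G1 G2 simp: Bochner_Integration.integral_sum G1 G2 G3 sum_negf)
  qed
  then show "integrable \<mu> (\<lambda>p. v p * lap u p)" "integrable \<mu> (gip v u)"
    "(\<integral>p. v p * lap u p \<partial>\<mu>) = - (\<integral>p. gip v u p \<partial>\<mu>)" by auto
qed

end

section \<open>Curves and distance\<close>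

context rmanifold
begin

text \<open>\<open>\<gamma>\<close> is \<open>C\<^sup>1\<close> near \<open>t\<close>. Being local, this is easier to transport along reparametrizations and
  concatenations than \<open>piecewise_C1_curve\<close>.\<close>
definition C1_near :: "(real \<Rightarrow> 'b) \<Rightarrow> real \<Rightarrow> bool" where
  "C1_near \<gamma> t \<longleftrightarrow> (\<exists>c\<in>\<B>. \<exists>N. open N \<and> t \<in> N \<and> \<gamma> ` N \<subseteq> fst c \<and> (snd c \<circ> \<gamma>) C1_differentiable_on N)"

text \<open>The chain rule with the transition map. Continuity of \<open>\<gamma>\<close> has to be
  recovered first, from its chart expression, so that the curve stays in the second chart for nearby
  times.\<close>

lemma C1_near_chart:
  assumes "C1_near \<gamma> t" and c': "c' \<in> \<B>" "\<gamma> t \<in> fst c'"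
  obtains N where "open N" "t \<in> N" "\<gamma> ` N \<subseteq> fst c'" "(snd c' \<circ> \<gamma>) C1_differentiable_on N"
proof -
  obtain c N where c: "c \<in> \<B>" and N: "open N" "t \<in> N" "\<gamma> ` N \<subseteq> fst c" "(snd c \<circ> \<gamma>) C1_differentiable_on N"
    using assms(1) unfolding C1_near_def by metis
  obtain D where D: "\<And>s. s \<in> N \<Longrightarrow> ((snd c \<circ> \<gamma>) has_vector_derivative D s) (at s)" "continuous_on N D"
    using N(4) unfolding C1_differentiable_on_def by blast
  have cs: "continuous_on N (snd c \<circ> \<gamma>)"
    by (rule continuous_at_imp_continuous_on) (use D(1) has_vector_derivative_continuous in blast)
  have "continuous_on N (\<lambda>s. param c ((snd c \<circ> \<gamma>) s))"
    by (rule continuous_on_compose2[OF chart_cont(2)[OF c] cs]) (use N(3) c in \<open>auto simp: image_subset_iff\<close>)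
  then have cg: "continuous_on N \<gamma>"
    by (rule continuous_on_eq) (use N(3) c in \<open>auto simp: image_subset_iff\<close>)
  define N' where "N' = \<gamma> -` fst c' \<inter> N"
  have oN': "open N'" unfolding N'_def
    using continuous_on_open_vimage[THEN iffD1, OF N(1), rule_format, OF cg chartD(1)[OF c'(1)]] .
  define \<tau> where "\<tau> = transition c c'"
  have ov: "snd c (\<gamma> s) \<in> overlap c c'" if "s \<in> N'" for s
    using that N(3) by (intro overlap_snd) (auto simp: N'_def)
  define D' where "D' s = (\<Sum>i\<in>UNIV. D s $ i *\<^sub>R pd i \<tau> (snd c (\<gamma> s)))" for s
  have der: "((snd c' \<circ> \<gamma>) has_vector_derivative D' s) (at s)" if s: "s \<in> N'" for s
  proof -
    have d\<tau>: "\<tau> differentiable (at (snd c (\<gamma> s)))"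
      unfolding \<tau>_def by (rule smooth_onD_differentiable[OF smooth_transition[OF c c'(1)] ov[OF s]])
    have "((snd c \<circ> \<gamma>) has_derivative (\<lambda>r. r *\<^sub>R D s)) (at s)"
      using D(1) s by (simp add: N'_def has_vector_derivative_def)
    from has_derivative_compose[OF this, of \<tau> "\<lambda>v. dird v \<tau> (snd c (\<gamma> s))"] has_derivative_dird[OF d\<tau>]
    have "((\<lambda>s. \<tau> ((snd c \<circ> \<gamma>) s)) has_derivative (\<lambda>r. dird (r *\<^sub>R D s) \<tau> (snd c (\<gamma> s)))) (at s)" by simp
    then have 1: "((\<lambda>s. \<tau> ((snd c \<circ> \<gamma>) s)) has_vector_derivative D' s) (at s)"
      unfolding has_vector_derivative_def D'_def dird_expand[OF d\<tau>, symmetric] linear_cmul[OF dird_linear[OF d\<tau>]] .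
    show ?thesis
      by (rule has_vector_derivative_transform_within_open[OF 1 oN' s]) (use N(3) c in \<open>auto simp: \<tau>_def N'_def image_subset_iff\<close>)
  qed
  have "continuous_on N' (pd i \<tau> \<circ> (snd c \<circ> \<gamma>))" for i
    by (rule continuous_on_compose[OF continuous_on_subset[OF cs] continuous_on_subset[OF smooth_on_continuous[OF smooth_on_pd[OF smooth_transition[OF c c'(1)]]]], folded \<tau>_def])
      (use ov in \<open>auto simp: N'_def\<close>)
  then have "continuous_on N' D'" unfolding D'_def o_def
    by (intro continuous_intros continuous_on_subset[OF D(2)]) (auto simp: N'_def)
  with der have "(snd c' \<circ> \<gamma>) C1_differentiable_on N'" unfolding C1_differentiable_on_def by blast
  then show ?thesis using oN' that[of N'] N(2) c'(2) by (auto simp: N'_def)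
qed

text \<open>The end points join the exceptional set, so that only interior times with two-sided
  derivatives remain.\<close>

lemma piecewise_C1_curve_iff:
  "piecewise_C1_curve \<B> \<gamma> \<longleftrightarrow> continuous_on {0..1} \<gamma> \<and> (\<exists>S. finite S \<and> (\<forall>t\<in>{0<..<1} - S. C1_near \<gamma> t))"
proof
  assume "piecewise_C1_curve \<B> \<gamma>"
  then obtain S where S: "continuous_on {0..1} \<gamma>" "finite S"
    "\<And>c. c \<in> \<B> \<Longrightarrow> (snd c \<circ> \<gamma>) C1_differentiable_on {t \<in> {0..1} - S. \<gamma> t \<in> fst c}"
    unfolding piecewise_C1_curve_def by blast
  have "C1_near \<gamma> t" if t: "t \<in> {0<..<1} - S" for t
  proof -
    define c where "c = chart_at \<B> (\<gamma> t)"
    have c: "c \<in> \<B>" "\<gamma> t \<in> fst c" using chart_at by (auto simp: c_def)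
    have o: "open ({0<..<1} - S)" by (intro open_Diff finite_imp_closed S) auto
    have "continuous_on ({0<..<1} - S) \<gamma>" by (rule continuous_on_subset[OF S(1)]) auto
    then have "open (\<gamma> -` fst c \<inter> ({0<..<1} - S))"
      using continuous_on_open_vimage[THEN iffD1, OF o, rule_format] chartD(1)[OF c(1)] by blast
    moreover have "(snd c \<circ> \<gamma>) C1_differentiable_on (\<gamma> -` fst c \<inter> ({0<..<1} - S))"
      by (rule C1_differentiable_on_subset[OF S(3)[OF c(1)]]) auto
    ultimately show ?thesis unfolding C1_near_def using c t by blast
  qed
  then show "continuous_on {0..1} \<gamma> \<and> (\<exists>S. finite S \<and> (\<forall>t\<in>{0<..<1} - S. C1_near \<gamma> t))" using S by blast
next
  assume "continuous_on {0..1} \<gamma> \<and> (\<exists>S. finite S \<and> (\<forall>t\<in>{0<..<1} - S. C1_near \<gamma> t))"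
  then obtain S where S: "continuous_on {0..1} \<gamma>" "finite S" "\<And>t. t \<in> {0<..<1} - S \<Longrightarrow> C1_near \<gamma> t" by blast
  have "(snd c \<circ> \<gamma>) C1_differentiable_on {t \<in> {0..1} - (S \<union> {0, 1}). \<gamma> t \<in> fst c}" if c: "c \<in> \<B>" for c
    unfolding C1_differentiable_on_eq
  proof (intro conjI ballI continuous_at_imp_continuous_on)
    fix t assume t: "t \<in> {t \<in> {0..1} - (S \<union> {0, 1}). \<gamma> t \<in> fst c}"
    then have "C1_near \<gamma> t" "\<gamma> t \<in> fst c" by (auto intro!: S(3))
    then obtain N where N: "open N" "t \<in> N" "(snd c \<circ> \<gamma>) C1_differentiable_on N"
      using C1_near_chart[OF _ c] by metis
    then show "(snd c \<circ> \<gamma>) differentiable at t" "isCont (\<lambda>x. vector_derivative (snd c \<circ> \<gamma>) (at x)) t"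
      by (auto simp: C1_differentiable_on_eq continuous_on_eq_continuous_at)
  qed
  then show "piecewise_C1_curve \<B> \<gamma>"
    unfolding piecewise_C1_curve_def using S(1,2) by (intro conjI exI[of _ "S \<union> {0, 1}"] ballI) simp_all
qed

abbreviation "spd \<equiv> speed \<B> h"

lemma C1_near_has_vector_derivative:
  assumes "C1_near \<gamma> t" "c \<in> \<B>" "\<gamma> t \<in> fst c"
  shows "((snd c \<circ> \<gamma>) has_vector_derivative vector_derivative (snd c \<circ> \<gamma>) (at t)) (at t)"
proof (rule C1_near_chart[OF assms])
  fix N assume "open N" "t \<in> N" "\<gamma> ` N \<subseteq> fst c" "(snd c \<circ> \<gamma>) C1_differentiable_on N"
  then show ?thesis by (simp add: C1_differentiable_on_eq vector_derivative_works)
qed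

text \<open>The chart picked by \<open>speed\<close> differs from the given one by an isometry,
  which preserves the length of the velocity.\<close>

lemma speed_chart:
  assumes C: "C1_near \<gamma> t" and c: "c \<in> \<B>" "\<gamma> t \<in> fst c"
    and v: "((snd c \<circ> \<gamma>) has_vector_derivative v) (at t)"
  shows "spd \<gamma> t = sqrt (ip (h c (snd c (\<gamma> t))) v v)"
proof -
  define c' where "c' = chart_at \<B> (\<gamma> t)"
  have c': "c' \<in> \<B>" "\<gamma> t \<in> fst c'" using chart_at by (auto simp: c'_def)
  interpret coord_isometry "overlap c c'" "cdom c'" "h c" "h c'" "transition c c'"
    by (rule coord_isometry_transition[OF c(1) c'(1)])
  have x: "snd c (\<gamma> t) \<in> overlap c c'" by (rule overlap_snd[OF c(2) c'(2)])
  obtain N where N: "open N" "t \<in> N" "\<gamma> ` N \<subseteq> fst c"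
    using C1_near_chart[OF C c] by metis
  have "((snd c \<circ> \<gamma>) has_derivative (\<lambda>r. r *\<^sub>R v)) (at t)" using v by (simp add: has_vector_derivative_def)
  from has_derivative_compose[OF this, of "transition c c'"] has_derivative_dird[OF diff[OF x]]
  have "((\<lambda>s. transition c c' ((snd c \<circ> \<gamma>) s)) has_derivative (\<lambda>r. dird (r *\<^sub>R v) (transition c c') (snd c (\<gamma> t)))) (at t)"
    by simp
  then have "((\<lambda>s. transition c c' ((snd c \<circ> \<gamma>) s)) has_vector_derivative dird v (transition c c') (snd c (\<gamma> t))) (at t)"
    unfolding has_vector_derivative_def linear_cmul[OF lin[OF x]] .
  then have "((snd c' \<circ> \<gamma>) has_vector_derivative dird v (transition c c') (snd c (\<gamma> t))) (at t)"
    by (rule has_vector_derivative_transform_within_open[OF _ N(1,2)]) (use N(3) c in \<open>auto simp: image_subset_iff\<close>)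
  then have "vector_derivative (snd c' \<circ> \<gamma>) (at t) = dird v (transition c c') (snd c (\<gamma> t))"
    by (rule vector_derivative_at)
  then show ?thesis using pull[OF x] c by (simp add: speed_def Let_def c'_def[symmetric])
qed

lemma C1_near_cong:
  assumes "C1_near \<gamma> t" "open T" "t \<in> T" "\<And>s. s \<in> T \<Longrightarrow> \<gamma>' s = \<gamma> s"
  shows "C1_near \<gamma>' t" "spd \<gamma>' t = spd \<gamma> t"
proof -
  define c where "c = chart_at \<B> (\<gamma> t)"
  have c: "c \<in> \<B>" "\<gamma> t \<in> fst c" using chart_at by (auto simp: c_def)
  obtain N where N: "open N" "t \<in> N" "\<gamma> ` N \<subseteq> fst c" "(snd c \<circ> \<gamma>) C1_differentiable_on N"
    using C1_near_chart[OF assms(1) c] by metis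
  obtain D where D: "\<And>s. s \<in> N \<Longrightarrow> ((snd c \<circ> \<gamma>) has_vector_derivative D s) (at s)" "continuous_on N D"
    using N(4) unfolding C1_differentiable_on_def by blast
  have o: "open (N \<inter> T)" using N assms by auto
  have D': "((snd c \<circ> \<gamma>') has_vector_derivative D s) (at s)" if "s \<in> N \<inter> T" for s
    by (rule has_vector_derivative_transform_within_open[OF D(1) o that]) (use that assms in auto)
  then have "(snd c \<circ> \<gamma>') C1_differentiable_on (N \<inter> T)"
    unfolding C1_differentiable_on_def using continuous_on_subset[OF D(2)] by (meson inf_le1)
  moreover have "\<gamma>' ` (N \<inter> T) \<subseteq> fst c" using N(3) assms(4) by auto
  ultimately show C: "C1_near \<gamma>' t" unfolding C1_near_def using c(1) o N(2) assms(3) by blast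
  have e: "\<gamma>' t = \<gamma> t" using assms by simp
  have "spd \<gamma>' t = sqrt (ip (h c (snd c (\<gamma>' t))) (D t) (D t))"
    by (rule speed_chart[OF C c(1)]) (use e c D' N(2) assms(3) in auto)
  also have "\<dots> = spd \<gamma> t"
    unfolding e by (rule speed_chart[OF assms(1) c D(1)[OF N(2)], symmetric])
  finally show "spd \<gamma>' t = spd \<gamma> t" .
qed

lemma C1_near_affine:
  assumes "C1_near \<gamma> (a + r * t)" and r: "r \<noteq> 0"
  shows "C1_near (\<lambda>s. \<gamma> (a + r * s)) t" "spd (\<lambda>s. \<gamma> (a + r * s)) t = \<bar>r\<bar> * spd \<gamma> (a + r * t)"
proof -
  define c where "c = chart_at \<B> (\<gamma> (a + r * t))"
  have c: "c \<in> \<B>" "\<gamma> (a + r * t) \<in> fst c" using chart_at by (auto simp: c_def)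
  obtain N where N: "open N" "a + r * t \<in> N" "\<gamma> ` N \<subseteq> fst c" "(snd c \<circ> \<gamma>) C1_differentiable_on N"
    using C1_near_chart[OF assms(1) c] by metis
  obtain D where D: "\<And>s. s \<in> N \<Longrightarrow> ((snd c \<circ> \<gamma>) has_vector_derivative D s) (at s)" "continuous_on N D"
    using N(4) unfolding C1_differentiable_on_def by blast
  define N' where "N' = (\<lambda>s. a + r * s) -` N"
  have o: "open N'" unfolding N'_def by (intro open_vimage N(1) continuous_intros)
  have D': "((snd c \<circ> (\<lambda>s. \<gamma> (a + r * s))) has_vector_derivative r *\<^sub>R D (a + r * s)) (at s)" if "s \<in> N'" for s
  proof -
    have "((\<lambda>s. a + r * s) has_vector_derivative r) (at s)" by (auto intro!: derivative_eq_intros)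
    from vector_diff_chain_at[OF this, of "snd c \<circ> \<gamma>"] D(1) that
    show ?thesis by (simp add: N'_def o_def)
  qed
  have "continuous_on N' (\<lambda>s. r *\<^sub>R D (a + r * s))"
    by (intro continuous_intros continuous_on_compose2[OF D(2)]) (auto simp: N'_def)
  then have "(snd c \<circ> (\<lambda>s. \<gamma> (a + r * s))) C1_differentiable_on N'"
    unfolding C1_differentiable_on_def
    by (intro exI[of _ "\<lambda>s. r *\<^sub>R D (a + r * s)"] conjI ballI D')
  then show C: "C1_near (\<lambda>s. \<gamma> (a + r * s)) t"
    unfolding C1_near_def using c(1) o N(2,3) by (intro bexI[of _ c] exI[of _ N']) (auto simp: N'_def)
  have "spd (\<lambda>s. \<gamma> (a + r * s)) t = sqrt (ip (h c (snd c (\<gamma> (a + r * t)))) (r *\<^sub>R D (a + r * t)) (r *\<^sub>R D (a + r * t)))"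
    by (rule speed_chart[OF C c(1)]) (use c D' N(2) in \<open>auto simp: N'_def\<close>)
  also have "\<dots> = \<bar>r\<bar> * sqrt (ip (h c (snd c (\<gamma> (a + r * t)))) (D (a + r * t)) (D (a + r * t)))"
    by (simp add: ip_simps real_sqrt_mult mult.assoc[symmetric])
  also have "\<dots> = \<bar>r\<bar> * spd \<gamma> (a + r * t)"
    using speed_chart[OF assms(1) c D(1)[OF N(2)]] by simp
  finally show "spd (\<lambda>s. \<gamma> (a + r * s)) t = \<bar>r\<bar> * spd \<gamma> (a + r * t)" .
qed

lemma continuous_speed:
  assumes "open T" "\<And>t. t \<in> T \<Longrightarrow> C1_near \<gamma> t" shows "continuous_on T (spd \<gamma>)"
proof (rule continuous_at_imp_continuous_on, rule ballI)
  fix t assume t: "t \<in> T"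
  define c where "c = chart_at \<B> (\<gamma> t)"
  have c: "c \<in> \<B>" "\<gamma> t \<in> fst c" using chart_at by (auto simp: c_def)
  obtain N where N: "open N" "t \<in> N" "\<gamma> ` N \<subseteq> fst c" "(snd c \<circ> \<gamma>) C1_differentiable_on N"
    using C1_near_chart[OF assms(2)[OF t] c] by metis
  obtain D where D: "\<And>s. s \<in> N \<Longrightarrow> ((snd c \<circ> \<gamma>) has_vector_derivative D s) (at s)" "continuous_on N D"
    using N(4) unfolding C1_differentiable_on_def by blast
  have cs: "continuous_on N (snd c \<circ> \<gamma>)"
    by (rule continuous_at_imp_continuous_on) (use D(1) has_vector_derivative_continuous in blast)
  have "continuous_on N (\<lambda>s. h c ((snd c \<circ> \<gamma>) s))"
    by (rule continuous_on_compose2[OF smooth_on_continuous[OF metric_onD(2)[OF metric_on_chart[OF c(1)]]] cs])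
      (use N(3) in \<open>auto simp: image_subset_iff\<close>)
  then have "continuous_on N (\<lambda>s. sqrt (D s \<bullet> (h c ((snd c \<circ> \<gamma>) s) *v D s)))"
    by (intro continuous_intros D(2) bounded_bilinear.continuous_on[OF bounded_bilinear_matrix_vector])
  then have "continuous_on (N \<inter> T) (\<lambda>s. sqrt (ip (h c (snd c (\<gamma> s))) (D s) (D s)))"
    unfolding ip_def o_def by (rule continuous_on_subset) auto
  then have "continuous_on (N \<inter> T) (spd \<gamma>)"
  proof (rule continuous_on_eq)
    fix s assume "s \<in> N \<inter> T"
    then show "sqrt (ip (h c (snd c (\<gamma> s))) (D s) (D s)) = spd \<gamma> s"
      using N(3) D(1) assms(2) by (intro speed_chart[symmetric] c) auto
  qed
  then show "isCont (spd \<gamma>) t" using N assms(1) t by (simp add: continuous_on_eq_continuous_at open_Int)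
qed

lemma speed_nonneg: "spd \<gamma> t \<ge> 0"
  unfolding speed_def Let_def
  by (intro real_sqrt_ge_zero posdef_nonneg posdef_h chart_at snd_in)

section \<open>Length, reversal, restriction and concatenation of curves\<close>

definition arc_length :: "(real \<Rightarrow> 'b) \<Rightarrow> real \<Rightarrow> real \<Rightarrow> ennreal" where
  "arc_length \<gamma> a b = (\<integral>\<^sup>+t. ennreal (spd \<gamma> t) * indicator {a..b} t \<partial>lborel)"

lemma curve_length_eq: "curve_length \<B> h \<gamma> = arc_length \<gamma> 0 1"
  by (simp add: curve_length_def arc_length_def)

text \<open>Finitely many times are a null set. Discarding them leaves an open set, on which the
  speed of a piecewise smooth curve is continuous and hence measurable.\<close>

lemma arc_length_regular:
  assumes S: "finite S"
  shows "arc_length \<gamma> a b = (\<integral>\<^sup>+t. ennreal (spd \<gamma> t) * indicator ({a<..<b} - S) t \<partial>lborel)"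
  unfolding arc_length_def
proof (rule nn_integral_cong_AE)
  have "AE t in lborel. t \<notin> S \<union> {a, b}"
    using S by (intro AE_not_in finite_imp_null_set_lborel) simp
  then show "AE t in lborel. ennreal (spd \<gamma> t) * indicator {a..b} t = ennreal (spd \<gamma> t) * indicator ({a<..<b} - S) t"
    by eventually_elim (auto split: split_indicator)
qed

lemma speed_measurable:
  assumes S: "finite S" "\<And>t. t \<in> {a<..<b} - S \<Longrightarrow> C1_near \<gamma> t"
  shows "(\<lambda>t. ennreal (spd \<gamma> t) * indicator ({a<..<b} - S) t) \<in> borel_measurable borel"
proof -
  have "open ({a<..<b} - S)" by (intro open_Diff finite_imp_closed S) auto
  then show ?thesis by (intro borel_indicator_continuous continuous_speed S(2)) auto
qed

lemma arc_length_split: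
  assumes "a \<le> b" "b \<le> c" "finite S" "\<And>t. t \<in> {a<..<c} - S \<Longrightarrow> C1_near \<gamma> t"
  shows "arc_length \<gamma> a c = arc_length \<gamma> a b + arc_length \<gamma> b c"
proof -
  define S' where "S' = insert b S"
  have f: "finite S'" using assms by (simp add: S'_def)
  have C1: "\<And>t. t \<in> {a<..<b} - S' \<Longrightarrow> C1_near \<gamma> t" "\<And>t. t \<in> {b<..<c} - S' \<Longrightarrow> C1_near \<gamma> t"
    using assms by (auto simp: S'_def)
  have "arc_length \<gamma> a c = (\<integral>\<^sup>+t. ennreal (spd \<gamma> t) * indicator ({a<..<b} - S') t + ennreal (spd \<gamma> t) * indicator ({b<..<c} - S') t \<partial>lborel)"
    unfolding arc_length_regular[OF f] using assms(1,2)
    by (intro nn_integral_cong) (auto simp: S'_def split: split_indicator)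
  also have "\<dots> = arc_length \<gamma> a b + arc_length \<gamma> b c"
    unfolding arc_length_regular[OF f]
    by (rule nn_integral_add) (use speed_measurable[OF f C1(1)] speed_measurable[OF f C1(2)] in auto)
  finally show ?thesis .
qed

text \<open>Covers reversal, restriction and both halves of a concatenation alike; the condition
  \<open>im\<close> on the intervals allows negative \<open>r\<close>.\<close>

lemma arc_length_affine:
  assumes r: "r \<noteq> 0" and S: "finite S" "\<And>t. t \<in> {a<..<b} - S \<Longrightarrow> C1_near \<gamma> t"
    and im: "\<And>s. s \<in> {u<..<w} \<longleftrightarrow> d + r * s \<in> {a<..<b}"
  shows "arc_length (\<lambda>s. \<gamma> (d + r * s)) u w = arc_length \<gamma> a b"
proof -
  define S' where "S' = (\<lambda>t. (t - d) / r) ` S"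
  have fS': "finite S'" using S by (simp add: S'_def)
  have inS: "s \<in> S' \<longleftrightarrow> d + r * s \<in> S" for s
    using r by (auto simp: S'_def image_iff field_simps)
  have "arc_length \<gamma> a b = \<bar>r\<bar> * (\<integral>\<^sup>+s. ennreal (spd \<gamma> (d + r * s)) * indicator ({a<..<b} - S) (d + r * s) \<partial>lborel)"
    unfolding arc_length_regular[OF S(1)] by (rule nn_integral_real_affine[OF speed_measurable[OF S] r])
  also have "\<dots> = (\<integral>\<^sup>+s. ennreal \<bar>r\<bar> * (ennreal (spd \<gamma> (d + r * s)) * indicator ({a<..<b} - S) (d + r * s)) \<partial>lborel)"
  proof (rule nn_integral_cmult[symmetric])
    have "(\<lambda>s. d + r * s) \<in> borel_measurable borel" by measurable
    from measurable_compose[OF this speed_measurable[OF S]]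
    show "(\<lambda>s. ennreal (spd \<gamma> (d + r * s)) * indicator ({a<..<b} - S) (d + r * s)) \<in> borel_measurable lborel" by simp
  qed
  also have "\<dots> = (\<integral>\<^sup>+s. ennreal (spd (\<lambda>s. \<gamma> (d + r * s)) s) * indicator ({u<..<w} - S') s \<partial>lborel)"
  proof (rule nn_integral_cong)
    fix s
    show "ennreal \<bar>r\<bar> * (ennreal (spd \<gamma> (d + r * s)) * indicator ({a<..<b} - S) (d + r * s))
      = ennreal (spd (\<lambda>s. \<gamma> (d + r * s)) s) * indicator ({u<..<w} - S') s"
    proof (cases "s \<in> {u<..<w} - S'")
      case True
      then have m: "d + r * s \<in> {a<..<b} - S" using im[of s] inS[of s] by blast
      show ?thesis using True m C1_near_affine(2)[OF S(2)[OF m] r] by (simp add: ennreal_mult speed_nonneg)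
    next
      case False
      then have "d + r * s \<notin> {a<..<b} - S" using im[of s] inS[of s] by blast
      then show ?thesis using False by simp
    qed
  qed
  also have "\<dots> = arc_length (\<lambda>s. \<gamma> (d + r * s)) u w" by (rule arc_length_regular[OF fS', symmetric])
  finally show ?thesis by simp
qed

lemma arc_length_cong:
  assumes "finite S" "\<And>t. t \<in> {a<..<b} - S \<Longrightarrow> C1_near \<gamma> t" "\<And>t. t \<in> {a<..<b} \<Longrightarrow> \<gamma>' t = \<gamma> t"
  shows "arc_length \<gamma>' a b = arc_length \<gamma> a b"
  unfolding arc_length_regular[OF assms(1)]
proof (rule nn_integral_cong)
  fix t
  have "spd \<gamma>' t = spd \<gamma> t" if "t \<in> {a<..<b} - S"
    by (rule C1_near_cong(2)[OF assms(2)[OF that], of "{a<..<b}"]) (use that assms(3) in auto)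
  then show "ennreal (spd \<gamma>' t) * indicator ({a<..<b} - S) t = ennreal (spd \<gamma> t) * indicator ({a<..<b} - S) t"
    by (auto split: split_indicator)
qed

definition joins :: "(real \<Rightarrow> 'b) \<Rightarrow> 'b \<Rightarrow> 'b \<Rightarrow> bool" where
  "joins \<gamma> p q \<longleftrightarrow> piecewise_C1_curve \<B> \<gamma> \<and> \<gamma> 0 = p \<and> \<gamma> 1 = q"

lemma joins_reverse:
  assumes "joins \<gamma> p q" shows "joins (\<lambda>s. \<gamma> (1 + (-1) * s)) q p"
    "arc_length (\<lambda>s. \<gamma> (1 + (-1) * s)) 0 1 = arc_length \<gamma> 0 1"
proof -
  obtain S where S: "continuous_on {0..1} \<gamma>" "finite S" "\<And>t. t \<in> {0<..<1} - S \<Longrightarrow> C1_near \<gamma> t"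
    using assms unfolding joins_def piecewise_C1_curve_iff by blast
  show "arc_length (\<lambda>s. \<gamma> (1 + (-1) * s)) 0 1 = arc_length \<gamma> 0 1"
    by (rule arc_length_affine[OF _ S(2,3)]) auto
  have "continuous_on {0..1} (\<lambda>s. \<gamma> (1 + (-1) * s))"
    by (rule continuous_on_compose2[OF S(1)]) (auto intro!: continuous_intros)
  moreover have "C1_near (\<lambda>s. \<gamma> (1 + (-1) * s)) t" if "t \<in> {0<..<1} - (\<lambda>t. 1 - t) ` S" for t
  proof (rule C1_near_affine(1))
    have "1 + - 1 * t \<notin> S" using that by (auto simp: image_iff) 
    then show "C1_near \<gamma> (1 + - 1 * t)" using that by (intro S(3)) auto
  qed simp
  ultimately have "piecewise_C1_curve \<B> (\<lambda>s. \<gamma> (1 + (-1) * s))"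
    unfolding piecewise_C1_curve_iff using finite_imageI[OF S(2)] by blast
  then show "joins (\<lambda>s. \<gamma> (1 + (-1) * s)) q p" using assms by (simp add: joins_def)
qed

lemma joins_restrict:
  assumes "joins \<gamma> p q" and ab: "0 \<le> a" "a < b" "b \<le> 1"
  shows "joins (\<lambda>s. \<gamma> (a + (b - a) * s)) (\<gamma> a) (\<gamma> b)"
    "arc_length (\<lambda>s. \<gamma> (a + (b - a) * s)) 0 1 = arc_length \<gamma> a b"
proof -
  obtain S where S: "continuous_on {0..1} \<gamma>" "finite S" "\<And>t. t \<in> {0<..<1} - S \<Longrightarrow> C1_near \<gamma> t"
    using assms unfolding joins_def piecewise_C1_curve_iff by blast
  have im: "s \<in> {0<..<1} \<longleftrightarrow> a + (b - a) * s \<in> {a<..<b}" for s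
  proof -
    have *: "(b - a) * s < b - a \<longleftrightarrow> s < 1" "0 < (b - a) * s \<longleftrightarrow> 0 < s"
      using ab mult_less_cancel_left_pos[of "b - a" s 1] by (simp_all add: zero_less_mult_iff)
    show ?thesis unfolding greaterThanLessThan_iff *[symmetric] by linarith
  qed
  show "arc_length (\<lambda>s. \<gamma> (a + (b - a) * s)) 0 1 = arc_length \<gamma> a b"
    by (rule arc_length_affine[OF _ S(2) S(3) im]) (use ab in auto)
  have cl: "a + (b - a) * s \<in> {0..1}" if "s \<in> {0..1}" for s
  proof -
    have "(b - a) * s \<le> b - a" using mult_left_mono[of s 1 "b - a"] that ab by simp
    moreover have "(b - a) * s \<ge> 0" using that ab by auto
    ultimately have "0 \<le> a + (b - a) * s" "a + (b - a) * s \<le> 1" using ab by linarith+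
    then show ?thesis by simp
  qed
  have "continuous_on {0..1} (\<lambda>s. \<gamma> (a + (b - a) * s))"
    by (rule continuous_on_compose2[OF S(1)]) (use cl in \<open>auto intro!: continuous_intros\<close>)
  moreover have "C1_near (\<lambda>s. \<gamma> (a + (b - a) * s)) t" if t: "t \<in> {0<..<1} - (\<lambda>t. (t - a) / (b - a)) ` S" for t
  proof (rule C1_near_affine(1))
    have "a + (b - a) * t \<notin> S"
    proof
      assume "a + (b - a) * t \<in> S"
      then have "(a + (b - a) * t - a) / (b - a) \<in> (\<lambda>t. (t - a) / (b - a)) ` S" by (rule imageI)
      then show False using t ab by simp
    qed
    moreover have "a + (b - a) * t \<in> {a<..<b}" using im[of t] t by blast
    ultimately show "C1_near \<gamma> (a + (b - a) * t)" using ab by (intro S(3)) auto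
  qed (use ab in auto)
  ultimately have "piecewise_C1_curve \<B> (\<lambda>s. \<gamma> (a + (b - a) * s))"
    unfolding piecewise_C1_curve_iff using finite_imageI[OF S(2)] by blast
  then show "joins (\<lambda>s. \<gamma> (a + (b - a) * s)) (\<gamma> a) (\<gamma> b)" by (simp add: joins_def)
qed

lemma joins_append:
  assumes 1: "joins \<gamma>\<^sub>1 p q" and 2: "joins \<gamma>\<^sub>2 q r"
  obtains \<gamma> where "joins \<gamma> p r" "arc_length \<gamma> 0 1 = arc_length \<gamma>\<^sub>1 0 1 + arc_length \<gamma>\<^sub>2 0 1"
proof -
  obtain S1 where S1: "continuous_on {0..1} \<gamma>\<^sub>1" "finite S1" "\<And>t. t \<in> {0<..<1} - S1 \<Longrightarrow> C1_near \<gamma>\<^sub>1 t"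
    using 1 unfolding joins_def piecewise_C1_curve_iff by blast
  obtain S2 where S2: "continuous_on {0..1} \<gamma>\<^sub>2" "finite S2" "\<And>t. t \<in> {0<..<1} - S2 \<Longrightarrow> C1_near \<gamma>\<^sub>2 t"
    using 2 unfolding joins_def piecewise_C1_curve_iff by blast
  define \<gamma> where "\<gamma> t = (if t \<le> 1/2 then \<gamma>\<^sub>1 (0 + 2 * t) else \<gamma>\<^sub>2 (-1 + 2 * t))" for t
  define S where "S = insert (1/2) ((\<lambda>t. t / 2) ` S1 \<union> (\<lambda>t. (t + 1) / 2) ` S2)"
  have fS: "finite S" using S1 S2 by (simp add: S_def)
  have "continuous_on {0..1} \<gamma>"
  proof -
    have "continuous_on ({0..1/2} \<union> {1/2..1}) \<gamma>" unfolding \<gamma>_def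
    proof (rule continuous_on_If)
      show "continuous_on {0..1/2} (\<lambda>t. \<gamma>\<^sub>1 (0 + 2 * t))"
        by (rule continuous_on_compose2[OF S1(1)]) (auto intro!: continuous_intros)
      show "continuous_on {1/2..1} (\<lambda>t. \<gamma>\<^sub>2 (-1 + 2 * t))"
        by (rule continuous_on_compose2[OF S2(1)]) (auto intro!: continuous_intros)
      have half: "x = 1/2" if "x \<in> {1/2..1}" "x \<le> 1/2" for x :: real using that by auto
      show "\<gamma>\<^sub>1 (0 + 2 * x) = \<gamma>\<^sub>2 (-1 + 2 * x)" if "x \<in> {1/2..1}" "x \<le> 1/2" for x
        unfolding half[OF that] using 1 2 by (simp add: joins_def)
    qed auto
    moreover have "{0..1/2} \<union> {1/2..1} = {0..1::real}" by auto
    ultimately show ?thesis by simp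
  qed
  moreover have C: "C1_near \<gamma> t" if t: "t \<in> {0<..<1} - S" for t
  proof (cases "t < 1/2")
    case True
    have "0 + 2 * t \<notin> S1"
    proof
      assume "0 + 2 * t \<in> S1"
      then have "(0 + 2 * t) / 2 \<in> (\<lambda>t. t / 2) ` S1" by (rule imageI)
      then show False using t by (simp add: S_def)
    qed
    then have "C1_near (\<lambda>t. \<gamma>\<^sub>1 (0 + 2 * t)) t" using True t by (intro C1_near_affine(1) S1(3)) auto
    then show ?thesis by (rule C1_near_cong(1)[of _ _ "{..<1/2}"]) (use True in \<open>auto simp: \<gamma>_def\<close>)
  next
    case False
    then have t': "t > 1/2" using t by (cases "t = 1/2") (auto simp: S_def)
    have "-1 + 2 * t \<notin> S2"
    proof
      assume "-1 + 2 * t \<in> S2"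
      then have "(-1 + 2 * t + 1) / 2 \<in> (\<lambda>t. (t + 1) / 2) ` S2" by (rule imageI)
      then show False using t by (simp add: S_def)
    qed
    then have "C1_near (\<lambda>t. \<gamma>\<^sub>2 (-1 + 2 * t)) t" using t' t by (intro C1_near_affine(1) S2(3)) auto
    then show ?thesis by (rule C1_near_cong(1)[of _ _ "{1/2<..}"]) (use t' in \<open>auto simp: \<gamma>_def\<close>)
  qed
  ultimately have "piecewise_C1_curve \<B> \<gamma>" unfolding piecewise_C1_curve_iff using fS by blast
  then have j: "joins \<gamma> p r" using 1 2 by (simp add: joins_def \<gamma>_def)
  have "arc_length \<gamma> 0 (1/2) = arc_length (\<lambda>t. \<gamma>\<^sub>1 (0 + 2 * t)) 0 (1/2)"
    by (rule arc_length_cong[symmetric, OF fS]) (use C in \<open>auto simp: \<gamma>_def\<close>)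
  also have "\<dots> = arc_length \<gamma>\<^sub>1 0 1" by (rule arc_length_affine[OF _ S1(2,3)]) auto
  finally have A: "arc_length \<gamma> 0 (1/2) = arc_length \<gamma>\<^sub>1 0 1" .
  have "arc_length \<gamma> (1/2) 1 = arc_length (\<lambda>t. \<gamma>\<^sub>2 (-1 + 2 * t)) (1/2) 1"
    by (rule arc_length_cong[symmetric, OF fS]) (use C in \<open>auto simp: \<gamma>_def\<close>)
  also have "\<dots> = arc_length \<gamma>\<^sub>2 0 1" by (rule arc_length_affine[OF _ S2(2,3)]) auto
  finally have B: "arc_length \<gamma> (1/2) 1 = arc_length \<gamma>\<^sub>2 0 1" .
  have "arc_length \<gamma> 0 1 = arc_length \<gamma> 0 (1/2) + arc_length \<gamma> (1/2) 1"
    by (rule arc_length_split[OF _ _ fS C]) auto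
  then show ?thesis using that[OF j] A B by simp
qed

end

context rmanifold
begin

section \<open>The distance and its finiteness\<close>

abbreviation "rd \<equiv> rdist \<B> h"

text \<open>The curve is the coordinate segment; its chart velocity is the constant
  \<open>y - x\<close>, so its speed is at most \<open>M\<close>.\<close>

lemma joins_segment:
  assumes c: "c \<in> \<B>" and T: "convex T" "T \<subseteq> cdom c" and xy: "x \<in> T" "y \<in> T"
    and M: "\<And>z. z \<in> T \<Longrightarrow> sqrt (ip (h c z) (y - x) (y - x)) \<le> M"
  shows "\<exists>\<gamma>. joins \<gamma> (param c x) (param c y) \<and> arc_length \<gamma> 0 1 \<le> ennreal M"
proof -
  define l where "l t = x + t *\<^sub>R (y - x)" for t :: real
  define \<gamma> where "\<gamma> t = param c (l t)" for t
  have lT: "l t \<in> T" if "t \<in> {0..1}" for t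
  proof -
    have "l t = (1 - t) *\<^sub>R x + t *\<^sub>R y" by (simp add: l_def algebra_simps)
    then show ?thesis using T(1) xy that by (simp add: convex_def)
  qed
  define N where "N = l -` cdom c"
  have cl: "continuous_on S l" for S unfolding l_def by (intro continuous_intros)
  have oN: "open N" unfolding N_def by (intro open_vimage chartD(2)[OF c] cl)
  have gN: "\<gamma> ` N \<subseteq> fst c" using c by (auto simp: N_def \<gamma>_def)
  have d: "((snd c \<circ> \<gamma>) has_vector_derivative (y - x)) (at t)" if "t \<in> N" for t
  proof -
    have "(l has_vector_derivative (y - x)) (at t)" unfolding l_def
      by (auto intro!: derivative_eq_intros)
    then show ?thesis
      by (rule has_vector_derivative_transform_within_open[OF _ oN that]) (use c in \<open>auto simp: N_def \<gamma>_def\<close>)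
  qed
  then have C1: "(snd c \<circ> \<gamma>) C1_differentiable_on N"
    unfolding C1_differentiable_on_def by (intro exI[of _ "\<lambda>t. y - x"] conjI ballI continuous_on_const)
  have C: "C1_near \<gamma> t" if "t \<in> N" for t unfolding C1_near_def using c oN that gN C1 by blast
  have sub: "{0..1} \<subseteq> N" unfolding N_def using subsetD[OF T(2) lT] by (intro subsetI vimageI2)
  have "continuous_on {0..1} \<gamma>" unfolding \<gamma>_def
    by (rule continuous_on_compose2[OF chart_cont(2)[OF c] cl]) (use lT T(2) in auto)
  moreover have "\<forall>t\<in>{0<..<1} - {}. C1_near \<gamma> t"
  proof
    fix t :: real assume "t \<in> {0<..<1} - {}"
    then have "t \<in> N" using sub by auto
    then show "C1_near \<gamma> t" by (rule C)
  qed
  ultimately have "piecewise_C1_curve \<B> \<gamma>" unfolding piecewise_C1_curve_iff using finite.emptyI by blast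
  then have "joins \<gamma> (param c x) (param c y)" by (simp add: joins_def \<gamma>_def l_def)
  moreover have "arc_length \<gamma> 0 1 \<le> ennreal M"
  proof -
    have "arc_length \<gamma> 0 1 \<le> (\<integral>\<^sup>+t. ennreal M * indicator {0..1::real} t \<partial>lborel)"
      unfolding arc_length_def
    proof (rule nn_integral_mono)
      fix t :: real
      have "spd \<gamma> t \<le> M" if t: "t \<in> {0..1}"
      proof -
        have tN: "t \<in> N" using t sub by auto
        have g: "\<gamma> t \<in> fst c" using gN tN by auto
        have "spd \<gamma> t = sqrt (ip (h c (snd c (\<gamma> t))) (y - x) (y - x))"
          by (rule speed_chart[OF C[OF tN] c g d[OF tN]])
        also have "snd c (\<gamma> t) = l t" using tN c by (simp add: \<gamma>_def N_def)
        finally show ?thesis using M[OF lT[OF t]] by simp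
      qed
      then show "ennreal (spd \<gamma> t) * indicator {0..1} t \<le> ennreal M * indicator {0..1} t"
        by (auto split: split_indicator intro: ennreal_leI)
    qed
    also have "\<dots> = ennreal M" by (simp add: nn_integral_cmult_indicator)
    finally show ?thesis .
  qed
  ultimately show ?thesis by blast
qed

text \<open>\<open>A\<close> is the metric frozen at \<open>z\<close>. On a small coordinate ball it
  agrees with the metric up to the factor 4, so coordinate segments are curves of at most twice
  their \<open>A\<close>-length.\<close>

lemma comparison_chart:
  assumes W: "open W" "z \<in> W"
  obtains c A r m where "c \<in> \<B>" "z \<in> fst c" "posdef A" "r > 0" "m > 0" "cball (snd c z) r \<subseteq> cdom c"
    "param c ` cball (snd c z) r \<subseteq> W" "\<And>v. m * (norm v)\<^sup>2 \<le> ip A v v"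
    "\<And>y v. y \<in> cball (snd c z) r \<Longrightarrow> ip A v v \<le> 4 * ip (h c y) v v"
    "\<And>x y. x \<in> cball (snd c z) r \<Longrightarrow> y \<in> cball (snd c z) r
       \<Longrightarrow> \<exists>\<gamma>. joins \<gamma> (param c x) (param c y) \<and> arc_length \<gamma> 0 1 \<le> ennreal (2 * sqrt (ip A (y - x) (y - x)))"
proof -
  define c where "c = chart_at \<B> z"
  have c: "c \<in> \<B>" "z \<in> fst c" using chart_at by (auto simp: c_def)
  define T where "T = snd c ` (W \<inter> fst c)"
  have "open T" unfolding T_def by (rule open_snd_image[OF c(1)]) (use W chartD(1)[OF c(1)] in auto)
  then have mT: "metric_on T (h c)"
    using metric_on_chart[OF c(1)] unfolding metric_on_def T_def by (auto intro: smooth_on_subset)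
  have zT: "snd c z \<in> T" using W c by (auto simp: T_def)
  obtain r where r: "r > 0" "cball (snd c z) r \<subseteq> T"
    "\<And>y v. y \<in> cball (snd c z) r \<Longrightarrow> ip (h c (snd c z)) v v / 4 \<le> ip (h c y) v v \<and> ip (h c y) v v \<le> 4 * ip (h c (snd c z)) v v"
    using metric_comparison[OF mT zT] by blast
  have pd: "posdef (h c (snd c z))" using posdef_h[OF c(1)] c(2) by simp
  obtain m where m: "m > 0" "\<And>v. m * (norm v)\<^sup>2 \<le> ip (h c (snd c z)) v v" using posdef_lower_bound[OF pd] by blast
  have Tc: "T \<subseteq> cdom c" by (auto simp: T_def)
  show ?thesis
  proof (rule that[OF c pd r(1) m(1) _ _ m(2)])
    show "cball (snd c z) r \<subseteq> cdom c" using r(2) Tc by auto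
    show "param c ` cball (snd c z) r \<subseteq> W" using r(2) c by (force simp: T_def)
    show "ip (h c (snd c z)) v v \<le> 4 * ip (h c y) v v" if "y \<in> cball (snd c z) r" for y v
      using r(3)[OF that, of v] by simp
    show "\<exists>\<gamma>. joins \<gamma> (param c x) (param c y)
        \<and> arc_length \<gamma> 0 1 \<le> ennreal (2 * sqrt (ip (h c (snd c z)) (y - x) (y - x)))"
      if xy: "x \<in> cball (snd c z) r" "y \<in> cball (snd c z) r" for x y
    proof (rule joins_segment[OF c(1) convex_cball _ xy])
      show "cball (snd c z) r \<subseteq> cdom c" using r(2) Tc by auto
      fix w assume w: "w \<in> cball (snd c z) r"
      have "sqrt (ip (h c w) (y - x) (y - x)) \<le> sqrt (4 * ip (h c (snd c z)) (y - x) (y - x))"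
        using r(3)[OF w] by simp
      then show "sqrt (ip (h c w) (y - x) (y - x)) \<le> 2 * sqrt (ip (h c (snd c z)) (y - x) (y - x))"
        by (simp add: real_sqrt_mult)
    qed
  qed
qed

lemma locally_joined:
  "\<exists>N. open N \<and> z \<in> N \<and> (\<forall>w\<in>N. \<exists>\<gamma>. joins \<gamma> z w \<and> arc_length \<gamma> 0 1 < \<infinity>)"
proof (rule comparison_chart[OF open_UNIV UNIV_I, of z])
  fix c A r m
  assume c: "c \<in> \<B>" "z \<in> fst c" "posdef A" "(r::real) > 0" "(m::real) > 0" "cball (snd c z) r \<subseteq> cdom c"
    and j: "\<And>x y. x \<in> cball (snd c z) r \<Longrightarrow> y \<in> cball (snd c z) r
       \<Longrightarrow> \<exists>\<gamma>. joins \<gamma> (param c x) (param c y) \<and> arc_length \<gamma> 0 1 \<le> ennreal (2 * sqrt (ip A (y - x) (y - x)))"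
  have b: "ball (snd c z) r \<subseteq> cdom c" using c(6) by auto
  have "\<exists>\<gamma>. joins \<gamma> z w \<and> arc_length \<gamma> 0 1 < \<infinity>" if w: "w \<in> param c ` ball (snd c z) r" for w
  proof -
    obtain y where y: "w = param c y" "y \<in> ball (snd c z) r" using w by blast
    obtain \<gamma> where "joins \<gamma> (param c (snd c z)) (param c y)"
      "arc_length \<gamma> 0 1 \<le> ennreal (2 * sqrt (ip A (y - snd c z) (y - snd c z)))"
      using j[of "snd c z" y] y c(4) by auto
    moreover have "ennreal (2 * sqrt (ip A (y - snd c z) (y - snd c z))) < \<infinity>" by simp
    ultimately show ?thesis using c y(1) by (intro exI[of _ \<gamma>] conjI) (simp, rule le_less_trans)
  qed
  moreover have "open (param c ` ball (snd c z) r)" by (rule open_param_image[OF c(1) open_ball b])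
  moreover have "z \<in> param c ` ball (snd c z) r" using c by (intro image_eqI[of _ _ "snd c z"]) auto
  ultimately show ?thesis by blast
qed

text \<open>The points reachable by curves of finite length form an open set with open complement.
  Finiteness matters because \<open>rdist\<close> turns an infimum in the extended reals into a real
  number, sending infinity to 0.\<close>

lemma joined:
  fixes p q :: 'b
  shows "\<exists>\<gamma>. joins \<gamma> p q \<and> arc_length \<gamma> 0 1 < \<infinity>"
proof -
  define R where "R = {q. \<exists>\<gamma>. joins \<gamma> p q \<and> arc_length \<gamma> 0 1 < \<infinity>}"
  have trans: "r \<in> R" if qR: "q \<in> R" and jn: "joins \<gamma> q r" and jl: "arc_length \<gamma> 0 1 < \<infinity>" for q r \<gamma>
  proof -
    obtain \<gamma>' where g': "joins \<gamma>' p q" "arc_length \<gamma>' 0 1 < \<infinity>" using qR unfolding R_def by blast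
    obtain \<gamma>'' where "joins \<gamma>'' p r" "arc_length \<gamma>'' 0 1 = arc_length \<gamma>' 0 1 + arc_length \<gamma> 0 1"
      by (rule joins_append[OF g'(1) jn])
    then show ?thesis using g'(2) jl by (auto simp: R_def)
  qed
  have "open R"
  proof (subst open_subopen, rule ballI)
    fix q assume q: "q \<in> R"
    obtain N where N: "open N" "q \<in> N" "\<And>w. w \<in> N \<Longrightarrow> \<exists>\<gamma>. joins \<gamma> q w \<and> arc_length \<gamma> 0 1 < \<infinity>"
      using locally_joined[of q] by blast
    then have "N \<subseteq> R" using trans[OF q] by blast
    then show "\<exists>T. open T \<and> q \<in> T \<and> T \<subseteq> R" using N by blast
  qed
  moreover have "closed R" unfolding closed_def
  proof (subst open_subopen, rule ballI)
    fix q assume q: "q \<in> - R"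
    obtain N where N: "open N" "q \<in> N" "\<And>w. w \<in> N \<Longrightarrow> \<exists>\<gamma>. joins \<gamma> q w \<and> arc_length \<gamma> 0 1 < \<infinity>"
      using locally_joined[of q] by blast
    have "w \<notin> R" if w: "w \<in> N" for w
    proof
      assume wR: "w \<in> R"
      obtain \<gamma> where g: "joins \<gamma> q w" "arc_length \<gamma> 0 1 < \<infinity>" using N(3)[OF w] by blast
      have "q \<in> R" by (rule trans[OF wR joins_reverse(1)[OF g(1)]]) (simp only: joins_reverse(2)[OF g(1)] g(2))
      then show False using q by simp
    qed
    then show "\<exists>T. open T \<and> q \<in> T \<and> T \<subseteq> - R" using N by blast
  qed
  moreover have "p \<in> R" using locally_joined[of p] by (auto simp: R_def)
  ultimately have "R = UNIV" using connected_M connected_clopen[of UNIV]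
    by (metis Int_UNIV_right closed_closedin empty_iff open_openin subtopology_UNIV)
  then have "q \<in> R" by blast
  then show ?thesis unfolding R_def by blast
qed

lemma rdist_eq: "rd p q = enn2real (INF \<gamma>\<in>{\<gamma>. joins \<gamma> p q}. arc_length \<gamma> 0 1)"
  unfolding rdist_def joins_def curve_length_eq ..

lemma ennreal_rdist: "ennreal (rd p q) = (INF \<gamma>\<in>{\<gamma>. joins \<gamma> p q}. arc_length \<gamma> 0 1)"
proof -
  obtain \<gamma> where "joins \<gamma> p q" "arc_length \<gamma> 0 1 < \<infinity>" using joined by blast
  then have "(INF \<gamma>\<in>{\<gamma>. joins \<gamma> p q}. arc_length \<gamma> 0 1) < \<infinity>"
    by (intro le_less_trans[OF INF_lower[of \<gamma>]]) simp_all
  then show ?thesis unfolding rdist_eq by (intro ennreal_enn2real) (simp only: infinity_ennreal_def)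
qed

lemma rdist_nonneg: "rd p q \<ge> 0" by (simp add: rdist_eq)

lemma rdist_le: "joins \<gamma> p q \<Longrightarrow> arc_length \<gamma> 0 1 \<le> ennreal l \<Longrightarrow> l \<ge> 0 \<Longrightarrow> rd p q \<le> l"
proof -
  assume a: "joins \<gamma> p q" "arc_length \<gamma> 0 1 \<le> ennreal l" "l \<ge> 0"
  then have "ennreal (rd p q) \<le> ennreal l" unfolding ennreal_rdist by (intro INF_lower2[of \<gamma>]) auto
  then show ?thesis using a(3) by (simp add: ennreal_le_iff)
qed

lemma rdist_less:
  assumes "rd p q < l" obtains \<gamma> where "joins \<gamma> p q" "arc_length \<gamma> 0 1 < ennreal l"
proof -
  have "ennreal (rd p q) < ennreal l" using assms rdist_nonneg[of p q] by (simp add: ennreal_less_iff)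
  then show ?thesis using that unfolding ennreal_rdist INF_less_iff by blast
qed

lemma rdist_refl: "rd p p = 0"
proof -
  have "rd p p \<le> 0"
  proof (rule comparison_chart[OF open_UNIV UNIV_I, of p])
    fix c A r m
    assume c: "c \<in> \<B>" "p \<in> fst c" "(r::real) > 0"
      and j: "\<And>x y. x \<in> cball (snd c p) r \<Longrightarrow> y \<in> cball (snd c p) r
       \<Longrightarrow> \<exists>\<gamma>. joins \<gamma> (param c x) (param c y) \<and> arc_length \<gamma> 0 1 \<le> ennreal (2 * sqrt (ip A (y - x) (y - x)))"
    obtain \<gamma> where "joins \<gamma> p p" "arc_length \<gamma> 0 1 \<le> ennreal 0"
      using j[of "snd c p" "snd c p"] c by (auto simp: ip_simps)
    then show ?thesis by (rule rdist_le) simp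
  qed
  then show ?thesis using rdist_nonneg[of p p] by simp
qed

lemma rdist_commute: "rd p q = rd q p"
proof -
  have "rd p q \<le> l" if l: "rd q p < l" for p q l
  proof -
    obtain \<gamma> where g: "joins \<gamma> q p" "arc_length \<gamma> 0 1 < ennreal l" using l by (rule rdist_less)
    show ?thesis
      by (rule rdist_le[OF joins_reverse(1)[OF g(1)]])
        (use g rdist_nonneg[of q p] l in \<open>auto simp only: joins_reverse(2)[OF g(1)]\<close>)
  qed
  then have "rd p q \<le> rd q p" for p q by (meson dense_ge)
  then show ?thesis by (simp add: antisym)
qed

lemma rdist_triangle: "rd p r \<le> rd p q + rd q r"
proof (rule field_le_epsilon)
  fix e :: real assume e: "e > 0"
  obtain \<gamma>\<^sub>1 where g1: "joins \<gamma>\<^sub>1 p q" "arc_length \<gamma>\<^sub>1 0 1 < ennreal (rd p q + e / 2)"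
    using rdist_less[of p q "rd p q + e / 2"] e by auto
  obtain \<gamma>\<^sub>2 where g2: "joins \<gamma>\<^sub>2 q r" "arc_length \<gamma>\<^sub>2 0 1 < ennreal (rd q r + e / 2)"
    using rdist_less[of q r "rd q r + e / 2"] e by auto
  obtain \<gamma> where g: "joins \<gamma> p r" "arc_length \<gamma> 0 1 = arc_length \<gamma>\<^sub>1 0 1 + arc_length \<gamma>\<^sub>2 0 1"
    by (rule joins_append[OF g1(1) g2(1)])
  have "arc_length \<gamma> 0 1 \<le> ennreal (rd p q + e / 2) + ennreal (rd q r + e / 2)"
    unfolding g(2) using g1(2) g2(2) by (intro add_mono less_imp_le)
  also have "\<dots> = ennreal (rd p q + rd q r + e)"
    using e rdist_nonneg[of p q] rdist_nonneg[of q r] by (simp add: ennreal_plus[symmetric] del: ennreal_plus)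
  finally show "rd p r \<le> rd p q + rd q r + e"
    by (rule rdist_le[OF g(1)]) (use e rdist_nonneg[of p q] rdist_nonneg[of q r] in simp)
qed

section \<open>Bumps of uniform size and the topology of the distance\<close>

text \<open>The form is frozen at \<open>z\<close>, while the centre \<open>w\<close> ranges over a
  neighbourhood and the radius over an interval; a compact set then admits one common radius. The 2
  in \<open>rd w q \<le> 2 * \<delta>\<close> is the factor between \<open>A\<close>-length and
  length.\<close>

lemma local_bumps:
  assumes W: "open W" "z \<in> W"
  obtains U \<delta>\<^sub>0 where "open U" "z \<in> U" "\<delta>\<^sub>0 > 0"
    "\<And>w \<delta>. w \<in> U \<Longrightarrow> 0 < \<delta> \<Longrightarrow> \<delta> \<le> \<delta>\<^sub>0 \<Longrightarrow> \<exists>b. smooth b \<and> (\<forall>q. 0 \<le> b q \<and> b q \<le> 1)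
       \<and> (\<exists>V. open V \<and> w \<in> V \<and> (\<forall>q\<in>V. b q = 1)) \<and> (\<forall>q. b q \<noteq> 0 \<longrightarrow> q \<in> W \<and> rd w q \<le> 2 * \<delta>)
       \<and> (\<forall>q. grad_le b q (8 * step_bound / \<delta>))"
proof (rule comparison_chart[OF W])
  fix c A r m
  assume c: "c \<in> \<B>" "z \<in> fst c" "posdef A" "(r::real) > 0" "(m::real) > 0" "cball (snd c z) r \<subseteq> cdom c"
    "param c ` cball (snd c z) r \<subseteq> W" and m: "\<And>v. m * (norm v)\<^sup>2 \<le> ip A v v"
    and le: "\<And>y v. y \<in> cball (snd c z) r \<Longrightarrow> ip A v v \<le> 4 * ip (h c y) v v"
    and j: "\<And>x y. x \<in> cball (snd c z) r \<Longrightarrow> y \<in> cball (snd c z) r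
       \<Longrightarrow> \<exists>\<gamma>. joins \<gamma> (param c x) (param c y) \<and> arc_length \<gamma> 0 1 \<le> ennreal (2 * sqrt (ip A (y - x) (y - x)))"
  define U where "U = param c ` ball (snd c z) (r / 2)"
  define \<delta>\<^sub>0 where "\<delta>\<^sub>0 = sqrt m * (r / 2)"
  have b: "ball (snd c z) (r / 2) \<subseteq> cdom c" using c(4,6) by (intro subset_trans[OF _ c(6)]) auto
  have U: "open U" "z \<in> U" unfolding U_def
    using open_param_image[OF c(1) open_ball b] c by (auto intro!: image_eqI[of _ _ "snd c z"])
  show ?thesis
  proof (rule that[OF U])
    show "\<delta>\<^sub>0 > 0" using c by (simp add: \<delta>\<^sub>0_def)
    fix w \<delta> assume w: "w \<in> U" and \<delta>: "0 < \<delta>" "\<delta> \<le> \<delta>\<^sub>0"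
    obtain a where a: "w = param c a" "a \<in> ball (snd c z) (r / 2)" using w by (auto simp: U_def)
    have ac: "a \<in> cdom c" "a \<in> cball (snd c z) r" using a b c(4) by auto
    \<comment> \<open>By the choice of \<open>\<delta>\<^sub>0\<close> the ellipsoid has Euclidean
      radius at most r / 2, so around a point of the half ball it stays in the full ball.\<close>
    have E: "x \<in> cball (snd c z) r" if x: "ip A (x - a) (x - a) \<le> \<delta>\<^sup>2" for x
    proof -
      have "m * (norm (x - a))\<^sup>2 \<le> \<delta>\<^sup>2" using m[of "x - a"] x by linarith
      also have "\<dots> \<le> \<delta>\<^sub>0\<^sup>2" using \<delta> by (intro power_mono) auto
      also have "\<dots> = m * (r / 2)\<^sup>2" using c(5) by (simp add: \<delta>\<^sub>0_def power_mult_distrib power_divide)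
      finally have "(norm (x - a))\<^sup>2 \<le> (r / 2)\<^sup>2" using c(5) by simp
      then have "norm (x - a) \<le> r / 2" by (rule power2_le_imp_le) (use c(4) in simp)
      then have "dist x a \<le> r / 2" by (simp add: dist_norm)
      moreover have "dist (snd c z) x \<le> dist (snd c z) a + dist x a" by (rule dist_triangle2)
      moreover have "dist (snd c z) a < r / 2" using a(2) by simp
      ultimately show ?thesis by simp
    qed
    then have E': "{x. ip A (x - a) (x - a) \<le> \<delta>\<^sup>2} \<subseteq> cdom c" using c(6) by blast
    have sm: "smooth (ebump c A a \<delta>)" by (rule ebump_smooth[OF c(1,3) \<delta>(1) E'])
    have gr: "grad_le (ebump c A a \<delta>) q (8 * step_bound / \<delta>)" for q
      by (rule ebump_grad[OF c(1,3) \<delta>(1) E' le[OF E]])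
    define V where "V = {q \<in> fst c. ip A (snd c q - a) (snd c q - a) < \<delta>\<^sup>2 / 2}"
    have cont: "continuous_on (fst c) (\<lambda>q. ip A (snd c q - a) (snd c q - a))" unfolding ip_def
      by (intro continuous_intros chart_cont(1)[OF c(1)] bounded_bilinear.continuous_on[OF bounded_bilinear_matrix_vector])
    have "open ((\<lambda>q. ip A (snd c q - a) (snd c q - a)) -` {..<\<delta>\<^sup>2 / 2} \<inter> fst c)"
      by (rule continuous_on_open_vimage[OF chartD(1)[OF c(1)], THEN iffD1, OF cont, rule_format, OF open_lessThan])
    moreover have "(\<lambda>q. ip A (snd c q - a) (snd c q - a)) -` {..<\<delta>\<^sup>2 / 2} \<inter> fst c = V" by (auto simp: V_def)
    ultimately have "open V" by simp
    moreover have "w \<in> V" using a ac c(1) \<delta> by (simp add: V_def ip_simps)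
    moreover have "ebump c A a \<delta> q = 1" if "q \<in> V" for q
      by (rule ebump_one) (use that \<delta> in \<open>auto simp: V_def\<close>)
    moreover have "q \<in> W \<and> rd w q \<le> 2 * \<delta>" if q: "ebump c A a \<delta> q \<noteq> 0" for q
    proof -
      have q1: "q \<in> fst c" using q by (auto simp: ebump_def split: if_splits)
      have q2: "ip A (snd c q - a) (snd c q - a) \<le> \<delta>\<^sup>2"
        using q ebump_zero[OF \<delta>(1), of A c q a] by fastforce
      have q3: "snd c q \<in> cball (snd c z) r" by (rule E[OF q2])
      obtain \<gamma> where g: "joins \<gamma> (param c a) (param c (snd c q))"
        "arc_length \<gamma> 0 1 \<le> ennreal (2 * sqrt (ip A (snd c q - a) (snd c q - a)))"
        using j[OF ac(2) q3] by blast
      have "sqrt (ip A (snd c q - a) (snd c q - a)) \<le> \<delta>" using q2 \<delta>(1) by (simp add: real_le_lsqrt)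
      then have "rd w q \<le> 2 * sqrt (ip A (snd c q - a) (snd c q - a))"
        using rdist_le[OF g] posdef_nonneg[OF c(3)] q1 c(1) a(1) by simp
      with \<open>sqrt _ \<le> \<delta>\<close> have "rd w q \<le> 2 * \<delta>" by linarith
      moreover have "q \<in> W"
      proof -
        have "param c (snd c q) \<in> W" using c(7) q3 by blast
        then show ?thesis using q1 c(1) by simp
      qed
      ultimately show ?thesis by simp
    qed
    ultimately show "\<exists>b. smooth b \<and> (\<forall>q. 0 \<le> b q \<and> b q \<le> 1)
       \<and> (\<exists>V. open V \<and> w \<in> V \<and> (\<forall>q\<in>V. b q = 1)) \<and> (\<forall>q. b q \<noteq> 0 \<longrightarrow> q \<in> W \<and> rd w q \<le> 2 * \<delta>)
       \<and> (\<forall>q. grad_le b q (8 * step_bound / \<delta>))"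
      using sm gr ebump_range by (intro exI[of _ "ebump c A a \<delta>"]) blast
  qed
qed

text \<open>The difference of values is the integral of the derivative of \<open>u\<close> along a
  nearly shortest curve, and this derivative is at most \<open>L\<close> times the speed.\<close>

lemma grad_le_rdist:
  assumes u: "smooth u" and g: "\<And>p. grad_le u p L" and L: "L \<ge> 0"
  shows "u q - u p \<le> L * rd p q"
proof (rule field_le_epsilon)
  fix e :: real assume e: "e > 0"
  \<comment> \<open>Dividing by L + 1 rather than L covers the case L = 0.\<close>
  define l where "l = rd p q + e / (L + 1)"
  have l: "rd p q < l" using e L by (simp add: l_def)
  obtain \<gamma> where \<gamma>: "joins \<gamma> p q" "arc_length \<gamma> 0 1 < ennreal l" by (rule rdist_less[OF l])
  obtain S where S: "continuous_on {0..1} \<gamma>" "finite S" "\<And>t. t \<in> {0<..<1} - S \<Longrightarrow> C1_near \<gamma> t"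
    using \<gamma>(1) unfolding joins_def piecewise_C1_curve_iff by blast
  define s where "s t = indicator ({0<..<1} - S) t * spd \<gamma> t" for t
  have es: "ennreal (s t) = ennreal (spd \<gamma> t) * indicator ({0<..<1} - S) t" for t
    by (auto simp: s_def split: split_indicator)
  have sm: "s \<in> borel_measurable borel"
  proof -
    have "open ({0<..<1} - S)" by (intro open_Diff finite_imp_closed S) auto
    then have "(\<lambda>t. indicator ({0<..<1} - S) t *\<^sub>R spd \<gamma> t) \<in> borel_measurable borel"
      by (intro borel_measurable_continuous_on_indicator continuous_speed S(3)) auto
    then show ?thesis by (simp add: s_def[abs_def])
  qed
  have al: "arc_length \<gamma> 0 1 = (\<integral>\<^sup>+t. ennreal (s t) \<partial>lborel)"
    unfolding arc_length_regular[OF S(2)] es ..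
  obtain i where i: "arc_length \<gamma> 0 1 = ennreal i" "i \<ge> 0" "i < l"
  proof -
    have "arc_length \<gamma> 0 1 < \<infinity>" using \<gamma>(2) by (rule less_trans) simp
    then obtain i where "arc_length \<gamma> 0 1 = ennreal i" "i \<ge> 0"
      by (cases "arc_length \<gamma> 0 1") auto
    then show ?thesis using that \<gamma>(2) by (simp add: ennreal_less_iff)
  qed
  have "(s has_integral i) UNIV"
    by (rule nn_integral_has_integral[OF sm _ _ i(2)]) (use i al speed_nonneg in \<open>auto simp: s_def\<close>)
  moreover have "s = (\<lambda>t. if t \<in> {0..1} then s t else 0)" by (auto simp: s_def fun_eq_iff)
  ultimately have hs: "(s has_integral i) {0..1}" using has_integral_restrict_UNIV by metis
  \<comment> \<open>Set to 0 at end points and break times, where the fundamental theorem asks for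
    no derivative but \<open>D t \<le> L * s t\<close> must still hold.\<close>
  define D where "D t = (if t \<in> {0<..<1} - S then vector_derivative (\<lambda>t. u (\<gamma> t)) (at t) else 0)" for t
  have key: "((\<lambda>t. u (\<gamma> t)) has_vector_derivative D t) (at t) \<and> D t \<le> L * s t" if t: "t \<in> {0<..<1} - S" for t
  proof -
    define c where "c = chart_at \<B> (\<gamma> t)"
    have c: "c \<in> \<B>" "\<gamma> t \<in> fst c" using chart_at by (auto simp: c_def)
    note C = S(3)[OF t]
    define v where "v = vector_derivative (snd c \<circ> \<gamma>) (at t)"
    have hv: "((snd c \<circ> \<gamma>) has_vector_derivative v) (at t)"
      unfolding v_def by (rule C1_near_has_vector_derivative[OF C c])
    obtain N where N: "open N" "t \<in> N" "\<gamma> ` N \<subseteq> fst c" using C1_near_chart[OF C c] by metis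
    note du = diff_chart[OF u c(1), of "snd c (\<gamma> t)"]
    have "((snd c \<circ> \<gamma>) has_derivative (\<lambda>r. r *\<^sub>R v)) (at t)" using hv by (simp add: has_vector_derivative_def)
    from has_derivative_compose[OF this, of "\<lambda>x. u (param c x)"] has_derivative_dird[OF du] c(2)
    have "((\<lambda>t. u (param c ((snd c \<circ> \<gamma>) t))) has_derivative (\<lambda>r. dird (r *\<^sub>R v) (\<lambda>x. u (param c x)) (snd c (\<gamma> t)))) (at t)"
      by simp
    then have "((\<lambda>t. u (param c ((snd c \<circ> \<gamma>) t))) has_vector_derivative dird v (\<lambda>x. u (param c x)) (snd c (\<gamma> t))) (at t)"
      using linear_cmul[OF dird_linear[OF du]] c(2) by (simp add: has_vector_derivative_def)
    then have hu: "((\<lambda>t. u (\<gamma> t)) has_vector_derivative dird v (\<lambda>x. u (param c x)) (snd c (\<gamma> t))) (at t)"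
      by (rule has_vector_derivative_transform_within_open[OF _ N(1,2)]) (use N(3) c in \<open>auto simp: image_subset_iff\<close>)
    then have D: "D t = dird v (\<lambda>x. u (param c x)) (snd c (\<gamma> t))" using t by (simp add: D_def vector_derivative_at)
    have "\<bar>D t\<bar> \<le> L * sqrt (ip (h c (snd c (\<gamma> t))) v v)" unfolding D by (rule grad_leD[OF g c])
    also have "sqrt (ip (h c (snd c (\<gamma> t))) v v) = spd \<gamma> t" by (rule speed_chart[OF C c hv, symmetric])
    finally show ?thesis using hu D t by (simp add: s_def)
  qed
  have "(D has_integral (u (\<gamma> 1) - u (\<gamma> 0))) {0..1}"
  proof (rule fundamental_theorem_of_calculus_interior_strong[OF S(2)])
    show "continuous_on {0..1} (\<lambda>t. u (\<gamma> t))"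
      by (rule continuous_on_compose2[OF smooth_continuous[OF u] S(1)]) auto
  qed (use key in auto)
  moreover have "((\<lambda>t. L * s t) has_integral L * i) {0..1}" by (rule has_integral_mult_right[OF hs])
  moreover have "D t \<le> L * s t" for t
    using key[of t] L speed_nonneg[of \<gamma> t] by (cases "t \<in> {0<..<1} - S") (auto simp: D_def s_def)
  ultimately have "u (\<gamma> 1) - u (\<gamma> 0) \<le> L * i" by (rule has_integral_le)
  also have "\<dots> \<le> L * l" using i L by (intro mult_left_mono) auto
  also have "\<dots> = L * rd p q + L * (e / (L + 1))" by (simp add: l_def algebra_simps)
  also have "L * (e / (L + 1)) \<le> e" using L e by (simp add: field_simps)
  finally show "u q - u p \<le> L * rd p q + e" using \<gamma>(1) by (simp add: joins_def)
qed

text \<open>A bump that is 1 at \<open>p\<close> and 0 outside \<open>W\<close> is Lipschitz for the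
  distance, so points outside \<open>W\<close> have distance at least 1 / L from
  \<open>p\<close>.\<close>

lemma rdist_ball_subset:
  assumes W: "open W" "p \<in> W" shows "\<exists>e>0. \<forall>q. rd p q < e \<longrightarrow> q \<in> W"
proof (rule local_bumps[OF W])
  fix U \<delta>\<^sub>0 assume U: "p \<in> U" "(\<delta>\<^sub>0::real) > 0"
    and *: "\<And>w \<delta>. w \<in> U \<Longrightarrow> 0 < \<delta> \<Longrightarrow> \<delta> \<le> \<delta>\<^sub>0 \<Longrightarrow> \<exists>b. smooth b \<and> (\<forall>q. 0 \<le> b q \<and> b q \<le> 1)
       \<and> (\<exists>V. open V \<and> w \<in> V \<and> (\<forall>q\<in>V. b q = 1)) \<and> (\<forall>q. b q \<noteq> 0 \<longrightarrow> q \<in> W \<and> rd w q \<le> 2 * \<delta>)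
       \<and> (\<forall>q. grad_le b q (8 * step_bound / \<delta>))"
  define L where "L = 8 * step_bound / \<delta>\<^sub>0"
  have L: "L > 0" using U step_bound by (simp add: L_def)
  obtain b where b: "smooth b" "b p = 1" "\<And>q. b q \<noteq> 0 \<Longrightarrow> q \<in> W" "\<And>q. grad_le b q L"
    using *[OF U(1,2) order_refl] unfolding L_def by metis
  have "q \<in> W" if "rd p q < 1 / L" for q
  proof (rule ccontr)
    assume "q \<notin> W"
    then have "b q = 0" using b(3) by blast
    then have "1 \<le> L * rd q p" using grad_le_rdist[OF b(1,4), of p q] L b(2) by simp
    then show False using that L by (simp add: rdist_commute[of q p] field_simps)
  qed
  then show ?thesis using L by (intro exI[of _ "1 / L"]) auto
qed

lemma rdist_zero: "rd p q = 0 \<longleftrightarrow> p = q"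
proof
  assume 0: "rd p q = 0"
  show "p = q"
  proof (rule ccontr)
    assume "p \<noteq> q"
    then have "open (- {q})" "p \<in> - {q}" by auto
    then obtain e where e: "e > 0" "\<forall>r. rd p r < e \<longrightarrow> r \<in> - {q}" using rdist_ball_subset[of "- {q}" p] by blast
    then show False using 0 e(2)[rule_format, of q] by simp
  qed
qed (simp add: rdist_refl)

sublocale Metric_space UNIV rd
  by unfold_locales (auto simp: rdist_nonneg rdist_zero rdist_triangle intro: rdist_commute)

lemma rdist_small:
  assumes "e > 0" shows "\<exists>N. open N \<and> p \<in> N \<and> (\<forall>q\<in>N. rd p q < e)"
proof (rule local_bumps[OF open_UNIV UNIV_I, of p])
  fix U \<delta>\<^sub>0 assume U: "p \<in> U" "(\<delta>\<^sub>0::real) > 0"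
    and *: "\<And>w \<delta>. w \<in> U \<Longrightarrow> 0 < \<delta> \<Longrightarrow> \<delta> \<le> \<delta>\<^sub>0 \<Longrightarrow> \<exists>b. smooth b \<and> (\<forall>q. 0 \<le> b q \<and> b q \<le> 1)
       \<and> (\<exists>V. open V \<and> w \<in> V \<and> (\<forall>q\<in>V. b q = 1)) \<and> (\<forall>q. b q \<noteq> 0 \<longrightarrow> q \<in> UNIV \<and> rd w q \<le> 2 * \<delta>)
       \<and> (\<forall>q. grad_le b q (8 * step_bound / \<delta>))"
  define \<delta> where "\<delta> = min \<delta>\<^sub>0 (e / 4)"
  have d: "0 < \<delta>" "\<delta> \<le> \<delta>\<^sub>0" "2 * \<delta> < e" using U assms by (auto simp: \<delta>_def min_def)
  obtain b :: "'b \<Rightarrow> real" and V where b: "open V" "p \<in> V" "\<And>q. q \<in> V \<Longrightarrow> b q = 1"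
     "\<And>q. b q \<noteq> 0 \<Longrightarrow> rd p q \<le> 2 * \<delta>"
    using *[OF U(1) d(1,2)] by metis
  have "rd p q < e" if "q \<in> V" for q using b(3)[OF that] b(4)[of q] d(3) by simp
  then show ?thesis using b by blast
qed

lemma openin_rdist_iff: "openin mtopology S \<longleftrightarrow> open S"
proof
  assume S: "openin mtopology S"
  show "open S"
  proof (subst open_subopen, rule ballI)
    fix p assume "p \<in> S"
    then obtain r where r: "r > 0" "mball p r \<subseteq> S" using S unfolding openin_mtopology by blast
    obtain N where "open N" "p \<in> N" "\<forall>q\<in>N. rd p q < r" using rdist_small[OF r(1)] by blast
    then show "\<exists>T. open T \<and> p \<in> T \<and> T \<subseteq> S" using r(2) by (intro exI[of _ N]) auto
  qed
next
  assume S: "open S"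
  show "openin mtopology S" unfolding openin_mtopology
  proof (intro conjI allI impI)
    fix p assume "p \<in> S"
    then obtain e where "e > 0" "\<forall>q. rd p q < e \<longrightarrow> q \<in> S" using rdist_ball_subset[OF S] by blast
    then show "\<exists>r>0. mball p r \<subseteq> S" by (intro exI[of _ e]) auto
  qed simp
qed

text \<open>Lets facts on metric spaces, such as the compactness of closures of totally bounded
  sets, be read in the manifold topology.\<close>

lemma mtopology_eq: "mtopology = euclidean"
  by (simp add: topology_eq openin_rdist_iff)

lemma continuous_rdist: "continuous_on UNIV (rd p)"
proof -
  have "isCont (rd p) q" for q unfolding continuous_at_open
  proof (intro allI impI)
    fix t assume t: "open t \<and> rd p q \<in> t"
    then obtain e where e: "e > 0" "ball (rd p q) e \<subseteq> t" using open_contains_ball by blast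
    obtain N where N: "open N" "q \<in> N" "\<forall>r\<in>N. rd q r < e" using rdist_small[OF e(1)] by blast
    have "rd p r \<in> t" if "r \<in> N" for r
    proof -
      have "\<bar>rd p q - rd p r\<bar> < e"
        using rdist_triangle[of p q r] rdist_triangle[of p r q] rdist_commute[of q r] N(3) that
        by (smt (verit))
      then show ?thesis using e(2) by (auto simp: dist_real_def)
    qed
    then show "\<exists>s. open s \<and> q \<in> s \<and> (\<forall>x'\<in>s. rd p x' \<in> t)" using N by blast
  qed
  then show ?thesis by (simp add: continuous_at_imp_continuous_on)
qed

end

section \<open>Complete manifolds\<close>

context rmanifold
begin

definition cb :: "'b \<Rightarrow> real \<Rightarrow> 'b set" where "cb o' r = {q. rd o' q \<le> r}"

lemma closed_cb: "closed (cb o' r)"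
  unfolding cb_def by (intro closed_Collect_le continuous_rdist continuous_on_const)

lemma rdist_le_arc_length: "joins \<gamma> p q \<Longrightarrow> ennreal (rd p q) \<le> arc_length \<gamma> 0 1"
  unfolding ennreal_rdist by (rule INF_lower) simp

text \<open>On a nearly shortest curve from \<open>o'\<close> to \<open>p\<close> the intermediate
  value theorem gives a point at distance exactly \<open>s\<close>. The first piece has length at
  least \<open>s\<close>, so less than \<open>t\<close> is left for the second.\<close>

lemma rdist_between:
  assumes "rd o' p < s + t" "0 \<le> s" "0 < t" shows "\<exists>q. rd o' q \<le> s \<and> rd q p < t"
proof (cases "rd o' p \<le> s \<or> s = 0")
  case True
  then show ?thesis using assms rdist_refl by (metis add_0 order_refl)
next
  case False
  then have s: "s > 0" "s < rd o' p" using assms by auto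
  obtain \<gamma> where \<gamma>: "joins \<gamma> o' p" "arc_length \<gamma> 0 1 < ennreal (s + t)" by (rule rdist_less[OF assms(1)])
  obtain S where S: "continuous_on {0..1} \<gamma>" "finite S" "\<And>t. t \<in> {0<..<1} - S \<Longrightarrow> C1_near \<gamma> t"
    using \<gamma>(1) unfolding joins_def piecewise_C1_curve_iff by blast
  have e: "\<gamma> 0 = o'" "\<gamma> 1 = p" using \<gamma>(1) by (auto simp: joins_def)
  have "continuous_on {0..1} (\<lambda>t. rd o' (\<gamma> t))"
    by (rule continuous_on_compose2[OF continuous_rdist S(1)]) auto
  then obtain \<tau> where \<tau>: "0 \<le> \<tau>" "\<tau> \<le> 1" "rd o' (\<gamma> \<tau>) = s"
    using IVT'[of "\<lambda>t. rd o' (\<gamma> t)" 0 s 1] s e rdist_refl by auto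
  have \<tau>': "0 < \<tau>" "\<tau> < 1" using \<tau> s e rdist_refl[of o'] by (auto simp: less_le)
  have "ennreal s \<le> arc_length \<gamma> 0 \<tau>"
    using rdist_le_arc_length[OF joins_restrict(1)[OF \<gamma>(1), of 0 \<tau>]] joins_restrict(2)[OF \<gamma>(1), of 0 \<tau>] \<tau> \<tau>' e by simp
  moreover have "ennreal (rd (\<gamma> \<tau>) p) \<le> arc_length \<gamma> \<tau> 1"
    using rdist_le_arc_length[OF joins_restrict(1)[OF \<gamma>(1), of \<tau> 1]] joins_restrict(2)[OF \<gamma>(1), of \<tau> 1] \<tau> \<tau>' e by simp
  ultimately have "ennreal s + ennreal (rd (\<gamma> \<tau>) p) \<le> arc_length \<gamma> 0 \<tau> + arc_length \<gamma> \<tau> 1" by (rule add_mono)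
  also have "\<dots> = arc_length \<gamma> 0 1" by (rule arc_length_split[symmetric, OF \<tau>(1,2) S(2,3)])
  also have "\<dots> < ennreal (s + t)" by (rule \<gamma>(2))
  finally have "ennreal s + ennreal (rd (\<gamma> \<tau>) p) < ennreal (s + t)" .
  moreover have "ennreal (s + rd (\<gamma> \<tau>) p) = ennreal s + ennreal (rd (\<gamma> \<tau>) p)"
    by (rule ennreal_plus) (use s rdist_nonneg in auto)
  ultimately have "ennreal (s + rd (\<gamma> \<tau>) p) < ennreal (s + t)" by (simp only:)
  then have "s + rd (\<gamma> \<tau>) p < s + t" by (subst (asm) ennreal_less_iff) (use s rdist_nonneg in auto)
  then have "rd (\<gamma> \<tau>) p < t" by simp
  then show ?thesis using \<tau>(3) by auto
qed

text \<open>Finitely many of the neighbourhoods cover \<open>K\<close>, and by monotonicity the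
  least of their bounds serves them all.\<close>

lemma compact_uniform:
  fixes K :: "'b set"
  assumes K: "compact K" and loc: "\<And>z. z \<in> K \<Longrightarrow> \<exists>U \<delta>. open U \<and> z \<in> U \<and> \<delta> > 0 \<and> (\<forall>w\<in>U. P w \<delta>)"
    and mono: "\<And>w \<delta> \<delta>'. P w \<delta> \<Longrightarrow> 0 < \<delta>' \<Longrightarrow> \<delta>' \<le> \<delta> \<Longrightarrow> P w \<delta>'"
  obtains \<delta> :: real where "\<delta> > 0" "\<And>w. w \<in> K \<Longrightarrow> P w \<delta>"
proof -
  obtain U \<delta> where U: "\<And>z. z \<in> K \<Longrightarrow> open (U z) \<and> z \<in> U z \<and> \<delta> z > 0 \<and> (\<forall>w\<in>U z. P w (\<delta> z))"
    using loc by metis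
  obtain Z where Z: "Z \<subseteq> K" "finite Z" "K \<subseteq> (\<Union>z\<in>Z. U z)"
    by (rule compactE_image[OF K, of K U]) (use U in auto)
  \<comment> \<open>The 1 keeps the minimum meaningful when \<open>Z\<close> is empty.\<close>
  define d where "d = Min (insert 1 (\<delta> ` Z))"
  have d: "d > 0" "\<And>z. z \<in> Z \<Longrightarrow> d \<le> \<delta> z" using Z U by (auto simp: d_def)
  show ?thesis
  proof (rule that[OF d(1)])
    fix w assume "w \<in> K"
    then obtain z where z: "z \<in> Z" "w \<in> U z" using Z by auto
    then have "P w (\<delta> z)" using U Z by blast
    then show "P w d" by (rule mono[OF _ d(1) d(2)[OF z(1)]])
  qed
qed

lemma compact_nbhd:
  fixes K :: "'b set"
  assumes K: "compact K" "K \<subseteq> U" "open U" obtains e where "e > 0" "\<And>q p. q \<in> K \<Longrightarrow> rd q p < e \<Longrightarrow> p \<in> U"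
proof (rule compact_uniform[OF K(1), of "\<lambda>q e. \<forall>p. rd q p < e \<longrightarrow> p \<in> U"])
  fix d :: real assume "d > 0" "\<And>w. w \<in> K \<Longrightarrow> \<forall>p. rd w p < d \<longrightarrow> p \<in> U"
  then show thesis using that by blast
next
  show "\<forall>p. rd w p < d' \<longrightarrow> p \<in> U" if "\<forall>p. rd w p < d \<longrightarrow> p \<in> U" "d' \<le> d" for w d d'
    using that(1) less_le_trans[OF _ that(2)] by blast
  fix z assume "z \<in> K"
  then obtain e where e: "e > 0" "\<forall>q. rd z q < e \<longrightarrow> q \<in> U" using rdist_ball_subset[OF K(3), of z] K by blast
  have "p \<in> U" if "rd z w < e / 2" "rd w p < e / 2" for w p
    using rdist_triangle[of z p w] e(2) that by (smt (verit) field_sum_of_halves)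
  moreover have "open {w. rd z w < e / 2}" by (intro open_Collect_less continuous_rdist continuous_on_const)
  ultimately show "\<exists>U' \<delta>. open U' \<and> z \<in> U' \<and> \<delta> > 0 \<and> (\<forall>w\<in>U'. \<forall>p. rd w p < \<delta> \<longrightarrow> p \<in> U)"
    using e(1) by (intro exI[of _ "{w. rd z w < e / 2}"] exI[of _ "e / 2"]) (auto simp: rdist_refl)
qed

text \<open>Hopf--Rinow: the radii of compact closed balls form a set that is open and closed.\<close>
lemma compact_cb:
  assumes complete: "complete_riemannian \<B> h" shows "compact (cb o' r)"
proof (rule ccontr)
  assume r: "\<not> compact (cb o' r)"
  define S where "S = {s. 0 \<le> s \<and> compact (cb o' s)}"
  have sub: "compact (cb o' s)" if "compact (cb o' t)" "s \<le> t" for s t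
  proof -
    have "cb o' s = cb o' t \<inter> cb o' s" using that(2) by (auto simp: cb_def)
    then show ?thesis using compact_Int_closed[OF that(1) closed_cb] by metis
  qed
  have "cb o' 0 = {o'}" using antisym[OF _ rdist_nonneg[of o']] rdist_zero[of o'] by (auto simp: cb_def rdist_refl)
  then have 0: "0 \<in> S" by (simp add: S_def)
  have bdd: "bdd_above S" unfolding bdd_above_def 
  proof (intro exI[of _ r] ballI, rule ccontr)
    fix t assume "t \<in> S" "\<not> t \<le> r"
    then show False using r sub[of t r] by (simp add: S_def)
  qed
  define R where "R = Sup S"
  have R: "R \<ge> 0" unfolding R_def by (rule cSup_upper[OF 0 bdd])
  have below: "compact (cb o' s)" if "s < R" for s
  proof -
    obtain t where "t \<in> S" "s < t" using \<open>s < R\<close> less_cSup_iff[OF _ bdd, of s] 0 unfolding R_def by blast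
    then show ?thesis using sub[of t s] by (simp add: S_def)
  qed
  have cR: "compact (cb o' R)"
  proof (cases "R = 0")
    case True then show ?thesis using 0 by (simp add: S_def)
  next
    case False
    \<comment> \<open>By \<open>rdist_between\<close> every point of the ball of radius
      \<open>R\<close> is within e / 2 of a compact ball of slightly smaller radius
      \<open>s\<close>, so a finite net of the latter serves the former.\<close>
    have "mtotally_bounded (cb o' R)"
      unfolding mtotally_bounded_def
    proof (intro allI impI)
      fix e :: real assume e: "e > 0"
      define s where "s = max 0 (R - e / 4)"
      have s: "0 \<le> s" "s < R" "R < s + e / 2" using False R e by (auto simp: s_def)
      obtain Z where Z: "Z \<subseteq> cb o' s" "finite Z" "cb o' s \<subseteq> (\<Union>z\<in>Z. {q. rd z q < e / 2})"
      proof (rule compactE_image[OF below[OF s(2)]])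
        show "open {q. rd z q < e / 2}" for z by (intro open_Collect_less continuous_rdist continuous_on_const)
        show "cb o' s \<subseteq> (\<Union>z\<in>cb o' s. {q. rd z q < e / 2})" using e rdist_refl by auto
      qed
      have "cb o' R \<subseteq> (\<Union>x\<in>Z. mball x e)"
      proof
        fix p assume "p \<in> cb o' R"
        then have "rd o' p < s + e / 2" using s by (simp add: cb_def)
        then obtain q where q: "rd o' q \<le> s" "rd q p < e / 2" using rdist_between s(1) e by (meson half_gt_zero)
        then obtain z where "z \<in> Z" "rd z q < e / 2" using Z(3) by (auto simp: cb_def)
        then show "p \<in> (\<Union>x\<in>Z. mball x e)" using q(2) rdist_triangle[of z p q] by (intro UN_I[of z]) auto
      qed
      moreover have "Z \<subseteq> cb o' R" using Z(1) s(2) by (auto simp: cb_def)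
      ultimately show "\<exists>K. finite K \<and> K \<subseteq> cb o' R \<and> cb o' R \<subseteq> (\<Union>x\<in>K. mball x e)" using Z(2) by blast
    qed
    then have "compactin mtopology (mtopology closure_of (cb o' R))"
      using mtotally_bounded_eq_compact_closure_of complete unfolding complete_riemannian_def by blast
    then have "compact (closure (cb o' R))" by (simp add: mtopology_eq)
    then show ?thesis by (simp add: closure_closed[OF closed_cb])
  qed
  \<comment> \<open>The compact ball has a relatively compact neighbourhood, which contains a ball
    of larger radius; this contradicts the choice of \<open>R\<close> as supremum.\<close>
  obtain \<Omega> where \<Omega>: "compact_domain \<Omega>" "cb o' R \<subseteq> interior \<Omega>" by (rule compact_domain_exists[OF cR])
  obtain e where e: "e > 0" "\<And>q p. q \<in> cb o' R \<Longrightarrow> rd q p < e \<Longrightarrow> p \<in> interior \<Omega>"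
    using compact_nbhd[OF cR \<Omega>(2) open_interior] by blast
  have "cb o' (R + e / 2) \<subseteq> \<Omega>"
  proof
    fix p assume "p \<in> cb o' (R + e / 2)"
    then have "rd o' p < R + e" using e(1) by (simp add: cb_def)
    then obtain q where "rd o' q \<le> R" "rd q p < e" using rdist_between R e(1) by blast
    then show "p \<in> \<Omega>" using e(2)[of q p] interior_subset by (auto simp: cb_def)
  qed
  then have "cb o' (R + e / 2) = \<Omega> \<inter> cb o' (R + e / 2)" by blast
  then have "compact (cb o' (R + e / 2))"
    using compact_Int_closed[OF _ closed_cb] \<Omega>(1) unfolding compact_domain_def by metis
  then have "R + e / 2 \<in> S" using R e by (simp add: S_def)
  then have "R + e / 2 \<le> R" unfolding R_def by (rule cSup_upper[OF _ bdd])
  then show False using e(1) by simp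
qed

section \<open>Cutoff functions\<close>

text \<open>A smooth maximum of finitely many bumps whose plateaus cover the ball. The constant is
  \<open>2 * step_bound\<close> times the bound \<open>8 * step_bound / \<delta>\<close> of the
  single bumps, whatever their number.\<close>

lemma cutoff_layer:
  fixes o' :: 'b
  assumes K: "compact (cb o' t)" "0 \<le> t" and \<delta>: "\<delta> > 0"
    and b: "\<And>w. w \<in> cb o' t \<Longrightarrow> \<exists>b. smooth b \<and> (\<forall>q. 0 \<le> b q \<and> b q \<le> 1)
       \<and> (\<exists>V. open V \<and> w \<in> V \<and> (\<forall>q\<in>V. b q = 1)) \<and> (\<forall>q. b q \<noteq> 0 \<longrightarrow> rd w q \<le> 2 * \<delta>)
       \<and> (\<forall>q. grad_le b q (8 * step_bound / \<delta>))"
  shows "\<exists>w. smooth w \<and> (\<forall>q. 0 \<le> w q \<and> w q \<le> 1) \<and> (\<forall>q. rd o' q \<le> t \<longrightarrow> w q = 1)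
    \<and> (\<forall>q. w q \<noteq> 0 \<longrightarrow> rd o' q \<le> t + 2 * \<delta>) \<and> (\<forall>q. grad_le w q (16 * step_bound\<^sup>2 / \<delta>))"
proof -
  define Q where "Q w b V \<longleftrightarrow> smooth b \<and> (\<forall>q. 0 \<le> b q \<and> b q \<le> 1) \<and> open V \<and> w \<in> V \<and> (\<forall>q\<in>V. b q = 1)
       \<and> (\<forall>q. b q \<noteq> 0 \<longrightarrow> rd w q \<le> 2 * \<delta>) \<and> (\<forall>q. grad_le b q (8 * step_bound / \<delta>))" for w b V
  have "\<exists>b V. Q w b V" if "w \<in> cb o' t" for w using b[OF that] unfolding Q_def by blast
  then obtain b V where Q: "\<And>w. w \<in> cb o' t \<Longrightarrow> Q w (b w) (V w)" by metis
  have b: "\<And>w. w \<in> cb o' t \<Longrightarrow> smooth (b w)" "\<And>w q. w \<in> cb o' t \<Longrightarrow> 0 \<le> b w q \<and> b w q \<le> 1"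
    "\<And>w. w \<in> cb o' t \<Longrightarrow> open (V w)" "\<And>w. w \<in> cb o' t \<Longrightarrow> w \<in> V w" "\<And>w q. w \<in> cb o' t \<Longrightarrow> q \<in> V w \<Longrightarrow> b w q = 1"
    "\<And>w q. w \<in> cb o' t \<Longrightarrow> b w q \<noteq> 0 \<Longrightarrow> rd w q \<le> 2 * \<delta>"
    "\<And>w q. w \<in> cb o' t \<Longrightarrow> grad_le (b w) q (8 * step_bound / \<delta>)"
    using Q unfolding Q_def by blast+
  obtain Z where Z: "Z \<subseteq> cb o' t" "finite Z" "cb o' t \<subseteq> (\<Union>z\<in>Z. V z)"
    by (rule compactE_image[OF K(1), of "cb o' t" V]) (use b in auto)
  have "o' \<in> cb o' t" using K(2) by (simp add: cb_def rdist_refl)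
  then have Z0: "Z \<noteq> {}" using Z by auto
  have L: "8 * step_bound / \<delta> \<ge> 0" using step_bound(1) \<delta> by simp
  obtain w where w: "smooth w" "\<And>q. 0 \<le> w q \<and> w q \<le> 1" "\<And>q. \<exists>z\<in>Z. b z q = 1 \<Longrightarrow> w q = 1"
    "\<And>q. \<forall>z\<in>Z. b z q = 0 \<Longrightarrow> w q = 0" "\<And>q. grad_le w q (2 * step_bound * (8 * step_bound / \<delta>))"
  proof -
    have "\<exists>w. smooth w \<and> (\<forall>p. 0 \<le> w p \<and> w p \<le> 1) \<and> (\<forall>p. (\<exists>z\<in>Z. b z p = 1) \<longrightarrow> w p = 1)
      \<and> (\<forall>p. (\<forall>z\<in>Z. b z p = 0) \<longrightarrow> w p = 0) \<and> (\<forall>p. grad_le w p (2 * step_bound * (8 * step_bound / \<delta>)))"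
      by (rule smooth_maximum[OF Z(2) Z0 _ _ _ L]) (use b Z(1) in blast)+
    then show ?thesis using that by blast
  qed
  have "w q = 1" if "rd o' q \<le> t" for q
  proof (rule w(3))
    have "q \<in> cb o' t" using that by (simp add: cb_def)
    then show "\<exists>z\<in>Z. b z q = 1" using b(5) Z by blast
  qed
  moreover have "rd o' q \<le> t + 2 * \<delta>" if q: "w q \<noteq> 0" for q
  proof -
    obtain z where z: "z \<in> Z" "b z q \<noteq> 0" using w(4) q by blast
    then have "rd o' z \<le> t" "rd z q \<le> 2 * \<delta>" using b(6) Z(1) by (auto simp: cb_def)
    then show ?thesis using rdist_triangle[of o' q z] by linarith
  qed
  moreover have "2 * step_bound * (8 * step_bound / \<delta>) = 16 * step_bound\<^sup>2 / \<delta>" by (simp add: power2_eq_square)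
  ultimately show ?thesis using w(1,2,5) by (intro exI[of _ w] conjI allI impI) (simp_all only: simp_thms)
qed

text \<open>Averaging \<open>N\<close> layers of thickness \<open>1 / N\<close> gives a gradient bound that does not depend on how
  small the local charts are: at every point at most one layer has a nonzero gradient.\<close>
lemma cutoff:
  fixes o' :: 'b
  assumes K: "\<And>r. compact (cb o' r)" and s: "s \<ge> 0"
  shows "\<exists>w. smooth w \<and> (\<forall>q. 0 \<le> w q \<and> w q \<le> 1) \<and> (\<forall>q. rd o' q \<le> s \<longrightarrow> w q = 1)
    \<and> (\<forall>q. w q \<noteq> 0 \<longrightarrow> rd o' q \<le> s + 1) \<and> (\<forall>q. grad_le w q (32 * step_bound\<^sup>2))"
proof -
  define B where "B w \<delta> \<longleftrightarrow> (\<exists>b. smooth b \<and> (\<forall>q. 0 \<le> b q \<and> b q \<le> 1)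
       \<and> (\<exists>V. open V \<and> w \<in> V \<and> (\<forall>q\<in>V. b q = 1)) \<and> (\<forall>q. b q \<noteq> 0 \<longrightarrow> rd w q \<le> 2 * \<delta>)
       \<and> (\<forall>q. grad_le b q (8 * step_bound / \<delta>)))" for w \<delta>
  define P where "P w \<delta>\<^sub>0 \<longleftrightarrow> (\<forall>\<delta>. 0 < \<delta> \<longrightarrow> \<delta> \<le> \<delta>\<^sub>0 \<longrightarrow> B w \<delta>)" for w \<delta>\<^sub>0
  obtain \<delta>\<^sub>0 where d0: "\<delta>\<^sub>0 > 0" "\<And>w. w \<in> cb o' (s + 1) \<Longrightarrow> P w \<delta>\<^sub>0"
  proof (rule compact_uniform[OF K, of "s + 1" P])
    fix z assume "z \<in> cb o' (s + 1)"
    show "\<exists>U \<delta>. open U \<and> z \<in> U \<and> \<delta> > 0 \<and> (\<forall>w\<in>U. P w \<delta>)"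
    proof (rule local_bumps[OF open_UNIV UNIV_I, of z])
      fix U \<delta>\<^sub>0 assume U: "open U" "z \<in> U" "(\<delta>\<^sub>0::real) > 0"
        and *: "\<And>w \<delta>. w \<in> U \<Longrightarrow> 0 < \<delta> \<Longrightarrow> \<delta> \<le> \<delta>\<^sub>0 \<Longrightarrow> \<exists>b. smooth b \<and> (\<forall>q. 0 \<le> b q \<and> b q \<le> 1)
           \<and> (\<exists>V. open V \<and> w \<in> V \<and> (\<forall>q\<in>V. b q = 1)) \<and> (\<forall>q. b q \<noteq> 0 \<longrightarrow> q \<in> UNIV \<and> rd w q \<le> 2 * \<delta>)
           \<and> (\<forall>q. grad_le b q (8 * step_bound / \<delta>))"
      have "P w \<delta>\<^sub>0" if "w \<in> U" for w unfolding P_def B_def using *[OF that] by simp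
      then show ?thesis using U by blast
    qed
  qed (auto simp: P_def)
  obtain n where n: "1 / (2 * \<delta>\<^sub>0) < real n" using reals_Archimedean2 by blast
  define N where "N = Suc n"
  have N: "N > 0" by (simp add: N_def)
  \<comment> \<open>With this value layer \<open>j\<close> falls from 1 to 0 between the radii s + j
    / N and s + (j + 1) / N; \<open>N\<close> is large enough for \<delta> to be admissible on the
    whole ball of radius s + 1.\<close>
  define \<delta> where "\<delta> = 1 / (2 * real N)"
  have \<delta>: "\<delta> > 0" "\<delta> \<le> \<delta>\<^sub>0" using n d0(1) by (auto simp: \<delta>_def N_def field_simps)
  define Q where "Q j w \<longleftrightarrow> smooth w \<and> (\<forall>q. 0 \<le> w q \<and> w q \<le> 1) \<and> (\<forall>q. rd o' q \<le> s + real j / N \<longrightarrow> w q = 1)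
    \<and> (\<forall>q. w q \<noteq> 0 \<longrightarrow> rd o' q \<le> s + real j / N + 2 * \<delta>) \<and> (\<forall>q. grad_le w q (16 * step_bound\<^sup>2 / \<delta>))" for j w
  have "\<exists>w. Q j w" if j: "j < N" for j unfolding Q_def
  proof (rule cutoff_layer[OF K _ \<delta>(1)])
    fix w assume "w \<in> cb o' (s + real j / N)"
    moreover have "real j / N \<le> 1" using j N by simp
    ultimately have "w \<in> cb o' (s + 1)" by (simp add: cb_def)
    then have "B w \<delta>" using d0(2) \<delta> unfolding P_def by blast
    then show "\<exists>b. smooth b \<and> (\<forall>q. 0 \<le> b q \<and> b q \<le> 1)
       \<and> (\<exists>V. open V \<and> w \<in> V \<and> (\<forall>q\<in>V. b q = 1)) \<and> (\<forall>q. b q \<noteq> 0 \<longrightarrow> rd w q \<le> 2 * \<delta>)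
       \<and> (\<forall>q. grad_le b q (8 * step_bound / \<delta>))" unfolding B_def .
  qed (use s in simp)
  then obtain w where Q: "\<And>j. j < N \<Longrightarrow> Q j (w j)" by metis
  have \<delta>_eq: "2 * \<delta> = 1 / N" "16 * step_bound\<^sup>2 / \<delta> = N * (32 * step_bound\<^sup>2)" by (simp_all add: \<delta>_def)
  have w: "\<And>j. j < N \<Longrightarrow> smooth (w j)" "\<And>j q. j < N \<Longrightarrow> 0 \<le> w j q \<and> w j q \<le> 1"
    "\<And>j q. j < N \<Longrightarrow> rd o' q \<le> s + real j / N \<Longrightarrow> w j q = 1"
    "\<And>j q. j < N \<Longrightarrow> w j q \<noteq> 0 \<Longrightarrow> rd o' q \<le> s + real j / N + 1 / N"
    "\<And>j q. j < N \<Longrightarrow> grad_le (w j) q (N * (32 * step_bound\<^sup>2))"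
    using Q unfolding Q_def \<delta>_eq by blast+
  define W where "W q = 1 / N * (\<Sum>j<N. w j q)" for q
  have sm: "smooth (\<lambda>q. \<Sum>j<N. w j q)" by (rule smooth_sum) (use w(1) in auto)
  have "smooth W" unfolding W_def[abs_def] by (intro smooth_mult smooth_const sm)
  moreover have "0 \<le> W q \<and> W q \<le> 1" for q
  proof -
    have "(\<Sum>j<N. w j q) \<le> (\<Sum>j<N. 1)" by (rule sum_mono) (use w(2) in auto)
    moreover have "(\<Sum>j<N. w j q) \<ge> 0" by (rule sum_nonneg) (use w(2) in auto)
    ultimately show ?thesis using N by (simp add: W_def)
  qed
  moreover have "W q = 1" if "rd o' q \<le> s" for q
  proof -
    have "w j q = 1" if "j < N" for j
      by (rule w(3)[OF that]) (use \<open>rd o' q \<le> s\<close> in \<open>auto intro: order_trans\<close>)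
    then show ?thesis using N by (simp add: W_def)
  qed
  moreover have "rd o' q \<le> s + 1" if q: "W q \<noteq> 0" for q
  proof -
    have "\<exists>j<N. w j q \<noteq> 0"
    proof (rule ccontr)
      assume "\<not> ?thesis" then have "W q = 0" by (simp add: W_def)
      then show False using q by simp
    qed
    then obtain j where j: "j < N" "w j q \<noteq> 0" by blast
    have "real j / N + 1 / N \<le> 1" using j(1) by (simp add: add_divide_distrib[symmetric])
    then show ?thesis using w(4)[OF j] by linarith
  qed
  moreover have "grad_le W q (32 * step_bound\<^sup>2)" for q
  proof -
    \<comment> \<open>The layers with a value strictly between 0 and 1 at \<open>q\<close>; every
      other layer has an extremum there and hence no gradient.\<close>
    define J where "J = {j. j < N \<and> 0 < w j q \<and> w j q < 1}"
    define L where "L j = (if j \<in> J then N * (32 * step_bound\<^sup>2) else 0)" for j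
    have "grad_le (w j) q (L j)" if j: "j < N" for j
    proof (cases "j \<in> J")
      case False
      then have "w j q = 0 \<or> w j q = 1" using w(2)[OF j, of q] j by (auto simp: J_def)
      then have "(\<forall>p. w j p \<le> w j q) \<or> (\<forall>p. w j q \<le> w j p)" using w(2)[OF j] by auto
      then show ?thesis using False by (simp add: L_def grad_le_extremum[OF w(1)[OF j]])
    qed (use w(5)[OF j] in \<open>simp add: L_def\<close>)
    then have "grad_le (\<lambda>q. \<Sum>j<N. w j q) q (\<Sum>j<N. L j)"
      by (intro grad_le_sum) (use w(1) in auto)
    then have g: "grad_le W q (\<bar>1 / N\<bar> * (\<Sum>j<N. L j))" unfolding W_def[abs_def] by (rule grad_le_cmult[OF sm])
    \<comment> \<open>Both layers are in transition at \<open>q\<close>, and their half-open shells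
      of thickness 1 / N are disjoint for different indices.\<close>
    have eq: "i = j" if ij: "i \<in> J" "j \<in> J" for i j
    proof (rule ccontr)
      have *: "real j < real i + 1" if "i \<in> J" "j \<in> J" for i j
      proof -
        have "s + real j / N < rd o' q" using w(3)[of j q] that by (force simp: J_def)
        moreover have "rd o' q \<le> s + real i / N + 1 / N" using w(4)[of i q] that by (force simp: J_def)
        ultimately have "real j / N < (real i + 1) / N" by (simp add: add_divide_distrib)
        then show ?thesis using N by (simp add: divide_less_cancel)
      qed
      assume "i \<noteq> j"
      then show False using *[OF ij] *[OF ij(2,1)] by linarith
    qed
    have fJ: "finite J" by (simp add: J_def)
    have "card J \<le> 1" using eq fJ by (metis One_nat_def card_le_Suc0_iff_eq)
    have "(\<Sum>j<N. L j) = (\<Sum>j\<in>J. N * (32 * step_bound\<^sup>2))" unfolding L_def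
      by (rule sum.mono_neutral_cong_right) (auto simp: J_def)
    also have "\<dots> \<le> N * (32 * step_bound\<^sup>2)"
      using mult_right_mono[of "real (card J)" 1 "N * (32 * step_bound\<^sup>2)"] \<open>card J \<le> 1\<close> by simp
    finally have "\<bar>1 / N\<bar> * (\<Sum>j<N. L j) \<le> 32 * step_bound\<^sup>2" using N by (simp add: field_simps)
    then show ?thesis using g grad_le_mono by blast
  qed
  ultimately show ?thesis by blast
qed

end

section \<open>Negative directions of a Schroedinger operator\<close>

lemma power_exceeds_powr:
  fixes y v C c \<alpha> :: real
  assumes "y > 1" "v > 0" shows "\<exists>n. C * (real n + c) powr \<alpha> < y ^ n * v"
proof -
  have "((\<lambda>n. (real n + c) powr \<alpha> / y ^ n) \<longlongrightarrow> 0) at_top" using assms(1) by real_asymp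
  then have "((\<lambda>n. C * ((real n + c) powr \<alpha> / y ^ n)) \<longlongrightarrow> C * 0) at_top" by (intro tendsto_intros)
  then have "\<forall>\<^sub>F n in at_top. C * ((real n + c) powr \<alpha> / y ^ n) < v"
    using assms(2) by (intro order_tendstoD(2)) auto
  then obtain n where "C * ((real n + c) powr \<alpha> / y ^ n) < v" by (auto simp: eventually_at_top_linorder)
  then show ?thesis using assms(1) by (intro exI[of _ n]) (simp add: field_simps)
qed

text \<open>Otherwise \<open>V\<close> would satisfy \<open>V (b + 1) \<ge> (1 + k / (2 * D)) * V b\<close> for large \<open>b\<close>, hence grow
  exponentially.\<close>
lemma polynomial_growth_slow_step:
  fixes V :: "nat \<Rightarrow> real"
  assumes mono: "mono V" and unbounded: "\<And>B. \<exists>n. V n > B"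
    and growth: "\<And>n. n \<ge> n\<^sub>0 \<Longrightarrow> V n \<le> C * (real n + 1) powr \<alpha>" and D: "D > 0" and k: "k > 0"
  shows "\<exists>b\<ge>Suc a. D * (V (Suc a) - V a + (V (Suc b) - V b)) < k * (V b - V (Suc a))"
proof (rule ccontr)
  assume "\<not> ?thesis"
  then have H: "k * (V b - V (Suc a)) \<le> D * (V (Suc a) - V a + (V (Suc b) - V b))" if "b \<ge> Suc a" for b
    using that not_less by blast
  \<comment> \<open>The terms independent of \<open>b\<close>. Once k V(b) >= 2 E they are absorbed
    at the cost of half of k, which is the origin of the 2 in \<open>y\<close>.\<close>
  define E where "E = k * V (Suc a) + D * (V (Suc a) - V a)"
  obtain m where m: "V m > max (2 * E / k) 0" using unbounded by blast
  define b\<^sub>0 where "b\<^sub>0 = max m (max (Suc a) n\<^sub>0)"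
  define y where "y = 1 + k / (2 * D)"
  have y: "y > 1" using D k by (simp add: y_def)
  have step: "y * V b \<le> V (Suc b)" if b: "b \<ge> b\<^sub>0" for b
  proof -
    have "V b \<ge> V m" using mono b by (simp add: b\<^sub>0_def mono_def)
    then have "k * V m \<le> k * V b" using k by simp
    moreover have "2 * E < k * V m" using m k by (simp add: field_simps)
    ultimately have "k * V b \<ge> 2 * E" by linarith
    moreover have "k * V b - E \<le> D * (V (Suc b) - V b)" using H[of b] b by (simp add: b\<^sub>0_def E_def algebra_simps)
    ultimately have "k * V b \<le> 2 * D * (V (Suc b) - V b)" by linarith
    then show ?thesis using D by (simp add: y_def field_simps)
  qed
  have exp: "y ^ n * V b\<^sub>0 \<le> V (b\<^sub>0 + n)" for n
  proof (induction n)
    case (Suc n)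
    have "y ^ Suc n * V b\<^sub>0 = y * (y ^ n * V b\<^sub>0)" by simp
    also have "\<dots> \<le> y * V (b\<^sub>0 + n)" using Suc y by (intro mult_left_mono) auto
    also have "\<dots> \<le> V (b\<^sub>0 + Suc n)" using step[of "b\<^sub>0 + n"] by simp
    finally show ?case .
  qed simp
  have "V m \<le> V b\<^sub>0" using mono by (simp add: b\<^sub>0_def mono_def)
  then have "V b\<^sub>0 > 0" using m by linarith
  then obtain n where "C * (real n + (real b\<^sub>0 + 1)) powr \<alpha> < y ^ n * V b\<^sub>0"
    using power_exceeds_powr[OF y] by blast
  moreover have "V (b\<^sub>0 + n) \<le> C * (real (b\<^sub>0 + n) + 1) powr \<alpha>" by (rule growth) (simp add: b\<^sub>0_def)
  ultimately show False using exp[of n] by (simp add: algebra_simps)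
qed

context weighted_rmanifold
begin

section \<open>The quadratic form of a potential\<close>

text \<open>The stability form after integration by parts, for a general potential \<open>q\<close>;
  only first derivatives of \<open>u\<close> are left.\<close>

definition qform :: "('b \<Rightarrow> real) \<Rightarrow> ('b \<Rightarrow> real) \<Rightarrow> real" where
  "qform q u = (\<integral>p. gip u u p \<partial>\<mu>) - (\<integral>p. q p * u p * u p \<partial>\<mu>)"

lemma gip_extremum:
  assumes u: "smooth u" "smooth w" and ext: "(\<forall>q. u q \<le> u p) \<or> (\<forall>q. u p \<le> u q)"
  shows "gip u w p = 0"
proof -
  have c: "chart_at \<B> p \<in> \<B>" "p \<in> fst (chart_at \<B> p)" using chart_at by auto
  show ?thesis unfolding gip_dird[OF u c] by (rule dird_extremum[OF u(1) c ext])
qed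

lemma gip_cmult_left:
  assumes u: "smooth u" "smooth w" shows "gip (\<lambda>p. a * u p) w p = a * gip u w p"
proof -
  have c: "chart_at \<B> p \<in> \<B>" "p \<in> fst (chart_at \<B> p)" using chart_at by auto
  have s: "smooth (\<lambda>p. a * u p)" by (intro smooth_mult smooth_const u)
  show ?thesis unfolding gip_dird[OF u c] gip_dird[OF s u(2) c]
    by (rule dird_eqI) (intro has_derivative_mult_right has_derivative_dird diff_chart[OF u(1) c(1)] snd_in c)
qed

lemma integrable_test:
  assumes u: "smooth u" "compact (closure {p. u p \<noteq> 0})"
  shows "integrable \<mu> (gip u u)" "continuous_on UNIV q \<Longrightarrow> integrable \<mu> (\<lambda>p. q p * u p * u p)"
proof -
  show "integrable \<mu> (gip u u)" by (rule Green(2)[OF u u(1)])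
  show "integrable \<mu> (\<lambda>p. q p * u p * u p)" if "continuous_on UNIV q"
    by (rule integrable_compact_support[OF _ u]) (intro continuous_intros that smooth_continuous[OF u(1)])
qed

lemma qform_nonzero: assumes "smooth u" "qform q u < 0" shows "\<exists>p. u p \<noteq> 0"
proof (rule ccontr)
  assume "\<not> ?thesis"
  then have 0: "u p = 0" for p by blast
  then have "gip u u p = 0" for p by (intro gip_extremum assms(1)) auto
  then show False using assms(2) 0 by (simp add: qform_def)
qed

lemma compact_closure_bounded:
  assumes "compact K" "\<And>p::'b. u p \<noteq> (0::real) \<Longrightarrow> p \<in> K"
  shows "closure {p. u p \<noteq> 0} \<subseteq> K" "compact (closure {p. u p \<noteq> 0})"
proof -
  show s: "closure {p. u p \<noteq> 0} \<subseteq> K" by (rule closure_minimal) (use assms compact_imp_closed in auto)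
  then have "closure {p. u p \<noteq> 0} = K \<inter> closure {p. u p \<noteq> 0}" by blast
  then show "compact (closure {p. u p \<noteq> 0})" using compact_Int_closed[OF assms(1) closed_closure] by metis
qed

text \<open>At each point at most one of the functions is nonzero. The others have a minimum there,
  since all are nonnegative, and hence no gradient; so all cross terms vanish.\<close>

lemma gip_combination:
  assumes S: "\<And>u. u \<in> S \<Longrightarrow> smooth u" and fin: "finite S" and nonneg: "\<And>u p. u \<in> S \<Longrightarrow> u p \<ge> 0"
    and disj: "\<And>u v p. u \<in> S \<Longrightarrow> v \<in> S \<Longrightarrow> u \<noteq> v \<Longrightarrow> u p = 0 \<or> v p = 0"
  shows "gip (\<lambda>p. \<Sum>u\<in>S. c u * u p) (\<lambda>p. \<Sum>u\<in>S. c u * u p) p = (\<Sum>u\<in>S. (c u)\<^sup>2 * gip u u p)"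
proof -
  define w where "w = (\<lambda>p. \<Sum>u\<in>S. c u * u p)"
  have sc: "smooth (\<lambda>p. c u * u p)" if "u \<in> S" for u by (intro smooth_mult smooth_const S that)
  have w: "smooth w" unfolding w_def by (rule smooth_sum) (rule sc)
  have 0: "gip u v p = 0" if uv: "u \<in> S" "v \<in> S" "u \<noteq> v" for u v
    using disj[OF uv, of p]
  proof
    assume "u p = 0"
    then show ?thesis by (intro gip_extremum S uv) (use nonneg[OF uv(1)] in auto)
  next
    assume "v p = 0"
    then show ?thesis by (subst gip_commute, intro gip_extremum S uv) (use nonneg[OF uv(2)] in auto)
  qed
  have 1: "gip v w p = c v * gip v v p" if v: "v \<in> S" for v
  proof -
    have "gip v w p = gip w v p" by (rule gip_commute)
    also have "\<dots> = (\<Sum>u\<in>S. gip (\<lambda>p. c u * u p) v p)" unfolding w_def by (rule gip_sum_left[OF sc S[OF v]])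
    also have "\<dots> = (\<Sum>u\<in>S. c u * gip u v p)" by (intro sum.cong refl gip_cmult_left S v)
    also have "\<dots> = (\<Sum>u\<in>{v}. c u * gip u v p)"
      by (rule sum.mono_neutral_right[OF fin]) (use v 0[OF _ v] in auto)
    finally show ?thesis by simp
  qed
  have "gip w w p = (\<Sum>u\<in>S. gip (\<lambda>p. c u * u p) w p)" by (subst (1) w_def, rule gip_sum_left[OF sc w])
  also have "\<dots> = (\<Sum>u\<in>S. (c u)\<^sup>2 * gip u u p)"
    by (intro sum.cong refl) (simp add: gip_cmult_left[OF S w] 1 power2_eq_square)
  finally show ?thesis by (simp add: w_def)
qed

lemma qform_combination:
  assumes S: "\<And>u. u \<in> S \<Longrightarrow> smooth u" "\<And>u. u \<in> S \<Longrightarrow> compact (closure {p. u p \<noteq> 0})" and fin: "finite S"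
    and nonneg: "\<And>u p. u \<in> S \<Longrightarrow> u p \<ge> 0" and q: "continuous_on UNIV q"
    and disj: "\<And>u v p. u \<in> S \<Longrightarrow> v \<in> S \<Longrightarrow> u \<noteq> v \<Longrightarrow> u p = 0 \<or> v p = 0"
  shows "qform q (\<lambda>p. \<Sum>u\<in>S. c u * u p) = (\<Sum>u\<in>S. (c u)\<^sup>2 * qform q u)"
proof -
  have sq: "(\<Sum>u\<in>S. c u * u p) * (\<Sum>u\<in>S. c u * u p) = (\<Sum>u\<in>S. (c u)\<^sup>2 * (u p * u p))" for p
  proof -
    have "(\<Sum>u\<in>S. c u * u p) * (\<Sum>u\<in>S. c u * u p) = (\<Sum>u\<in>S. \<Sum>v\<in>S. c u * u p * (c v * v p))"
      by (rule sum_product)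
    also have "\<dots> = (\<Sum>u\<in>S. (c u)\<^sup>2 * (u p * u p))"
    proof (rule sum.cong[OF refl])
      fix u assume u: "u \<in> S"
      have "(\<Sum>v\<in>S. c u * u p * (c v * v p)) = (\<Sum>v\<in>{u}. c u * u p * (c v * v p))"
        by (rule sum.mono_neutral_right[OF fin]) (use u disj[OF u] in auto)
      then show "(\<Sum>v\<in>S. c u * u p * (c v * v p)) = (c u)\<^sup>2 * (u p * u p)" by (simp add: power2_eq_square)
    qed
    finally show ?thesis .
  qed
  have "(\<integral>p. (\<Sum>u\<in>S. (c u)\<^sup>2 * gip u u p) \<partial>\<mu>) = (\<Sum>u\<in>S. (c u)\<^sup>2 * (\<integral>p. gip u u p \<partial>\<mu>))"
    by (simp add: integrable_test(1) S)
  moreover have "(\<integral>p. (\<Sum>u\<in>S. (c u)\<^sup>2 * (q p * u p * u p)) \<partial>\<mu>) = (\<Sum>u\<in>S. (c u)\<^sup>2 * (\<integral>p. q p * u p * u p \<partial>\<mu>))"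
    by (simp add: integrable_test(2)[OF S q])
  moreover have "q p * (\<Sum>u\<in>S. c u * u p) * (\<Sum>u\<in>S. c u * u p) = (\<Sum>u\<in>S. (c u)\<^sup>2 * (q p * u p * u p))" for p
  proof -
    have "q p * (\<Sum>u\<in>S. c u * u p) * (\<Sum>u\<in>S. c u * u p) = q p * (\<Sum>u\<in>S. (c u)\<^sup>2 * (u p * u p))"
      by (simp only: mult.assoc sq)
    then show ?thesis by (simp add: sum_distrib_left mult.assoc mult.left_commute)
  qed
  moreover have "gip (\<lambda>p. \<Sum>u\<in>S. c u * u p) (\<lambda>p. \<Sum>u\<in>S. c u * u p) = (\<lambda>p. \<Sum>u\<in>S. (c u)\<^sup>2 * gip u u p)"
    by (rule ext, rule gip_combination) (fact S(1) fin nonneg disj)+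
  ultimately show ?thesis unfolding qform_def
    by (simp only: right_diff_distrib sum_subtractf)
qed

section \<open>Negative directions under completeness and polynomial growth\<close>

context
  fixes o' :: 'b and q :: "'b \<Rightarrow> real" and k C \<alpha> R\<^sub>0 :: real
  assumes complete: "complete_riemannian \<B> h"
    and growth: "\<And>r. r \<ge> R\<^sub>0 \<Longrightarrow> emeasure \<mu> (mball o' r) \<le> ennreal (C * r powr \<alpha>)"
    and C: "C > 0" and infinite_volume: "emeasure \<mu> UNIV = \<infinity>"
    and q: "continuous_on UNIV q" "\<And>p. q p \<ge> k" and k: "k > 0"
begin

lemma cb_sets: "cb o' r \<in> sets \<mu>" using closed_cb by (simp add: sets_\<mu>)

text \<open>Growth is given for open balls; the closed ball lies in the open ball of radius r + 1,
  hence the shift in the bound.\<close>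

lemma emeasure_cb: "r + 1 \<ge> R\<^sub>0 \<Longrightarrow> emeasure \<mu> (cb o' r) \<le> ennreal (C * (r + 1) powr \<alpha>)"
proof -
  assume r: "r + 1 \<ge> R\<^sub>0"
  have "openin mtopology (mball o' (r + 1))" by (rule openin_mball)
  then have "mball o' (r + 1) \<in> sets \<mu>" by (simp add: sets_\<mu> openin_rdist_iff)
  moreover have "cb o' r \<subseteq> mball o' (r + 1)" by (auto simp: cb_def)
  ultimately have "emeasure \<mu> (cb o' r) \<le> emeasure \<mu> (mball o' (r + 1))" by (intro emeasure_mono)
  then show ?thesis using growth[OF r] by (rule order_trans)
qed

lemma cb_mono: "r \<le> s \<Longrightarrow> cb o' r \<subseteq> cb o' s" by (auto simp: cb_def)

lemma emeasure_cb_finite: "emeasure \<mu> (cb o' r) \<noteq> \<infinity>"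
proof -
  define s where "s = max r R\<^sub>0"
  have "emeasure \<mu> (cb o' r) \<le> emeasure \<mu> (cb o' s)" by (intro emeasure_mono cb_mono cb_sets) (simp add: s_def)
  also have "\<dots> \<le> ennreal (C * (s + 1) powr \<alpha>)" by (rule emeasure_cb) (simp add: s_def)
  also have "\<dots> < \<infinity>" by simp
  finally show ?thesis by simp
qed

lemma cb_integrable: "integrable \<mu> (indicat_real (cb o' r))"
  using emeasure_cb_finite[of r] by (intro integrable_real_indicator cb_sets) (simp add: less_top)

lemma annulus_exists:
  assumes D: "D > 0"
  shows "\<exists>b\<ge>Suc a. D * (measure \<mu> (cb o' (real (Suc a))) - measure \<mu> (cb o' (real a))
      + (measure \<mu> (cb o' (real (Suc b))) - measure \<mu> (cb o' (real b))))
    < k * (measure \<mu> (cb o' (real b)) - measure \<mu> (cb o' (real (Suc a))))"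
proof -
  define V where "V n = measure \<mu> (cb o' (real n))" for n
  have eV: "emeasure \<mu> (cb o' (real n)) = ennreal (V n)" for n
    unfolding V_def using emeasure_cb_finite[of "real n"] by (intro emeasure_eq_ennreal_measure) auto
  obtain n\<^sub>0 where n0: "R\<^sub>0 \<le> real n\<^sub>0" using real_arch_simple by blast
  have "\<exists>b\<ge>Suc a. D * (V (Suc a) - V a + (V (Suc b) - V b)) < k * (V b - V (Suc a))"
  proof (rule polynomial_growth_slow_step[OF _ _ _ D k])
    show "mono V"
    proof (rule monoI)
      fix m n :: nat assume "m \<le> n"
      then have "emeasure \<mu> (cb o' (real m)) \<le> emeasure \<mu> (cb o' (real n))"
        by (intro emeasure_mono cb_mono cb_sets) simp
      then show "V m \<le> V n" unfolding eV by (simp add: V_def)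
    qed
    show "V n \<le> C * (real n + 1) powr \<alpha>" if "n \<ge> n\<^sub>0" for n
    proof -
      have "ennreal (V n) \<le> ennreal (C * (real n + 1) powr \<alpha>)"
        unfolding eV[symmetric] by (rule emeasure_cb) (use n0 that in linarith)
      then show ?thesis using C by (subst (asm) ennreal_le_iff) auto
    qed
    show "\<exists>n. V n > B" for B
    proof (rule ccontr)
      assume "\<not> ?thesis"
      then have B: "V n \<le> B" for n by (simp add: not_less)
      have "range (\<lambda>n. cb o' (real n)) \<subseteq> sets \<mu>" using cb_sets by auto
      moreover have "incseq (\<lambda>n. cb o' (real n))" by (intro monoI cb_mono) simp
      ultimately have "(SUP n. emeasure \<mu> (cb o' (real n))) = emeasure \<mu> (\<Union>n. cb o' (real n))"
        by (rule SUP_emeasure_incseq)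
      also have "(\<Union>n. cb o' (real n)) = UNIV" using real_arch_simple by (auto simp: cb_def)
      finally have "(SUP n. emeasure \<mu> (cb o' (real n))) = \<infinity>" using infinite_volume by simp
      moreover have "(SUP n. emeasure \<mu> (cb o' (real n))) \<le> ennreal B"
        unfolding eV by (intro SUP_least ennreal_leI B)
      ultimately have "\<infinity> \<le> ennreal B" by (simp only:)
      then show False by (simp add: top_unique)
    qed
  qed
  then show ?thesis by (simp only: V_def)
qed

text \<open>The product of an outer cutoff with the complement of an inner one. It is 1 on the
  annulus between the radii \<open>Suc a\<close> and \<open>b\<close>, and has a gradient only on
  the collars from \<open>a\<close> to \<open>Suc a\<close> and from \<open>b\<close> to
  \<open>Suc b\<close>.\<close>

lemma negative_test_function:
  fixes a :: nat
  shows "\<exists>u b. smooth u \<and> (\<forall>p. 0 \<le> u p) \<and> (\<forall>p. u p \<noteq> 0 \<longrightarrow> real a < rd o' p \<and> rd o' p \<le> real b) \<and> qform q u < 0"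
proof -
  define L where "L = 32 * step_bound\<^sup>2"
  \<comment> \<open>Bounds the squared gradient of the product, to which each factor contributes
    \<open>L\<close>.\<close>
  define D where "D = (L + L)\<^sup>2"
  have L: "L > 0" using step_bound(1) by (simp add: L_def)
  then have D: "D > 0" by (simp add: D_def)
  obtain b where b: "b \<ge> Suc a" and less: "D * (measure \<mu> (cb o' (real (Suc a))) - measure \<mu> (cb o' (real a))
      + (measure \<mu> (cb o' (real (Suc b))) - measure \<mu> (cb o' (real b))))
    < k * (measure \<mu> (cb o' (real b)) - measure \<mu> (cb o' (real (Suc a))))"
    using annulus_exists[OF D, of a] by blast
  note K = compact_cb[OF complete]
  obtain wa where wa: "smooth wa" "\<And>p. 0 \<le> wa p \<and> wa p \<le> 1" "\<And>p. rd o' p \<le> real a \<Longrightarrow> wa p = 1"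
    "\<And>p. wa p \<noteq> 0 \<Longrightarrow> rd o' p \<le> real a + 1" "\<And>p. grad_le wa p L"
    using cutoff[OF K, of "real a" o'] unfolding L_def by auto
  obtain wb where wb: "smooth wb" "\<And>p. 0 \<le> wb p \<and> wb p \<le> 1" "\<And>p. rd o' p \<le> real b \<Longrightarrow> wb p = 1"
    "\<And>p. wb p \<noteq> 0 \<Longrightarrow> rd o' p \<le> real b + 1" "\<And>p. grad_le wb p L"
    using cutoff[OF K, of "real b" o'] unfolding L_def by auto
  define wa' where "wa' p = 1 - wa p" for p
  have wa': "smooth wa'" unfolding wa'_def[abs_def] by (intro smooth_diff smooth_const wa)
  have ga': "grad_le wa' p L" for p
  proof -
    have "dird w (\<lambda>t. 1 - t :: real) t = - w" for w t by (rule dird_eqI) (auto intro!: derivative_eq_intros)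
    then have "grad_le (\<lambda>q. (\<lambda>t. 1 - t) (wa q)) p (1 * L)"
      by (intro grad_le_compose[OF wa(1)] smooth_on_diff smooth_on_const smooth_on_id wa(5)) auto
    then show ?thesis by (simp add: wa'_def[abs_def])
  qed
  define u where "u p = wb p * wa' p" for p
  have u: "smooth u" unfolding u_def[abs_def] by (intro smooth_mult wb wa')
  have range: "0 \<le> u p" "u p \<le> 1" for p
    using wa(2)[of p] wb(2)[of p] by (auto simp: u_def wa'_def intro: mult_le_one)
  have supp: "real a < rd o' p \<and> rd o' p \<le> real b + 1" if "u p \<noteq> 0" for p
    using that wa(3)[of p] wb(4)[of p] by (force simp: u_def wa'_def)
  have one: "u p = 1" if "real a + 1 < rd o' p" "rd o' p \<le> real b" for p
    using that wa(4)[of p] wb(3)[of p] by (force simp: u_def wa'_def)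
  have cu: "compact (closure {p. u p \<noteq> 0})"
    by (rule compact_closure_bounded(2)[OF K[of o' "real b + 1"]]) (use supp in \<open>auto simp: cb_def\<close>)
  let ?I = "\<lambda>n p. indicat_real (cb o' (real n)) p"
  have g: "gip u u p \<le> D * (?I (Suc a) p - ?I a p + (?I (Suc b) p - ?I b p))" for p
  proof (cases "(real a < rd o' p \<and> rd o' p \<le> real a + 1) \<or> (real b < rd o' p \<and> rd o' p \<le> real b + 1)")
    case True
    have "\<bar>wa' p\<bar> \<le> 1" "\<bar>wb p\<bar> \<le> 1" using wa(2)[of p] wb(2)[of p] by (auto simp: wa'_def)
    then have "grad_le u p (L + L)" unfolding u_def[abs_def] by (intro grad_le_mult wb wa' ga')
    then have "gip u u p \<le> D" unfolding D_def by (rule gip_le[OF u]) (use L in simp)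
    moreover have "?I (Suc a) p - ?I a p + (?I (Suc b) p - ?I b p) = 1"
      using True b by (auto simp: cb_def indicator_def)
    ultimately show ?thesis by simp
  next
    case False
    \<comment> \<open>Outside the collars \<open>u\<close> takes one of its extreme values.\<close>
    then have "u p = 0 \<or> u p = 1" using supp[of p] one[of p] by linarith
    then have "gip u u p = 0" by (intro gip_extremum u) (use range in auto)
    moreover have "?I (Suc a) p - ?I a p + (?I (Suc b) p - ?I b p) \<ge> 0"
      using b by (auto simp: cb_def indicator_def)
    ultimately show ?thesis using D by simp
  qed
  have q': "k * (?I b p - ?I (Suc a) p) \<le> q p * u p * u p" for p
  proof (cases "real a + 1 < rd o' p \<and> rd o' p \<le> real b")
    case True
    then show ?thesis using q(2)[of p] one[of p] by (simp add: cb_def)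
  next
    case False
    then have "?I b p - ?I (Suc a) p \<le> 0" by (auto simp: cb_def indicator_def)
    then have "k * (?I b p - ?I (Suc a) p) \<le> 0" using k by (simp add: mult_le_0_iff)
    also have "\<dots> \<le> q p * u p * u p" using q(2)[of p] k by (simp add: mult.assoc)
    finally show ?thesis .
  qed
  have sp: "space \<mu> = UNIV" using sets_eq_imp_space_eq[OF sets_\<mu>] by simp
  have int: "(\<integral>p. D * (?I (Suc a) p - ?I a p + (?I (Suc b) p - ?I b p)) \<partial>\<mu>)
      = D * (measure \<mu> (cb o' (real (Suc a))) - measure \<mu> (cb o' (real a))
      + (measure \<mu> (cb o' (real (Suc b))) - measure \<mu> (cb o' (real b))))"
    "(\<integral>p. k * (?I b p - ?I (Suc a) p) \<partial>\<mu>) = k * (measure \<mu> (cb o' (real b)) - measure \<mu> (cb o' (real (Suc a))))"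
    by (simp_all add: cb_integrable cb_sets sp del: of_nat_Suc)
  have "(\<integral>p. gip u u p \<partial>\<mu>) \<le> (\<integral>p. D * (?I (Suc a) p - ?I a p + (?I (Suc b) p - ?I b p)) \<partial>\<mu>)"
    by (intro integral_mono integrable_test[OF u cu] g integrable_mult_right Bochner_Integration.integrable_add
        Bochner_Integration.integrable_diff cb_integrable)
  moreover have "(\<integral>p. k * (?I b p - ?I (Suc a) p) \<partial>\<mu>) \<le> (\<integral>p. q p * u p * u p \<partial>\<mu>)"
    by (intro integral_mono integrable_test(2)[OF u cu q(1)] q' integrable_mult_right
        Bochner_Integration.integrable_diff cb_integrable)
  ultimately have "qform q u < 0" unfolding qform_def int using less by linarith
  then show ?thesis using u range(1) supp by (intro exI[of _ u] exI[of _ "Suc b"]) (auto simp: add.commute)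
qed

text \<open>Each new function lives beyond the radius \<open>a\<close> that encloses the earlier
  ones, so it vanishes wherever one of them does not. Having a negative form it is not zero, hence
  it is a new member.\<close>

lemma negative_test_family:
  "\<exists>S b. finite S \<and> card S = N \<and> (\<forall>u\<in>S. smooth u \<and> (\<forall>p. 0 \<le> u p) \<and> (\<forall>p. u p \<noteq> 0 \<longrightarrow> rd o' p \<le> real b) \<and> qform q u < 0)
     \<and> (\<forall>u\<in>S. \<forall>v\<in>S. u \<noteq> v \<longrightarrow> (\<forall>p. u p = 0 \<or> v p = 0))"
proof (induction N)
  case 0
  show ?case by (intro exI[of _ "{}"]) simp
next
  case (Suc N)
  then obtain S a where fin: "finite S" "card S = N"
    and S': "\<forall>u\<in>S. smooth u \<and> (\<forall>p. 0 \<le> u p) \<and> (\<forall>p. u p \<noteq> 0 \<longrightarrow> rd o' p \<le> real a) \<and> qform q u < 0"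
      "\<forall>u\<in>S. \<forall>v\<in>S. u \<noteq> v \<longrightarrow> (\<forall>p. u p = 0 \<or> v p = 0)"
    by (elim exE conjE)
  obtain w b where w: "smooth w" "\<And>p. 0 \<le> w p" "\<And>p. w p \<noteq> 0 \<Longrightarrow> real a < rd o' p \<and> rd o' p \<le> real b" "qform q w < 0"
    using negative_test_function[of a] by blast
  have disj: "u p = 0 \<or> w p = 0" if "u \<in> S" for u p
    using bspec[OF S'(1) that] w(3)[of p] by force
  have "w \<notin> S" using qform_nonzero[OF w(1,4)] disj[of w] by auto
  then have "finite (insert w S)" "card (insert w S) = Suc N" using fin by auto
  moreover have "\<forall>u\<in>insert w S. smooth u \<and> (\<forall>p. 0 \<le> u p) \<and> (\<forall>p. u p \<noteq> 0 \<longrightarrow> rd o' p \<le> real (max a b)) \<and> qform q u < 0"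
  proof
    fix u assume u: "u \<in> insert w S"
    show "smooth u \<and> (\<forall>p. 0 \<le> u p) \<and> (\<forall>p. u p \<noteq> 0 \<longrightarrow> rd o' p \<le> real (max a b)) \<and> qform q u < 0"
    proof (cases "u = w")
      case True
      then show ?thesis using w by (auto simp: of_nat_max le_max_iff_disj)
    next
      case False
      then show ?thesis using bspec[OF S'(1), of u] u by (auto simp: of_nat_max le_max_iff_disj)
    qed
  qed
  moreover have "\<forall>u\<in>insert w S. \<forall>v\<in>insert w S. u \<noteq> v \<longrightarrow> (\<forall>p. u p = 0 \<or> v p = 0)"
    using S'(2) disj by (metis insert_iff)
  ultimately show ?case by (intro exI[of _ "insert w S"] exI[of _ "max a b"] conjI)
qed

lemma sum_fun_scaleR: "(\<Sum>u\<in>S. c u *\<^sub>R u) = (\<lambda>p::'b. \<Sum>u\<in>S. c u * (u p :: real))"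
  by (induction S rule: infinite_finite_induct) (auto simp: fun_eq_iff scaleR_fun_def)

text \<open>On the span of the family the form is diagonal with negative entries. Independence
  follows by evaluation at a point where exactly one member is nonzero, and \<Omega> is a compact
  domain around the ball that contains all supports.\<close>

lemma negative_subspace:
  "\<exists>\<Omega> W. compact_domain \<Omega> \<and> subspace W \<and> W \<subseteq> smooth_compact_support \<B> \<Omega> \<and> dim W = N
     \<and> (\<forall>u\<in>W. u \<noteq> 0 \<longrightarrow> qform q u < 0)"
proof -
  obtain S b where fin: "finite S" "card S = N"
    and S': "\<forall>u\<in>S. smooth u \<and> (\<forall>p. 0 \<le> u p) \<and> (\<forall>p. u p \<noteq> 0 \<longrightarrow> rd o' p \<le> real b) \<and> qform q u < 0"
      "\<forall>u\<in>S. \<forall>v\<in>S. u \<noteq> v \<longrightarrow> (\<forall>p. u p = 0 \<or> v p = 0)"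
    using negative_test_family[of N] by (elim exE conjE)
  have S: "finite S" "card S = N" "\<And>u. u \<in> S \<Longrightarrow> smooth u" "\<And>u p. u \<in> S \<Longrightarrow> 0 \<le> u p"
    "\<And>u p. u \<in> S \<Longrightarrow> u p \<noteq> 0 \<Longrightarrow> rd o' p \<le> real b" "\<And>u. u \<in> S \<Longrightarrow> qform q u < 0"
    "\<And>u v p. u \<in> S \<Longrightarrow> v \<in> S \<Longrightarrow> u \<noteq> v \<Longrightarrow> u p = 0 \<or> v p = 0"
    using fin S' by simp_all
  note K = compact_cb[OF complete, of o' "real b"]
  obtain \<Omega> where \<Omega>: "compact_domain \<Omega>" "cb o' (real b) \<subseteq> interior \<Omega>" by (rule compact_domain_exists[OF K])
  have sp: "w \<in> span S \<Longrightarrow> \<exists>c. w = (\<lambda>p. \<Sum>u\<in>S. c u * u p)" for w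
    unfolding span_finite[OF S(1)] sum_fun_scaleR by auto
  have "independent S"
  proof (rule independent_if_scalars_zero[OF S(1)])
    fix c w assume 0: "(\<Sum>u\<in>S. c u *\<^sub>R u) = 0" and w: "w \<in> S"
    obtain p where p: "w p \<noteq> 0" using qform_nonzero[OF S(3,6)] w by blast
    have "0 = (\<Sum>u\<in>S. c u * u p)" using fun_cong[OF 0, of p] unfolding sum_fun_scaleR by simp
    also have "\<dots> = (\<Sum>u\<in>{w}. c u * u p)"
      by (rule sum.mono_neutral_right[OF S(1)]) (use w p S(7)[OF w, of _ p] in auto)
    finally show "c w = 0" using p by simp
  qed
  then have "dim (span S) = N" using S(2) by (simp add: dim_eq_card_independent)
  moreover have "span S \<subseteq> smooth_compact_support \<B> \<Omega>"
  proof
    fix w assume "w \<in> span S"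
    then obtain c where w: "w = (\<lambda>p. \<Sum>u\<in>S. c u * u p)" using sp by blast
    have "smooth w" unfolding w by (intro smooth_sum smooth_mult smooth_const S)
    moreover have "p \<in> cb o' (real b)" if "w p \<noteq> 0" for p
    proof -
      have "\<exists>u\<in>S. u p \<noteq> 0"
      proof (rule ccontr)
        assume "\<not> ?thesis" then have "w p = 0" unfolding w by (intro sum.neutral) simp
        then show False using that by simp
      qed
      then show ?thesis using S(5) by (auto simp: cb_def)
    qed
    ultimately show "w \<in> smooth_compact_support \<B> \<Omega>"
      using compact_closure_bounded[OF K, of w] \<Omega>(2) by (auto simp: smooth_compact_support_def)
  qed
  moreover have "qform q w < 0" if w: "w \<in> span S" "w \<noteq> 0" for w
  proof -
    obtain c where c: "w = (\<lambda>p. \<Sum>u\<in>S. c u * u p)" using sp w(1) by blast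
    have "\<exists>u\<in>S. c u \<noteq> 0"
    proof (rule ccontr)
      assume "\<not> ?thesis" then have "w = 0" by (simp add: c fun_eq_iff)
      then show False using w by simp
    qed
    then obtain v where v: "v \<in> S" "c v \<noteq> 0" by blast
    have cc: "compact (closure {p. u p \<noteq> 0})" if "u \<in> S" for u
      by (rule compact_closure_bounded(2)[OF K]) (use S(5)[OF that] in \<open>auto simp: cb_def\<close>)
    have "qform q w = (\<Sum>u\<in>S. (c u)\<^sup>2 * qform q u)"
      unfolding c by (rule qform_combination) (fact S(3) cc S(1,4) q(1) S(7))+
    also have "\<dots> < (\<Sum>u\<in>S. 0)"
    proof (rule sum_strict_mono_ex1[OF S(1)])
      show "\<forall>u\<in>S. (c u)\<^sup>2 * qform q u \<le> 0" by (intro ballI mult_nonneg_nonpos less_imp_le[OF S(6)]) auto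
      show "\<exists>u\<in>S. (c u)\<^sup>2 * qform q u < 0" using v S(6) by (intro bexI[of _ v]) (auto intro!: mult_pos_neg)
    qed
    finally show ?thesis by simp
  qed
  ultimately show ?thesis using \<Omega>(1) subspace_span by blast
qed

end

end

section \<open>Immersed hypersurfaces\<close>

locale immersed_manifold = amb: rmanifold \<A> g + M: rmanifold \<B> h
  for \<A> :: "('a::{t2_space,second_countable_topology}, 'm::finite) chart set" and g
    and \<B> :: "('b::{t2_space,second_countable_topology}, 'n::finite) chart set" and h +
  fixes X :: "'b \<Rightarrow> 'a" and f :: "'a \<Rightarrow> real"
  assumes f: "smooth_function \<A> f" and card: "CARD('m) = CARD('n) + 1"
    and immersed: "isometric_immersion \<A> g \<B> h X"
begin

lemma continuous_X: "continuous_on UNIV X"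
  using immersed by (simp add: isometric_immersion_def immersion_def smooth_map_def)

lemma open_X_vimage: "open S \<Longrightarrow> open (X -` S)" using continuous_X by (rule open_vimage[rotated])

lemma open_local_dom:
  assumes "c \<in> \<A>" "d \<in> \<B>" shows "open (local_dom c X d)"
  unfolding local_dom_def
  by (rule M.open_snd_image[OF assms(2)]) (auto intro!: open_Int M.chartD open_X_vimage amb.chartD assms)

lemma local_dom_iff: "d \<in> \<B> \<Longrightarrow> x \<in> local_dom c X d \<longleftrightarrow> x \<in> cdom d \<and> X (param d x) \<in> fst c"
  unfolding local_dom_def by (subst M.snd_image) auto

lemma local_rep: "local_rep c X d x = snd c (X (param d x))" by (simp add: local_rep_def)

lemma smooth_local_rep: "c \<in> \<A> \<Longrightarrow> d \<in> \<B> \<Longrightarrow> smooth_on (local_dom c X d) (local_rep c X d)"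
  using immersed by (simp add: isometric_immersion_def immersion_def smooth_map_def)

lemma local_rep_into: "d \<in> \<B> \<Longrightarrow> local_rep c X d ` local_dom c X d \<subseteq> cdom c"
  by (auto simp: local_rep local_dom_iff)

lemma local_hypersurface:
  assumes c: "c \<in> \<A>" and d: "d \<in> \<B>" and V: "open V" "V \<subseteq> local_dom c X d"
    and U: "open U" "U \<subseteq> cdom c" "local_rep c X d ` V \<subseteq> U"
  shows "local_hypersurface U V (g c) (f \<circ> param c) (h d) (local_rep c X d)"
proof
  show "metric_on U (g c)" using amb.metric_on_chart[OF c] U unfolding metric_on_def by (auto intro: smooth_on_subset)
  have "V \<subseteq> cdom d" using V(2) d by (auto simp: local_dom_iff)
  then show "metric_on V (h d)" using M.metric_on_chart[OF d] V unfolding metric_on_def by (auto intro: smooth_on_subset)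
  show "smooth_on U (f \<circ> param c)" using f c U(2) by (auto simp: smooth_function_def intro: smooth_on_subset)
  show s: "smooth_on V (local_rep c X d)" using smooth_local_rep[OF c d] V(2) by (rule smooth_on_subset)
  show "local_rep c X d ` V \<subseteq> U" by (rule U(3))
  show "CARD('m) = CARD('n) + 1" by (rule card)
  fix x v w assume x: "x \<in> V"
  then have "h d x = transpose (jacobian (local_rep c X d) (at x)) ** g c (local_rep c X d x)
                  ** jacobian (local_rep c X d) (at x)"
    using immersed c d V(2) by (auto simp: isometric_immersion_def)
  then show "ip (h d x) v w = ip (g c (local_rep c X d x)) (dird v (local_rep c X d) x) (dird w (local_rep c X d) x)"
    by (simp add: ip_congruence M.jacobian_apply[OF smooth_onD_differentiable[OF s x]])
qed

text \<open>Around each point an ambient chart turns this into a composite of smooth coordinate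
  functions. It makes the hypersurface a weighted manifold with weight
  \<open>f \<circ> X\<close>.\<close>

lemma smooth_fX: "smooth_function \<B> (f \<circ> X)"
  unfolding M.smooth_iff
proof (intro ballI smooth_on_locally)
  fix d x assume d: "d \<in> \<B>" and x: "x \<in> cdom d"
  define c where "c = chart_at \<A> (X (param d x))"
  have c: "c \<in> \<A>" "X (param d x) \<in> fst c" using amb.chart_at by (auto simp: c_def)
  have "smooth_on (local_dom c X d) (\<lambda>x. (f \<circ> param c) (local_rep c X d x))"
    by (rule smooth_on_compose[OF _ smooth_local_rep[OF c(1) d] local_rep_into[OF d] open_local_dom[OF c(1) d] amb.chartD(2)[OF c(1)]])
      (use amb.smoothD[OF f c(1)] in \<open>simp add: o_def\<close>)
  moreover have "(f \<circ> param c) (local_rep c X d y) = (f \<circ> X) (param d y)" if "y \<in> local_dom c X d" for y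
    using that c d by (simp add: local_rep local_dom_iff)
  ultimately have "smooth_on (local_dom c X d) (\<lambda>x. (f \<circ> X) (param d x))"
    using smooth_on_cong[OF open_local_dom[OF c(1) d]] by (metis (no_types, lifting))
  then show "\<exists>T. open T \<and> x \<in> T \<and> smooth_on T (\<lambda>x. (f \<circ> X) (param d x))"
    using open_local_dom[OF c(1) d] c(2) x d by (auto simp: local_dom_iff)
qed

sublocale weighted_rmanifold \<B> h "f \<circ> X"
  by (intro weighted_rmanifold.intro weighted_rmanifold_axioms.intro M.rmanifold_axioms smooth_fX)

section \<open>The zeroth-order term as a function on the hypersurface\<close>

abbreviation "potential c d \<equiv> stability_potential (g c) (f \<circ> param c) (h d) (local_rep c X d)"

definition pot :: "'b \<Rightarrow> real" where
  "pot p = potential (chart_at \<A> (X p)) (chart_at \<B> p) (snd (chart_at \<B> p) p)"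

text \<open>On a neighbourhood where both pairs of charts are defined, the two coordinate pictures
  are related by the transition maps, which is the situation of
  \<open>hypersurface_change\<close>.\<close>

lemma potential_chart:
  assumes c: "c \<in> \<A>" "X p \<in> fst c" and d: "d \<in> \<B>" "p \<in> fst d"
    and c': "c' \<in> \<A>" "X p \<in> fst c'" and d': "d' \<in> \<B>" "p \<in> fst d'"
  shows "potential c d (snd d p) = potential c' d' (snd d' p)"
proof -
  define N where "N = fst d \<inter> fst d' \<inter> X -` (fst c \<inter> fst c')"
  define V where "V = snd d ` N"
  have "open N" unfolding N_def by (intro open_Int open_X_vimage amb.chartD(1) M.chartD(1) c c' d d')
  then have oV: "open V" unfolding V_def by (intro M.open_snd_image d) (auto simp: N_def)
  have Vs: "V \<subseteq> local_dom c X d" "V \<subseteq> overlap d d'" by (auto simp: V_def N_def local_dom_def overlap_def)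
  have U: "overlap c c' \<subseteq> cdom c" by (auto simp: overlap_def cdom_def)
  have into: "local_rep c X d ` V \<subseteq> overlap c c'"
    using c d by (auto simp: V_def N_def local_rep intro!: amb.overlap_snd)
  have W: "transition d d' ` V \<subseteq> local_dom c' X d'"
    using d by (auto simp: V_def N_def local_dom_def)
  interpret hypersurface_change "overlap c c'" "cdom c'" V "local_dom c' X d'" "g c" "g c'" "f \<circ> param c"
    "f \<circ> param c'" "h d" "h d'" "local_rep c X d" "local_rep c' X d'" "transition c c'" "transition d d'"
  proof (intro hypersurface_change.intro hypersurface_change_axioms.intro)
    show "local_hypersurface (overlap c c') V (g c) (f \<circ> param c) (h d) (local_rep c X d)"
      by (rule local_hypersurface[OF c(1) d(1) oV Vs(1) amb.open_overlap[OF c(1) c'(1)] U into])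
    show "local_hypersurface (cdom c') (local_dom c' X d') (g c') (f \<circ> param c') (h d') (local_rep c' X d')"
      by (rule local_hypersurface[OF c'(1) d'(1) open_local_dom[OF c'(1) d'(1)] order_refl amb.chartD(2)[OF c'(1)]
            order_refl local_rep_into[OF d'(1)]])
    show "coord_isometry (overlap c c') (cdom c') (g c) (g c') (transition c c')"
      by (rule amb.coord_isometry_transition[OF c(1) c'(1)])
    interpret T: coord_isometry "overlap d d'" "cdom d'" "h d" "h d'" "transition d d'"
      by (rule M.coord_isometry_transition[OF d(1) d'(1)])
    show "coord_isometry V (local_dom c' X d') (h d) (h d') (transition d d')"
    proof
      show "metric_on V (h d)" using T.G oV Vs(2) unfolding metric_on_def by (auto intro: smooth_on_subset)
      have "local_dom c' X d' \<subseteq> cdom d'" using d' by (auto simp: local_dom_iff)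
      then show "metric_on (local_dom c' X d') (h d')"
        using T.G' open_local_dom[OF c'(1) d'(1)] unfolding metric_on_def by (auto intro: smooth_on_subset)
      show "smooth_on V (transition d d')" by (rule smooth_on_subset[OF T.smooth Vs(2)])
      show "transition d d' ` V \<subseteq> local_dom c' X d'" by (rule W)
      show "ip (h d x) v w = ip (h d' (transition d d' x)) (dird v (transition d d') x) (dird w (transition d d') x)"
        if "x \<in> V" for x v w using T.pull Vs(2) that by blast
    qed
    show "(f \<circ> param c) y = (f \<circ> param c') (transition c c' y)" if "y \<in> overlap c c'" for y
      using amb.param_transition[OF c(1) c'(1) that] by simp
    show "local_rep c' X d' (transition d d' x) = transition c c' (local_rep c X d x)" if "x \<in> V" for x
      using that c c' d d' by (auto simp: V_def N_def local_rep)
  qed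
  have "snd d p \<in> V" using c c' d d' by (auto simp: V_def N_def)
  then have "potential c d (snd d p) = potential c' d' (transition d d' (snd d p))" by (rule stability_potential_transform)
  then show ?thesis using d by simp
qed

lemma pot_chart: "c \<in> \<A> \<Longrightarrow> X p \<in> fst c \<Longrightarrow> d \<in> \<B> \<Longrightarrow> p \<in> fst d \<Longrightarrow> pot p = potential c d (snd d p)"
  unfolding pot_def by (rule potential_chart) (auto intro: amb.chart_at M.chart_at)

lemma local_hypersurface_dom:
  "c \<in> \<A> \<Longrightarrow> d \<in> \<B> \<Longrightarrow> local_hypersurface (cdom c) (local_dom c X d) (g c) (f \<circ> param c) (h d) (local_rep c X d)"
  by (rule local_hypersurface) (auto intro: open_local_dom amb.chartD simp: local_rep local_dom_iff)

text \<open>The definition of \<open>pot\<close> may switch charts from point to point, but near a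
  given point it agrees with the expression in one fixed pair of charts.\<close>

lemma continuous_pot: "continuous_on UNIV pot"
proof -
  have "isCont pot p" for p
  proof -
    define c where "c = chart_at \<A> (X p)"
    define d where "d = chart_at \<B> p"
    have c: "c \<in> \<A>" "X p \<in> fst c" using amb.chart_at by (auto simp: c_def)
    have d: "d \<in> \<B>" "p \<in> fst d" using M.chart_at by (auto simp: d_def)
    interpret H: local_hypersurface "cdom c" "local_dom c X d" "g c" "f \<circ> param c" "h d" "local_rep c X d"
      by (rule local_hypersurface_dom[OF c(1) d(1)])
    define N where "N = fst d \<inter> X -` fst c"
    have oN: "open N" unfolding N_def by (intro open_Int open_X_vimage amb.chartD(1) M.chartD(1) c d)
    have "continuous_on N (snd d)" by (rule continuous_on_subset[OF M.chart_cont(1)[OF d(1)]]) (simp add: N_def)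
    then have "continuous_on N (\<lambda>p. potential c d (snd d p))"
      by (rule continuous_on_compose2[OF H.continuous_on_stability_potential]) (auto simp: N_def local_dom_def)
    then have "continuous_on N pot"
      by (rule continuous_on_cong[THEN iffD2, OF refl, rotated]) (simp add: N_def pot_chart c d)
    moreover have "p \<in> N" using c d by (simp add: N_def)
    ultimately show ?thesis using oN continuous_on_eq_continuous_at by blast
  qed
  then show ?thesis by (simp add: continuous_at_imp_continuous_on)
qed

lemma pot_ge:
  assumes "bakry_emery_ge \<A> g f k" shows "pot p \<ge> k"
proof -
  define c where "c = chart_at \<A> (X p)"
  define d where "d = chart_at \<B> p"
  have c: "c \<in> \<A>" "X p \<in> fst c" using amb.chart_at by (auto simp: c_def)
  have d: "d \<in> \<B>" "p \<in> fst d" using M.chart_at by (auto simp: d_def)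
  interpret H: local_hypersurface "cdom c" "local_dom c X d" "g c" "f \<circ> param c" "h d" "local_rep c X d"
    by (rule local_hypersurface_dom[OF c(1) d(1)])
  have x: "snd d p \<in> local_dom c X d" using c d by (auto simp: local_dom_def)
  have "local_rep c X d (snd d p) \<in> cdom c" using H.in_U[OF x] .
  then have "potential c d (snd d p) \<ge> k"
    using assms c(1) by (intro H.stability_potential_ge[OF x]) (simp add: bakry_emery_ge_def)
  then show ?thesis by (simp add: pot_chart[OF c d])
qed

text \<open>\<open>stability_op\<close>, \<open>lap\<close> and \<open>pot\<close> pick the same
  charts by \<open>chart_at\<close>, so the operator is literally
  \<open>lap u p + pot p * u p\<close>; Green's formula with \<open>v = u\<close> does the
  rest.\<close>

lemma stability_form_eq:
  assumes u: "u \<in> smooth_compact_support \<B> \<Omega>" shows "stability_form \<A> g f \<B> h X u = qform pot u"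
proof -
  have u: "M.smooth u" "compact (closure {p. u p \<noteq> 0})" using u by (auto simp: smooth_compact_support_def)
  have op: "stability_op \<A> g f \<B> h X u p = lap u p + pot p * u p" for p
    unfolding stability_op_def Let_def pot_def lap_def chart_laplacian_def by (simp add: o_def)
  have "(\<integral>p. u p * stability_op \<A> g f \<B> h X u p \<partial>\<mu>) = (\<integral>p. u p * lap u p + pot p * u p * u p \<partial>\<mu>)"
    by (simp add: op algebra_simps)
  also have "\<dots> = (\<integral>p. u p * lap u p \<partial>\<mu>) + (\<integral>p. pot p * u p * u p \<partial>\<mu>)"
    by (intro Bochner_Integration.integral_add Green(1)[OF u u(1)] integrable_test(2)[OF u continuous_pot])
  also have "(\<integral>p. u p * lap u p \<partial>\<mu>) = - (\<integral>p. M.gip u u p \<partial>\<mu>)" by (rule Green(3)[OF u u(1)])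
  finally show ?thesis unfolding stability_form_def qform_def by linarith
qed

text \<open>A finite index \<open>n\<close> would be exceeded by a negative subspace of dimension
  \<open>Suc n\<close> supported in some compact domain.\<close>

lemma f_index_infinite:
  assumes complete: "complete_riemannian \<B> h" and growth: "polynomial_weighted_volume_growth \<B> h (f \<circ> X)"
    and volume: "emeasure \<mu> UNIV = \<infinity>" and curvature: "bakry_emery_ge \<A> g f k" and k: "k > 0"
  shows "f_index \<A> g f \<B> h X = \<infinity>"
proof (rule ccontr)
  assume "f_index \<A> g f \<B> h X \<noteq> \<infinity>"
  then obtain n where n: "f_index \<A> g f \<B> h X = enat n" by auto
  obtain o' C \<alpha> R\<^sub>0 where G: "C > 0" "\<And>r. r \<ge> R\<^sub>0 \<Longrightarrow> emeasure \<mu> (M.mball o' r) \<le> ennreal (C * r powr \<alpha>)"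
    using growth unfolding polynomial_weighted_volume_growth_def by blast
  have "\<exists>\<Omega> W. compact_domain \<Omega> \<and> subspace W \<and> W \<subseteq> smooth_compact_support \<B> \<Omega> \<and> dim W = Suc n
      \<and> (\<forall>u\<in>W. u \<noteq> 0 \<longrightarrow> qform pot u < 0)"
    by (rule negative_subspace[OF complete G(2,1) volume continuous_pot pot_ge[OF curvature] k])
  then obtain \<Omega> W where W: "compact_domain \<Omega>" "subspace W" "W \<subseteq> smooth_compact_support \<B> \<Omega>" "dim W = Suc n"
    "\<forall>u\<in>W. u \<noteq> 0 \<longrightarrow> qform pot u < 0"
    by (elim exE conjE)
  have "\<forall>u\<in>W. u \<noteq> 0 \<longrightarrow> stability_form \<A> g f \<B> h X u < 0"
    using W(5) stability_form_eq[OF subsetD[OF W(3)]] by simp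
  then have "enat (Suc n) \<le> index_on \<A> g f \<B> h X \<Omega>"
    unfolding index_on_def W(4)[symmetric] using W(2,3) by (intro SUP_upper) simp
  also have "\<dots> \<le> f_index \<A> g f \<B> h X" unfolding f_index_def by (intro SUP_upper) (simp add: W(1))
  finally show False by (simp add: n)
qed

end

theorem corollary1p6:
  fixes \<A> :: "('a::{t2_space,second_countable_topology}, 'm::finite) chart set"
    and g :: "('a, 'm) metric_field"
    and f :: "'a \<Rightarrow> real"
    and k :: real
  assumes "weighted_manifold \<A> g f"
    and "oriented_atlas \<A>"
    and "complete_riemannian \<A> g"
    and "k > 0"
    and "bakry_emery_ge \<A> g f k"
  shows "\<not> (\<exists>(\<B> :: ('b::{t2_space,second_countable_topology}, 'n::finite) chart set)
              (h :: ('b, 'n) metric_field) (X :: 'b \<Rightarrow> 'a).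
            immersed_hypersurface \<A> g \<B> h X
          \<and> complete_riemannian \<B> h
          \<and> \<not> compact (UNIV :: 'b set)
          \<and> orientable \<B>
          \<and> f_minimal \<A> g f \<B> h X
          \<and> emeasure (weighted_volume \<B> h (f \<circ> X)) UNIV = \<infinity>
          \<and> f_index \<A> g f \<B> h X < \<infinity>
          \<and> polynomial_weighted_volume_growth \<B> h (f \<circ> X))"
proof (intro notI, elim exE conjE)
  fix \<B> :: "('b, 'n) chart set" and h X
  assume X: "immersed_hypersurface \<A> g \<B> h X" "complete_riemannian \<B> h"
    "emeasure (weighted_volume \<B> h (f \<circ> X)) UNIV = \<infinity>" "f_index \<A> g f \<B> h X < \<infinity>"
    "polynomial_weighted_volume_growth \<B> h (f \<circ> X)"
  interpret immersed_manifold \<A> g \<B> h X f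
    using assms(1) X(1) by unfold_locales (auto simp: weighted_manifold_def immersed_hypersurface_def)
  show False using f_index_infinite[OF X(2,5,3) assms(5,4)] X(4) by simp
qed

end
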